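(* Let $(\mathcal A,\mathcal B,\mathcal C)$ be a recollement of abelian categories with functors $i\colon\mathcal A\to\mathcal B$ and $e\colon\mathcal B\to\mathcal C$, where $\mathcal B$ and $\mathcal C$ have enough projective objects. Then the following statements are equivalent: (i) $\operatorname{pd}_{\mathcal B}i(A)<\infty$ and $\operatorname{pd}_{\mathcal C}e(P)<\infty$ for every $A\in\mathcal A$ and every projective object $P$ of $\mathcal B$. (ii) The functor $e\colon\mathcal B\to\mathcal C$ induces a singular equivalence $\mathsf D_{\mathsf{sg}}(e)\colon\mathsf D_{\mathsf{sg}}(\mathcal B)\xrightarrow{\ \simeq\ }\mathsf D_{\mathsf{sg}}(\mathcal C)$ between $\mathcal B$ and $\mathcal C$.
   Context: A recollement $(\mathcal A,\mathcal B,\mathcal C)$ of abelian categories consists of abelian categories and additive functors $i\colon\mathcal A\to\mathcal B$, $e\colon\mathcal B\to\mathcal C$, $q,p\colon\mathcal B\to\mathcal A$, $l,r\colon\mathcal C\to\mathcal B$ such that $l\dashv e\dashv r$ and $q\dashv i\dashv p$ are adjoint triples, $i,l,r$ are fully faithful, and the essential image of $i$ equals $\operatorname{Ker}e=\{B\mid e(B)=0\}$. The functors $i$ and $e$ are then exact. For an abelian category $\mathcal B$ with enough projective objects, the singularity category is the Verdier quotient $\mathsf D_{\mathsf{sg}}(\mathcal B)=\mathsf D^{\mathsf b}(\mathcal B)/\mathsf K^{\mathsf b}(\operatorname{Proj}\mathcal B)$ of the bounded derived category by the bounded homotopy category of projective objects. The exact functor $e$ induces a singular equivalence if the derived functor $\mathsf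 D^{\mathsf b}(e)\colon\mathsf D^{\mathsf b}(\mathcal B)\to\mathsf D^{\mathsf b}(\mathcal C)$ sends $\mathsf K^{\mathsf b}(\operatorname{Proj}\mathcal B)$ into $\mathsf K^{\mathsf b}(\operatorname{Proj}\mathcal C)$ (up to isomorphism in $\mathsf D^{\mathsf b}(\mathcal C)$) and the resulting triangulated functor $\mathsf D_{\mathsf{sg}}(e)$ between the quotients is an equivalence. *)

theory Defs
  imports "HOL-Algebra.Group" "HOL-Library.Extended_Nat"
begin

section \<open>Categories and functors\<close>

record ('o, 'm) cat =
  ob :: "'o set"
  mor :: "'m set"
  src :: "'m \<Rightarrow> 'o"
  trg :: "'m \<Rightarrow> 'o"
  idm :: "'o \<Rightarrow> 'm"
  cmp :: "'m \<Rightarrow> 'm \<Rightarrow> 'm"  (infixl "\<cdot>\<index>" 70)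

definition Hom :: "('o, 'm, 'z) cat_scheme \<Rightarrow> 'o \<Rightarrow> 'o \<Rightarrow> 'm set" where
  "Hom C x y = {f \<in> mor C. src C f = x \<and> trg C f = y}"

locale category =
  fixes C :: "('o, 'm, 'z) cat_scheme" (structure)
  assumes src_ob: "f \<in> mor C \<Longrightarrow> src C f \<in> ob C"
    and trg_ob: "f \<in> mor C \<Longrightarrow> trg C f \<in> ob C"
    and idm_Hom: "x \<in> ob C \<Longrightarrow> idm C x \<in> Hom C x x"
    and cmp_Hom: "f \<in> Hom C x y \<Longrightarrow> g \<in> Hom C y z \<Longrightarrow> g \<cdot> f \<in> Hom C x z"
    and cmp_idm: "f \<in> mor C \<Longrightarrow> f \<cdot> idm C (src C f) = f"
    and idm_cmp: "f \<in> mor C \<Longrightarrow> idm C (trg C f) \<cdot> f = f"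
    and cmp_assoc: "f \<in> Hom C w x \<Longrightarrow> g \<in> Hom C x y \<Longrightarrow> h \<in> Hom C y z \<Longrightarrow>
      (h \<cdot> g) \<cdot> f = h \<cdot> (g \<cdot> f)"

definition is_iso :: "('o, 'm, 'z) cat_scheme \<Rightarrow> 'm \<Rightarrow> bool" where
  "is_iso C f \<longleftrightarrow> f \<in> mor C \<and> (\<exists>g \<in> Hom C (trg C f) (src C f).
     g \<cdot>\<^bsub>C\<^esub> f = idm C (src C f) \<and> f \<cdot>\<^bsub>C\<^esub> g = idm C (trg C f))"

definition isomorphic :: "('o, 'm, 'z) cat_scheme \<Rightarrow> 'o \<Rightarrow> 'o \<Rightarrow> bool" where
  "isomorphic C x y \<longleftrightarrow> (\<exists>f \<in> Hom C x y. is_iso C f)"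

definition is_mono :: "('o, 'm, 'z) cat_scheme \<Rightarrow> 'm \<Rightarrow> bool" where
  "is_mono C f \<longleftrightarrow> f \<in> mor C \<and> (\<forall>x \<in> ob C. \<forall>g \<in> Hom C x (src C f). \<forall>h \<in> Hom C x (src C f).
     f \<cdot>\<^bsub>C\<^esub> g = f \<cdot>\<^bsub>C\<^esub> h \<longrightarrow> g = h)"

definition is_epi :: "('o, 'm, 'z) cat_scheme \<Rightarrow> 'm \<Rightarrow> bool" where
  "is_epi C f \<longleftrightarrow> f \<in> mor C \<and> (\<forall>x \<in> ob C. \<forall>g \<in> Hom C (trg C f) x. \<forall>h \<in> Hom C (trg C f) x.
     g \<cdot>\<^bsub>C\<^esub> f = h \<cdot>\<^bsub>C\<^esub> f \<longrightarrow> g = h)"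

definition zero_object :: "('o, 'm, 'z) cat_scheme \<Rightarrow> 'o \<Rightarrow> bool" where
  "zero_object C z \<longleftrightarrow> z \<in> ob C \<and>
     (\<forall>x \<in> ob C. (\<exists>!f. f \<in> Hom C x z) \<and> (\<exists>!f. f \<in> Hom C z x))"

record ('o1, 'm1, 'o2, 'm2) functr =
  fob :: "'o1 \<Rightarrow> 'o2"
  fmor :: "'m1 \<Rightarrow> 'm2"

locale is_functor =
  dom: category C + cod: category D
  for C :: "('o1, 'm1, 'z1) cat_scheme" and D :: "('o2, 'm2, 'z2) cat_scheme" +
  fixes F :: "('o1, 'm1, 'o2, 'm2) functr"
  assumes fob_ob: "x \<in> ob C \<Longrightarrow> fob F x \<in> ob D"
    and fmor_Hom: "f \<in> Hom C x y \<Longrightarrow> fmor F f \<in> Hom D (fob F x) (fob F y)"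
    and fmor_idm: "x \<in> ob C \<Longrightarrow> fmor F (idm C x) = idm D (fob F x)"
    and fmor_cmp: "f \<in> Hom C x y \<Longrightarrow> g \<in> Hom C y z \<Longrightarrow>
      fmor F (g \<cdot>\<^bsub>C\<^esub> f) = fmor F g \<cdot>\<^bsub>D\<^esub> fmor F f"

definition id_functor :: "('o, 'm, 'o, 'm) functr" where
  "id_functor = \<lparr>fob = (\<lambda>x. x), fmor = (\<lambda>f. f)\<rparr>"

definition comp_functor ::
  "('o2, 'm2, 'o3, 'm3) functr \<Rightarrow> ('o1, 'm1, 'o2, 'm2) functr \<Rightarrow> ('o1, 'm1, 'o3, 'm3) functr" where
  "comp_functor G F = \<lparr>fob = fob G \<circ> fob F, fmor = fmor G \<circ> fmor F\<rparr>"

definition fully_faithful :: "('o1, 'm1, 'z1) cat_scheme \<Rightarrow> ('o2, 'm2, 'z2) cat_scheme \<Rightarrow>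
    ('o1, 'm1, 'o2, 'm2) functr \<Rightarrow> bool" where
  "fully_faithful C D F \<longleftrightarrow>
     (\<forall>x \<in> ob C. \<forall>y \<in> ob C. bij_betw (fmor F) (Hom C x y) (Hom D (fob F x) (fob F y)))"

definition naturally_isomorphic :: "('o1, 'm1, 'z1) cat_scheme \<Rightarrow> ('o2, 'm2, 'z2) cat_scheme \<Rightarrow>
    ('o1, 'm1, 'o2, 'm2) functr \<Rightarrow> ('o1, 'm1, 'o2, 'm2) functr \<Rightarrow> bool" where
  "naturally_isomorphic C D F G \<longleftrightarrow> (\<exists>\<eta>.
     (\<forall>x \<in> ob C. \<eta> x \<in> Hom D (fob F x) (fob G x) \<and> is_iso D (\<eta> x)) \<and>
     (\<forall>x \<in> ob C. \<forall>y \<in> ob C. \<forall>f \<in> Hom C x y. \<eta> y \<cdot>\<^bsub>D\<^esub> fmor F f = fmor G f \<cdot>\<^bsub>D\<^esub> \<eta> x))"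

definition is_equivalence :: "('o1, 'm1, 'z1) cat_scheme \<Rightarrow> ('o2, 'm2, 'z2) cat_scheme \<Rightarrow>
    ('o1, 'm1, 'o2, 'm2) functr \<Rightarrow> bool" where
  "is_equivalence C D F \<longleftrightarrow> is_functor C D F \<and>
     (\<exists>G. is_functor D C G \<and>
        naturally_isomorphic C C (comp_functor G F) id_functor \<and>
        naturally_isomorphic D D (comp_functor F G) id_functor)"

text \<open>\<open>adjoint C D F G\<close>: the functor \<open>F : C \<rightarrow> D\<close> is left adjoint to \<open>G : D \<rightarrow> C\<close>.\<close>

definition adjoint :: "('o1, 'm1, 'z1) cat_scheme \<Rightarrow> ('o2, 'm2, 'z2) cat_scheme \<Rightarrow>
    ('o1, 'm1, 'o2, 'm2) functr \<Rightarrow> ('o2, 'm2, 'o1, 'm1) functr \<Rightarrow> bool" where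
  "adjoint C D F G \<longleftrightarrow> (\<exists>\<phi>.
     (\<forall>x \<in> ob C. \<forall>y \<in> ob D. bij_betw (\<phi> x y) (Hom D (fob F x) y) (Hom C x (fob G y))) \<and>
     (\<forall>x \<in> ob C. \<forall>x' \<in> ob C. \<forall>y \<in> ob D. \<forall>y' \<in> ob D.
        \<forall>f \<in> Hom C x' x. \<forall>g \<in> Hom D y y'. \<forall>h \<in> Hom D (fob F x) y.
          \<phi> x' y' (g \<cdot>\<^bsub>D\<^esub> h \<cdot>\<^bsub>D\<^esub> fmor F f) = fmor G g \<cdot>\<^bsub>C\<^esub> \<phi> x y h \<cdot>\<^bsub>C\<^esub> f))"


section \<open>Abelian categories\<close>

record ('o, 'm) addcat = "('o, 'm) cat" +
  add :: "'m \<Rightarrow> 'm \<Rightarrow> 'm"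
  zer :: "'o \<Rightarrow> 'o \<Rightarrow> 'm"

definition Hom_group :: "('o, 'm, 'z) addcat_scheme \<Rightarrow> 'o \<Rightarrow> 'o \<Rightarrow> 'm monoid" where
  "Hom_group C x y = \<lparr>carrier = Hom C x y, monoid.mult = add C, one = zer C x y\<rparr>"

definition neg :: "('o, 'm, 'z) addcat_scheme \<Rightarrow> 'm \<Rightarrow> 'm" where
  "neg C f = m_inv (Hom_group C (src C f) (trg C f)) f"

locale preadditive_category = category C
  for C :: "('o, 'm, 'z) addcat_scheme" (structure) +
  assumes Hom_comm_group: "x \<in> ob C \<Longrightarrow> y \<in> ob C \<Longrightarrow> comm_group (Hom_group C x y)"
    and cmp_add_left: "f \<in> Hom C x y \<Longrightarrow> g \<in> Hom C y z \<Longrightarrow> h \<in> Hom C y z \<Longrightarrow>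
      add C g h \<cdot> f = add C (g \<cdot> f) (h \<cdot> f)"
    and cmp_add_right: "f \<in> Hom C x y \<Longrightarrow> g \<in> Hom C x y \<Longrightarrow> h \<in> Hom C y z \<Longrightarrow>
      h \<cdot> add C f g = add C (h \<cdot> f) (h \<cdot> g)"

definition is_biproduct :: "('o, 'm, 'z) addcat_scheme \<Rightarrow> 'o \<Rightarrow> 'o \<Rightarrow> 'o \<Rightarrow>
    'm \<Rightarrow> 'm \<Rightarrow> 'm \<Rightarrow> 'm \<Rightarrow> bool" where
  "is_biproduct C x y s i1 i2 p1 p2 \<longleftrightarrow> x \<in> ob C \<and> y \<in> ob C \<and> s \<in> ob C \<and>
     i1 \<in> Hom C x s \<and> i2 \<in> Hom C y s \<and> p1 \<in> Hom C s x \<and> p2 \<in> Hom C s y \<and>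
     p1 \<cdot>\<^bsub>C\<^esub> i1 = idm C x \<and> p2 \<cdot>\<^bsub>C\<^esub> i2 = idm C y \<and>
     p1 \<cdot>\<^bsub>C\<^esub> i2 = zer C y x \<and> p2 \<cdot>\<^bsub>C\<^esub> i1 = zer C x y \<and>
     add C (i1 \<cdot>\<^bsub>C\<^esub> p1) (i2 \<cdot>\<^bsub>C\<^esub> p2) = idm C s"

definition is_kernel :: "('o, 'm, 'z) addcat_scheme \<Rightarrow> 'm \<Rightarrow> 'm \<Rightarrow> bool" where
  "is_kernel C f k \<longleftrightarrow> f \<in> mor C \<and> k \<in> mor C \<and> trg C k = src C f \<and>
     f \<cdot>\<^bsub>C\<^esub> k = zer C (src C k) (trg C f) \<and>
     (\<forall>x \<in> ob C. \<forall>h \<in> Hom C x (src C f). f \<cdot>\<^bsub>C\<^esub> h = zer C x (trg C f) \<longrightarrow>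
        (\<exists>!u. u \<in> Hom C x (src C k) \<and> k \<cdot>\<^bsub>C\<^esub> u = h))"

definition is_cokernel :: "('o, 'm, 'z) addcat_scheme \<Rightarrow> 'm \<Rightarrow> 'm \<Rightarrow> bool" where
  "is_cokernel C f c \<longleftrightarrow> f \<in> mor C \<and> c \<in> mor C \<and> src C c = trg C f \<and>
     c \<cdot>\<^bsub>C\<^esub> f = zer C (src C f) (trg C c) \<and>
     (\<forall>x \<in> ob C. \<forall>h \<in> Hom C (trg C f) x. h \<cdot>\<^bsub>C\<^esub> f = zer C (src C f) x \<longrightarrow>
        (\<exists>!u. u \<in> Hom C (trg C c) x \<and> u \<cdot>\<^bsub>C\<^esub> c = h))"

locale abelian_category = preadditive_category +
  assumes ex_zero: "\<exists>z. zero_object C z"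
    and ex_biproduct: "x \<in> ob C \<Longrightarrow> y \<in> ob C \<Longrightarrow> \<exists>s i1 i2 p1 p2. is_biproduct C x y s i1 i2 p1 p2"
    and ex_kernel: "f \<in> mor C \<Longrightarrow> \<exists>k. is_kernel C f k"
    and ex_cokernel: "f \<in> mor C \<Longrightarrow> \<exists>c. is_cokernel C f c"
    and mono_is_kernel: "is_mono C m \<Longrightarrow> \<exists>f. is_kernel C f m"
    and epi_is_cokernel: "is_epi C m \<Longrightarrow> \<exists>f. is_cokernel C f m"

definition is_image :: "('o, 'm, 'z) addcat_scheme \<Rightarrow> 'm \<Rightarrow> 'm \<Rightarrow> bool" where
  "is_image C f m \<longleftrightarrow> (\<exists>c. is_cokernel C f c \<and> is_kernel C c m)"

text \<open>Kernels and images are determined only up to isomorphism, so exactness of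
  \<open>f\<close>, \<open>g\<close> says that a common morphism represents both subobjects.\<close>

definition exact_at :: "('o, 'm, 'z) addcat_scheme \<Rightarrow> 'm \<Rightarrow> 'm \<Rightarrow> bool" where
  "exact_at C f g \<longleftrightarrow> (\<exists>m. is_image C f m \<and> is_kernel C g m)"

definition projective :: "('o, 'm, 'z) cat_scheme \<Rightarrow> 'o \<Rightarrow> bool" where
  "projective C P \<longleftrightarrow> P \<in> ob C \<and>
     (\<forall>g. is_epi C g \<longrightarrow> (\<forall>f \<in> Hom C P (trg C g). \<exists>h \<in> Hom C P (src C g). g \<cdot>\<^bsub>C\<^esub> h = f))"

definition enough_projectives :: "('o, 'm, 'z) cat_scheme \<Rightarrow> bool" where
  "enough_projectives C \<longleftrightarrow>
     (\<forall>x \<in> ob C. \<exists>P. projective C P \<and> (\<exists>g \<in> Hom C P x. is_epi C g))"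

definition projective_resolution ::
  "('o, 'm, 'z) addcat_scheme \<Rightarrow> 'o \<Rightarrow> (nat \<Rightarrow> 'o) \<Rightarrow> (nat \<Rightarrow> 'm) \<Rightarrow> 'm \<Rightarrow> bool" where
  "projective_resolution C x P d \<epsilon> \<longleftrightarrow>
     (\<forall>n. projective C (P n) \<and> d n \<in> Hom C (P (Suc n)) (P n)) \<and>
     \<epsilon> \<in> Hom C (P 0) x \<and> is_epi C \<epsilon> \<and>
     exact_at C (d 0) \<epsilon> \<and> (\<forall>n. exact_at C (d (Suc n)) (d n))"

text \<open>The projective dimension; it is \<open>\<infinity> = Inf {}\<close> if there is no finite projective resolution.\<close>

definition pd :: "('o, 'm, 'z) addcat_scheme \<Rightarrow> 'o \<Rightarrow> enat" where
  "pd C x = Inf {enat n | n. \<exists>P d \<epsilon>. projective_resolution C x P d \<epsilon> \<and>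
     (\<forall>k > n. zero_object C (P k))}"

definition additive_functor :: "('o1, 'm1, 'z1) addcat_scheme \<Rightarrow> ('o2, 'm2, 'z2) addcat_scheme \<Rightarrow>
    ('o1, 'm1, 'o2, 'm2) functr \<Rightarrow> bool" where
  "additive_functor C D F \<longleftrightarrow> is_functor C D F \<and>
     (\<forall>x \<in> ob C. \<forall>y \<in> ob C. \<forall>f \<in> Hom C x y. \<forall>g \<in> Hom C x y.
        fmor F (add C f g) = add D (fmor F f) (fmor F g))"

definition recollement ::
  "('oa, 'ma, 'za) addcat_scheme \<Rightarrow> ('ob, 'mb, 'zb) addcat_scheme \<Rightarrow> ('oc, 'mc, 'zc) addcat_scheme \<Rightarrow>
   ('oa, 'ma, 'ob, 'mb) functr \<Rightarrow> ('ob, 'mb, 'oc, 'mc) functr \<Rightarrow>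
   ('ob, 'mb, 'oa, 'ma) functr \<Rightarrow> ('ob, 'mb, 'oa, 'ma) functr \<Rightarrow>
   ('oc, 'mc, 'ob, 'mb) functr \<Rightarrow> ('oc, 'mc, 'ob, 'mb) functr \<Rightarrow> bool" where
  "recollement A B C i e q p l r \<longleftrightarrow>
     abelian_category A \<and> abelian_category B \<and> abelian_category C \<and>
     additive_functor A B i \<and> additive_functor B C e \<and>
     additive_functor B A q \<and> additive_functor B A p \<and>
     additive_functor C B l \<and> additive_functor C B r \<and>
     adjoint C B l e \<and> adjoint B C e r \<and>
     adjoint B A q i \<and> adjoint A B i p \<and>
     fully_faithful A B i \<and> fully_faithful C B l \<and> fully_faithful C B r \<and>
     {b \<in> ob B. \<exists>a \<in> ob A. isomorphic B (fob i a) b} = {b \<in> ob B. zero_object C (fob e b)}"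


section \<open>Shifts, triangles and Verdier quotients\<close>

text \<open>The data of a triangulated category that matter for Verdier quotients: the shift and the
  distinguished triangles \<open>x \<rightarrow> y \<rightarrow> z \<rightarrow> x[1]\<close>, given by their three morphisms. The addition of
  morphisms is not recorded, as neither Verdier quotients nor equivalences refer to it.\<close>

record ('o, 'm) tricat = "('o, 'm) cat" +
  shift :: "('o, 'm, 'o, 'm) functr"
  triangles :: "('m \<times> 'm \<times> 'm) set"

fun is_candidate :: "('o, 'm, 'z) tricat_scheme \<Rightarrow> 'm \<times> 'm \<times> 'm \<Rightarrow> bool" where
  "is_candidate T (u, v, w) \<longleftrightarrow> u \<in> mor T \<and> v \<in> mor T \<and> w \<in> mor T \<and>
     trg T u = src T v \<and> trg T v = src T w \<and> trg T w = fob (shift T) (src T u)"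

fun triangle_iso :: "('o, 'm, 'z) tricat_scheme \<Rightarrow> 'm \<times> 'm \<times> 'm \<Rightarrow> 'm \<times> 'm \<times> 'm \<Rightarrow> bool" where
  "triangle_iso T (u, v, w) (u', v', w') \<longleftrightarrow> (\<exists>a b c.
     a \<in> Hom T (src T u) (src T u') \<and> b \<in> Hom T (src T v) (src T v') \<and>
     c \<in> Hom T (src T w) (src T w') \<and> is_iso T a \<and> is_iso T b \<and> is_iso T c \<and>
     b \<cdot>\<^bsub>T\<^esub> u = u' \<cdot>\<^bsub>T\<^esub> a \<and> c \<cdot>\<^bsub>T\<^esub> v = v' \<cdot>\<^bsub>T\<^esub> b \<and> fmor (shift T) a \<cdot>\<^bsub>T\<^esub> w = w' \<cdot>\<^bsub>T\<^esub> c)"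

definition close_triangles :: "('o, 'm) tricat \<Rightarrow> ('o, 'm) tricat" where
  "close_triangles T =
     T\<lparr>triangles := {t. is_candidate T t \<and> (\<exists>t' \<in> triangles T. triangle_iso T t t')}\<rparr>"

text \<open>The localization of \<open>C\<close> at a set \<open>W\<close> of morphisms, following Gabriel and Zisman: morphisms are
  zigzags of morphisms of \<open>C\<close> and formal inverses of elements of \<open>W\<close>, modulo the congruence that
  makes \<open>C\<close> map functorially to it and the formal inverses two-sided inverses. Zigzags list their steps in
  the order of travel, i.e. opposite to the order of composition.\<close>

datatype 'm zstep = Fwd 'm | Bwd 'm

inductive zigzag :: "('o, 'm, 'z) cat_scheme \<Rightarrow> 'm set \<Rightarrow> 'o \<Rightarrow> 'o \<Rightarrow> 'm zstep list \<Rightarrow> bool"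
  for C W where
    zigzag_Nil: "x \<in> ob C \<Longrightarrow> zigzag C W x x []"
  | zigzag_Fwd: "f \<in> mor C \<Longrightarrow> zigzag C W (trg C f) y p \<Longrightarrow> zigzag C W (src C f) y (Fwd f # p)"
  | zigzag_Bwd: "s \<in> W \<Longrightarrow> zigzag C W (src C s) y p \<Longrightarrow> zigzag C W (trg C s) y (Bwd s # p)"

inductive zequiv ::
  "('o, 'm, 'z) cat_scheme \<Rightarrow> 'm set \<Rightarrow> 'o \<Rightarrow> 'o \<Rightarrow> 'm zstep list \<Rightarrow> 'm zstep list \<Rightarrow> bool"
  for C W where
    zequiv_refl: "zigzag C W x y p \<Longrightarrow> zequiv C W x y p p"
  | zequiv_sym: "zequiv C W x y p p' \<Longrightarrow> zequiv C W x y p' p"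
  | zequiv_trans: "zequiv C W x y p p' \<Longrightarrow> zequiv C W x y p' p'' \<Longrightarrow> zequiv C W x y p p''"
  | zequiv_append: "zequiv C W x y p p' \<Longrightarrow> zequiv C W y z q q' \<Longrightarrow> zequiv C W x z (p @ q) (p' @ q')"
  | zequiv_idm: "x \<in> ob C \<Longrightarrow> zequiv C W x x [Fwd (idm C x)] []"
  | zequiv_cmp: "f \<in> Hom C x y \<Longrightarrow> g \<in> Hom C y z \<Longrightarrow>
      zequiv C W x z [Fwd f, Fwd g] [Fwd (g \<cdot>\<^bsub>C\<^esub> f)]"
  | zequiv_Fwd_Bwd: "s \<in> W \<Longrightarrow> zequiv C W (src C s) (src C s) [Fwd s, Bwd s] []"
  | zequiv_Bwd_Fwd: "s \<in> W \<Longrightarrow> zequiv C W (trg C s) (trg C s) [Bwd s, Fwd s] []"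

type_synonym ('o, 'm) loc_mor = "'o \<times> 'o \<times> 'm zstep list set"

definition zclass ::
  "('o, 'm, 'z) cat_scheme \<Rightarrow> 'm set \<Rightarrow> 'o \<Rightarrow> 'o \<Rightarrow> 'm zstep list \<Rightarrow> ('o, 'm) loc_mor" where
  "zclass C W x y p = (x, y, {p'. zequiv C W x y p p'})"

definition localization ::
  "('o, 'm, 'z) cat_scheme \<Rightarrow> 'm set \<Rightarrow> ('o, ('o, 'm) loc_mor) cat" where
  "localization C W =
     \<lparr>ob = ob C,
      mor = {zclass C W x y p | x y p. zigzag C W x y p},
      src = (\<lambda>(x, y, P). x),
      trg = (\<lambda>(x, y, P). y),
      idm = (\<lambda>x. zclass C W x x []),
      cmp = (\<lambda>(y, z, Q) (x, y', P). (x, z, \<Union>p \<in> P. \<Union>q \<in> Q. snd (snd (zclass C W x z (p @ q)))))\<rparr>"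

definition loc_functor :: "('o, 'm, 'z) cat_scheme \<Rightarrow> 'm set \<Rightarrow> ('o, 'm, 'o, ('o, 'm) loc_mor) functr" where
  "loc_functor C W = \<lparr>fob = (\<lambda>x. x), fmor = (\<lambda>f. zclass C W (src C f) (trg C f) [Fwd f])\<rparr>"

text \<open>The functor from a localization of the source of \<open>F\<close> to \<open>localization D W\<close> induced by \<open>F\<close>;
  meaningful only if \<open>F\<close> maps the inverted morphisms into \<open>W\<close>.\<close>

definition loc_induced :: "('o2, 'm2, 'z) cat_scheme \<Rightarrow> 'm2 set \<Rightarrow> ('o1, 'm1, 'o2, 'm2) functr \<Rightarrow>
    ('o1, ('o1, 'm1) loc_mor, 'o2, ('o2, 'm2) loc_mor) functr" where
  "loc_induced D W F =
     \<lparr>fob = fob F,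
      fmor = (\<lambda>(x, y, P). (fob F x, fob F y,
        \<Union>p \<in> P. snd (snd (zclass D W (fob F x) (fob F y) (map (map_zstep (fmor F)) p)))))\<rparr>"

text \<open>The morphisms with cone in \<open>S\<close>. As distinguished triangles are closed under isomorphism, this
  depends only on the closure of \<open>S\<close> under isomorphism.\<close>

definition verdier_mors :: "('o, 'm, 'z) tricat_scheme \<Rightarrow> 'o set \<Rightarrow> 'm set" where
  "verdier_mors T S = {u \<in> mor T. \<exists>v w. (u, v, w) \<in> triangles T \<and> trg T v \<in> S}"

definition verdier_quotient ::
  "('o, 'm, 'z) tricat_scheme \<Rightarrow> 'o set \<Rightarrow> ('o, ('o, 'm) loc_mor) tricat" where
  "verdier_quotient T S = (let W = verdier_mors T S; Q = fmor (loc_functor T W) in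
     close_triangles (cat.extend (localization T W)
       \<lparr>shift = loc_induced T W (shift T),
        triangles = {(Q u, Q v, Q w) | u v w. (u, v, w) \<in> triangles T}\<rparr>))"

definition verdier_induced :: "('o2, 'm2, 'z) tricat_scheme \<Rightarrow> 'o2 set \<Rightarrow> ('o1, 'm1, 'o2, 'm2) functr \<Rightarrow>
    ('o1, ('o1, 'm1) loc_mor, 'o2, ('o2, 'm2) loc_mor) functr" where
  "verdier_induced T S F = loc_induced T (verdier_mors T S) F"


section \<open>Bounded homotopy, derived and singularity categories\<close>

record ('o, 'm) cochain =
  term_at :: "int \<Rightarrow> 'o"
  diff_at :: "int \<Rightarrow> 'm"

definition bounded_complexes :: "('o, 'm, 'z) addcat_scheme \<Rightarrow> ('o, 'm) cochain set" where
  "bounded_complexes B = {X.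
     (\<forall>n. term_at X n \<in> ob B \<and> diff_at X n \<in> Hom B (term_at X n) (term_at X (n + 1)) \<and>
        diff_at X (n + 1) \<cdot>\<^bsub>B\<^esub> diff_at X n = zer B (term_at X n) (term_at X (n + 2))) \<and>
     (\<exists>N. \<forall>n. \<bar>n\<bar> > N \<longrightarrow> zero_object B (term_at X n))}"

definition chain_maps :: "('o, 'm, 'z) addcat_scheme \<Rightarrow> ('o, 'm) cochain \<Rightarrow> ('o, 'm) cochain \<Rightarrow>
    (int \<Rightarrow> 'm) set" where
  "chain_maps B X Y = {f. \<forall>n. f n \<in> Hom B (term_at X n) (term_at Y n) \<and>
     diff_at Y n \<cdot>\<^bsub>B\<^esub> f n = f (n + 1) \<cdot>\<^bsub>B\<^esub> diff_at X n}"

definition homotopic :: "('o, 'm, 'z) addcat_scheme \<Rightarrow> ('o, 'm) cochain \<Rightarrow> ('o, 'm) cochain \<Rightarrow>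
    (int \<Rightarrow> 'm) \<Rightarrow> (int \<Rightarrow> 'm) \<Rightarrow> bool" where
  "homotopic B X Y f g \<longleftrightarrow> (\<exists>h. \<forall>n. h n \<in> Hom B (term_at X n) (term_at Y (n - 1)) \<and>
     f n = add B (g n) (add B (diff_at Y (n - 1) \<cdot>\<^bsub>B\<^esub> h n) (h (n + 1) \<cdot>\<^bsub>B\<^esub> diff_at X n)))"

type_synonym ('o, 'm) htpy_mor = "('o, 'm) cochain \<times> ('o, 'm) cochain \<times> (int \<Rightarrow> 'm) set"

definition hclass :: "('o, 'm, 'z) addcat_scheme \<Rightarrow> ('o, 'm) cochain \<Rightarrow> ('o, 'm) cochain \<Rightarrow>
    (int \<Rightarrow> 'm) \<Rightarrow> ('o, 'm) htpy_mor" where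
  "hclass B X Y f = (X, Y, {g \<in> chain_maps B X Y. homotopic B X Y f g})"

definition shift_complex :: "('o, 'm, 'z) addcat_scheme \<Rightarrow> ('o, 'm) cochain \<Rightarrow> ('o, 'm) cochain" where
  "shift_complex B X =
     \<lparr>term_at = (\<lambda>n. term_at X (n + 1)), diff_at = (\<lambda>n. neg B (diff_at X (n + 1)))\<rparr>"

text \<open>\<open>Z\<close> is a mapping cone of \<open>f : X \<rightarrow> Y\<close>, i.e. \<open>Z\<^sup>n = X\<^sup>n\<^sup>+\<^sup>1 \<oplus> Y\<^sup>n\<close> with differential
  \<open>(x, y) \<mapsto> (- d x, f x + d y)\<close>, with inclusion \<open>j : Y \<rightarrow> Z\<close> and projection \<open>p : Z \<rightarrow> X[1]\<close>.\<close>

definition is_mapping_cone :: "('o, 'm, 'z) addcat_scheme \<Rightarrow> ('o, 'm) cochain \<Rightarrow> ('o, 'm) cochain \<Rightarrow>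
    (int \<Rightarrow> 'm) \<Rightarrow> ('o, 'm) cochain \<Rightarrow> (int \<Rightarrow> 'm) \<Rightarrow> (int \<Rightarrow> 'm) \<Rightarrow> bool" where
  "is_mapping_cone B X Y f Z j p \<longleftrightarrow> (\<exists>k q. \<forall>n.
     is_biproduct B (term_at X (n + 1)) (term_at Y n) (term_at Z n) (k n) (j n) (p n) (q n) \<and>
     diff_at Z n =
       add B (k (n + 1) \<cdot>\<^bsub>B\<^esub> neg B (diff_at X (n + 1)) \<cdot>\<^bsub>B\<^esub> p n)
        (add B (j (n + 1) \<cdot>\<^bsub>B\<^esub> f (n + 1) \<cdot>\<^bsub>B\<^esub> p n)
               (j (n + 1) \<cdot>\<^bsub>B\<^esub> diff_at Y n \<cdot>\<^bsub>B\<^esub> q n)))"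

definition Kb :: "('o, 'm, 'z) addcat_scheme \<Rightarrow> (('o, 'm) cochain, ('o, 'm) htpy_mor) tricat" where
  "Kb B = close_triangles
     \<lparr>ob = bounded_complexes B,
      mor = {hclass B X Y f | X Y f.
        X \<in> bounded_complexes B \<and> Y \<in> bounded_complexes B \<and> f \<in> chain_maps B X Y},
      src = (\<lambda>(X, Y, F). X),
      trg = (\<lambda>(X, Y, F). Y),
      idm = (\<lambda>X. hclass B X X (\<lambda>n. idm B (term_at X n))),
      cmp = (\<lambda>(Y, Z, G) (X, Y', F).
        (X, Z, \<Union>f \<in> F. \<Union>g \<in> G. snd (snd (hclass B X Z (\<lambda>n. g n \<cdot>\<^bsub>B\<^esub> f n))))),
      shift =
        \<lparr>fob = shift_complex B,
         fmor = (\<lambda>(X, Y, F). (shift_complex B X, shift_complex B Y, (\<lambda>f n. f (n + 1)) ` F))\<rparr>,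
      triangles = {(hclass B X Y f, hclass B Y Z j, hclass B Z (shift_complex B X) p) | X Y Z f j p.
        X \<in> bounded_complexes B \<and> Y \<in> bounded_complexes B \<and> Z \<in> bounded_complexes B \<and>
        f \<in> chain_maps B X Y \<and> is_mapping_cone B X Y f Z j p}\<rparr>"

definition acyclic_complexes :: "('o, 'm, 'z) addcat_scheme \<Rightarrow> ('o, 'm) cochain set" where
  "acyclic_complexes B =
     {X \<in> bounded_complexes B. \<forall>n. exact_at B (diff_at X n) (diff_at X (n + 1))}"

definition Kb_Proj :: "('o, 'm, 'z) addcat_scheme \<Rightarrow> ('o, 'm) cochain set" where
  "Kb_Proj B = {X \<in> bounded_complexes B. \<forall>n. projective B (term_at X n)}"

type_synonym ('o, 'm) der_mor = "(('o, 'm) cochain, ('o, 'm) htpy_mor) loc_mor"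

type_synonym ('o, 'm) sing_mor = "(('o, 'm) cochain, ('o, 'm) der_mor) loc_mor"

definition Db :: "('o, 'm, 'z) addcat_scheme \<Rightarrow> (('o, 'm) cochain, ('o, 'm) der_mor) tricat" where
  "Db B = verdier_quotient (Kb B) (acyclic_complexes B)"

definition Dsg :: "('o, 'm, 'z) addcat_scheme \<Rightarrow> (('o, 'm) cochain, ('o, 'm) sing_mor) tricat" where
  "Dsg B = verdier_quotient (Db B) (Kb_Proj B)"

definition Kb_functor :: "('o2, 'm2, 'z) addcat_scheme \<Rightarrow> ('o1, 'm1, 'o2, 'm2) functr \<Rightarrow>
    (('o1, 'm1) cochain, ('o1, 'm1) htpy_mor, ('o2, 'm2) cochain, ('o2, 'm2) htpy_mor) functr" where
  "Kb_functor D F =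
     (let FC = (\<lambda>X. \<lparr>term_at = (\<lambda>n. fob F (term_at X n)), diff_at = (\<lambda>n. fmor F (diff_at X n))\<rparr>) in
      \<lparr>fob = FC,
       fmor = (\<lambda>(X, Y, G). (FC X, FC Y,
         \<Union>f \<in> G. snd (snd (hclass D (FC X) (FC Y) (\<lambda>n. fmor F (f n))))))\<rparr>)"

text \<open>The derived functor of an exact functor \<open>F\<close> with target \<open>D\<close>, and the functor it induces on
  singularity categories; the latter is meaningful only if \<open>F\<close> preserves perfect complexes.\<close>

definition Db_functor :: "('o2, 'm2, 'z) addcat_scheme \<Rightarrow> ('o1, 'm1, 'o2, 'm2) functr \<Rightarrow>
    (('o1, 'm1) cochain, ('o1, 'm1) der_mor, ('o2, 'm2) cochain, ('o2, 'm2) der_mor) functr" where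
  "Db_functor D F = verdier_induced (Kb D) (acyclic_complexes D) (Kb_functor D F)"

definition Dsg_functor :: "('o2, 'm2, 'z) addcat_scheme \<Rightarrow> ('o1, 'm1, 'o2, 'm2) functr \<Rightarrow>
    (('o1, 'm1) cochain, ('o1, 'm1) sing_mor, ('o2, 'm2) cochain, ('o2, 'm2) sing_mor) functr" where
  "Dsg_functor D F = verdier_induced (Db D) (Kb_Proj D) (Db_functor D F)"

definition induces_singular_equivalence :: "('o1, 'm1, 'z1) addcat_scheme \<Rightarrow>
    ('o2, 'm2, 'z2) addcat_scheme \<Rightarrow> ('o1, 'm1, 'o2, 'm2) functr \<Rightarrow> bool" where
  "induces_singular_equivalence B C e \<longleftrightarrow>
     (\<forall>X \<in> Kb_Proj B. \<exists>Y \<in> Kb_Proj C. isomorphic (Db C) (fob (Db_functor C e) X) Y) \<and>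
     is_equivalence (Dsg B) (Dsg C) (Dsg_functor C e)"

end

theory Submission imports Defs begin

text \<open>
  Call a bounded complex perfect if it is isomorphic in the derived category to a bounded complex
  of projectives, equivalently if some bounded above projective resolution of it is split exact in
  low degrees.

  Assume the projective dimensions are finite. Then \<open>e\<close> maps perfect complexes to perfect complexes,
  and a complex with \<open>e X\<close> acyclic has its cohomology in the image of \<open>i\<close>, so it is perfect. A
  quasi-inverse is induced by the termwise application of \<open>l\<close>, without deriving it: although \<open>l\<close> is
  only right exact, \<open>e l \<simeq> 1\<close> shows that \<open>l\<close> sends acyclic complexes to perfect ones, hence
  quasi-isomorphisms to isomorphisms of the singularity category, and the counit \<open>l e X \<rightarrow> X\<close> has
  perfect cone because it becomes invertible under \<open>e\<close>.

  For the converse, \<open>i a\<close> becomes isomorphic to \<open>0\<close> in the singularity category since \<open>e (i a) = 0\<close>,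
  and what is needed is that an object isomorphic to \<open>0\<close> there is perfect. This is read off from a
  functor on the singularity category whose value on \<open>X\<close> consists of the germs at infinity of
  families in \<open>Ext\<^sup>n (X, Y n)\<close>, for arbitrary sequences of objects \<open>Y\<close>: it inverts the morphisms
  with perfect cone, and it vanishes on \<open>X\<close> for all \<open>Y\<close> only if \<open>X\<close> is perfect.
\<close>

section \<open>Categories, isomorphisms and localizations\<close>

text \<open>The localizations consist of zigzags without a calculus of fractions, so the shape of a
  morphism in \<open>Db C\<close> or \<open>Dsg C\<close> gives little information. Statements about
  their morphisms come from functors out of them, given by the universal property, and from
  induction over the generating morphisms. The first way yields the quasi-inverse and the invariant
  of perfect complexes, the second the naturality of the comparison maps. Cohomology objects do not
  occur. With enough projective objects, exactness is tested on morphisms T -> X from projective T,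
  and diagram chases become calculations with such elements. Exactness of \<open>e\<close> is
  derived in this language: \<open>e\<close> preserves epimorphisms as a left adjoint of
  \<open>r\<close>, so \<open>l\<close> preserves projective objects, and transposition turns
  elements T -> e y into elements l T -> y. The bound in \<open>lc\<close> is uniform in the test
  object y. This is the reason for sequences Y in the invariant: the failure of \<open>lc\<close>
  may require a different y in each degree, which one fixed test object need not see.\<close>

lemma HomI: "f \<in> mor C \<Longrightarrow> src C f = x \<Longrightarrow> trg C f = y \<Longrightarrow> f \<in> Hom C x y"
  by (simp add: Hom_def)

lemma Hom_mor: "f \<in> Hom C x y \<Longrightarrow> f \<in> mor C"
  and Hom_src: "f \<in> Hom C x y \<Longrightarrow> src C f = x"
  and Hom_trg: "f \<in> Hom C x y \<Longrightarrow> trg C f = y"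
  by (simp_all add: Hom_def)

lemmas HomD = Hom_mor Hom_src Hom_trg

lemma mor_Hom: "f \<in> mor C \<Longrightarrow> f \<in> Hom C (src C f) (trg C f)"
  by (simp add: Hom_def)

definition inv_mor :: "('o, 'm, 'z) cat_scheme \<Rightarrow> 'm \<Rightarrow> 'm" where
  "inv_mor C f = (SOME g. g \<in> Hom C (trg C f) (src C f) \<and>
     g \<cdot>\<^bsub>C\<^esub> f = idm C (src C f) \<and> f \<cdot>\<^bsub>C\<^esub> g = idm C (trg C f))"

lemma inv_mor:
  assumes "is_iso C f"
  shows inv_mor_Hom: "inv_mor C f \<in> Hom C (trg C f) (src C f)"
    and inv_mor_left: "inv_mor C f \<cdot>\<^bsub>C\<^esub> f = idm C (src C f)"
    and inv_mor_right: "f \<cdot>\<^bsub>C\<^esub> inv_mor C f = idm C (trg C f)"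
proof -
  have "\<exists>g. g \<in> Hom C (trg C f) (src C f) \<and>
     g \<cdot>\<^bsub>C\<^esub> f = idm C (src C f) \<and> f \<cdot>\<^bsub>C\<^esub> g = idm C (trg C f)"
    using assms unfolding is_iso_def by blast
  then have "inv_mor C f \<in> Hom C (trg C f) (src C f) \<and>
     inv_mor C f \<cdot>\<^bsub>C\<^esub> f = idm C (src C f) \<and> f \<cdot>\<^bsub>C\<^esub> inv_mor C f = idm C (trg C f)"
    unfolding inv_mor_def by (rule someI_ex)
  then show "inv_mor C f \<in> Hom C (trg C f) (src C f)"
    "inv_mor C f \<cdot>\<^bsub>C\<^esub> f = idm C (src C f)" "f \<cdot>\<^bsub>C\<^esub> inv_mor C f = idm C (trg C f)" by auto
qed

lemma is_iso_mor: "is_iso C f \<Longrightarrow> f \<in> mor C"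
  by (simp add: is_iso_def)

lemma is_isoI:
  "f \<in> Hom C x y \<Longrightarrow> g \<in> Hom C y x \<Longrightarrow> g \<cdot>\<^bsub>C\<^esub> f = idm C x \<Longrightarrow> f \<cdot>\<^bsub>C\<^esub> g = idm C y \<Longrightarrow> is_iso C f"
  unfolding is_iso_def Hom_def by auto

context category
begin

lemma cmp_mor [simp]: "f \<in> mor C \<Longrightarrow> g \<in> mor C \<Longrightarrow> src C g = trg C f \<Longrightarrow> g \<cdot> f \<in> mor C"
  and src_cmp [simp]: "f \<in> mor C \<Longrightarrow> g \<in> mor C \<Longrightarrow> src C g = trg C f \<Longrightarrow> src C (g \<cdot> f) = src C f"
  and trg_cmp [simp]: "f \<in> mor C \<Longrightarrow> g \<in> mor C \<Longrightarrow> src C g = trg C f \<Longrightarrow> trg C (g \<cdot> f) = trg C g"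
  using cmp_Hom[of f "src C f" "trg C f" g "trg C g"] by (auto simp: Hom_def)

lemma idm_mor [simp]: "x \<in> ob C \<Longrightarrow> idm C x \<in> mor C"
  and src_idm [simp]: "x \<in> ob C \<Longrightarrow> src C (idm C x) = x"
  and trg_idm [simp]: "x \<in> ob C \<Longrightarrow> trg C (idm C x) = x"
  using idm_Hom[of x] by (auto simp: Hom_def)

lemma src_ob' [simp]: "f \<in> mor C \<Longrightarrow> src C f \<in> ob C"
  and trg_ob' [simp]: "f \<in> mor C \<Longrightarrow> trg C f \<in> ob C"
  by (fact src_ob trg_ob)+

lemma Hom_ob: assumes "f \<in> Hom C x y" shows Hom_ob1: "x \<in> ob C" and Hom_ob2: "y \<in> ob C"
  using assms src_ob trg_ob unfolding Hom_def by auto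

lemma cmp_idm' [simp]: "f \<in> mor C \<Longrightarrow> src C f = x \<Longrightarrow> f \<cdot> idm C x = f"
  and idm_cmp' [simp]: "f \<in> mor C \<Longrightarrow> trg C f = y \<Longrightarrow> idm C y \<cdot> f = f"
  using cmp_idm idm_cmp by auto

lemma assoc: "f \<in> mor C \<Longrightarrow> g \<in> mor C \<Longrightarrow> h \<in> mor C \<Longrightarrow> src C g = trg C f \<Longrightarrow> src C h = trg C g \<Longrightarrow>
    (h \<cdot> g) \<cdot> f = h \<cdot> (g \<cdot> f)"
  using cmp_assoc mor_Hom by metis

lemma inv_mor_mor [simp]: "is_iso C f \<Longrightarrow> inv_mor C f \<in> mor C"
  and inv_mor_src [simp]: "is_iso C f \<Longrightarrow> src C (inv_mor C f) = trg C f"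
  and inv_mor_trg [simp]: "is_iso C f \<Longrightarrow> trg C (inv_mor C f) = src C f"
  using inv_mor_Hom[of C f] by (auto simp: Hom_def)

lemma inv_mor_cancel1: "is_iso C f \<Longrightarrow> g \<in> mor C \<Longrightarrow> trg C g = src C f \<Longrightarrow> inv_mor C f \<cdot> (f \<cdot> g) = g"
  by (simp add: assoc[symmetric] is_iso_mor inv_mor_left)

lemma inv_mor_cancel2: "is_iso C f \<Longrightarrow> g \<in> mor C \<Longrightarrow> trg C g = trg C f \<Longrightarrow> f \<cdot> (inv_mor C f \<cdot> g) = g"
  by (simp add: assoc[symmetric] is_iso_mor inv_mor_right)

lemma inv_mor_iso: "is_iso C f \<Longrightarrow> is_iso C (inv_mor C f)"
  by (rule is_isoI[of _ C "trg C f" "src C f" f])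
    (auto simp: inv_mor_left inv_mor_right Hom_def is_iso_mor)

lemma iso_idm: "x \<in> ob C \<Longrightarrow> is_iso C (idm C x)"
  by (rule is_isoI[of _ C x x "idm C x"]) (auto simp: Hom_def)

lemma iso_cmp: assumes "is_iso C f" "is_iso C g" "src C g = trg C f" shows "is_iso C (g \<cdot> f)"
proof (rule is_isoI)
  note [simp] = is_iso_mor[OF assms(1)] is_iso_mor[OF assms(2)] assms
  show "g \<cdot> f \<in> Hom C (src C f) (trg C g)" "inv_mor C f \<cdot> inv_mor C g \<in> Hom C (trg C g) (src C f)"
    by (auto simp: Hom_def)
  show "inv_mor C f \<cdot> inv_mor C g \<cdot> (g \<cdot> f) = idm C (src C f)"
    by (simp add: assoc inv_mor_cancel1 inv_mor_left)
  show "g \<cdot> f \<cdot> (inv_mor C f \<cdot> inv_mor C g) = idm C (trg C g)"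
    by (simp add: assoc inv_mor_cancel2 inv_mor_right)
qed

lemma iso_cancel_left:
  assumes "is_iso C g" "is_iso C (g \<cdot> f)" "f \<in> mor C" "src C g = trg C f" shows "is_iso C f"
proof -
  have "inv_mor C g \<cdot> (g \<cdot> f) = f" using assms by (simp add: inv_mor_cancel1)
  moreover have "is_iso C (inv_mor C g \<cdot> (g \<cdot> f))"
    using assms by (intro iso_cmp[OF assms(2) inv_mor_iso[OF assms(1)]]) (auto simp: is_iso_mor)
  ultimately show ?thesis by metis
qed

lemma iso_cancel_right:
  assumes "is_iso C f" "is_iso C (g \<cdot> f)" "g \<in> mor C" "src C g = trg C f" shows "is_iso C g"
proof -
  have "(g \<cdot> f) \<cdot> inv_mor C f = g" using assms by (simp add: assoc is_iso_mor inv_mor_right)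
  moreover have "is_iso C ((g \<cdot> f) \<cdot> inv_mor C f)"
    using assms by (intro iso_cmp[OF inv_mor_iso[OF assms(1)] assms(2)]) (auto simp: is_iso_mor)
  ultimately show ?thesis by metis
qed

lemma isomorphicI: "is_iso C f \<Longrightarrow> src C f = x \<Longrightarrow> trg C f = y \<Longrightarrow> isomorphic C x y"
  unfolding isomorphic_def using is_iso_mor[of C f] by (auto simp: Hom_def)

lemma isomorphic_sym: "isomorphic C x y \<Longrightarrow> isomorphic C y x"
proof -
  assume "isomorphic C x y"
  then obtain f where f: "is_iso C f" "src C f = x" "trg C f = y"
    unfolding isomorphic_def Hom_def by blast
  then show ?thesis by (intro isomorphicI[OF inv_mor_iso[OF f(1)]]) auto
qed

lemma isomorphic_trans: "isomorphic C x y \<Longrightarrow> isomorphic C y z \<Longrightarrow> isomorphic C x z"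
proof -
  assume "isomorphic C x y" "isomorphic C y z"
  then obtain f g where "is_iso C f" "src C f = x" "trg C f = y" "is_iso C g" "src C g = y" "trg C g = z"
    unfolding isomorphic_def Hom_def by blast
  then show ?thesis by (intro isomorphicI[of "g \<cdot> f"] iso_cmp) (auto simp: is_iso_mor)
qed

lemma isomorphic_refl: "x \<in> ob C \<Longrightarrow> isomorphic C x x"
  by (rule isomorphicI[OF iso_idm]) auto

end

context is_functor
begin

lemma fob [simp]: "x \<in> ob C \<Longrightarrow> fob F x \<in> ob D" by (rule fob_ob)

lemma fmor_mor [simp]: "f \<in> mor C \<Longrightarrow> fmor F f \<in> mor D"
  and fmor_src [simp]: "f \<in> mor C \<Longrightarrow> src D (fmor F f) = fob F (src C f)"
  and fmor_trg [simp]: "f \<in> mor C \<Longrightarrow> trg D (fmor F f) = fob F (trg C f)"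
  using fmor_Hom[of f "src C f" "trg C f"] by (auto simp: Hom_def)

lemma fmor_cmp': "f \<in> mor C \<Longrightarrow> g \<in> mor C \<Longrightarrow> src C g = trg C f \<Longrightarrow>
      fmor F (g \<cdot>\<^bsub>C\<^esub> f) = fmor F g \<cdot>\<^bsub>D\<^esub> fmor F f"
  using fmor_cmp mor_Hom by metis

lemma fmor_iso: assumes "is_iso C f" shows "is_iso D (fmor F f)"
proof (rule is_isoI)
  have "f \<in> mor C" using assms by (rule is_iso_mor)
  then show "fmor F f \<in> Hom D (fob F (src C f)) (fob F (trg C f))"
    "fmor F (inv_mor C f) \<in> Hom D (fob F (trg C f)) (fob F (src C f))"
    "fmor F (inv_mor C f) \<cdot>\<^bsub>D\<^esub> fmor F f = idm D (fob F (src C f))"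
    "fmor F f \<cdot>\<^bsub>D\<^esub> fmor F (inv_mor C f) = idm D (fob F (trg C f))"
    using assms by (auto simp: fmor_cmp'[symmetric] inv_mor_left inv_mor_right fmor_idm Hom_def)
qed

lemma fob_isomorphic: "isomorphic C x y \<Longrightarrow> isomorphic D (fob F x) (fob F y)"
  unfolding isomorphic_def using fmor_iso fmor_Hom by blast

end

lemma comp_functor_simps [simp]:
  "fob (comp_functor G F) x = fob G (fob F x)" "fmor (comp_functor G F) f = fmor G (fmor F f)"
  by (simp_all add: comp_functor_def)

lemma id_functor_simps [simp]: "fob id_functor x = x" "fmor id_functor f = f"
  by (simp_all add: id_functor_def)

lemma is_functor_comp:
  assumes "is_functor C D F" "is_functor D E G" shows "is_functor C E (comp_functor G F)"
proof -
  interpret F: is_functor C D F by fact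
  interpret G: is_functor D E G by fact
  show ?thesis
    by unfold_locales (auto simp: F.fmor_idm G.fmor_idm F.fmor_cmp G.fmor_cmp[OF F.fmor_Hom F.fmor_Hom]
      intro: F.fmor_Hom G.fmor_Hom)
qed

lemma is_functor_id: "category C \<Longrightarrow> is_functor C C id_functor"
  unfolding is_functor_def is_functor_axioms_def by auto

subsection \<open>The Gabriel--Zisman localization\<close>

text \<open>Verdier quotients are localizations with more structure, so the localization is
  treated up to equality of the underlying category.\<close>

definition is_loc :: "('o, 'm, 'z) cat_scheme \<Rightarrow> 'm set \<Rightarrow> ('o, ('o, 'm) loc_mor, 'w) cat_scheme \<Rightarrow> bool" where
  "is_loc C W L \<longleftrightarrow> ob L = ob (localization C W) \<and> mor L = mor (localization C W) \<and>
     src L = src (localization C W) \<and> trg L = trg (localization C W) \<and>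
     idm L = idm (localization C W) \<and> cmp L = cmp (localization C W)"

locale localized = category C
  for C :: "('o, 'm, 'z) cat_scheme" (structure) +
  fixes W :: "'m set" and L :: "('o, ('o, 'm) loc_mor, 'w) cat_scheme"
  assumes W_mor: "W \<subseteq> mor C" and is_loc: "is_loc C W L"
begin

abbreviation "zz \<equiv> zigzag C W"
abbreviation "ze \<equiv> zequiv C W"
abbreviation "zc \<equiv> zclass C W"
abbreviation "Q \<equiv> fmor (loc_functor C W)"

lemma W_morD [simp]: "s \<in> W \<Longrightarrow> s \<in> mor C" using W_mor by auto

lemma zigzag_ob: "zz x y p \<Longrightarrow> x \<in> ob C \<and> y \<in> ob C"
  by (induction rule: zigzag.induct) auto

lemma zigzag_append: "zz x y p \<Longrightarrow> zz y z q \<Longrightarrow> zz x z (p @ q)"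
  by (induction rule: zigzag.induct) (auto intro: zigzag.intros)

lemma zigzag_FwdI: "f \<in> Hom C x y \<Longrightarrow> zz x y [Fwd f]"
  using zigzag_Fwd[of f C W y "[]"] zigzag_Nil[of y C W] by (auto simp: Hom_def)

lemma zigzag_BwdI: "s \<in> W \<Longrightarrow> zz (trg C s) (src C s) [Bwd s]"
  using zigzag_Bwd[of s W C "src C s" "[]"] zigzag_Nil[of "src C s" C W] by auto

lemma zequiv_zigzag: "ze x y p p' \<Longrightarrow> zz x y p \<and> zz x y p'"
proof (induction rule: zequiv.induct)
  case (zequiv_cmp f x y g z)
  then show ?case using zigzag_append[of x y "[Fwd f]" z "[Fwd g]"]
    by (auto intro: zigzag_FwdI cmp_Hom)
next
  case (zequiv_Fwd_Bwd s)
  then show ?case using zigzag_append[OF zigzag_FwdI[OF mor_Hom] zigzag_BwdI, of s]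
    by (auto intro: zigzag_Nil)
next
  case (zequiv_Bwd_Fwd s)
  then show ?case using zigzag_append[OF zigzag_BwdI zigzag_FwdI[OF mor_Hom], of s]
    by (auto intro: zigzag_Nil)
qed (auto intro: zigzag_append zigzag_FwdI zigzag_Nil idm_Hom)

lemma zclass_eq: "zz x y p \<Longrightarrow> zc x y p = zc x y p' \<longleftrightarrow> ze x y p p'"
  unfolding zclass_def by (auto intro: zequiv_sym zequiv_trans zequiv_refl)

lemma zclass_eqI: "ze x y p p' \<Longrightarrow> zc x y p = zc x y p'"
  using zclass_eq zequiv_zigzag by blast

lemma L_simps:
  "ob L = ob C" "idm L x = zc x x []" "src L (zc x y p) = x" "trg L (zc x y p) = y"
  "zz x y p \<Longrightarrow> zc x y p \<in> mor L"
  using is_loc by (auto simp: is_loc_def localization_def zclass_def)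

lemma Hom_L: "Hom L x y = {zc x y p | p. zz x y p}"
proof -
  have "mor L = {zc x y p | x y p. zz x y p}"
    using is_loc by (simp add: is_loc_def localization_def)
  then show ?thesis unfolding Hom_def by (auto simp: L_simps)
qed

lemma Hom_LI: "zz x y p \<Longrightarrow> zc x y p \<in> Hom L x y"
  by (auto simp: Hom_L)

text \<open>The composite in \<open>localization\<close> is a union over all representatives. By the
  congruence rule \<open>zequiv_append\<close> every member of this union is the same class, and the
  union is not empty.\<close>

lemma cmp_L:
  assumes "zz x y p" "zz y z q"
  shows "cmp L (zc y z q) (zc x y p) = zc x z (p @ q)"
proof -
  have *: "snd (snd (zc x z (p' @ q'))) = snd (snd (zc x z (p @ q)))"
    if "ze x y p p'" "ze y z q q'" for p' q'
    using zclass_eqI[OF zequiv_append[OF that]] by simp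
  have "cmp L (zc y z q) (zc x y p) =
      (x, z, \<Union>p'\<in>{p'. ze x y p p'}. \<Union>q'\<in>{q'. ze y z q q'}. snd (snd (zc x z (p' @ q'))))"
    using is_loc by (simp add: is_loc_def localization_def zclass_def)
  also have "\<dots> = (x, z, \<Union>p'\<in>{p'. ze x y p p'}. \<Union>q'\<in>{q'. ze y z q q'}. snd (snd (zc x z (p @ q))))"
    using * by simp
  also have "\<dots> = (x, z, snd (snd (zc x z (p @ q))))"
    using zequiv_refl[OF assms(1)] zequiv_refl[OF assms(2)] by auto
  also have "\<dots> = zc x z (p @ q)" by (simp add: zclass_def)
  finally show ?thesis .
qed

lemma category_L: "category L"
proof
  fix f assume f: "f \<in> mor L"
  then obtain p where p: "f = zc (src L f) (trg L f) p" "zz (src L f) (trg L f) p"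
    using mor_Hom[OF f] unfolding Hom_L by auto
  show "src L f \<in> ob L" "trg L f \<in> ob L" using zigzag_ob[OF p(2)] by (auto simp: L_simps)
  then show "cmp L f (idm L (src L f)) = f" "cmp L (idm L (trg L f)) f = f"
    using p cmp_L[OF zigzag_Nil p(2)] cmp_L[OF p(2) zigzag_Nil] by (auto simp: L_simps)
next
  fix x assume "x \<in> ob L" then show "idm L x \<in> Hom L x x"
    by (auto simp: L_simps intro!: Hom_LI zigzag_Nil)
next
  fix f g x y z assume "f \<in> Hom L x y" "g \<in> Hom L y z"
  then show "cmp L g f \<in> Hom L x z" by (auto simp: Hom_L cmp_L intro: zigzag_append)
next
  fix f g h w x y z assume "f \<in> Hom L w x" "g \<in> Hom L x y" "h \<in> Hom L y z"
  then show "cmp L (cmp L h g) f = cmp L h (cmp L g f)"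
    by (auto simp: Hom_L cmp_L zigzag_append)
qed

lemma loc_functor_simps [simp]: "fob (loc_functor C W) x = x"
  "f \<in> Hom C x y \<Longrightarrow> Q f = zc x y [Fwd f]"
  by (auto simp: loc_functor_def Hom_def)

lemma Q_cmp: "f \<in> Hom C x y \<Longrightarrow> g \<in> Hom C y z \<Longrightarrow> Q (g \<cdot> f) = cmp L (Q g) (Q f)"
  using cmp_L[OF zigzag_FwdI zigzag_FwdI, of f x y g z] loc_functor_simps(2)[OF cmp_Hom]
    zclass_eqI[OF zequiv_cmp, of f x y g z] by simp

lemma loc_functor_is_functor: "is_functor C L (loc_functor C W)"
proof -
  interpret L: category L by (rule category_L)
  show ?thesis
  proof
    fix x assume "x \<in> ob C" then show "Q (idm C x) = idm L (fob (loc_functor C W) x)"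
      using idm_Hom[of x] by (simp add: L_simps zclass_eqI zequiv_idm)
  qed (auto simp: L_simps Q_cmp Hom_LI zigzag_FwdI simp del: loc_functor_simps(2),
       auto simp: Hom_LI zigzag_FwdI)
qed

definition Qinv :: "'m \<Rightarrow> ('o, 'm) loc_mor" where
  "Qinv s = zc (trg C s) (src C s) [Bwd s]"

lemma Qinv: assumes "s \<in> W"
  shows "Qinv s \<in> Hom L (trg C s) (src C s)"
    "cmp L (Qinv s) (Q s) = idm L (src C s)" "cmp L (Q s) (Qinv s) = idm L (trg C s)"
  using assms cmp_L[OF zigzag_FwdI[OF mor_Hom] zigzag_BwdI, of s] cmp_L[OF zigzag_BwdI zigzag_FwdI[OF mor_Hom], of s]
  by (auto simp: Qinv_def L_simps loc_functor_simps(2)[OF mor_Hom] intro: Hom_LI zigzag_BwdI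
     intro!: zclass_eqI zequiv_Fwd_Bwd zequiv_Bwd_Fwd)

lemma Q_iso: "s \<in> W \<Longrightarrow> is_iso L (Q s)"
  using Qinv by (intro is_isoI[of _ L "src C s" "trg C s" "Qinv s"])
   (auto simp: loc_functor_simps(2)[OF mor_Hom] intro!: Hom_LI zigzag_FwdI mor_Hom)

text \<open>A morphism of the localization is the class of a zigzag, hence built from an identity by
  precomposition with images of morphisms of C and with formal inverses. The induction adds steps at
  the source end because zigzags are listed in the order of travel.\<close>

lemma loc_induct [consumes 1, case_names idm Fwd Bwd]:
  assumes "m \<in> Hom L x y"
    and "\<And>x. x \<in> ob C \<Longrightarrow> P x x (idm L x)"
    and "\<And>f y m. f \<in> mor C \<Longrightarrow> m \<in> Hom L (trg C f) y \<Longrightarrow> P (trg C f) y m \<Longrightarrow> P (src C f) y (cmp L m (Q f))"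
    and "\<And>s y m. s \<in> W \<Longrightarrow> m \<in> Hom L (src C s) y \<Longrightarrow> P (src C s) y m \<Longrightarrow> P (trg C s) y (cmp L m (Qinv s))"
  shows "P x y m"
proof -
  obtain p where p: "m = zc x y p" "zz x y p" using assms(1) by (auto simp: Hom_L)
  have "P x y (zc x y p)" using p(2)
  proof (induction rule: zigzag.induct)
    case (zigzag_Nil x) then show ?case using assms(2) by (simp add: L_simps)
  next
    case (zigzag_Fwd f y p)
    then show ?case using assms(3)[of f "zc (trg C f) y p" y] cmp_L[OF zigzag_FwdI[OF mor_Hom], of f y p]
      by (simp add: Hom_LI loc_functor_simps(2)[OF mor_Hom])
  next
    case (zigzag_Bwd s y p)
    then show ?case using assms(4)[of s "zc (src C s) y p" y] cmp_L[OF zigzag_BwdI, of s y p]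
      by (simp add: Hom_LI Qinv_def)
  qed
  then show ?thesis using p by simp
qed

end

lemma localized_localization: "category C \<Longrightarrow> W \<subseteq> mor C \<Longrightarrow> is_loc C W L \<Longrightarrow> localized C W L"
  by (simp add: localized_def localized_axioms_def)

section \<open>Functors out of a localization: the universal property\<close>

primrec zinterp :: "('o1, 'm1, 'z1) cat_scheme \<Rightarrow> ('o2, 'm2, 'z2) cat_scheme \<Rightarrow>
    ('o1, 'm1, 'o2, 'm2) functr \<Rightarrow> 'o1 \<Rightarrow> 'm1 zstep list \<Rightarrow> 'm2" where
  "zinterp C D H x [] = idm D (fob H x)"
| "zinterp C D H x (st # p) = (case st of
      Fwd f \<Rightarrow> zinterp C D H (trg C f) p \<cdot>\<^bsub>D\<^esub> fmor H f
    | Bwd s \<Rightarrow> zinterp C D H (src C s) p \<cdot>\<^bsub>D\<^esub> inv_mor D (fmor H s))"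

text \<open>A morphism of the localization is a class of zigzags. An arbitrary representative is
  chosen, which is harmless because \<open>zinterp\<close> is constant on classes when H inverts W
  (\<open>zinterp_zequiv\<close>).\<close>

definition loc_lift :: "('o1, 'm1, 'z1) cat_scheme \<Rightarrow> ('o2, 'm2, 'z2) cat_scheme \<Rightarrow>
    ('o1, 'm1, 'o2, 'm2) functr \<Rightarrow> ('o1, ('o1, 'm1) loc_mor, 'o2, 'm2) functr" where
  "loc_lift C D H = \<lparr>fob = fob H, fmor = (\<lambda>(x, y, P). zinterp C D H x (SOME p. p \<in> P))\<rparr>"

lemma fob_loc_lift [simp]: "fob (loc_lift C D H) = fob H"
  by (simp add: loc_lift_def)

locale inverting_functor = localized C W L + H: is_functor C D H
  for C :: "('o, 'm, 'z) cat_scheme" and W :: "'m set" and L :: "('o, ('o, 'm) loc_mor, 'w) cat_scheme"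
    and D :: "('o2, 'm2, 'z2) cat_scheme" and H :: "('o, 'm, 'o2, 'm2) functr" +
  assumes inverts: "s \<in> W \<Longrightarrow> is_iso D (fmor H s)"
begin

abbreviation "zi \<equiv> zinterp C D H"

lemma zinterp_Hom: "zz x y p \<Longrightarrow> zi x p \<in> Hom D (fob H x) (fob H y)"
proof (induction rule: zigzag.induct)
  case (zigzag_Nil x) then show ?case by (simp add: H.cod.idm_Hom)
next
  case (zigzag_Fwd f y p) then show ?case by (auto simp: Hom_def)
next
  case (zigzag_Bwd s y p) then show ?case using inverts[of s] by (auto simp: Hom_def)
qed

lemma zinterp_append: "zz x y p \<Longrightarrow> zz y z q \<Longrightarrow> zi x (p @ q) = zi y q \<cdot>\<^bsub>D\<^esub> zi x p"
proof (induction rule: zigzag.induct)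
  case (zigzag_Nil x) then show ?case using HomD[OF zinterp_Hom[OF zigzag_Nil(2)]] by simp
next
  case (zigzag_Fwd f y p) then show ?case
    using HomD[OF zinterp_Hom[OF zigzag_Fwd(2)]] HomD[OF zinterp_Hom[OF zigzag_Fwd(4)]]
    by (simp add: H.cod.assoc)
next
  case (zigzag_Bwd s y p) then show ?case
    using HomD[OF zinterp_Hom[OF zigzag_Bwd(2)]] HomD[OF zinterp_Hom[OF zigzag_Bwd(4)]] inverts[of s]
    by (simp add: H.cod.assoc)
qed

text \<open>Each generating relation of the congruence becomes true in D: the relations for
  identities and composites by functoriality of H, the two cancellation relations because H sends W
  to isomorphisms.\<close>

lemma zinterp_zequiv: "ze x y p p' \<Longrightarrow> zi x p = zi x p'"
proof (induction rule: zequiv.induct)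
  case (zequiv_append x y p p' z q q')
  then show ?case using zequiv_zigzag zinterp_append by metis
next
  case (zequiv_cmp f x y g z)
  then show ?case using HomD[OF zequiv_cmp(1)] HomD[OF zequiv_cmp(2)] by (auto simp: H.fmor_cmp')
qed (use inverts in \<open>auto simp: H.fmor_idm inv_mor_left inv_mor_right\<close>)

lemma fmor_loc_lift: assumes "zz x y p" shows "fmor (loc_lift C D H) (zc x y p) = zi x p"
proof -
  have "ze x y p (SOME q. ze x y p q)" by (rule someI[of _ p]) (rule zequiv_refl[OF assms])
  then show ?thesis by (simp add: loc_lift_def zclass_def zinterp_zequiv[symmetric])
qed

lemma loc_lift_functor: "is_functor L D (loc_lift C D H)"
proof -
  interpret L: category L by (rule category_L)
  show ?thesis
  proof
    fix x assume "x \<in> ob L" then show "fob (loc_lift C D H) x \<in> ob D" by (simp add: L_simps)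
  next
    fix f x y assume "f \<in> Hom L x y"
    then show "fmor (loc_lift C D H) f \<in> Hom D (fob (loc_lift C D H) x) (fob (loc_lift C D H) y)"
      by (auto simp: Hom_L fmor_loc_lift zinterp_Hom)
  next
    fix x assume "x \<in> ob L"
    then show "fmor (loc_lift C D H) (idm L x) = idm D (fob (loc_lift C D H) x)"
      using zigzag_Nil[of x C W] by (simp add: L_simps fmor_loc_lift)
  next
    fix f g x y z assume "f \<in> Hom L x y" "g \<in> Hom L y z"
    then show "fmor (loc_lift C D H) (cmp L g f) = fmor (loc_lift C D H) g \<cdot>\<^bsub>D\<^esub> fmor (loc_lift C D H) f"
      by (auto simp: Hom_L cmp_L fmor_loc_lift zigzag_append zinterp_append)
  qed
qed

lemma loc_lift_Q: "f \<in> mor C \<Longrightarrow> fmor (loc_lift C D H) (Q f) = fmor H f"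
  using fmor_loc_lift[OF zigzag_FwdI[OF mor_Hom], of f] by (simp add: loc_functor_simps(2)[OF mor_Hom])

end

section \<open>Functors between localizations\<close>

locale loc_functors = L1: localized C W L + L2: localized D V M + is_functor C D F
  for C :: "('o, 'm, 'z) cat_scheme" and W :: "'m set" and L :: "('o, ('o, 'm) loc_mor, 'w) cat_scheme"
    and D :: "('o2, 'm2, 'z2) cat_scheme" and V :: "'m2 set" and M :: "('o2, ('o2, 'm2) loc_mor, 'w2) cat_scheme"
    and F :: "('o, 'm, 'o2, 'm2) functr" +
  assumes preserves: "s \<in> W \<Longrightarrow> fmor F s \<in> V"
begin

lemma zigzag_map: "L1.zz x y p \<Longrightarrow> L2.zz (fob F x) (fob F y) (map (map_zstep (fmor F)) p)"
proof (induction rule: zigzag.induct)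
  case (zigzag_Nil x) then show ?case by (auto intro: zigzag.zigzag_Nil)
next
  case (zigzag_Fwd f y p)
  then show ?case using zigzag.zigzag_Fwd[of "fmor F f" D V "fob F y"] by simp
next
  case (zigzag_Bwd s y p)
  then show ?case using zigzag.zigzag_Bwd[of "fmor F s" V D "fob F y"] preserves[of s] by simp
qed

lemma zequiv_map: "L1.ze x y p p' \<Longrightarrow>
  L2.ze (fob F x) (fob F y) (map (map_zstep (fmor F)) p) (map (map_zstep (fmor F)) p')"
proof (induction rule: zequiv.induct)
  case (zequiv_refl x y p) then show ?case by (intro zequiv.zequiv_refl zigzag_map)
next
  case zequiv_sym then show ?case by (blast intro: zequiv.zequiv_sym)
next
  case zequiv_trans then show ?case by (blast intro: zequiv.zequiv_trans)
next
  case zequiv_append then show ?case by (auto intro: zequiv.zequiv_append)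
next
  case (zequiv_idm x) then show ?case using zequiv.zequiv_idm[of "fob F x" D V] by (simp add: fmor_idm)
next
  case (zequiv_cmp f x y g z)
  then show ?case using zequiv.zequiv_cmp[OF fmor_Hom fmor_Hom, of f x y g z] by (simp add: fmor_cmp)
next
  case (zequiv_Fwd_Bwd s)
  then show ?case using zequiv.zequiv_Fwd_Bwd[OF preserves, of s D] by simp
next
  case (zequiv_Bwd_Fwd s)
  then show ?case using zequiv.zequiv_Bwd_Fwd[OF preserves, of s D] by simp
qed

lemma fob_loc_induced: "fob (loc_induced D V F) x = fob F x"
  by (simp add: loc_induced_def)

text \<open>As for composition, the union over representatives collapses to a single class, here by
  \<open>zequiv_map\<close>.\<close>

lemma fmor_loc_induced:
  assumes "L1.zz x y p"
  shows "fmor (loc_induced D V F) (L1.zc x y p) = L2.zc (fob F x) (fob F y) (map (map_zstep (fmor F)) p)"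
proof -
  let ?m = "map (map_zstep (fmor F))"
  have *: "snd (snd (L2.zc (fob F x) (fob F y) (?m p'))) = snd (snd (L2.zc (fob F x) (fob F y) (?m p)))"
    if "L1.ze x y p p'" for p'
    using L2.zclass_eqI[OF zequiv_map[OF that]] by simp
  have "fmor (loc_induced D V F) (L1.zc x y p) = (fob F x, fob F y,
      \<Union>p'\<in>{p'. L1.ze x y p p'}. snd (snd (L2.zc (fob F x) (fob F y) (?m p'))))"
    by (simp add: loc_induced_def zclass_def)
  also have "\<dots> = (fob F x, fob F y,
      \<Union>p'\<in>{p'. L1.ze x y p p'}. snd (snd (L2.zc (fob F x) (fob F y) (?m p))))"
    using * by simp
  also have "\<dots> = (fob F x, fob F y, snd (snd (L2.zc (fob F x) (fob F y) (?m p))))"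
    using zequiv_refl[OF assms] by auto
  finally show ?thesis by (simp add: zclass_def)
qed

lemma loc_induced_functor: "is_functor L M (loc_induced D V F)"
proof -
  interpret L: category L by (rule L1.category_L)
  interpret M: category M by (rule L2.category_L)
  show ?thesis
  proof
    fix x assume "x \<in> ob L" then show "fob (loc_induced D V F) x \<in> ob M"
      by (simp add: L1.L_simps L2.L_simps fob_loc_induced)
  next
    fix f x y assume "f \<in> Hom L x y"
    then show "fmor (loc_induced D V F) f \<in> Hom M (fob (loc_induced D V F) x) (fob (loc_induced D V F) y)"
      by (auto simp: L1.Hom_L fmor_loc_induced fob_loc_induced intro!: L2.Hom_LI zigzag_map)
  next
    fix x assume "x \<in> ob L"
    then show "fmor (loc_induced D V F) (idm L x) = idm M (fob (loc_induced D V F) x)"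
      using zigzag_Nil[of x C W] by (simp add: L1.L_simps L2.L_simps fmor_loc_induced fob_loc_induced)
  next
    fix f g x y z assume "f \<in> Hom L x y" "g \<in> Hom L y z"
    then show "fmor (loc_induced D V F) (cmp L g f) =
        fmor (loc_induced D V F) g \<cdot>\<^bsub>M\<^esub> fmor (loc_induced D V F) f"
      by (auto simp: L1.Hom_L L1.cmp_L fmor_loc_induced L1.zigzag_append L2.cmp_L zigzag_map)
  qed
qed

lemma loc_induced_Q: "f \<in> mor C \<Longrightarrow> fmor (loc_induced D V F) (L1.Q f) = L2.Q (fmor F f)"
  using fmor_loc_induced[OF L1.zigzag_FwdI[OF mor_Hom], of f]
  by (simp add: L1.loc_functor_simps(2)[OF mor_Hom] L2.loc_functor_simps(2)[OF mor_Hom])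

end

section \<open>Natural transformations between functors on a localization\<close>

context localized
begin

text \<open>Naturality squares can be pasted, so only the generators matter. The square of a formal
  inverse is the square of the inverted morphism with two opposite sides inverted. Thus naturality
  on a singularity category can be reduced to chain maps.\<close>

lemma naturality_from_generators:
  assumes "is_functor L D F" "is_functor L D G"
    and eta: "\<And>x. x \<in> ob C \<Longrightarrow> \<eta> x \<in> Hom D (fob F x) (fob G x)"
    and nat: "\<And>f. f \<in> mor C \<Longrightarrow> \<eta> (trg C f) \<cdot>\<^bsub>D\<^esub> fmor F (Q f) = fmor G (Q f) \<cdot>\<^bsub>D\<^esub> \<eta> (src C f)"
    and m: "m \<in> Hom L x y"
  shows "\<eta> y \<cdot>\<^bsub>D\<^esub> fmor F m = fmor G m \<cdot>\<^bsub>D\<^esub> \<eta> x"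
proof -
  interpret F: is_functor L D F by fact
  interpret G: is_functor L D G by fact
  have [simp]: "\<eta> x \<in> mor D" "src D (\<eta> x) = fob F x" "trg D (\<eta> x) = fob G x" if "x \<in> ob C" for x
    using HomD[OF eta[OF that]] by auto
  have [simp]: "Q f \<in> mor L" "src L (Q f) = src C f" "trg L (Q f) = trg C f" if "f \<in> mor C" for f
    using that loc_functor_simps(2)[OF mor_Hom] zigzag_FwdI[OF mor_Hom] by (auto simp: L_simps)
  from m show ?thesis
  proof (induction rule: loc_induct)
    case (idm x) then show ?case by (simp add: F.fmor_idm[unfolded L_simps(1)] G.fmor_idm[unfolded L_simps(1)])
  next
    case (Fwd f y m)
    note [simp] = HomD[OF Fwd(2)]
    have y: "y \<in> ob C" using F.dom.Hom_ob2[OF Fwd(2)] by (simp add: L_simps)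
    have "\<eta> y \<cdot>\<^bsub>D\<^esub> fmor F (cmp L m (Q f)) = (\<eta> y \<cdot>\<^bsub>D\<^esub> fmor F m) \<cdot>\<^bsub>D\<^esub> fmor F (Q f)"
      using Fwd(1) y by (simp add: F.fmor_cmp' F.cod.assoc)
    also have "\<dots> = fmor G m \<cdot>\<^bsub>D\<^esub> (\<eta> (trg C f) \<cdot>\<^bsub>D\<^esub> fmor F (Q f))"
      using Fwd(1) y by (simp add: Fwd(3) F.cod.assoc)
    also have "\<dots> = (fmor G m \<cdot>\<^bsub>D\<^esub> fmor G (Q f)) \<cdot>\<^bsub>D\<^esub> \<eta> (src C f)"
      using Fwd(1) y by (simp add: nat F.cod.assoc)
    also have "\<dots> = fmor G (cmp L m (Q f)) \<cdot>\<^bsub>D\<^esub> \<eta> (src C f)" using Fwd(1) by (simp add: G.fmor_cmp')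
    finally show ?case .
  next
    case (Bwd s y m)
    note [simp] = HomD[OF Bwd(2)] HomD[OF Qinv(1)[OF Bwd(1)]] W_morD[OF Bwd(1)]
    have y: "y \<in> ob C" using F.dom.Hom_ob2[OF Bwd(2)] by (simp add: L_simps)
    \<comment> \<open>Insert the identity \<open>Qinv s\<close> after \<open>Q s\<close> on the
      left, move \<eta> across \<open>Q s\<close> by naturality, and cancel \<open>Q s\<close>
      against \<open>Qinv s\<close> on the right.\<close>
    have 1: "\<eta> (src C s) \<cdot>\<^bsub>D\<^esub> fmor F (Qinv s) = fmor G (Qinv s) \<cdot>\<^bsub>D\<^esub> \<eta> (trg C s)"
    proof -
      have "\<eta> (src C s) \<cdot>\<^bsub>D\<^esub> fmor F (Qinv s) =
          (fmor G (Qinv s) \<cdot>\<^bsub>D\<^esub> fmor G (Q s)) \<cdot>\<^bsub>D\<^esub> (\<eta> (src C s) \<cdot>\<^bsub>D\<^esub> fmor F (Qinv s))"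
        using Bwd(1) by (simp add: G.fmor_cmp'[symmetric] Qinv(2) G.fmor_idm[unfolded L_simps(1)])
      also have "\<dots> = fmor G (Qinv s) \<cdot>\<^bsub>D\<^esub> ((fmor G (Q s) \<cdot>\<^bsub>D\<^esub> \<eta> (src C s)) \<cdot>\<^bsub>D\<^esub> fmor F (Qinv s))"
        by (simp add: F.cod.assoc)
      also have "\<dots> = fmor G (Qinv s) \<cdot>\<^bsub>D\<^esub> (\<eta> (trg C s) \<cdot>\<^bsub>D\<^esub> (fmor F (Q s) \<cdot>\<^bsub>D\<^esub> fmor F (Qinv s)))"
        by (simp add: nat[symmetric] F.cod.assoc)
      also have "\<dots> = fmor G (Qinv s) \<cdot>\<^bsub>D\<^esub> \<eta> (trg C s)"
        using Bwd(1) by (simp add: F.fmor_cmp'[symmetric] Qinv(3) F.fmor_idm[unfolded L_simps(1)])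
      finally show ?thesis .
    qed
    have "\<eta> y \<cdot>\<^bsub>D\<^esub> fmor F (cmp L m (Qinv s)) = (\<eta> y \<cdot>\<^bsub>D\<^esub> fmor F m) \<cdot>\<^bsub>D\<^esub> fmor F (Qinv s)"
      using y by (simp add: F.fmor_cmp' F.cod.assoc)
    also have "\<dots> = fmor G m \<cdot>\<^bsub>D\<^esub> (\<eta> (src C s) \<cdot>\<^bsub>D\<^esub> fmor F (Qinv s))"
      using y by (simp add: Bwd(3) F.cod.assoc)
    also have "\<dots> = (fmor G m \<cdot>\<^bsub>D\<^esub> fmor G (Qinv s)) \<cdot>\<^bsub>D\<^esub> \<eta> (trg C s)"
      using y by (simp add: 1 F.cod.assoc)
    also have "\<dots> = fmor G (cmp L m (Qinv s)) \<cdot>\<^bsub>D\<^esub> \<eta> (trg C s)" by (simp add: G.fmor_cmp')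
    finally show ?case .
  qed
qed

end

section \<open>Preadditive and abelian categories\<close>

definition sub :: "('o, 'm, 'z) addcat_scheme \<Rightarrow> 'm \<Rightarrow> 'm \<Rightarrow> 'm" where
  "sub C f g = add C f (neg C g)"

context category
begin
lemmas hom = Hom_mor Hom_src Hom_trg Hom_ob1 Hom_ob2

text \<open>Composites are normalized to the right, so a rule with left side
  \<open>g \<cdot> f\<close> does not match inside \<open>g \<cdot> (f \<cdot> x)\<close>. This
  derives the matching form of the rule.\<close>

lemma cmp_eq_assoc: "g \<cdot> f = h \<Longrightarrow> f \<in> mor C \<Longrightarrow> g \<in> mor C \<Longrightarrow> src C g = trg C f \<Longrightarrow>
    x \<in> mor C \<Longrightarrow> trg C x = src C f \<Longrightarrow> g \<cdot> (f \<cdot> x) = h \<cdot> x"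
  using assoc by metis
end

context preadditive_category
begin

abbreviation add_infix (infixl "\<oplus>" 65) where "f \<oplus> g \<equiv> add C f g"
abbreviation sub_infix (infixl "\<ominus>" 65) where "f \<ominus> g \<equiv> sub C f g"

lemma group: "x \<in> ob C \<Longrightarrow> y \<in> ob C \<Longrightarrow> comm_group (Hom_group C x y)"
  by (rule Hom_comm_group)

lemma group_simps [simp]: "carrier (Hom_group C x y) = Hom C x y"
  "monoid.mult (Hom_group C x y) = add C" "one (Hom_group C x y) = zer C x y"
  by (simp_all add: Hom_group_def)

lemma add_Hom: "f \<in> Hom C x y \<Longrightarrow> g \<in> Hom C x y \<Longrightarrow> f \<oplus> g \<in> Hom C x y"
proof -
  assume f: "f \<in> Hom C x y" and g: "g \<in> Hom C x y"
  interpret comm_group "Hom_group C x y" using group Hom_ob[OF f] by blast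
  show ?thesis using m_closed f g by simp
qed

lemma zer_Hom: "x \<in> ob C \<Longrightarrow> y \<in> ob C \<Longrightarrow> zer C x y \<in> Hom C x y"
proof -
  assume "x \<in> ob C" "y \<in> ob C"
  then interpret comm_group "Hom_group C x y" by (rule group)
  show ?thesis using one_closed by simp
qed

lemma neg_Hom: "f \<in> Hom C x y \<Longrightarrow> neg C f \<in> Hom C x y"
proof -
  assume f: "f \<in> Hom C x y"
  interpret comm_group "Hom_group C x y" using group Hom_ob[OF f] by blast
  show ?thesis using inv_closed f by (simp add: neg_def HomD[OF f])
qed

lemma sub_Hom: "f \<in> Hom C x y \<Longrightarrow> g \<in> Hom C x y \<Longrightarrow> f \<ominus> g \<in> Hom C x y"
  unfolding sub_def by (intro add_Hom neg_Hom)

lemma add_mor [simp]: "f \<in> mor C \<Longrightarrow> g \<in> mor C \<Longrightarrow> src C f = src C g \<Longrightarrow> trg C f = trg C g \<Longrightarrow> f \<oplus> g \<in> mor C"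
  and src_add [simp]: "f \<in> mor C \<Longrightarrow> g \<in> mor C \<Longrightarrow> src C f = src C g \<Longrightarrow> trg C f = trg C g \<Longrightarrow> src C (f \<oplus> g) = src C g"
  and trg_add [simp]: "f \<in> mor C \<Longrightarrow> g \<in> mor C \<Longrightarrow> src C f = src C g \<Longrightarrow> trg C f = trg C g \<Longrightarrow> trg C (f \<oplus> g) = trg C g"
  using add_Hom[of f "src C f" "trg C f" g] by (auto simp: Hom_def)

lemma sub_mor [simp]: "f \<in> mor C \<Longrightarrow> g \<in> mor C \<Longrightarrow> src C f = src C g \<Longrightarrow> trg C f = trg C g \<Longrightarrow> f \<ominus> g \<in> mor C"
  and src_sub [simp]: "f \<in> mor C \<Longrightarrow> g \<in> mor C \<Longrightarrow> src C f = src C g \<Longrightarrow> trg C f = trg C g \<Longrightarrow> src C (f \<ominus> g) = src C g"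
  and trg_sub [simp]: "f \<in> mor C \<Longrightarrow> g \<in> mor C \<Longrightarrow> src C f = src C g \<Longrightarrow> trg C f = trg C g \<Longrightarrow> trg C (f \<ominus> g) = trg C g"
  using sub_Hom[of f "src C f" "trg C f" g] by (auto simp: Hom_def)

lemma zer_mor [simp]: "x \<in> ob C \<Longrightarrow> y \<in> ob C \<Longrightarrow> zer C x y \<in> mor C"
  and src_zer [simp]: "x \<in> ob C \<Longrightarrow> y \<in> ob C \<Longrightarrow> src C (zer C x y) = x"
  and trg_zer [simp]: "x \<in> ob C \<Longrightarrow> y \<in> ob C \<Longrightarrow> trg C (zer C x y) = y"
  using zer_Hom[of x y] by (auto simp: Hom_def)

lemma neg_mor [simp]: "f \<in> mor C \<Longrightarrow> neg C f \<in> mor C"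
  and src_neg [simp]: "f \<in> mor C \<Longrightarrow> src C (neg C f) = src C f"
  and trg_neg [simp]: "f \<in> mor C \<Longrightarrow> trg C (neg C f) = trg C f"
  using neg_Hom[of f "src C f" "trg C f"] by (auto simp: Hom_def)

context
  fixes f x y
  assumes f: "f \<in> Hom C x y"
begin

interpretation G: comm_group "Hom_group C x y" using group Hom_ob[OF f] by blast

lemma add_comm0: "g \<in> Hom C x y \<Longrightarrow> f \<oplus> g = g \<oplus> f"
  using f G.m_comm by simp

lemma add_assoc0: "g \<in> Hom C x y \<Longrightarrow> h \<in> Hom C x y \<Longrightarrow> f \<oplus> g \<oplus> h = f \<oplus> (g \<oplus> h)"
  using f G.m_assoc by simp

lemma add_zer0: "f \<oplus> zer C x y = f"
  using f G.r_one by simp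

lemma add_neg0: "f \<oplus> neg C f = zer C x y"
  using f G.r_inv by (simp add: neg_def HomD[OF f])

lemma add_cancel0: "g \<in> Hom C x y \<Longrightarrow> h \<in> Hom C x y \<Longrightarrow> f \<oplus> g = f \<oplus> h \<longleftrightarrow> g = h"
  using f G.right_cancel[of f g h] add_comm0 by simp

end

lemma add_comm: "f \<in> mor C \<Longrightarrow> g \<in> mor C \<Longrightarrow> src C f = src C g \<Longrightarrow> trg C f = trg C g \<Longrightarrow> f \<oplus> g = g \<oplus> f"
  by (rule add_comm0) (auto intro: HomI)

lemma add_assoc: "f \<in> mor C \<Longrightarrow> g \<in> mor C \<Longrightarrow> h \<in> mor C \<Longrightarrow> src C f = src C g \<Longrightarrow> trg C f = trg C g \<Longrightarrow>
    src C g = src C h \<Longrightarrow> trg C g = trg C h \<Longrightarrow> f \<oplus> g \<oplus> h = f \<oplus> (g \<oplus> h)"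
  by (rule add_assoc0) (auto intro: HomI)

lemma add_left_comm: "f \<in> mor C \<Longrightarrow> g \<in> mor C \<Longrightarrow> h \<in> mor C \<Longrightarrow> src C f = src C g \<Longrightarrow> trg C f = trg C g \<Longrightarrow>
    src C g = src C h \<Longrightarrow> trg C g = trg C h \<Longrightarrow> f \<oplus> (g \<oplus> h) = g \<oplus> (f \<oplus> h)"
  by (simp add: add_assoc[symmetric] add_comm[of f g])

lemma add_zer [simp]: "f \<in> mor C \<Longrightarrow> src C f = x \<Longrightarrow> trg C f = y \<Longrightarrow> f \<oplus> zer C x y = f"
  using add_zer0[of f x y] by (simp add: HomI)

lemma zer_add [simp]: "f \<in> mor C \<Longrightarrow> src C f = x \<Longrightarrow> trg C f = y \<Longrightarrow> zer C x y \<oplus> f = f"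
  using add_zer[of f x y] add_comm[of "zer C x y" f] by (metis zer_mor src_zer trg_zer src_ob trg_ob)

lemma add_neg: "f \<in> mor C \<Longrightarrow> f \<oplus> neg C f = zer C (src C f) (trg C f)"
  by (rule add_neg0) (auto intro: HomI)

lemma add_cancel: "f \<in> mor C \<Longrightarrow> g \<in> mor C \<Longrightarrow> h \<in> mor C \<Longrightarrow> src C f = src C g \<Longrightarrow> trg C f = trg C g \<Longrightarrow>
    src C g = src C h \<Longrightarrow> trg C g = trg C h \<Longrightarrow> f \<oplus> g = f \<oplus> h \<longleftrightarrow> g = h"
  by (rule add_cancel0) (auto intro: HomI)

lemma add_cancel_right: "f \<in> mor C \<Longrightarrow> g \<in> mor C \<Longrightarrow> h \<in> mor C \<Longrightarrow> src C f = src C g \<Longrightarrow> trg C f = trg C g \<Longrightarrow>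
    src C g = src C h \<Longrightarrow> trg C g = trg C h \<Longrightarrow> g \<oplus> f = h \<oplus> f \<longleftrightarrow> g = h"
  using add_cancel[of f g h] by (simp add: add_comm[of f])

lemma sub_add_cancel: "f \<in> mor C \<Longrightarrow> g \<in> mor C \<Longrightarrow> src C f = src C g \<Longrightarrow> trg C f = trg C g \<Longrightarrow> f \<ominus> g \<oplus> g = f"
  by (simp add: sub_def add_assoc add_comm[of "neg C g" g] add_neg)

lemma sub_eq: "f \<in> mor C \<Longrightarrow> g \<in> mor C \<Longrightarrow> h \<in> mor C \<Longrightarrow> src C f = src C g \<Longrightarrow> trg C f = trg C g \<Longrightarrow>
    src C g = src C h \<Longrightarrow> trg C g = trg C h \<Longrightarrow> f \<ominus> g = h \<longleftrightarrow> f = h \<oplus> g"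
  using add_cancel_right[of g "f \<ominus> g" h] by (simp add: sub_add_cancel)

lemma eq_sub: "f \<in> mor C \<Longrightarrow> g \<in> mor C \<Longrightarrow> h \<in> mor C \<Longrightarrow> src C f = src C g \<Longrightarrow> trg C f = trg C g \<Longrightarrow>
    src C g = src C h \<Longrightarrow> trg C g = trg C h \<Longrightarrow> h = f \<ominus> g \<longleftrightarrow> h \<oplus> g = f"
  using sub_eq[of f g h] by metis

lemma neg_sub: "f \<in> mor C \<Longrightarrow> neg C f = zer C (src C f) (trg C f) \<ominus> f"
  by (simp add: eq_sub add_comm[of "neg C f" f] add_neg)

lemma sub_self [simp]: "f \<in> mor C \<Longrightarrow> f \<ominus> f = zer C (src C f) (trg C f)"
  by (simp add: sub_eq)

lemma sub_zer [simp]: "f \<in> mor C \<Longrightarrow> src C f = x \<Longrightarrow> trg C f = y \<Longrightarrow> f \<ominus> zer C x y = f"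
  by (auto simp: sub_eq)

lemma add_sub: "f \<in> mor C \<Longrightarrow> g \<in> mor C \<Longrightarrow> h \<in> mor C \<Longrightarrow> src C f = src C g \<Longrightarrow> trg C f = trg C g \<Longrightarrow>
    src C g = src C h \<Longrightarrow> trg C g = trg C h \<Longrightarrow> f \<oplus> (g \<ominus> h) = f \<oplus> g \<ominus> h"
  by (simp add: eq_sub add_assoc sub_add_cancel)

lemma sub_add: "f \<in> mor C \<Longrightarrow> g \<in> mor C \<Longrightarrow> h \<in> mor C \<Longrightarrow> src C f = src C g \<Longrightarrow> trg C f = trg C g \<Longrightarrow>
    src C g = src C h \<Longrightarrow> trg C g = trg C h \<Longrightarrow> (f \<ominus> g) \<oplus> h = f \<oplus> h \<ominus> g"
  by (simp add: add_comm[of "f \<ominus> g" h] add_comm[of f h] add_sub)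

lemma sub_sub: "f \<in> mor C \<Longrightarrow> g \<in> mor C \<Longrightarrow> h \<in> mor C \<Longrightarrow> src C f = src C g \<Longrightarrow> trg C f = trg C g \<Longrightarrow>
    src C g = src C h \<Longrightarrow> trg C g = trg C h \<Longrightarrow> f \<ominus> (g \<ominus> h) = f \<oplus> h \<ominus> g"
proof -
  assume [simp]: "f \<in> mor C" "g \<in> mor C" "h \<in> mor C" "src C f = src C g" "trg C f = trg C g"
    "src C g = src C h" "trg C g = trg C h"
  have "f \<ominus> (g \<ominus> h) \<oplus> g = f \<ominus> (g \<ominus> h) \<oplus> ((g \<ominus> h) \<oplus> h)" by (simp add: sub_add_cancel)
  also have "\<dots> = f \<oplus> h" by (subst add_assoc[symmetric]) (simp_all add: sub_add_cancel)
  finally show "f \<ominus> (g \<ominus> h) = f \<oplus> h \<ominus> g" by (simp add: eq_sub)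
qed

lemma sub_sub': "f \<in> mor C \<Longrightarrow> g \<in> mor C \<Longrightarrow> h \<in> mor C \<Longrightarrow> src C f = src C g \<Longrightarrow> trg C f = trg C g \<Longrightarrow>
    src C g = src C h \<Longrightarrow> trg C g = trg C h \<Longrightarrow> (f \<ominus> g) \<ominus> h = f \<ominus> (g \<oplus> h)"
  by (simp add: sub_eq add_assoc add_comm[of g h] sub_add_cancel)

lemma cmp_add: "f \<in> mor C \<Longrightarrow> g \<in> mor C \<Longrightarrow> h \<in> mor C \<Longrightarrow> src C f = src C g \<Longrightarrow> trg C f = trg C g \<Longrightarrow>
    src C h = trg C g \<Longrightarrow> h \<cdot> (f \<oplus> g) = h \<cdot> f \<oplus> h \<cdot> g"
  using cmp_add_right[of f "src C f" "trg C f" g h "trg C h"] by (simp add: Hom_def)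

lemma add_cmp: "f \<in> mor C \<Longrightarrow> g \<in> mor C \<Longrightarrow> h \<in> mor C \<Longrightarrow> src C g = trg C f \<Longrightarrow> src C h = src C g \<Longrightarrow>
    trg C h = trg C g \<Longrightarrow> (g \<oplus> h) \<cdot> f = g \<cdot> f \<oplus> h \<cdot> f"
  using cmp_add_left[of f "src C f" "trg C f" g "trg C g" h] by (simp add: Hom_def)

lemma cmp_zer [simp]:
  assumes "h \<in> mor C" "src C h = y" "x \<in> ob C" shows "h \<cdot> zer C x y = zer C x (trg C h)"
proof -
  have y: "y \<in> ob C" using assms src_ob by auto
  have "h \<cdot> zer C x y \<oplus> h \<cdot> zer C x y = h \<cdot> zer C x y \<oplus> zer C x (trg C h)"
    using assms y by (simp add: cmp_add[symmetric])
  then show ?thesis using assms y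
    by (subst (asm) add_cancel) simp_all
qed

lemma zer_cmp [simp]:
  assumes "f \<in> mor C" "trg C f = y" "z \<in> ob C" shows "zer C y z \<cdot> f = zer C (src C f) z"
proof -
  have y: "y \<in> ob C" using assms trg_ob by auto
  have "zer C y z \<cdot> f \<oplus> zer C y z \<cdot> f = zer C y z \<cdot> f \<oplus> zer C (src C f) z"
    using assms y by (simp add: add_cmp[symmetric])
  then show ?thesis using assms y
    by (subst (asm) add_cancel) simp_all
qed

lemma cmp_sub: "f \<in> mor C \<Longrightarrow> g \<in> mor C \<Longrightarrow> h \<in> mor C \<Longrightarrow> src C f = src C g \<Longrightarrow> trg C f = trg C g \<Longrightarrow>
    src C h = trg C g \<Longrightarrow> h \<cdot> (f \<ominus> g) = h \<cdot> f \<ominus> h \<cdot> g"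
  by (simp add: eq_sub cmp_add[symmetric] sub_add_cancel)

lemma sub_cmp: "f \<in> mor C \<Longrightarrow> g \<in> mor C \<Longrightarrow> h \<in> mor C \<Longrightarrow> src C g = trg C f \<Longrightarrow> src C h = src C g \<Longrightarrow>
    trg C h = trg C g \<Longrightarrow> (g \<ominus> h) \<cdot> f = g \<cdot> f \<ominus> h \<cdot> f"
  by (simp add: eq_sub add_cmp[symmetric] sub_add_cancel)

text \<open>The normal form is a difference of sums of right-associated composites; an equation
  between such forms is rewritten to an equation between sums.\<close>

lemmas alg = assoc cmp_add add_cmp cmp_sub sub_cmp neg_sub add_sub sub_add sub_sub sub_sub' sub_eq eq_sub
  add_assoc add_comm add_left_comm

lemma sub_zer_iff: "f \<in> Hom C x y \<Longrightarrow> g \<in> Hom C x y \<Longrightarrow> f \<ominus> g = zer C x y \<longleftrightarrow> f = g"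
  using Hom_ob[of f x y] by (auto simp: Hom_def sub_eq)

lemma mono_iff: "is_mono C k \<longleftrightarrow> k \<in> mor C \<and>
    (\<forall>x. \<forall>a \<in> Hom C x (src C k). k \<cdot> a = zer C x (trg C k) \<longrightarrow> a = zer C x (src C k))"
  (is "_ \<longleftrightarrow> _ \<and> ?R")
proof (intro iffI conjI; (elim conjE)?)
  assume "is_mono C k"
  then show k: "k \<in> mor C" by (simp add: is_mono_def)
  show ?R
  proof (intro allI ballI impI)
    fix x a assume a: "a \<in> Hom C x (src C k)" "k \<cdot> a = zer C x (trg C k)"
    note [simp] = hom[OF a(1)] k
    have "k \<cdot> a = k \<cdot> zer C x (src C k)" using a by simp
    then show "a = zer C x (src C k)" using \<open>is_mono C k\<close> a zer_Hom[of x "src C k"]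
      unfolding is_mono_def by (meson hom(4) k src_ob)
  qed
next
  assume k: "k \<in> mor C" and R: ?R
  show "is_mono C k" unfolding is_mono_def
  proof (intro conjI ballI impI k)
    fix x g h assume gh: "x \<in> ob C" "g \<in> Hom C x (src C k)" "h \<in> Hom C x (src C k)" "k \<cdot> g = k \<cdot> h"
    note [simp] = hom[OF gh(2)] hom[OF gh(3)] k
    have "k \<cdot> (g \<ominus> h) = zer C x (trg C k)" using gh by (simp add: cmp_sub)
    then have "g \<ominus> h = zer C x (src C k)" using R sub_Hom[OF gh(2,3)] by blast
    then show "g = h" using sub_zer_iff gh by blast
  qed
qed

lemma epi_iff: "is_epi C k \<longleftrightarrow> k \<in> mor C \<and>
    (\<forall>x. \<forall>a \<in> Hom C (trg C k) x. a \<cdot> k = zer C (src C k) x \<longrightarrow> a = zer C (trg C k) x)"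
  (is "_ \<longleftrightarrow> _ \<and> ?R")
proof (intro iffI conjI; (elim conjE)?)
  assume "is_epi C k"
  then show k: "k \<in> mor C" by (simp add: is_epi_def)
  show ?R
  proof (intro allI ballI impI)
    fix x a assume a: "a \<in> Hom C (trg C k) x" "a \<cdot> k = zer C (src C k) x"
    note [simp] = hom[OF a(1)] k
    have "a \<cdot> k = zer C (trg C k) x \<cdot> k" using a by simp
    then show "a = zer C (trg C k) x" using \<open>is_epi C k\<close> a zer_Hom[of "trg C k" x]
      unfolding is_epi_def by (meson hom(5) k trg_ob)
  qed
next
  assume k: "k \<in> mor C" and R: ?R
  show "is_epi C k" unfolding is_epi_def
  proof (intro conjI ballI impI k)
    fix x g h assume gh: "x \<in> ob C" "g \<in> Hom C (trg C k) x" "h \<in> Hom C (trg C k) x" "g \<cdot> k = h \<cdot> k"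
    note [simp] = hom[OF gh(2)] hom[OF gh(3)] k
    have "(g \<ominus> h) \<cdot> k = zer C (src C k) x" using gh by (simp add: sub_cmp)
    then have "g \<ominus> h = zer C (trg C k) x" using R sub_Hom[OF gh(2,3)] by blast
    then show "g = h" using sub_zer_iff gh by blast
  qed
qed

lemma epiD: "is_epi C c \<Longrightarrow> c \<in> Hom C w x \<Longrightarrow> f \<in> Hom C x y \<Longrightarrow> g \<in> Hom C x y \<Longrightarrow> f \<cdot> c = g \<cdot> c \<Longrightarrow> f = g"
  unfolding is_epi_def by (metis Hom_trg Hom_ob2)

lemma monoD: "is_mono C c \<Longrightarrow> c \<in> Hom C y z \<Longrightarrow> f \<in> Hom C x y \<Longrightarrow> g \<in> Hom C x y \<Longrightarrow> c \<cdot> f = c \<cdot> g \<Longrightarrow> f = g"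
  unfolding is_mono_def by (metis Hom_src Hom_ob1)

lemma is_kernelD: "is_kernel C f k \<Longrightarrow> h \<in> Hom C w (src C f) \<Longrightarrow> f \<cdot> h = zer C w (trg C f) \<Longrightarrow>
    \<exists>u \<in> Hom C w (src C k). k \<cdot> u = h"
  unfolding is_kernel_def using Hom_ob1 by blast

lemma zero_object_iff: "zero_object C z \<longleftrightarrow> z \<in> ob C \<and> idm C z = zer C z z"
proof
  assume "zero_object C z" then show "z \<in> ob C \<and> idm C z = zer C z z"
    unfolding zero_object_def using idm_Hom zer_Hom by blast
next
  assume z: "z \<in> ob C \<and> idm C z = zer C z z"
  have "f = zer C x z" if "f \<in> Hom C x z" for f x
    using z idm_cmp'[of f z] hom[OF that] by simp
  moreover have "f = zer C z x" if "f \<in> Hom C z x" for f x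
    using z cmp_idm'[of f z] hom[OF that] by simp
  ultimately show "zero_object C z" unfolding zero_object_def using z zer_Hom by blast
qed

lemma to_zero: assumes "zero_object C z" "f \<in> Hom C x z" shows "f = zer C x z"
proof -
  note [simp] = hom[OF assms(2)]
  have "f = idm C z \<cdot> f" by simp
  also have "idm C z = zer C z z" using assms(1) by (simp add: zero_object_iff)
  finally show ?thesis by simp
qed

lemma from_zero: assumes "zero_object C z" "f \<in> Hom C z x" shows "f = zer C z x"
proof -
  note [simp] = hom[OF assms(2)]
  have "f = f \<cdot> idm C z" by simp
  also have "idm C z = zer C z z" using assms(1) by (simp add: zero_object_iff)
  finally show ?thesis by simp
qed

lemma zero_object_ob: "zero_object C z \<Longrightarrow> z \<in> ob C" by (simp add: zero_object_def)

lemma zero_object_projective: "zero_object C z \<Longrightarrow> projective C z"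
  unfolding projective_def is_epi_def
  by (auto simp: zero_object_ob)
    (metis cmp_zer from_zero src_ob zer_Hom zero_object_ob)

lemma projective_ob: "projective C P \<Longrightarrow> P \<in> ob C" by (simp add: projective_def)

lemma projective_lift:
  assumes "projective C P" "is_epi C g" "g \<in> Hom C x y" "f \<in> Hom C P y"
  obtains h where "h \<in> Hom C P x" "g \<cdot> h = f"
  using assms unfolding projective_def Hom_def by auto

text \<open>A lift of \<open>f \<cdot> r\<close> along g, restricted along s, is a lift of f because
  \<open>r \<cdot> s\<close> is the identity.\<close>

lemma projective_retract:
  assumes P: "projective C P" and s: "s \<in> Hom C M P" and r: "r \<in> Hom C P M" and rs: "r \<cdot> s = idm C M"
  shows "projective C M"
  unfolding projective_def
proof (intro conjI allI impI ballI)
  note [simp] = hom[OF s] hom[OF r]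
  show "M \<in> ob C" by simp
  fix g f assume g: "is_epi C g" and f: "f \<in> Hom C M (trg C g)"
  note [simp] = hom[OF f]
  have gm [simp]: "g \<in> mor C" using g by (simp add: is_epi_def)
  have "f \<cdot> r \<in> Hom C P (trg C g)" using f r by (auto simp: Hom_def)
  then obtain h where h: "h \<in> Hom C P (src C g)" "g \<cdot> h = f \<cdot> r"
    using projective_lift[OF P g mor_Hom[OF gm]] by blast
  note [simp] = hom[OF h(1)]
  have "g \<cdot> (h \<cdot> s) = f" by (simp add: assoc[symmetric] h(2)) (simp add: assoc rs)
  moreover have "h \<cdot> s \<in> Hom C M (src C g)" by (simp add: Hom_def)
  ultimately show "\<exists>h\<in>Hom C M (src C g). g \<cdot> h = f" by blast
qed

end

section \<open>Biproducts\<close>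

context
  fixes C (structure) and x y s i1 i2 p1 p2
  assumes bp: "is_biproduct C x y s i1 i2 p1 p2" and C: "preadditive_category C"
begin

interpretation preadditive_category C by (fact C)

lemma biproduct_simps:
  "x \<in> ob C" "y \<in> ob C" "s \<in> ob C" "i1 \<in> Hom C x s" "i2 \<in> Hom C y s" "p1 \<in> Hom C s x" "p2 \<in> Hom C s y"
  "p1 \<cdot> i1 = idm C x" "p2 \<cdot> i2 = idm C y" "p1 \<cdot> i2 = zer C y x" "p2 \<cdot> i1 = zer C x y"
  "i1 \<cdot> p1 \<oplus> i2 \<cdot> p2 = idm C s"
  using bp by (auto simp: is_biproduct_def)

lemma biproduct_projective: assumes "projective C x" "projective C y" shows "projective C s"
  unfolding projective_def
proof (intro conjI allI impI ballI)
  note [simp] = hom[OF biproduct_simps(4)] hom[OF biproduct_simps(5)] hom[OF biproduct_simps(6)] hom[OF biproduct_simps(7)]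
  show "s \<in> ob C" by simp
  fix g f assume g: "is_epi C g" and f: "f \<in> Hom C s (trg C g)"
  note [simp] = hom[OF f]
  have gm [simp]: "g \<in> mor C" using g by (simp add: is_epi_def)
  obtain h1 where h1: "h1 \<in> Hom C x (src C g)" "g \<cdot> h1 = f \<cdot> i1"
    using projective_lift[OF assms(1) g mor_Hom[OF gm], of "f \<cdot> i1"] f by (auto simp: Hom_def)
  obtain h2 where h2: "h2 \<in> Hom C y (src C g)" "g \<cdot> h2 = f \<cdot> i2"
    using projective_lift[OF assms(2) g mor_Hom[OF gm], of "f \<cdot> i2"] f by (auto simp: Hom_def)
  note [simp] = hom[OF h1(1)] hom[OF h2(1)]
  have "g \<cdot> (h1 \<cdot> p1 \<oplus> h2 \<cdot> p2) = f \<cdot> (i1 \<cdot> p1 \<oplus> i2 \<cdot> p2)"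
    by (simp add: cmp_add assoc[symmetric] h1(2) h2(2))
  then have "g \<cdot> (h1 \<cdot> p1 \<oplus> h2 \<cdot> p2) = f" by (simp add: biproduct_simps(12))
  moreover have "h1 \<cdot> p1 \<oplus> h2 \<cdot> p2 \<in> Hom C s (src C g)" by (simp add: Hom_def)
  ultimately show "\<exists>h\<in>Hom C s (src C g). g \<cdot> h = f" by blast
qed

lemma biproduct_zero: assumes "zero_object C x" "zero_object C y" shows "zero_object C s"
proof -
  note [simp] = hom[OF biproduct_simps(4)] hom[OF biproduct_simps(5)] hom[OF biproduct_simps(6)] hom[OF biproduct_simps(7)]
  have "i1 = zer C x s" "i2 = zer C y s" using from_zero assms biproduct_simps by blast+
  then show ?thesis using biproduct_simps(12) by (simp add: zero_object_iff)
qed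

end

locale abelian_enough = abelian_category C for C :: "('o, 'm, 'z) addcat_scheme" (structure) +
  assumes enough: "enough_projectives C"

section \<open>Kernels, cokernels and images\<close>

context abelian_category
begin

text \<open>The universal property in the form used by diagram chases: existence of the
  factorization, with its uniqueness packed into the monomorphism.\<close>

lemma kernel:
  assumes "f \<in> Hom C x y"
  obtains K k where "k \<in> Hom C K x" "f \<cdot> k = zer C K y" "is_mono C k"
    "\<And>w h. h \<in> Hom C w x \<Longrightarrow> f \<cdot> h = zer C w y \<Longrightarrow> \<exists>u \<in> Hom C w K. k \<cdot> u = h"
    "is_kernel C f k"
proof -
  note [simp] = hom[OF assms]
  obtain k where k: "is_kernel C f k" using ex_kernel[of f] by auto
  have *: "k \<in> mor C" "trg C k = x" "f \<cdot> k = zer C (src C k) y"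
     "\<And>w h. w \<in> ob C \<Longrightarrow> h \<in> Hom C w x \<Longrightarrow> f \<cdot> h = zer C w y \<Longrightarrow> \<exists>!u. u \<in> Hom C w (src C k) \<and> k \<cdot> u = h"
    using k by (auto simp: is_kernel_def)
  note [simp] = *(1,2)
  have "is_mono C k" unfolding is_mono_def
  proof (intro conjI ballI impI)
    fix w g h assume w: "w \<in> ob C" and gh: "g \<in> Hom C w (src C k)" "h \<in> Hom C w (src C k)" "k \<cdot> g = k \<cdot> h"
    note [simp] = hom[OF gh(1)] hom[OF gh(2)]
    have "f \<cdot> (k \<cdot> g) = zer C w y" by (simp add: assoc[symmetric] *(3))
    moreover have "k \<cdot> g \<in> Hom C w x" by (simp add: Hom_def)
    ultimately show "g = h" using *(4)[OF w] gh by metis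
  qed simp
  moreover have "\<exists>u \<in> Hom C w (src C k). k \<cdot> u = h" if "h \<in> Hom C w x" "f \<cdot> h = zer C w y" for w h
    using *(4)[OF Hom_ob1[OF that(1)] that] by blast
  ultimately show ?thesis using *(3) k by (intro that[of k "src C k"]) (auto intro: HomI)
qed

lemma cokernel:
  assumes "f \<in> Hom C x y"
  obtains K k where "k \<in> Hom C y K" "k \<cdot> f = zer C x K" "is_epi C k"
    "\<And>w h. h \<in> Hom C y w \<Longrightarrow> h \<cdot> f = zer C x w \<Longrightarrow> \<exists>u \<in> Hom C K w. u \<cdot> k = h"
    "is_cokernel C f k"
proof -
  note [simp] = hom[OF assms]
  obtain k where k: "is_cokernel C f k" using ex_cokernel[of f] by auto
  have *: "k \<in> mor C" "src C k = y" "k \<cdot> f = zer C x (trg C k)"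
     "\<And>w h. w \<in> ob C \<Longrightarrow> h \<in> Hom C y w \<Longrightarrow> h \<cdot> f = zer C x w \<Longrightarrow> \<exists>!u. u \<in> Hom C (trg C k) w \<and> u \<cdot> k = h"
    using k by (auto simp: is_cokernel_def)
  note [simp] = *(1,2)
  have "is_epi C k" unfolding is_epi_def
  proof (intro conjI ballI impI)
    fix w g h assume w: "w \<in> ob C" and gh: "g \<in> Hom C (trg C k) w" "h \<in> Hom C (trg C k) w" "g \<cdot> k = h \<cdot> k"
    note [simp] = hom[OF gh(1)] hom[OF gh(2)]
    have "(g \<cdot> k) \<cdot> f = zer C x w" by (simp add: assoc *(3))
    moreover have "g \<cdot> k \<in> Hom C y w" by (simp add: Hom_def)
    ultimately show "g = h" using *(4)[OF w] gh by metis
  qed simp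
  moreover have "\<exists>u \<in> Hom C (trg C k) w. u \<cdot> k = h" if "h \<in> Hom C y w" "h \<cdot> f = zer C x w" for w h
    using *(4)[OF Hom_ob2[OF that(1)] that] by blast
  ultimately show ?thesis using *(3) k by (intro that[of k "trg C k"]) (auto intro: HomI)
qed

text \<open>If \<open>m\<close> is the kernel of the cokernel of \<open>f = m u\<close>, and \<open>t u = 0\<close>, then the kernel of \<open>t\<close>
  composed with \<open>m\<close> is a kernel that contains the image of \<open>f\<close>, so it is all of \<open>m\<close>.\<close>

lemma image_factor_epi:
  assumes c: "is_cokernel C f c" and m: "is_kernel C c m" and u: "u \<in> Hom C (src C f) (src C m)" "m \<cdot> u = f"
  shows "is_epi C u"
proof -
  have f [simp]: "f \<in> mor C" "c \<in> mor C" "m \<in> mor C" "src C c = trg C f" "trg C m = trg C f"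
    and cf: "c \<cdot> f = zer C (src C f) (trg C c)" and cm: "c \<cdot> m = zer C (src C m) (trg C c)"
    using c m by (auto simp: is_cokernel_def is_kernel_def)
  note [simp] = hom[OF u(1)]
  have m_mono: "a = b" if "a \<in> Hom C w (src C m)" "b \<in> Hom C w (src C m)" "m \<cdot> a = m \<cdot> b" for a b w
  proof -
    note [simp] = hom[OF that(1)] hom[OF that(2)]
    have "c \<cdot> (m \<cdot> a) = zer C w (trg C c)" by (simp add: assoc[symmetric] cm)
    moreover have "m \<cdot> a \<in> Hom C w (src C c)" by (simp add: Hom_def)
    ultimately have "\<exists>!v. v \<in> Hom C w (src C m) \<and> m \<cdot> v = m \<cdot> a"
      using m unfolding is_kernel_def by simp
    then show ?thesis using that by metis
  qed
  show ?thesis unfolding epi_iff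
  proof (intro conjI allI ballI impI)
    fix z t assume t: "t \<in> Hom C (trg C u) z" "t \<cdot> u = zer C (src C u) z"
    then have t': "t \<in> Hom C (src C m) z" by simp
    note [simp] = hom[OF t']
    obtain K k where k: "k \<in> Hom C K (src C m)" "t \<cdot> k = zer C K z" "is_mono C k"
        "\<And>w h. h \<in> Hom C w (src C m) \<Longrightarrow> t \<cdot> h = zer C w z \<Longrightarrow> \<exists>u \<in> Hom C w K. k \<cdot> u = h"
      using kernel[OF t'] by metis
    note [simp] = hom[OF k(1)]
    obtain v where v: "v \<in> Hom C (src C f) K" "k \<cdot> v = u" using k(4)[OF u(1)] t by auto
    note [simp] = hom[OF v(1)]
    have "is_mono C (m \<cdot> k)" unfolding is_mono_def
    proof (intro conjI ballI impI)
      fix w a b assume ab: "w \<in> ob C" "a \<in> Hom C w (src C (m \<cdot> k))" "b \<in> Hom C w (src C (m \<cdot> k))"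
        "m \<cdot> k \<cdot> a = m \<cdot> k \<cdot> b"
      then have ab': "a \<in> Hom C w K" "b \<in> Hom C w K" by simp_all
      note [simp] = hom[OF ab'(1)] hom[OF ab'(2)]
      have "k \<cdot> a = k \<cdot> b" by (rule m_mono[where w = w]; (rule HomI)?) (use ab(4) in \<open>simp_all add: assoc\<close>)
      then show "a = b" using monoD[OF k(3,1) ab'] by blast
    qed simp
    then obtain g where g: "is_kernel C g (m \<cdot> k)" using mono_is_kernel by blast
    have gm [simp]: "g \<in> mor C" "src C g = trg C f" and gmk: "g \<cdot> (m \<cdot> k) = zer C K (trg C g)"
      using g by (auto simp: is_kernel_def)
    have "g \<cdot> f = g \<cdot> (m \<cdot> k) \<cdot> v" by (simp add: assoc u(2) v(2))
    then have "g \<cdot> f = zer C (src C f) (trg C g)" by (simp add: gmk)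
    then obtain w where w: "w \<in> Hom C (trg C c) (trg C g)" "w \<cdot> c = g"
      using c mor_Hom[OF gm(1)] unfolding is_cokernel_def by (metis gm trg_ob)
    note [simp] = hom[OF w(1)]
    have "g \<cdot> m = w \<cdot> (c \<cdot> m)" using w(2) by (simp add: assoc[symmetric])
    then have "g \<cdot> m = zer C (src C m) (trg C g)" by (simp add: cm)
    then obtain s where s: "s \<in> Hom C (src C m) K" "m \<cdot> k \<cdot> s = m"
      using is_kernelD[OF g, of m "src C m"] mor_Hom[OF f(3)] by auto
    note [simp] = hom[OF s(1)]
    have "k \<cdot> s = idm C (src C m)" by (rule m_mono[where w = "src C m"]; (rule HomI)?) (use s(2) in \<open>simp_all add: assoc\<close>)
    then have "t = t \<cdot> (k \<cdot> s)" by simp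
    also have "\<dots> = zer C (src C m) z" using k(2) by (simp add: assoc[symmetric])
    finally show "t = zer C (trg C u) z" by simp
  qed simp
qed

end

section \<open>Testing morphisms and exactness on projective objects\<close>

context abelian_enough
begin

lemma cover:
  assumes "x \<in> ob C" obtains P g where "projective C P" "g \<in> Hom C P x" "is_epi C g"
  using enough assms unfolding enough_projectives_def by metis

text \<open>An epimorphism from a projective object onto x already separates f and g. This is the
  principle behind treating morphisms from projective objects as elements.\<close>

lemma eq_on_projectives:
  assumes f: "f \<in> Hom C x y" and g: "g \<in> Hom C x y"
    and eq: "\<And>T a. projective C T \<Longrightarrow> a \<in> Hom C T x \<Longrightarrow> f \<cdot> a = g \<cdot> a"
  shows "f = g"
proof -
  obtain P c where c: "projective C P" "c \<in> Hom C P x" "is_epi C c" using cover Hom_ob1[OF f] by blast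
  then show ?thesis using eq[OF c(1,2)] f g epiD by blast
qed

lemma epi_if_surj_on_projectives:
  assumes g: "g \<in> Hom C x y"
    and surj: "\<And>T a. projective C T \<Longrightarrow> a \<in> Hom C T y \<Longrightarrow> \<exists>b\<in>Hom C T x. g \<cdot> b = a"
  shows "is_epi C g"
  unfolding epi_iff
proof (intro conjI allI ballI impI)
  note [simp] = hom[OF g]
  show "g \<in> mor C" by simp
  fix z a assume a: "a \<in> Hom C (trg C g) z" "a \<cdot> g = zer C (src C g) z"
  then have a': "a \<in> Hom C y z" by simp
  note [simp] = hom[OF a']
  show "a = zer C (trg C g) z"
  proof (rule eq_on_projectives[of _ y z])
    fix T b assume "projective C T" "b \<in> Hom C T y"
    then obtain c where c: "c \<in> Hom C T x" "g \<cdot> c = b" using surj by blast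
    note [simp] = hom[OF c(1)]
    show "a \<cdot> b = zer C (trg C g) z \<cdot> b" using a(2) c(2)[symmetric] by (simp add: assoc[symmetric])
  qed (use a' in \<open>auto intro: zer_Hom\<close>)
qed

lemma zero_if_no_elements:
  assumes "x \<in> ob C" "\<And>T a. projective C T \<Longrightarrow> a \<in> Hom C T x \<Longrightarrow> a = zer C T x"
  shows "zero_object C x"
  unfolding zero_object_iff
proof (rule conjI[OF assms(1) eq_on_projectives[of _ x x]])
  fix T a assume T: "projective C T" and a: "a \<in> Hom C T x"
  show "idm C x \<cdot> a = zer C x x \<cdot> a" using assms(2)[OF T a] hom[OF a] by simp
qed (use assms in \<open>auto intro: zer_Hom idm_Hom\<close>)

text \<open>The half of exactness that asserts existence: elements killed by g come from f. The
  condition that \<open>g \<cdot> f\<close> vanishes is kept separate.\<close>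

definition texact :: "'m \<Rightarrow> 'm \<Rightarrow> bool" where
  "texact f g \<longleftrightarrow> (\<forall>T. projective C T \<longrightarrow> (\<forall>a \<in> Hom C T (src C g). g \<cdot> a = zer C T (trg C g) \<longrightarrow>
      (\<exists>b \<in> Hom C T (src C f). f \<cdot> b = a)))"

lemma texactD: "texact f g \<Longrightarrow> f \<in> Hom C x y \<Longrightarrow> g \<in> Hom C y z \<Longrightarrow> projective C T \<Longrightarrow> a \<in> Hom C T y \<Longrightarrow>
    g \<cdot> a = zer C T z \<Longrightarrow> \<exists>b \<in> Hom C T x. f \<cdot> b = a"
  unfolding texact_def Hom_def by auto

lemma texactI: "f \<in> Hom C x y \<Longrightarrow> g \<in> Hom C y z \<Longrightarrow> (\<And>T a. projective C T \<Longrightarrow> a \<in> Hom C T y \<Longrightarrow>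
    g \<cdot> a = zer C T z \<Longrightarrow> \<exists>b \<in> Hom C T x. f \<cdot> b = a) \<Longrightarrow> texact f g"
  unfolding texact_def Hom_def by auto

text \<open>If one m is both the image of f and the kernel of g, then f is m after an epimorphism,
  and elements of the kernel lift along it by projectivity. Conversely, if elements lift, the kernel
  m of g is killed by the cokernel c of f, and as g factors through c, m is also the kernel of
  c.\<close>

lemma exact_at_iff:
  assumes f: "f \<in> Hom C x y" and g: "g \<in> Hom C y z"
  shows "exact_at C f g \<longleftrightarrow> g \<cdot> f = zer C x z \<and> texact f g"
proof
  note [simp] = hom[OF f] hom[OF g]
  assume "exact_at C f g"
  then obtain m c where c: "is_cokernel C f c" and m: "is_kernel C c m" and mg: "is_kernel C g m"
    unfolding exact_at_def is_image_def by blast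
  have [simp]: "c \<in> mor C" "m \<in> mor C" "src C c = y" "trg C m = y" and gm: "g \<cdot> m = zer C (src C m) z"
    and cf: "c \<cdot> f = zer C x (trg C c)"
    using c m mg by (auto simp: is_cokernel_def is_kernel_def)
  obtain u where u: "u \<in> Hom C x (src C m)" "m \<cdot> u = f"
    using is_kernelD[OF m, of f x] f cf by auto
  note [simp] = hom[OF u(1)]
  have "is_epi C u" using image_factor_epi[OF c m] u by simp
  have "g \<cdot> f = zer C x z" using gm unfolding u(2)[symmetric] by (simp add: assoc[symmetric])
  moreover have "texact f g"
  proof (rule texactI[OF f g])
    fix T a assume T: "projective C T" and a: "a \<in> Hom C T y" "g \<cdot> a = zer C T z"
    note [simp] = hom[OF a(1)]
    obtain b where b: "b \<in> Hom C T (src C m)" "m \<cdot> b = a" using is_kernelD[OF mg, of a T] a by auto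
    obtain d where d: "d \<in> Hom C T x" "u \<cdot> d = b"
      using projective_lift[OF T \<open>is_epi C u\<close> u(1) b(1)] by blast
    note [simp] = hom[OF d(1)]
    have "f \<cdot> d = a" using u(2) d(2) b(2) by (metis assoc d(1) u(1) hom \<open>m \<in> mor C\<close>)
    then show "\<exists>b\<in>Hom C T x. f \<cdot> b = a" using d by blast
  qed
  ultimately show "g \<cdot> f = zer C x z \<and> texact f g" by blast
next
  note [simp] = hom[OF f] hom[OF g]
  assume gf: "g \<cdot> f = zer C x z \<and> texact f g"
  obtain K m where m: "m \<in> Hom C K y" "g \<cdot> m = zer C K z" "is_mono C m"
      "\<And>w h. h \<in> Hom C w y \<Longrightarrow> g \<cdot> h = zer C w z \<Longrightarrow> \<exists>u \<in> Hom C w K. m \<cdot> u = h" "is_kernel C g m"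
    using kernel[OF g] by metis
  obtain L c where c: "c \<in> Hom C y L" "c \<cdot> f = zer C x L" "is_epi C c"
      "\<And>w h. h \<in> Hom C y w \<Longrightarrow> h \<cdot> f = zer C x w \<Longrightarrow> \<exists>u \<in> Hom C L w. u \<cdot> c = h" "is_cokernel C f c"
    using cokernel[OF f] by metis
  note [simp] = hom[OF m(1)] hom[OF c(1)]
  \<comment> \<open>On a projective T an element of K gives an element of the kernel of g. It lifts
    along f, and c kills f.\<close>
  have cm: "c \<cdot> m = zer C K L"
  proof (rule eq_on_projectives[of _ K L])
    fix T a assume T: "projective C T" and a: "a \<in> Hom C T K"
    note [simp] = hom[OF a]
    have "g \<cdot> (m \<cdot> a) = zer C T z" by (simp add: assoc[symmetric] m(2))
    then obtain b where b: "b \<in> Hom C T x" "f \<cdot> b = m \<cdot> a"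
      using texactD[OF conjunct2[OF gf] f g T, of "m \<cdot> a"] by (auto simp: Hom_def)
    note [simp] = hom[OF b(1)]
    have "c \<cdot> (m \<cdot> a) = c \<cdot> f \<cdot> b" by (simp add: assoc b(2))
    then show "c \<cdot> m \<cdot> a = zer C K L \<cdot> a" by (simp add: assoc c(2))
  qed (auto simp: Hom_def)
  have "is_kernel C c m" unfolding is_kernel_def
  proof (intro conjI ballI impI)
    fix w h assume w: "w \<in> ob C" and h: "h \<in> Hom C w (src C c)" "c \<cdot> h = zer C w (trg C c)"
    then have h': "h \<in> Hom C w y" by simp
    note [simp] = hom[OF h']
    \<comment> \<open>As \<open>g \<cdot> f\<close> vanishes, g factors through the cokernel c, so
      whatever c kills is killed by g.\<close>
    obtain v where v: "v \<in> Hom C L z" "v \<cdot> c = g" using c(4)[OF g] gf by blast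
    note [simp] = hom[OF v(1)]
    have "g \<cdot> h = v \<cdot> (c \<cdot> h)" using v(2) by (simp add: assoc[symmetric])
    then have "g \<cdot> h = zer C w z" using h by simp
    then have "\<exists>u\<in>Hom C w K. m \<cdot> u = h" using m(4)[OF h'] by simp
    moreover have "\<forall>a b. a \<in> Hom C w K \<and> b \<in> Hom C w K \<and> m \<cdot> a = m \<cdot> b \<longrightarrow> a = b"
      using monoD[OF m(3,1)] by blast
    ultimately show "\<exists>!u. u \<in> Hom C w (src C m) \<and> m \<cdot> u = h" by auto
  qed (use cm in auto)
  then show "exact_at C f g" unfolding exact_at_def is_image_def using c(5) m(5) by blast
qed

end

section \<open>Complexes and the homotopy category\<close>

context preadditive_category
begin

lemma neg_cmp: "f \<in> mor C \<Longrightarrow> g \<in> mor C \<Longrightarrow> src C g = trg C f \<Longrightarrow> neg C g \<cdot> f = neg C (g \<cdot> f)"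
  and cmp_neg: "f \<in> mor C \<Longrightarrow> g \<in> mor C \<Longrightarrow> src C g = trg C f \<Longrightarrow> g \<cdot> neg C f = neg C (g \<cdot> f)"
  by (simp_all add: alg)

lemma neg_neg [simp]: "f \<in> mor C \<Longrightarrow> neg C (neg C f) = f"
  by (simp add: alg)

lemma neg_zer [simp]: "x \<in> ob C \<Longrightarrow> y \<in> ob C \<Longrightarrow> neg C (zer C x y) = zer C x y"
  by (simp add: neg_sub)

lemma neg_eq: "f \<in> mor C \<Longrightarrow> g \<in> mor C \<Longrightarrow> neg C f = neg C g \<longleftrightarrow> f = g"
  using neg_neg by metis

text \<open>\<open>bounded_complexes\<close> is split into \<open>cx\<close> and \<open>bd\<close>
  because projective resolutions are complexes that may be unbounded below.\<close>

definition cx :: "('o, 'm) cochain \<Rightarrow> bool" where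
  "cx X \<longleftrightarrow> (\<forall>n. term_at X n \<in> ob C \<and> diff_at X n \<in> Hom C (term_at X n) (term_at X (n + 1)) \<and>
     diff_at X (n + 1) \<cdot> diff_at X n = zer C (term_at X n) (term_at X (n + 2)))"

definition bd :: "('o, 'm) cochain \<Rightarrow> bool" where
  "bd X \<longleftrightarrow> (\<exists>N. \<forall>n. \<bar>n\<bar> > N \<longrightarrow> zero_object C (term_at X n))"

lemma bounded_complexes_iff: "X \<in> bounded_complexes C \<longleftrightarrow> cx X \<and> bd X"
  by (auto simp: bounded_complexes_def cx_def bd_def)

lemma cx_simps [simp]:
  assumes "cx X"
  shows "term_at X n \<in> ob C" "diff_at X n \<in> mor C" "src C (diff_at X n) = term_at X n"
    "trg C (diff_at X n) = term_at X (n + 1)"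
    "m = n + 1 \<Longrightarrow> diff_at X m \<cdot> diff_at X n = zer C (term_at X n) (term_at X (n + 2))"
  using assms unfolding cx_def Hom_def by auto

lemma cx_diff_diff [simp]: "cx X \<Longrightarrow> m = n + 1 \<Longrightarrow> f \<in> mor C \<Longrightarrow> trg C f = term_at X n \<Longrightarrow>
    diff_at X m \<cdot> (diff_at X n \<cdot> f) = zer C (src C f) (term_at X (n + 2))"
  using cmp_eq_assoc[OF cx_simps(5), of X m n f] by simp

lemma cm_typ: assumes "f \<in> chain_maps C X Y"
  shows "f n \<in> mor C" "src C (f n) = term_at X n" "trg C (f n) = term_at Y n"
  using assms by (auto simp: chain_maps_def Hom_def)

lemma cm_comm: "f \<in> chain_maps C X Y \<Longrightarrow> diff_at Y n \<cdot> f n = f (n + 1) \<cdot> diff_at X n"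
  by (simp add: chain_maps_def)

lemma cm_comm': "f \<in> chain_maps C X Y \<Longrightarrow> cx X \<Longrightarrow> cx Y \<Longrightarrow> x \<in> mor C \<Longrightarrow> trg C x = term_at X n \<Longrightarrow>
    diff_at Y n \<cdot> (f n \<cdot> x) = f (n + 1) \<cdot> (diff_at X n \<cdot> x)"
  using cmp_eq_assoc[OF cm_comm, of f X Y n x] by (simp add: cm_typ assoc)

lemmas cm = cm_typ cm_comm

lemma cm_Hom: "f \<in> chain_maps C X Y \<Longrightarrow> f n \<in> Hom C (term_at X n) (term_at Y n)"
  by (simp add: chain_maps_def)

lemma cmI: "(\<And>n. f n \<in> mor C) \<Longrightarrow> (\<And>n. src C (f n) = term_at X n) \<Longrightarrow> (\<And>n. trg C (f n) = term_at Y n) \<Longrightarrow>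
    (\<And>n. diff_at Y n \<cdot> f n = f (n + 1) \<cdot> diff_at X n) \<Longrightarrow> f \<in> chain_maps C X Y"
  by (simp add: chain_maps_def Hom_def)

lemma cm_cmp:
  assumes "f \<in> chain_maps C X Y" "g \<in> chain_maps C Y Z" "cx X" "cx Y" "cx Z"
  shows "(\<lambda>n. g n \<cdot> f n) \<in> chain_maps C X Z"
  by (rule cmI) (simp_all add: assms cm[OF assms(1)] cm[OF assms(2)] cm_comm'[OF assms(2)]
     cmp_eq_assoc[OF cm_comm[OF assms(2)]] assoc)

lemma cm_idm: "cx X \<Longrightarrow> (\<lambda>n. idm C (term_at X n)) \<in> chain_maps C X X"
  by (rule cmI) simp_all

definition htp :: "('o, 'm) cochain \<Rightarrow> ('o, 'm) cochain \<Rightarrow> (int \<Rightarrow> 'm) \<Rightarrow> (int \<Rightarrow> 'm) \<Rightarrow> (int \<Rightarrow> 'm) \<Rightarrow> bool" where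
  "htp X Y f g h \<longleftrightarrow> (\<forall>n. h n \<in> Hom C (term_at X n) (term_at Y (n - 1)) \<and>
     f n = g n \<oplus> (diff_at Y (n - 1) \<cdot> h n \<oplus> h (n + 1) \<cdot> diff_at X n))"

lemma homotopic_htp: "homotopic C X Y f g \<longleftrightarrow> (\<exists>h. htp X Y f g h)"
  by (simp add: homotopic_def htp_def)

lemma htp: assumes "htp X Y f g h"
  shows "h n \<in> mor C" "src C (h n) = term_at X n" "trg C (h n) = term_at Y (n - 1)"
    "f n = g n \<oplus> (diff_at Y (n - 1) \<cdot> h n \<oplus> h (n + 1) \<cdot> diff_at X n)"
  using assms by (auto simp: htp_def Hom_def)

lemma htpI: "(\<And>n. h n \<in> mor C) \<Longrightarrow> (\<And>n. src C (h n) = term_at X n) \<Longrightarrow> (\<And>n. trg C (h n) = term_at Y (n - 1)) \<Longrightarrow>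
    (\<And>n. f n = g n \<oplus> (diff_at Y (n - 1) \<cdot> h n \<oplus> h (n + 1) \<cdot> diff_at X n)) \<Longrightarrow> homotopic C X Y f g"
  unfolding homotopic_htp htp_def Hom_def by blast

context
  fixes X Y assumes X: "cx X" and Y: "cx Y"
begin

lemma homotopic_refl: assumes f: "f \<in> chain_maps C X Y" shows "homotopic C X Y f f"
  by (rule htpI[of "\<lambda>n. zer C (term_at X n) (term_at Y (n - 1))"]) (simp_all add: X Y cm_typ[OF f])

lemma homotopic_sym:
  assumes f: "f \<in> chain_maps C X Y" and g: "g \<in> chain_maps C X Y" and h: "homotopic C X Y f g"
  shows "homotopic C X Y g f"
proof -
  obtain h where h: "htp X Y f g h" using h by (auto simp: homotopic_htp)
  note [simp] = X Y cm_typ[OF g] htp(1,2,3)[OF h]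
  show ?thesis
    by (rule htpI[of "\<lambda>n. neg C (h n)"]) (simp_all add: htp(4)[OF h, of n for n] alg)
qed

lemma homotopic_trans:
  assumes e: "e \<in> chain_maps C X Y"
    and "homotopic C X Y f g" and "homotopic C X Y g e"
  shows "homotopic C X Y f e"
proof -
  obtain h k where h: "htp X Y f g h" and k: "htp X Y g e k" using assms by (auto simp: homotopic_htp)
  note [simp] = X Y cm_typ[OF e] htp(1,2,3)[OF h] htp(1,2,3)[OF k]
  show ?thesis
    by (rule htpI[of "\<lambda>n. h n \<oplus> k n"])
      (simp_all add: htp(4)[OF h, of n for n] htp(4)[OF k, of n for n] alg)
qed

lemma homotopic_cmp_left:
  assumes f: "f \<in> chain_maps C X Y" and g: "g \<in> chain_maps C X Y" and "homotopic C X Y f g"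
    and e: "e \<in> chain_maps C Y Z" and Z: "cx Z"
  shows "homotopic C X Z (\<lambda>n. e n \<cdot> f n) (\<lambda>n. e n \<cdot> g n)"
proof -
  obtain h where h: "htp X Y f g h" using assms by (auto simp: homotopic_htp)
  note [simp] = X Y Z cm_typ[OF g] cm_typ[OF e] htp(1,2,3)[OF h]
  show ?thesis
    by (rule htpI[of "\<lambda>n. e (n - 1) \<cdot> h n"])
      (simp_all add: htp(4)[OF h, of n for n] cm_comm'[OF e] alg)
qed

lemma homotopic_cmp_right:
  assumes f: "f \<in> chain_maps C X Y" and g: "g \<in> chain_maps C X Y" and "homotopic C X Y f g"
    and e: "e \<in> chain_maps C W X" and W: "cx W"
  shows "homotopic C W Y (\<lambda>n. f n \<cdot> e n) (\<lambda>n. g n \<cdot> e n)"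
proof -
  obtain h where h: "htp X Y f g h" using assms by (auto simp: homotopic_htp)
  note [simp] = X Y W cm_typ[OF g] cm_typ[OF e] htp(1,2,3)[OF h]
  show ?thesis
    by (rule htpI[of "\<lambda>n. h n \<cdot> e n"])
      (simp_all add: htp(4)[OF h, of n for n] cm_comm[OF e] alg)
qed

end

lemma homotopic_cmp:
  assumes "f \<in> chain_maps C X Y" "f' \<in> chain_maps C X Y" "homotopic C X Y f f'"
    and "g \<in> chain_maps C Y Z" "g' \<in> chain_maps C Y Z" "homotopic C Y Z g g'"
    and "cx X" "cx Y" "cx Z"
  shows "homotopic C X Z (\<lambda>n. g n \<cdot> f n) (\<lambda>n. g' n \<cdot> f' n)"
  using assms
  by (intro homotopic_trans[OF _ _ cm_cmp[of f' X Y] homotopic_cmp_left[of X Y f f'] homotopic_cmp_right[of Y Z g g']]) auto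

abbreviation "bc \<equiv> bounded_complexes C"

lemma bc_cx [simp]: "X \<in> bc \<Longrightarrow> cx X" by (simp add: bounded_complexes_iff)

lemma hclass_eq:
  assumes "cx X" "cx Y" "f \<in> chain_maps C X Y" "g \<in> chain_maps C X Y"
  shows "hclass C X Y f = hclass C X Y g \<longleftrightarrow> homotopic C X Y f g"
proof
  assume "hclass C X Y f = hclass C X Y g"
  then show "homotopic C X Y f g" using homotopic_refl assms by (auto simp: hclass_def)
next
  assume "homotopic C X Y f g"
  then show "hclass C X Y f = hclass C X Y g" using assms homotopic_sym homotopic_trans
    unfolding hclass_def by blast
qed

lemma Kb_simps [simp]:
  "ob (Kb C) = bc" "src (Kb C) (hclass C X Y f) = X" "trg (Kb C) (hclass C X Y f) = Y"
  "idm (Kb C) X = hclass C X X (\<lambda>n. idm C (term_at X n))"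
  "fob (shift (Kb C)) = shift_complex C"
  by (simp_all add: Kb_def close_triangles_def hclass_def)

lemma hclass_mor [simp]: "X \<in> bc \<Longrightarrow> Y \<in> bc \<Longrightarrow> f \<in> chain_maps C X Y \<Longrightarrow> hclass C X Y f \<in> mor (Kb C)"
  by (auto simp add: Kb_def close_triangles_def)

lemma hclass_Hom: "X \<in> bc \<Longrightarrow> Y \<in> bc \<Longrightarrow> f \<in> chain_maps C X Y \<Longrightarrow> hclass C X Y f \<in> Hom (Kb C) X Y"
  by (intro HomI) auto

lemma Kb_morE:
  assumes "m \<in> mor (Kb C)"
  obtains X Y f where "X \<in> bc" "Y \<in> bc" "f \<in> chain_maps C X Y" "m = hclass C X Y f"
  using assms by (auto simp add: Kb_def close_triangles_def)

lemma Kb_HomE: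
  assumes "m \<in> Hom (Kb C) X Y"
  obtains f where "X \<in> bc" "Y \<in> bc" "f \<in> chain_maps C X Y" "m = hclass C X Y f"
  using assms Kb_morE unfolding Hom_def by (metis (mono_tags, lifting) Kb_simps(2,3) mem_Collect_eq)

text \<open>The union in the definition of composition is taken over all representatives. Homotopic
  chain maps have homotopic composites, so all its members are one and the same class.\<close>

lemma cmp_Kb [simp]:
  assumes "X \<in> bc" "Y \<in> bc" "Z \<in> bc" "f \<in> chain_maps C X Y" "g \<in> chain_maps C Y Z"
  shows "cmp (Kb C) (hclass C Y Z g) (hclass C X Y f) = hclass C X Z (\<lambda>n. g n \<cdot> f n)"
proof -
  let ?F = "{f' \<in> chain_maps C X Y. homotopic C X Y f f'}" and ?G = "{g' \<in> chain_maps C Y Z. homotopic C Y Z g g'}"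
  have *: "hclass C X Z (\<lambda>n. g' n \<cdot> f' n) = hclass C X Z (\<lambda>n. g n \<cdot> f n)" if "f' \<in> ?F" "g' \<in> ?G" for f' g'
    using that assms homotopic_cmp[of f X Y f' g Z g'] cm_cmp
    by (subst eq_commute, subst hclass_eq) auto
  have ne: "f \<in> ?F" "g \<in> ?G" using homotopic_refl assms by auto
  have "cmp (Kb C) (hclass C Y Z g) (hclass C X Y f) =
      (X, Z, \<Union>f'\<in>?F. \<Union>g'\<in>?G. snd (snd (hclass C X Z (\<lambda>n. g' n \<cdot> f' n))))"
    by (simp add: Kb_def close_triangles_def hclass_def)
  also have "\<dots> = (X, Z, \<Union>f'\<in>?F. \<Union>g'\<in>?G. snd (snd (hclass C X Z (\<lambda>n. g n \<cdot> f n))))"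
    using * by simp
  also have "\<dots> = (X, Z, snd (snd (hclass C X Z (\<lambda>n. g n \<cdot> f n))))" using ne by blast
  finally show ?thesis by (simp add: hclass_def)
qed

lemma Kb_category: "category (Kb C)"
proof
  fix f assume f: "f \<in> mor (Kb C)"
  then show "src (Kb C) f \<in> ob (Kb C)" "trg (Kb C) f \<in> ob (Kb C)"
    by (auto elim!: Kb_morE)
  from f show "cmp (Kb C) f (idm (Kb C) (src (Kb C) f)) = f"
    by (auto elim!: Kb_morE simp: cm_idm cm_typ)
  from f show "cmp (Kb C) (idm (Kb C) (trg (Kb C) f)) f = f"
    by (auto elim!: Kb_morE simp: cm_idm cm_typ)
next
  fix X assume "X \<in> ob (Kb C)" then show "idm (Kb C) X \<in> Hom (Kb C) X X"
    by (auto intro!: hclass_Hom cm_idm)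
next
  fix f g X Y Z assume "f \<in> Hom (Kb C) X Y" "g \<in> Hom (Kb C) Y Z"
  then show "cmp (Kb C) g f \<in> Hom (Kb C) X Z"
    by (auto elim!: Kb_HomE intro!: hclass_Hom cm_cmp)
next
  fix f g h W X Y Z assume "f \<in> Hom (Kb C) W X" "g \<in> Hom (Kb C) X Y" "h \<in> Hom (Kb C) Y Z"
  then obtain f' g' h' where "W \<in> bc" "X \<in> bc" "Y \<in> bc" "Z \<in> bc"
    "f = hclass C W X f'" "g = hclass C X Y g'" "h = hclass C Y Z h'"
    "f' \<in> chain_maps C W X" "g' \<in> chain_maps C X Y" "h' \<in> chain_maps C Y Z"
    by (auto elim!: Kb_HomE)
  then show "cmp (Kb C) (cmp (Kb C) h g) f = cmp (Kb C) h (cmp (Kb C) g f)"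
    by (simp add: cm_cmp cm_typ assoc)
qed

lemma shift_simps [simp]: "term_at (shift_complex C X) n = term_at X (n + 1)"
  "diff_at (shift_complex C X) n = neg C (diff_at X (n + 1))"
  by (simp_all add: shift_complex_def)

lemma cx_shift: "cx X \<Longrightarrow> cx (shift_complex C X)"
  unfolding cx_def[of "shift_complex C X"] by (auto simp: neg_cmp cmp_neg Hom_def add.commute)

lemma bd_shift: "bd X \<Longrightarrow> bd (shift_complex C X)"
proof -
  assume "bd X"
  then obtain N where N: "\<And>n. \<bar>n\<bar> > N \<Longrightarrow> zero_object C (term_at X n)" unfolding bd_def by blast
  have "zero_object C (term_at (shift_complex C X) n)" if "\<bar>n\<bar> > N + 1" for n
    using that by (simp add: N)
  then show ?thesis unfolding bd_def by blast
qed

lemma bc_shift [simp]: "X \<in> bc \<Longrightarrow> shift_complex C X \<in> bc"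
  by (simp add: bounded_complexes_iff cx_shift bd_shift)

lemma cm_shift:
  assumes "cx X" "cx Y"
  shows "(\<lambda>n. f (n + 1)) \<in> chain_maps C (shift_complex C X) (shift_complex C Y) \<longleftrightarrow> f \<in> chain_maps C X Y"
    (is "?L \<longleftrightarrow> ?R")
proof
  assume ?R
  note [simp] = cm_typ[OF this] assms
  show ?L by (rule cmI) (simp_all add: neg_cmp cmp_neg cm_comm[OF \<open>?R\<close>])
next
  assume L: ?L
  have t: "f n \<in> mor C" "src C (f n) = term_at X n" "trg C (f n) = term_at Y n" for n
    using cm_typ[OF L, of "n - 1"] by simp_all
  have "diff_at Y n \<cdot> f n = f (n + 1) \<cdot> diff_at X n" for n
    using cm_comm[OF L, of "n - 1"] by (simp add: t neg_cmp cmp_neg neg_eq assms)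
  then show ?R by (intro cmI t)
qed

lemma homotopic_shift:
  assumes "cx X" "cx Y" "g \<in> chain_maps C X Y"
  shows "homotopic C (shift_complex C X) (shift_complex C Y) (\<lambda>n. f (n + 1)) (\<lambda>n. g (n + 1)) \<longleftrightarrow> homotopic C X Y f g"
    (is "?L \<longleftrightarrow> ?R")
proof
  assume ?R
  then obtain h where h: "htp X Y f g h" by (auto simp: homotopic_htp)
  note [simp] = assms htp(1,2,3)[OF h] cm_typ[OF assms(3)]
  \<comment> \<open>The differential of the shift is negated, so the shifted homotopy has to be
    negated as well.\<close>
  show ?L by (rule htpI[of "\<lambda>n. neg C (h (n + 1))"])
    (simp_all add: neg_cmp cmp_neg htp(4)[OF h, of "n + 1" for n] add.commute[of 1])
next
  assume ?L
  then obtain h where h: "htp (shift_complex C X) (shift_complex C Y) (\<lambda>n. f (n + 1)) (\<lambda>n. g (n + 1)) h"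
    by (auto simp: homotopic_htp)
  have t: "h (n - 1) \<in> mor C" "src C (h (n - 1)) = term_at X n" "trg C (h (n - 1)) = term_at Y (n - 1)"
    "h n \<in> mor C" "src C (h n) = term_at X (n + 1)" "trg C (h n) = term_at Y n" for n
    using htp(1,2,3)[OF h, of "n - 1"] htp(1,2,3)[OF h, of n] by simp_all
  note [simp] = assms cm_typ[OF assms(3)] t
  show ?R
  proof (rule htpI[of "\<lambda>n. neg C (h (n - 1))"])
    fix n show "f n = g n \<oplus> (diff_at Y (n - 1) \<cdot> neg C (h (n - 1)) \<oplus> neg C (h (n + 1 - 1)) \<cdot> diff_at X n)"
      using htp(4)[OF h, of "n - 1"] by (simp add: neg_cmp cmp_neg)
  qed simp_all
qed

lemma fmor_shift:
  assumes "cx X" "cx Y" "f \<in> chain_maps C X Y"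
  shows "fmor (shift (Kb C)) (hclass C X Y f) = hclass C (shift_complex C X) (shift_complex C Y) (\<lambda>n. f (n + 1))"
proof -
  have "(\<lambda>f n. f (n + 1)) ` {g \<in> chain_maps C X Y. homotopic C X Y f g} =
      {g \<in> chain_maps C (shift_complex C X) (shift_complex C Y).
         homotopic C (shift_complex C X) (shift_complex C Y) (\<lambda>n. f (n + 1)) g}" (is "?s ` ?A = ?B")
  proof
    show "?s ` ?A \<subseteq> ?B" using assms by (auto simp: cm_shift homotopic_shift)
    show "?B \<subseteq> ?s ` ?A"
    proof
      fix g assume g: "g \<in> ?B"
      define k where "k = (\<lambda>n. g (n - 1))"
      have k: "g = (\<lambda>n. k (n + 1))" by (simp add: k_def)
      then show "g \<in> ?s ` ?A" using g assms unfolding k by (auto simp: cm_shift homotopic_shift)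
    qed
  qed
  then show ?thesis by (simp add: Kb_def close_triangles_def hclass_def)
qed

lemma shift_functor: "is_functor (Kb C) (Kb C) (shift (Kb C))"
proof -
  interpret Kb: category "Kb C" by (rule Kb_category)
  show ?thesis
    by unfold_locales
      (auto elim!: Kb_HomE simp: fmor_shift cm_idm cm_cmp cm_shift intro!: hclass_Hom)
qed

end

subsection \<open>Additive functors on complexes\<close>

locale additive = C: preadditive_category C + D: preadditive_category D
  for C :: "('o, 'm, 'z) addcat_scheme" and D :: "('o2, 'm2, 'z2) addcat_scheme" +
  fixes F :: "('o, 'm, 'o2, 'm2) functr"
  assumes additive: "additive_functor C D F"

sublocale additive \<subseteq> is_functor C D F
  using additive by (simp add: additive_functor_def)

context additive
begin

lemma fmor_add: "f \<in> mor C \<Longrightarrow> g \<in> mor C \<Longrightarrow> src C f = src C g \<Longrightarrow> trg C f = trg C g \<Longrightarrow>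
    fmor F (add C f g) = add D (fmor F f) (fmor F g)"
  using additive mor_Hom[of f C] mor_Hom[of g C] unfolding additive_functor_def by (metis C.src_ob C.trg_ob)

lemma fmor_zer [simp]: assumes "x \<in> ob C" "y \<in> ob C" shows "fmor F (zer C x y) = zer D (fob F x) (fob F y)"
proof -
  have "add D (fmor F (zer C x y)) (fmor F (zer C x y)) = add D (fmor F (zer C x y)) (zer D (fob F x) (fob F y))"
    using assms by (simp add: fmor_add[symmetric])
  then show ?thesis using assms by (subst (asm) D.add_cancel) simp_all
qed

lemma fmor_sub: "f \<in> mor C \<Longrightarrow> g \<in> mor C \<Longrightarrow> src C f = src C g \<Longrightarrow> trg C f = trg C g \<Longrightarrow>
    fmor F (sub C f g) = sub D (fmor F f) (fmor F g)"
  by (simp add: D.eq_sub fmor_add[symmetric] C.sub_add_cancel)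

lemma fmor_neg: "f \<in> mor C \<Longrightarrow> fmor F (neg C f) = neg D (fmor F f)"
  by (simp add: C.neg_sub D.neg_sub fmor_sub)

lemma fob_zero: "zero_object C z \<Longrightarrow> zero_object D (fob F z)"
  unfolding C.zero_object_iff D.zero_object_iff using fmor_idm fmor_zer by (metis fob)

lemma fob_biproduct: "is_biproduct C x y s i1 i2 p1 p2 \<Longrightarrow>
    is_biproduct D (fob F x) (fob F y) (fob F s) (fmor F i1) (fmor F i2) (fmor F p1) (fmor F p2)"
  unfolding is_biproduct_def
  by (auto simp: fmor_Hom fmor_cmp'[symmetric] fmor_add[symmetric] HomD fmor_idm)

abbreviation "K \<equiv> Kb_functor D F"

lemma K_simps [simp]: "term_at (fob K X) n = fob F (term_at X n)" "diff_at (fob K X) n = fmor F (diff_at X n)"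
  by (simp_all add: Kb_functor_def Let_def)

lemma K_cx: assumes "C.cx X" shows "D.cx (fob K X)"
  unfolding D.cx_def using assms fmor_cmp'[of "diff_at X n" "diff_at X (n + 1)" for n, symmetric]
  by (auto simp: Hom_def)

lemma K_bd: "C.bd X \<Longrightarrow> D.bd (fob K X)"
  unfolding C.bd_def D.bd_def by (auto intro!: fob_zero)

lemma K_bc [simp]: "X \<in> C.bc \<Longrightarrow> fob K X \<in> D.bc"
  by (simp add: C.bounded_complexes_iff D.bounded_complexes_iff K_cx K_bd)

lemma K_cm: assumes f: "f \<in> chain_maps C X Y" and X: "C.cx X" and Y: "C.cx Y"
  shows "(\<lambda>n. fmor F (f n)) \<in> chain_maps D (fob K X) (fob K Y)"
proof -
  note [simp] = C.cm_typ[OF f] X Y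
  show ?thesis by (rule D.cmI) (simp_all add: fmor_cmp'[symmetric] C.cm_comm[OF f])
qed

lemma K_homotopic:
  assumes "homotopic C X Y f g" and X: "C.cx X" and Y: "C.cx Y" and g: "g \<in> chain_maps C X Y"
  shows "homotopic D (fob K X) (fob K Y) (\<lambda>n. fmor F (f n)) (\<lambda>n. fmor F (g n))"
proof -
  obtain h where h: "C.htp X Y f g h" using assms by (auto simp: C.homotopic_htp)
  note [simp] = C.cm_typ[OF g] X Y C.htp(1,2,3)[OF h]
  show ?thesis by (rule D.htpI[of "\<lambda>n. fmor F (h n)"])
    (simp_all add: C.htp(4)[OF h, of n for n] fmor_add fmor_cmp')
qed

lemma fmor_K:
  assumes X: "C.cx X" and Y: "C.cx Y" and f: "f \<in> chain_maps C X Y"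
  shows "fmor K (hclass C X Y f) = hclass D (fob K X) (fob K Y) (\<lambda>n. fmor F (f n))"
proof -
  let ?F = "{f' \<in> chain_maps C X Y. homotopic C X Y f f'}"
  have *: "hclass D (fob K X) (fob K Y) (\<lambda>n. fmor F (f' n)) = hclass D (fob K X) (fob K Y) (\<lambda>n. fmor F (f n))"
    if "f' \<in> ?F" for f'
    using that by (subst eq_commute, subst D.hclass_eq) (auto simp: X Y f K_cx K_cm K_homotopic)
  have ne: "f \<in> ?F" using C.homotopic_refl[OF X Y f] f by auto
  have "fmor K (hclass C X Y f) = (fob K X, fob K Y,
      \<Union>f'\<in>?F. snd (snd (hclass D (fob K X) (fob K Y) (\<lambda>n. fmor F (f' n)))))"
    by (simp add: Kb_functor_def Let_def hclass_def)
  also have "\<dots> = (fob K X, fob K Y,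
      \<Union>f'\<in>?F. snd (snd (hclass D (fob K X) (fob K Y) (\<lambda>n. fmor F (f n)))))"
    using * by simp
  also have "\<dots> = (fob K X, fob K Y, snd (snd (hclass D (fob K X) (fob K Y) (\<lambda>n. fmor F (f n)))))"
    using ne by blast
  finally show ?thesis by (simp add: hclass_def)
qed

lemma K_functor: "is_functor (Kb C) (Kb D) K"
proof -
  interpret KC: category "Kb C" by (rule C.Kb_category)
  interpret KD: category "Kb D" by (rule D.Kb_category)
  show ?thesis
  proof
    fix x assume "x \<in> ob (Kb C)" then show "fob K x \<in> ob (Kb D)" by simp
  next
    fix f x y assume "f \<in> Hom (Kb C) x y" then show "fmor K f \<in> Hom (Kb D) (fob K x) (fob K y)"
      by (auto elim!: C.Kb_HomE simp: fmor_K intro!: D.hclass_Hom K_cm)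
  next
    fix x assume "x \<in> ob (Kb C)" then show "fmor K (idm (Kb C) x) = idm (Kb D) (fob K x)"
      by (simp add: fmor_K C.cm_idm fmor_idm)
  next
    fix f g x y z assume "f \<in> Hom (Kb C) x y" "g \<in> Hom (Kb C) y z"
    then show "fmor K (cmp (Kb C) g f) = cmp (Kb D) (fmor K g) (fmor K f)"
      by (auto elim!: C.Kb_HomE simp: fmor_K C.cm_cmp K_cm C.cm_typ fmor_cmp')
  qed
qed

end

section \<open>Mapping cones and quasi-isomorphisms\<close>

lemma close_triangles_simps [simp]:
  "ob (close_triangles T) = ob T" "mor (close_triangles T) = mor T" "src (close_triangles T) = src T"
  "trg (close_triangles T) = trg T" "idm (close_triangles T) = idm T" "cmp (close_triangles T) = cmp T"
  "shift (close_triangles T) = shift T" "Hom (close_triangles T) = Hom T"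
  by (auto simp: close_triangles_def Hom_def fun_eq_iff)

lemma close_triangles_is_iso [simp]: "is_iso (close_triangles T) = is_iso T"
  by (auto simp: is_iso_def fun_eq_iff)

text \<open>Closing the set of triangles changes neither the underlying category nor the shift, so
  candidates and isomorphisms of triangles mean the same before and after.\<close>

lemma close_triangles_iff:
  "t \<in> triangles (close_triangles T) \<longleftrightarrow> is_candidate (close_triangles T) t \<and>
     (\<exists>t'\<in>triangles T. triangle_iso (close_triangles T) t t')"
proof -
  have 1: "is_candidate (close_triangles T) t = is_candidate T t" for t by (cases t) simp
  have 2: "triangle_iso (close_triangles T) t t' = triangle_iso T t t'" for t t' by (cases t; cases t') simp
  show ?thesis unfolding 1 2 by (simp add: close_triangles_def)
qed

lemma triangle_iso_refl:
  assumes "category T" "is_functor T T (shift T)" "is_candidate T t"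
  shows "triangle_iso T t t"
proof -
  interpret is_functor T T "shift T" by fact
  obtain u v w where t: "t = (u, v, w)" by (cases t)
  show ?thesis using assms(3) unfolding t triangle_iso.simps
    by (intro exI[of _ "idm T (src T u)"] exI[of _ "idm T (src T v)"] exI[of _ "idm T (src T w)"])
      (auto simp: dom.iso_idm fmor_idm dom.idm_Hom)
qed

context preadditive_category
begin

text \<open>\<open>is_mapping_cone\<close> with the remaining two structure maps k and q of the
  biproducts as arguments. Calculations in a cone need all four maps.\<close>

definition cone :: "('o, 'm) cochain \<Rightarrow> ('o, 'm) cochain \<Rightarrow> (int \<Rightarrow> 'm) \<Rightarrow> ('o, 'm) cochain \<Rightarrow>
    (int \<Rightarrow> 'm) \<Rightarrow> (int \<Rightarrow> 'm) \<Rightarrow> (int \<Rightarrow> 'm) \<Rightarrow> (int \<Rightarrow> 'm) \<Rightarrow> bool" where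
  "cone X Y f Z k j p q \<longleftrightarrow> (\<forall>n.
     is_biproduct C (term_at X (n + 1)) (term_at Y n) (term_at Z n) (k n) (j n) (p n) (q n) \<and>
     diff_at Z n =
       (k (n + 1) \<cdot> neg C (diff_at X (n + 1)) \<cdot> p n) \<oplus>
        ((j (n + 1) \<cdot> f (n + 1) \<cdot> p n) \<oplus> (j (n + 1) \<cdot> diff_at Y n \<cdot> q n)))"

lemma is_mapping_cone_iff: "is_mapping_cone C X Y f Z j p \<longleftrightarrow> (\<exists>k q. cone X Y f Z k j p q)"
  by (simp add: is_mapping_cone_def cone_def)

lemma cone_typ:
  assumes "cone X Y f Z k j p q"
  shows "k n \<in> mor C" "src C (k n) = term_at X (n + 1)" "trg C (k n) = term_at Z n"
    "j n \<in> mor C" "src C (j n) = term_at Y n" "trg C (j n) = term_at Z n"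
    "p n \<in> mor C" "src C (p n) = term_at Z n" "trg C (p n) = term_at X (n + 1)"
    "q n \<in> mor C" "src C (q n) = term_at Z n" "trg C (q n) = term_at Y n"
    "p n \<cdot> k n = idm C (term_at X (n + 1))" "q n \<cdot> j n = idm C (term_at Y n)"
    "p n \<cdot> j n = zer C (term_at Y n) (term_at X (n + 1))" "q n \<cdot> k n = zer C (term_at X (n + 1)) (term_at Y n)"
    "term_at Z n \<in> ob C" "term_at X n \<in> ob C" "term_at Y n \<in> ob C"
  using assms unfolding cone_def
  by (auto simp: is_biproduct_def Hom_def dest: spec[of _ n] spec[of _ "n - 1"])

lemma cone_id: assumes "cone X Y f Z k j p q"
  shows "k n \<cdot> p n \<oplus> j n \<cdot> q n = idm C (term_at Z n)"
  using assms unfolding cone_def by (auto simp: is_biproduct_def)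

lemma cone_assoc:
  assumes cone: "cone X Y f Z k j p q" and x: "x \<in> mor C"
  shows "trg C x = term_at X (n + 1) \<Longrightarrow> p n \<cdot> (k n \<cdot> x) = x"
    "trg C x = term_at Y n \<Longrightarrow> q n \<cdot> (j n \<cdot> x) = x"
    "trg C x = term_at Y n \<Longrightarrow> p n \<cdot> (j n \<cdot> x) = zer C (src C x) (term_at X (n + 1))"
    "trg C x = term_at X (n + 1) \<Longrightarrow> q n \<cdot> (k n \<cdot> x) = zer C (src C x) (term_at Y n)"
  using x by (simp_all add: assoc[symmetric] cone_typ[OF cone])

text \<open>The components p and q determine a morphism into the cone because
  \<open>k \<cdot> p\<close> and \<open>j \<cdot> q\<close> add up to the identity. Identities in a
  cone are thereby reduced to identities in X and Y.\<close>

lemma cone_eq_in: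
  assumes cone: "cone X Y f Z k j p q" and a: "a \<in> Hom C T (term_at Z n)" and b: "b \<in> Hom C T (term_at Z n)"
    and "p n \<cdot> a = p n \<cdot> b" "q n \<cdot> a = q n \<cdot> b"
  shows "a = b"
proof -
  note [simp] = hom[OF a] hom[OF b] cone_typ[OF cone]
  have "(k n \<cdot> p n \<oplus> j n \<cdot> q n) \<cdot> a = (k n \<cdot> p n \<oplus> j n \<cdot> q n) \<cdot> b"
    using assms(4,5) by (simp add: add_cmp assoc)
  then show ?thesis by (simp add: cone_id[OF cone])
qed

lemma cone_eq_out:
  assumes cone: "cone X Y f Z k j p q" and a: "a \<in> Hom C (term_at Z n) T" and b: "b \<in> Hom C (term_at Z n) T"
    and "a \<cdot> k n = b \<cdot> k n" "a \<cdot> j n = b \<cdot> j n"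
  shows "a = b"
proof -
  note [simp] = hom[OF a] hom[OF b] cone_typ[OF cone]
  have "a \<cdot> (k n \<cdot> p n \<oplus> j n \<cdot> q n) = b \<cdot> (k n \<cdot> p n \<oplus> j n \<cdot> q n)"
    using assms(4,5) by (simp add: cmp_add assoc[symmetric])
  then show ?thesis by (simp add: cone_id[OF cone])
qed

context
  fixes X Y f Z k j p q
  assumes cone: "cone X Y f Z k j p q" and X: "cx X" and Y: "cx Y" and f: "f \<in> chain_maps C X Y"
begin

lemma cone_diff: "diff_at Z n = j (n + 1) \<cdot> (f (n + 1) \<cdot> p n) \<oplus> j (n + 1) \<cdot> (diff_at Y n \<cdot> q n)
    \<ominus> k (n + 1) \<cdot> (diff_at X (n + 1) \<cdot> p n)"
  using cone unfolding cone_def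
  by (simp add: cone_typ[OF cone] X Y cm_typ[OF f] alg)

lemma cone_diff_mor [simp]: "diff_at Z n \<in> mor C" "src C (diff_at Z n) = term_at Z n" "trg C (diff_at Z n) = term_at Z (n + 1)"
  by (simp_all add: cone_diff cone_typ[OF cone] X Y cm_typ[OF f])

lemma cone_pd: "m = n + 1 \<Longrightarrow> p m \<cdot> diff_at Z n = neg C (diff_at X m \<cdot> p n)"
  and cone_qd: "m = n + 1 \<Longrightarrow> q m \<cdot> diff_at Z n = f m \<cdot> p n \<oplus> diff_at Y n \<cdot> q n"
  and cone_dk: "diff_at Z n \<cdot> k n = j (n + 1) \<cdot> f (n + 1) \<ominus> k (n + 1) \<cdot> diff_at X (n + 1)"
  and cone_dj: "diff_at Z n \<cdot> j n = j (n + 1) \<cdot> diff_at Y n"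
  by (simp_all add: cone_diff cone_typ[OF cone] cone_assoc[OF cone] X Y cm_typ[OF f] alg)

lemma cone_pd': "m = n + 1 \<Longrightarrow> x \<in> mor C \<Longrightarrow> trg C x = term_at Z n \<Longrightarrow> p m \<cdot> (diff_at Z n \<cdot> x) = neg C (diff_at X m \<cdot> (p n \<cdot> x))"
  and cone_qd': "m = n + 1 \<Longrightarrow> x \<in> mor C \<Longrightarrow> trg C x = term_at Z n \<Longrightarrow> q m \<cdot> (diff_at Z n \<cdot> x) = f m \<cdot> (p n \<cdot> x) \<oplus> diff_at Y n \<cdot> (q n \<cdot> x)"
  and cone_dk': "x \<in> mor C \<Longrightarrow> trg C x = term_at X (n + 1) \<Longrightarrow> diff_at Z n \<cdot> (k n \<cdot> x) =
     j (n + 1) \<cdot> (f (n + 1) \<cdot> x) \<ominus> k (n + 1) \<cdot> (diff_at X (n + 1) \<cdot> x)"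
  and cone_dj': "x \<in> mor C \<Longrightarrow> trg C x = term_at Y n \<Longrightarrow> diff_at Z n \<cdot> (j n \<cdot> x) = j (n + 1) \<cdot> (diff_at Y n \<cdot> x)"
  using cone_typ[OF cone] X Y cm_typ[OF f] cmp_eq_assoc[OF cone_pd, of m n x] cmp_eq_assoc[OF cone_qd, of m n x]
    cmp_eq_assoc[OF cone_dk, of n x] cmp_eq_assoc[OF cone_dj, of n x]
  by (simp_all add: neg_cmp add_cmp sub_cmp assoc)

lemmas cone_simps = cone_typ[OF cone] cone_assoc[OF cone] cone_pd cone_qd cone_dk cone_dj cone_pd' cone_qd' cone_dk' cone_dj' X Y
  cm_typ[OF f]

lemma cone_cx: "cx Z"
  unfolding cx_def
proof (intro allI conjI)
  fix n
  show "term_at Z n \<in> ob C" "diff_at Z n \<in> Hom C (term_at Z n) (term_at Z (n + 1))"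
    by (auto simp: Hom_def cone_simps)
  show "diff_at Z (n + 1) \<cdot> diff_at Z n = zer C (term_at Z n) (term_at Z (n + 2))"
    by (rule cone_eq_in[OF cone, of _ "term_at Z n" "n + 2"])
     (simp_all add: Hom_def cone_simps alg cm_comm'[OF f] add.commute[of 2 n] add.commute[of 3 n])
qed

lemma cone_j: "j \<in> chain_maps C Y Z"
  by (rule cmI) (simp_all add: cone_simps)

lemma cone_p: "p \<in> chain_maps C Z (shift_complex C X)"
  by (rule cmI) (simp_all add: cone_simps neg_cmp)

end

text \<open>Exactness and quasi-isomorphisms are tested on morphisms from projective objects.\<close>

definition exact_cx :: "('o, 'm) cochain \<Rightarrow> bool" where
  "exact_cx X \<longleftrightarrow> (\<forall>T n x. projective C T \<longrightarrow> x \<in> Hom C T (term_at X n) \<longrightarrow>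
     diff_at X n \<cdot> x = zer C T (term_at X (n + 1)) \<longrightarrow> (\<exists>v \<in> Hom C T (term_at X (n - 1)). x = diff_at X (n - 1) \<cdot> v))"

text \<open>\<open>qsurj\<close> and \<open>qinj\<close> express surjectivity and injectivity of the
  map that f induces on the cohomology of the complexes Hom(T, X) and Hom(T, Y), for all projective
  T.\<close>

definition qsurj :: "('o, 'm) cochain \<Rightarrow> ('o, 'm) cochain \<Rightarrow> (int \<Rightarrow> 'm) \<Rightarrow> bool" where
  "qsurj X Y f \<longleftrightarrow> (\<forall>T n y. projective C T \<longrightarrow> y \<in> Hom C T (term_at Y n) \<longrightarrow>
     diff_at Y n \<cdot> y = zer C T (term_at Y (n + 1)) \<longrightarrow>
     (\<exists>x u. x \<in> Hom C T (term_at X n) \<and> diff_at X n \<cdot> x = zer C T (term_at X (n + 1)) \<and>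
        u \<in> Hom C T (term_at Y (n - 1)) \<and> y = f n \<cdot> x \<oplus> diff_at Y (n - 1) \<cdot> u))"

definition qinj :: "('o, 'm) cochain \<Rightarrow> ('o, 'm) cochain \<Rightarrow> (int \<Rightarrow> 'm) \<Rightarrow> bool" where
  "qinj X Y f \<longleftrightarrow> (\<forall>T n x u. projective C T \<longrightarrow> x \<in> Hom C T (term_at X n) \<longrightarrow>
     diff_at X n \<cdot> x = zer C T (term_at X (n + 1)) \<longrightarrow> u \<in> Hom C T (term_at Y (n - 1)) \<longrightarrow>
     f n \<cdot> x = diff_at Y (n - 1) \<cdot> u \<longrightarrow> (\<exists>v \<in> Hom C T (term_at X (n - 1)). x = diff_at X (n - 1) \<cdot> v))"

definition qis :: "('o, 'm) cochain \<Rightarrow> ('o, 'm) cochain \<Rightarrow> (int \<Rightarrow> 'm) \<Rightarrow> bool" where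
  "qis X Y f \<longleftrightarrow> qsurj X Y f \<and> qinj X Y f"

lemma exactD: assumes "exact_cx X" "projective C T" "x \<in> Hom C T (term_at X n)"
    "diff_at X n \<cdot> x = zer C T (term_at X (n + 1))"
  obtains v where "v \<in> Hom C T (term_at X (n - 1))" "x = diff_at X (n - 1) \<cdot> v"
  using assms unfolding exact_cx_def by blast

lemma qsurjD: assumes "qsurj X Y f" "projective C T" "y \<in> Hom C T (term_at Y n)"
    "diff_at Y n \<cdot> y = zer C T (term_at Y (n + 1))"
  obtains x u where "x \<in> Hom C T (term_at X n)" "diff_at X n \<cdot> x = zer C T (term_at X (n + 1))"
    "u \<in> Hom C T (term_at Y (n - 1))" "y = f n \<cdot> x \<oplus> diff_at Y (n - 1) \<cdot> u"
  using assms unfolding qsurj_def by blast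

lemma qinjD: assumes "qinj X Y f" "projective C T" "x \<in> Hom C T (term_at X n)"
    "diff_at X n \<cdot> x = zer C T (term_at X (n + 1))" "u \<in> Hom C T (term_at Y (n - 1))"
     "f n \<cdot> x = diff_at Y (n - 1) \<cdot> u"
  obtains v where "v \<in> Hom C T (term_at X (n - 1))" "x = diff_at X (n - 1) \<cdot> v"
  using assms unfolding qinj_def by blast

lemma exact_cxI:
  "(\<And>T n x. projective C T \<Longrightarrow> x \<in> Hom C T (term_at X n) \<Longrightarrow>
     diff_at X n \<cdot> x = zer C T (term_at X (n + 1)) \<Longrightarrow> (\<exists>v \<in> Hom C T (term_at X (n - 1)). x = diff_at X (n - 1) \<cdot> v))
  \<Longrightarrow> exact_cx X" unfolding exact_cx_def by blast

lemma qsurjI: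
  "(\<And>T n y. projective C T \<Longrightarrow> y \<in> Hom C T (term_at Y n) \<Longrightarrow>
     diff_at Y n \<cdot> y = zer C T (term_at Y (n + 1)) \<Longrightarrow>
     (\<exists>x u. x \<in> Hom C T (term_at X n) \<and> diff_at X n \<cdot> x = zer C T (term_at X (n + 1)) \<and>
        u \<in> Hom C T (term_at Y (n - 1)) \<and> y = f n \<cdot> x \<oplus> diff_at Y (n - 1) \<cdot> u)) \<Longrightarrow> qsurj X Y f"
  unfolding qsurj_def by blast

lemma qinjI:
  "(\<And>T n x u. projective C T \<Longrightarrow> x \<in> Hom C T (term_at X n) \<Longrightarrow>
     diff_at X n \<cdot> x = zer C T (term_at X (n + 1)) \<Longrightarrow> u \<in> Hom C T (term_at Y (n - 1)) \<Longrightarrow>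
     f n \<cdot> x = diff_at Y (n - 1) \<cdot> u \<Longrightarrow> (\<exists>v \<in> Hom C T (term_at X (n - 1)). x = diff_at X (n - 1) \<cdot> v))
   \<Longrightarrow> qinj X Y f"
  unfolding qinj_def by blast

section \<open>Homotopy invariance, composition and cancellation of quasi-isomorphisms\<close>

context
  fixes X Y f assumes X: "cx X" and Y: "cx Y" and f: "f \<in> chain_maps C X Y"
begin

lemma qsurj_homotopic: assumes "qsurj X Y f" "g \<in> chain_maps C X Y" "homotopic C X Y f g" shows "qsurj X Y g"
proof (rule qsurjI)
  obtain h where h: "htp X Y f g h" using assms by (auto simp: homotopic_htp)
  fix T n y assume T: "projective C T" and y: "y \<in> Hom C T (term_at Y n)" "diff_at Y n \<cdot> y = zer C T (term_at Y (n + 1))"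
  obtain x u where x: "x \<in> Hom C T (term_at X n)" "diff_at X n \<cdot> x = zer C T (term_at X (n + 1))"
    "u \<in> Hom C T (term_at Y (n - 1))" "y = f n \<cdot> x \<oplus> diff_at Y (n - 1) \<cdot> u"
    by (rule qsurjD[OF assms(1) T y])
  note [simp] = X Y htp(1,2,3)[OF h] hom[OF x(1)] hom[OF x(3)] cm_typ[OF f] cm_typ[OF assms(2)]
  have "y = g n \<cdot> x \<oplus> diff_at Y (n - 1) \<cdot> (u \<oplus> h n \<cdot> x)"
    unfolding x(4) by (simp add: htp(4)[OF h] alg x(2))
  then show "\<exists>x u. x \<in> Hom C T (term_at X n) \<and> diff_at X n \<cdot> x = zer C T (term_at X (n + 1)) \<and>
        u \<in> Hom C T (term_at Y (n - 1)) \<and> y = g n \<cdot> x \<oplus> diff_at Y (n - 1) \<cdot> u"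
    using x(1,2) by (intro exI[of _ x] exI[of _ "u \<oplus> h n \<cdot> x"]) (auto simp: Hom_def)
qed

lemma qinj_homotopic: assumes "qinj X Y f" "g \<in> chain_maps C X Y" "homotopic C X Y f g" shows "qinj X Y g"
proof (rule qinjI)
  obtain h where h: "htp X Y f g h" using assms by (auto simp: homotopic_htp)
  fix T n x u assume T: "projective C T" and x: "x \<in> Hom C T (term_at X n)" "diff_at X n \<cdot> x = zer C T (term_at X (n + 1))"
    "u \<in> Hom C T (term_at Y (n - 1))" "g n \<cdot> x = diff_at Y (n - 1) \<cdot> u"
  note [simp] = X Y htp(1,2,3)[OF h] hom[OF x(1)] hom[OF x(3)] cm_typ[OF f] cm_typ[OF assms(2)]
  have "f n \<cdot> x = diff_at Y (n - 1) \<cdot> (u \<oplus> h n \<cdot> x)"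
    by (simp add: htp(4)[OF h] alg x(2,4))
  then show "\<exists>v \<in> Hom C T (term_at X (n - 1)). x = diff_at X (n - 1) \<cdot> v"
    using qinjD[OF assms(1) T x(1,2), of "u \<oplus> h n \<cdot> x"] by (auto simp: HomI)
qed

lemma qis_homotopic: "qis X Y f \<Longrightarrow> g \<in> chain_maps C X Y \<Longrightarrow> homotopic C X Y f g \<Longrightarrow> qis X Y g"
  by (simp add: qis_def qsurj_homotopic qinj_homotopic)

lemma qis_exact: assumes "qis X Y f" shows "exact_cx X \<longleftrightarrow> exact_cx Y"
proof
  assume e: "exact_cx X"
  show "exact_cx Y"
  proof (rule exact_cxI)
    fix T n y assume T: "projective C T" and y: "y \<in> Hom C T (term_at Y n)" "diff_at Y n \<cdot> y = zer C T (term_at Y (n + 1))"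
    obtain x u where x: "x \<in> Hom C T (term_at X n)" "diff_at X n \<cdot> x = zer C T (term_at X (n + 1))"
      "u \<in> Hom C T (term_at Y (n - 1))" "y = f n \<cdot> x \<oplus> diff_at Y (n - 1) \<cdot> u"
      using qsurjD[OF _ T y] assms qis_def by blast
    obtain v where v: "v \<in> Hom C T (term_at X (n - 1))" "x = diff_at X (n - 1) \<cdot> v" by (rule exactD[OF e T x(1,2)])
    note [simp] = X Y hom[OF x(1)] hom[OF x(3)] hom[OF v(1)] cm_typ[OF f]
    have "y = diff_at Y (n - 1) \<cdot> (u \<oplus> f (n - 1) \<cdot> v)" unfolding x(4) v(2) by (simp add: alg cm_comm'[OF f])
    then show "\<exists>v \<in> Hom C T (term_at Y (n - 1)). y = diff_at Y (n - 1) \<cdot> v" by (rule bexI) (simp add: HomI)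
  qed
next
  assume e: "exact_cx Y"
  show "exact_cx X"
  proof (rule exact_cxI)
    fix T n x assume T: "projective C T" and x: "x \<in> Hom C T (term_at X n)" "diff_at X n \<cdot> x = zer C T (term_at X (n + 1))"
    note [simp] = X Y hom[OF x(1)] cm_typ[OF f]
    obtain u where u: "u \<in> Hom C T (term_at Y (n - 1))" "f n \<cdot> x = diff_at Y (n - 1) \<cdot> u"
      by (rule exactD[OF e T, of "f n \<cdot> x" n]) (auto simp: Hom_def cm_comm'[OF f] x(2))
    show "\<exists>v \<in> Hom C T (term_at X (n - 1)). x = diff_at X (n - 1) \<cdot> v"
      using qinjD[OF conjunct2[OF assms[unfolded qis_def]] T x u] by blast
  qed
qed

end

lemma qis_idm: assumes X: "cx X" shows "qis X X (\<lambda>n. idm C (term_at X n))"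
  unfolding qis_def
proof
  show "qsurj X X (\<lambda>n. idm C (term_at X n))"
  proof (rule qsurjI)
    fix T n y assume T: "projective C T" and y: "y \<in> Hom C T (term_at X n)" "diff_at X n \<cdot> y = zer C T (term_at X (n + 1))"
    note [simp] = X hom[OF y(1)]
    show "\<exists>x u. x \<in> Hom C T (term_at X n) \<and> diff_at X n \<cdot> x = zer C T (term_at X (n + 1)) \<and>
        u \<in> Hom C T (term_at X (n - 1)) \<and> y = idm C (term_at X n) \<cdot> x \<oplus> diff_at X (n - 1) \<cdot> u"
      using y by (intro exI[of _ y] exI[of _ "zer C T (term_at X (n - 1))"]) (auto intro: zer_Hom)
  qed
  show "qinj X X (\<lambda>n. idm C (term_at X n))"
    by (rule qinjI) (auto simp: hom)
qed

context
  fixes X Y Z f g assumes X: "cx X" and Y: "cx Y" and Z: "cx Z" and f: "f \<in> chain_maps C X Y" and g: "g \<in> chain_maps C Y Z"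
begin

abbreviation (input) "gf \<equiv> \<lambda>n. g n \<cdot> f n"

lemma qsurj_cmp: assumes "qsurj X Y f" "qsurj Y Z g" shows "qsurj X Z gf"
proof (rule qsurjI)
  fix T n z assume T: "projective C T" and z: "z \<in> Hom C T (term_at Z n)" "diff_at Z n \<cdot> z = zer C T (term_at Z (n + 1))"
  obtain y u where y: "y \<in> Hom C T (term_at Y n)" "diff_at Y n \<cdot> y = zer C T (term_at Y (n + 1))"
    "u \<in> Hom C T (term_at Z (n - 1))" "z = g n \<cdot> y \<oplus> diff_at Z (n - 1) \<cdot> u"
    by (rule qsurjD[OF assms(2) T z])
  obtain x v where x: "x \<in> Hom C T (term_at X n)" "diff_at X n \<cdot> x = zer C T (term_at X (n + 1))"
    "v \<in> Hom C T (term_at Y (n - 1))" "y = f n \<cdot> x \<oplus> diff_at Y (n - 1) \<cdot> v"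
    by (rule qsurjD[OF assms(1) T y(1,2)])
  note [simp] = X Y Z cm_typ[OF f] cm_typ[OF g] hom[OF y(1)] hom[OF y(3)] hom[OF x(1)] hom[OF x(3)]
  have "z = gf n \<cdot> x \<oplus> diff_at Z (n - 1) \<cdot> (u \<oplus> g (n - 1) \<cdot> v)"
    unfolding y(4) x(4) by (simp add: alg cm_comm'[OF g])
  then show "\<exists>x u. x \<in> Hom C T (term_at X n) \<and> diff_at X n \<cdot> x = zer C T (term_at X (n + 1)) \<and>
        u \<in> Hom C T (term_at Z (n - 1)) \<and> z = gf n \<cdot> x \<oplus> diff_at Z (n - 1) \<cdot> u"
    using x(1,2) by (intro exI[of _ x] exI[of _ "u \<oplus> g (n - 1) \<cdot> v"]) (auto simp: Hom_def)
qed

lemma qinj_cmp: assumes "qinj X Y f" "qinj Y Z g" shows "qinj X Z gf"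
proof (rule qinjI)
  fix T n x u assume T: "projective C T" and x: "x \<in> Hom C T (term_at X n)" "diff_at X n \<cdot> x = zer C T (term_at X (n + 1))"
    "u \<in> Hom C T (term_at Z (n - 1))" "gf n \<cdot> x = diff_at Z (n - 1) \<cdot> u"
  note [simp] = X Y Z cm_typ[OF f] cm_typ[OF g] hom[OF x(1)] hom[OF x(3)]
  obtain v where v: "v \<in> Hom C T (term_at Y (n - 1))" "f n \<cdot> x = diff_at Y (n - 1) \<cdot> v"
    by (rule qinjD[OF assms(2) T _ _ x(3), of "f n \<cdot> x"])
      (use x(4) in \<open>auto simp: Hom_def assoc cm_comm'[OF f] x(2)\<close>)
  show "\<exists>v\<in>Hom C T (term_at X (n - 1)). x = diff_at X (n - 1) \<cdot> v"
    using qinjD[OF assms(1) T x(1,2) v] by blast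
qed

lemma qinj_cancel: assumes "qinj X Z gf" shows "qinj X Y f"
proof (rule qinjI)
  fix T n x u assume T: "projective C T" and x: "x \<in> Hom C T (term_at X n)" "diff_at X n \<cdot> x = zer C T (term_at X (n + 1))"
    "u \<in> Hom C T (term_at Y (n - 1))" "f n \<cdot> x = diff_at Y (n - 1) \<cdot> u"
  note [simp] = X Y Z cm_typ[OF f] cm_typ[OF g] hom[OF x(1)] hom[OF x(3)]
  show "\<exists>v\<in>Hom C T (term_at X (n - 1)). x = diff_at X (n - 1) \<cdot> v"
    by (rule qinjD[OF assms T x(1,2), of "g (n - 1) \<cdot> u"]) (auto simp: Hom_def assoc x(4) cm_comm'[OF g])
qed

lemma qsurj_cancel: assumes "qsurj X Z gf" shows "qsurj Y Z g"
proof (rule qsurjI)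
  fix T n z assume T: "projective C T" and z: "z \<in> Hom C T (term_at Z n)" "diff_at Z n \<cdot> z = zer C T (term_at Z (n + 1))"
  obtain x u where x: "x \<in> Hom C T (term_at X n)" "diff_at X n \<cdot> x = zer C T (term_at X (n + 1))"
    "u \<in> Hom C T (term_at Z (n - 1))" "z = gf n \<cdot> x \<oplus> diff_at Z (n - 1) \<cdot> u"
    by (rule qsurjD[OF assms T z])
  note [simp] = X Y Z cm_typ[OF f] cm_typ[OF g] hom[OF x(1)] hom[OF x(3)]
  show "\<exists>y u. y \<in> Hom C T (term_at Y n) \<and> diff_at Y n \<cdot> y = zer C T (term_at Y (n + 1)) \<and>
        u \<in> Hom C T (term_at Z (n - 1)) \<and> z = g n \<cdot> y \<oplus> diff_at Z (n - 1) \<cdot> u"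
    using x by (intro exI[of _ "f n \<cdot> x"] exI[of _ u]) (auto simp: Hom_def assoc cm_comm'[OF f])
qed

lemma qsurj_cancel_left: assumes "qsurj X Z gf" "qinj Y Z g" shows "qsurj X Y f"
proof (rule qsurjI)
  fix T n y assume T: "projective C T" and y: "y \<in> Hom C T (term_at Y n)" "diff_at Y n \<cdot> y = zer C T (term_at Y (n + 1))"
  note [simp] = X Y Z cm_typ[OF f] cm_typ[OF g] hom[OF y(1)]
  obtain x u where x: "x \<in> Hom C T (term_at X n)" "diff_at X n \<cdot> x = zer C T (term_at X (n + 1))"
    "u \<in> Hom C T (term_at Z (n - 1))" "g n \<cdot> y = gf n \<cdot> x \<oplus> diff_at Z (n - 1) \<cdot> u"
    by (rule qsurjD[OF assms(1) T, of "g n \<cdot> y" n]) (auto simp: Hom_def cm_comm'[OF g] y)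
  note [simp] = hom[OF x(1)] hom[OF x(3)]
  obtain v where v: "v \<in> Hom C T (term_at Y (n - 1))" "y \<ominus> f n \<cdot> x = diff_at Y (n - 1) \<cdot> v"
    by (rule qinjD[OF assms(2) T _ _ x(3), of "y \<ominus> f n \<cdot> x"])
      (auto simp: Hom_def alg cm_comm'[OF f] y x(2,4))
  note [simp] = hom[OF v(1)]
  show "\<exists>x u. x \<in> Hom C T (term_at X n) \<and> diff_at X n \<cdot> x = zer C T (term_at X (n + 1)) \<and>
        u \<in> Hom C T (term_at Y (n - 1)) \<and> y = f n \<cdot> x \<oplus> diff_at Y (n - 1) \<cdot> u"
    using x v by (intro exI[of _ x] exI[of _ v]) (auto simp: alg)
qed

lemma qis_cmp: "qis X Y f \<Longrightarrow> qis Y Z g \<Longrightarrow> qis X Z gf"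
  and qis_cancel_left: "qis X Z gf \<Longrightarrow> qis Y Z g \<Longrightarrow> qis X Y f"
  unfolding qis_def
  using qsurj_cmp qinj_cmp qsurj_cancel_left qinj_cancel by blast+

end

text \<open>Let g be a homotopy inverse. Both composites are homotopic to identities and hence
  quasi-isomorphisms. Injectivity on cohomology is cancelled from g f, surjectivity from f
  g.\<close>

lemma Kb_iso_qis:
  assumes X: "X \<in> bc" and Y: "Y \<in> bc" and f: "f \<in> chain_maps C X Y" and iso: "is_iso (Kb C) (hclass C X Y f)"
  shows "qis X Y f"
proof -
  obtain m where m: "m \<in> Hom (Kb C) Y X" "cmp (Kb C) m (hclass C X Y f) = idm (Kb C) X"
     "cmp (Kb C) (hclass C X Y f) m = idm (Kb C) Y"
    using iso by (auto simp: is_iso_def)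
  obtain g where g: "g \<in> chain_maps C Y X" "m = hclass C Y X g" using m(1) by (auto elim: Kb_HomE)
  note c = bc_cx[OF X] bc_cx[OF Y]
  have 1: "homotopic C X X (\<lambda>n. idm C (term_at X n)) (\<lambda>n. g n \<cdot> f n)"
    using m(2) f g X Y by (subst hclass_eq[symmetric]) (auto simp: cm_idm cm_cmp)
  have 2: "homotopic C Y Y (\<lambda>n. idm C (term_at Y n)) (\<lambda>n. f n \<cdot> g n)"
    using m(3) f g X Y by (subst hclass_eq[symmetric]) (auto simp: cm_idm cm_cmp)
  have "qis X X (\<lambda>n. g n \<cdot> f n)"
    by (rule qis_homotopic[OF c(1) c(1) cm_idm[OF c(1)] qis_idm[OF c(1)] cm_cmp[OF f g(1) c(1,2,1)] 1])
  moreover have "qis Y Y (\<lambda>n. f n \<cdot> g n)"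
    by (rule qis_homotopic[OF c(2) c(2) cm_idm[OF c(2)] qis_idm[OF c(2)] cm_cmp[OF g(1) f c(2,1,2)] 2])
  ultimately show ?thesis unfolding qis_def
    using qinj_cancel[OF c(1,2) c(1) f g(1)] qsurj_cancel[OF c(2,1) c(2) g(1) f] by blast
qed

text \<open>This replaces the long exact cohomology sequence of the cone. In components, with
  differential (x, y) to (- d x, f x + d y), exactness of Z at suitable pairs is surjectivity and
  injectivity of f on cohomology.\<close>

lemma cone_exact_iff_qis:
  assumes cone: "cone X Y f Z k j p q" and X: "cx X" and Y: "cx Y" and f: "f \<in> chain_maps C X Y"
  shows "exact_cx Z \<longleftrightarrow> qis X Y f"
proof
  note [simp] = cone_simps[OF assms] cone_cx[OF assms]
  assume e: "exact_cx Z"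
  have "qsurj X Y f"
  proof (rule qsurjI)
    fix T n y assume T: "projective C T" and y: "y \<in> Hom C T (term_at Y n)" "diff_at Y n \<cdot> y = zer C T (term_at Y (n + 1))"
    note [simp] = hom[OF y(1)]
    \<comment> \<open>A cocycle y of Y gives the cocycle (0, y) of the cone. The components of an
      element bounding it are a cocycle of X that f sends to y up to a coboundary, and an element
      realizing that coboundary.\<close>
    obtain z where z: "z \<in> Hom C T (term_at Z (n - 1))" "j n \<cdot> y = diff_at Z (n - 1) \<cdot> z"
      by (rule exactD[OF e T, of "j n \<cdot> y" n]) (auto simp: Hom_def y(2))
    note [simp] = hom[OF z(1)]
    have "p n \<cdot> (j n \<cdot> y) = p n \<cdot> (diff_at Z (n - 1) \<cdot> z)" "q n \<cdot> (j n \<cdot> y) = q n \<cdot> (diff_at Z (n - 1) \<cdot> z)"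
      using z(2) by simp_all
    then have "neg C (diff_at X n \<cdot> (p (n - 1) \<cdot> z)) = zer C T (term_at X (n + 1))"
      "y = f n \<cdot> (p (n - 1) \<cdot> z) \<oplus> diff_at Y (n - 1) \<cdot> (q (n - 1) \<cdot> z)"
      by simp_all
    then show "\<exists>x u. x \<in> Hom C T (term_at X n) \<and> diff_at X n \<cdot> x = zer C T (term_at X (n + 1)) \<and>
        u \<in> Hom C T (term_at Y (n - 1)) \<and> y = f n \<cdot> x \<oplus> diff_at Y (n - 1) \<cdot> u"
      by (intro exI[of _ "p (n - 1) \<cdot> z"] exI[of _ "q (n - 1) \<cdot> z"]) (auto simp: Hom_def alg)
  qed
  moreover have "qinj X Y f"
  proof (rule qinjI)
    fix T n x u assume T: "projective C T" and x: "x \<in> Hom C T (term_at X n)" "diff_at X n \<cdot> x = zer C T (term_at X (n + 1))"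
      "u \<in> Hom C T (term_at Y (n - 1))" "f n \<cdot> x = diff_at Y (n - 1) \<cdot> u"
    note [simp] = hom[OF x(1)] hom[OF x(3)]
    \<comment> \<open>The equation f x = d u says precisely that (x, - u) is a cocycle of the
      cone.\<close>
    obtain w where w: "w \<in> Hom C T (term_at Z (n - 1 - 1))"
        "k (n - 1) \<cdot> x \<ominus> j (n - 1) \<cdot> u = diff_at Z (n - 1 - 1) \<cdot> w"
      by (rule exactD[OF e T, of "k (n - 1) \<cdot> x \<ominus> j (n - 1) \<cdot> u" "n - 1"]) (auto simp: Hom_def x(2,4) alg)
    note [simp] = hom[OF w(1)]
    have "p (n - 1) \<cdot> (k (n - 1) \<cdot> x \<ominus> j (n - 1) \<cdot> u) = p (n - 1) \<cdot> (diff_at Z (n - 1 - 1) \<cdot> w)"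
      using w(2) by simp
    then have "x = diff_at X (n - 1) \<cdot> neg C (p (n - 2) \<cdot> w)" by (simp add: cmp_neg cmp_sub)
    then show "\<exists>v\<in>Hom C T (term_at X (n - 1)). x = diff_at X (n - 1) \<cdot> v" by (rule bexI) (simp add: HomI)
  qed
  ultimately show "qis X Y f" by (simp add: qis_def)
next
  note [simp] = cone_simps[OF assms] cone_cx[OF assms]
  assume e: "qis X Y f"
  show "exact_cx Z"
  proof (rule exact_cxI)
    fix T n z assume T: "projective C T" and z: "z \<in> Hom C T (term_at Z n)" "diff_at Z n \<cdot> z = zer C T (term_at Z (n + 1))"
    note [simp] = hom[OF z(1)]
    have "p (n + 1) \<cdot> (diff_at Z n \<cdot> z) = p (n + 1) \<cdot> zer C T (term_at Z (n + 1))"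
      "q (n + 1) \<cdot> (diff_at Z n \<cdot> z) = q (n + 1) \<cdot> zer C T (term_at Z (n + 1))"
      using z(2) by simp_all
    then have 1: "diff_at X (n + 1) \<cdot> (p n \<cdot> z) = zer C T (term_at X (n + 2))"
      and 2: "f (n + 1) \<cdot> (p n \<cdot> z) \<oplus> diff_at Y n \<cdot> (q n \<cdot> z) = zer C T (term_at Y (n + 1))"
      by (simp_all add: alg add.commute[of 2 n])
    have 2: "f (n + 1) \<cdot> (p n \<cdot> z) = diff_at Y n \<cdot> neg C (q n \<cdot> z)"
      using 2 by (simp add: alg)
    obtain v where v: "v \<in> Hom C T (term_at X (n + 1 - 1))" "p n \<cdot> z = diff_at X (n + 1 - 1) \<cdot> v"
      by (rule qinjD[OF conjunct2[OF e[unfolded qis_def]] T, of "p n \<cdot> z" "n + 1" "neg C (q n \<cdot> z)"])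
        (auto simp: Hom_def 1 2 add.commute[of 2 n])
    then have v: "v \<in> Hom C T (term_at X n)" "p n \<cdot> z = diff_at X n \<cdot> v" by simp_all
    note [simp] = hom[OF v(1)]
    \<comment> \<open>Since p z = d v, adding the boundary of (v, 0) to z removes its X-component
      and leaves q z + f v, which is therefore a cocycle of Y.\<close>
    have 3: "diff_at Y n \<cdot> (q n \<cdot> z \<oplus> f n \<cdot> v) = zer C T (term_at Y (n + 1))"
      using 2 by (simp add: alg cm_comm'[OF f] v(2))
    obtain x u where x: "x \<in> Hom C T (term_at X n)" "diff_at X n \<cdot> x = zer C T (term_at X (n + 1))"
        "u \<in> Hom C T (term_at Y (n - 1))" "q n \<cdot> z \<oplus> f n \<cdot> v = f n \<cdot> x \<oplus> diff_at Y (n - 1) \<cdot> u"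
      by (rule qsurjD[OF conjunct1[OF e[unfolded qis_def]] T _ 3]) (auto simp: Hom_def)
    note [simp] = hom[OF x(1)] hom[OF x(3)]
    have 4: "q n \<cdot> z = f n \<cdot> x \<oplus> diff_at Y (n - 1) \<cdot> u \<ominus> f n \<cdot> v" using x(4) by (simp add: eq_sub)
    have "z = diff_at Z (n - 1) \<cdot> (k (n - 1) \<cdot> (x \<ominus> v) \<oplus> j (n - 1) \<cdot> u)"
      by (rule cone_eq_in[OF cone, of _ T n]) (simp_all add: Hom_def alg v(2) x(2) 4)
    then show "\<exists>v\<in>Hom C T (term_at Z (n - 1)). z = diff_at Z (n - 1) \<cdot> v" by (rule bexI) (simp add: HomI)
  qed
qed

section \<open>Triangles of the homotopy category and the morphisms with acyclic cone\<close>

lemma Kb_triangles: "t \<in> triangles (Kb C) \<longleftrightarrow> is_candidate (Kb C) t \<and>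
   (\<exists>X Y Z f k j p q. X \<in> bc \<and> Y \<in> bc \<and> Z \<in> bc \<and> f \<in> chain_maps C X Y \<and> cone X Y f Z k j p q \<and>
     triangle_iso (Kb C) t (hclass C X Y f, hclass C Y Z j, hclass C Z (shift_complex C X) p))"
proof -
  have "\<exists>T. Kb C = close_triangles T \<and> triangles T = {(hclass C X Y f, hclass C Y Z j, hclass C Z (shift_complex C X) p) |
      X Y Z f j p. X \<in> bc \<and> Y \<in> bc \<and> Z \<in> bc \<and> f \<in> chain_maps C X Y \<and> is_mapping_cone C X Y f Z j p}"
    by (rule exI, rule conjI, rule Kb_def, simp)
  then obtain T where T: "Kb C = close_triangles T" "triangles T = {(hclass C X Y f, hclass C Y Z j, hclass C Z (shift_complex C X) p) |
      X Y Z f j p. X \<in> bc \<and> Y \<in> bc \<and> Z \<in> bc \<and> f \<in> chain_maps C X Y \<and> is_mapping_cone C X Y f Z j p}" by blast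
  show ?thesis unfolding T(1) close_triangles_iff T(2) is_mapping_cone_iff by blast
qed

lemma standard_triangle:
  assumes "X \<in> bc" "Y \<in> bc" "Z \<in> bc" "f \<in> chain_maps C X Y" "cone X Y f Z k j p q"
  shows "(hclass C X Y f, hclass C Y Z j, hclass C Z (shift_complex C X) p) \<in> triangles (Kb C)"
proof -
  have j: "j \<in> chain_maps C Y Z" and p: "p \<in> chain_maps C Z (shift_complex C X)"
    using cone_j cone_p assms by (metis bc_cx)+
  let ?t = "(hclass C X Y f, hclass C Y Z j, hclass C Z (shift_complex C X) p)"
  have c: "is_candidate (Kb C) ?t" using assms j p by simp
  have "triangle_iso (Kb C) ?t ?t" by (rule triangle_iso_refl[OF Kb_category shift_functor c])
  then show ?thesis using c assms unfolding Kb_triangles by blast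
qed

lemma Kb_triangleE:
  assumes "(u, v, w) \<in> triangles (Kb C)"
  obtains X Y Z f k j p q where "X \<in> bc" "Y \<in> bc" "Z \<in> bc" "f \<in> chain_maps C X Y" "cone X Y f Z k j p q"
    "triangle_iso (Kb C) (u, v, w) (hclass C X Y f, hclass C Y Z j, hclass C Z (shift_complex C X) p)"
    "is_candidate (Kb C) (u, v, w)"
  using assms unfolding Kb_triangles by blast

end

context abelian_category
begin

lemma cone_exists:
  assumes X: "cx X" and Y: "cx Y"
  obtains Z k j p q where "cone X Y f Z k j p q"
proof -
  have "\<forall>n. \<exists>s i1 i2 p1 p2. is_biproduct C (term_at X (n + 1)) (term_at Y n) s i1 i2 p1 p2"
    using ex_biproduct X Y by simp
  then obtain s k j p q where bp: "\<And>n. is_biproduct C (term_at X (n + 1)) (term_at Y n) (s n) (k n) (j n) (p n) (q n)"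
    by metis
  let ?Z = "\<lparr>term_at = s, diff_at = (\<lambda>n. (k (n + 1) \<cdot> neg C (diff_at X (n + 1)) \<cdot> p n) \<oplus>
        ((j (n + 1) \<cdot> f (n + 1) \<cdot> p n) \<oplus> (j (n + 1) \<cdot> diff_at Y n \<cdot> q n)))\<rparr>"
  have "cone X Y f ?Z k j p q" unfolding cone_def using bp by simp
  then show ?thesis by (rule that)
qed

lemma cone_bd: assumes "cone X Y f Z k j p q" "bd X" "bd Y" shows "bd Z"
proof -
  obtain N M where N: "\<And>n. \<bar>n\<bar> > N \<Longrightarrow> zero_object C (term_at X n)" "\<And>n. \<bar>n\<bar> > M \<Longrightarrow> zero_object C (term_at Y n)"
    using assms unfolding bd_def by metis
  have "zero_object C (term_at Z n)" if n: "\<bar>n\<bar> > max (N + 1) M" for n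
  proof (rule biproduct_zero[OF _ preadditive_category_axioms])
    show "is_biproduct C (term_at X (n + 1)) (term_at Y n) (term_at Z n) (k n) (j n) (p n) (q n)"
      using assms(1) by (simp add: cone_def)
    show "zero_object C (term_at X (n + 1))" "zero_object C (term_at Y n)" using n by (auto intro!: N)
  qed
  then show ?thesis unfolding bd_def by blast
qed

lemma cone_bc:
  assumes "X \<in> bc" "Y \<in> bc" "f \<in> chain_maps C X Y"
  obtains Z k j p q where "cone X Y f Z k j p q" "Z \<in> bc"
proof -
  obtain Z k j p q where "cone X Y f Z k j p q" using cone_exists assms by (metis bc_cx)
  then show ?thesis using that cone_bd cone_cx assms by (simp add: bounded_complexes_iff)
qed

end

context abelian_enough
begin

lemma acyclic_iff: "X \<in> acyclic_complexes C \<longleftrightarrow> X \<in> bc \<and> exact_cx X"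
proof -
  have "(\<forall>n. exact_at C (diff_at X n) (diff_at X (n + 1))) \<longleftrightarrow> exact_cx X" if X: "X \<in> bc"
  proof -
    note [simp] = bc_cx[OF X]
    have "exact_at C (diff_at X n) (diff_at X (n + 1)) \<longleftrightarrow> texact (diff_at X n) (diff_at X (n + 1))" for n
      by (subst exact_at_iff[of _ "term_at X n" "term_at X (n + 1)" _ "term_at X (n + 2)"]) (simp_all add: Hom_def add.commute[of 2 n])
    \<comment> \<open>\<open>exact_cx\<close> refers to degree n by the outgoing differential,
      whereas \<open>acyclic_complexes\<close> uses the incoming one, hence the index shift.\<close>
    then have "(\<forall>n. exact_at C (diff_at X n) (diff_at X (n + 1))) \<longleftrightarrow> (\<forall>n. texact (diff_at X (n - 1)) (diff_at X (n - 1 + 1)))"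
      by (metis add_diff_cancel_right')
    then show ?thesis unfolding texact_def exact_cx_def by auto metis+
  qed
  then show ?thesis by (auto simp: acyclic_complexes_def)
qed

text \<open>For standard triangles this is \<open>cone_exact_iff_qis\<close>. A general triangle is
  only isomorphic in \<open>Kb C\<close> to a standard one; such isomorphisms are
  quasi-isomorphisms, so exactness of the third object and the property \<open>qis\<close> of the
  first morphism can be carried over by composition and cancellation.\<close>

lemma Kb_quasi_isos:
  "verdier_mors (Kb C) (acyclic_complexes C) =
    {hclass C X Y f | X Y f. X \<in> bc \<and> Y \<in> bc \<and> f \<in> chain_maps C X Y \<and> qis X Y f}" (is "?L = ?R")
proof
  interpret Kb: category "Kb C" by (rule Kb_category)
  show "?R \<subseteq> ?L"
  proof
    fix u assume "u \<in> ?R"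
    then obtain X Y f where u: "u = hclass C X Y f" "X \<in> bc" "Y \<in> bc" "f \<in> chain_maps C X Y" "qis X Y f" by blast
    obtain Z k j p q where Z: "cone X Y f Z k j p q" "Z \<in> bc" using cone_bc u by metis
    have "exact_cx Z" using cone_exact_iff_qis Z u by simp
    then have "Z \<in> acyclic_complexes C" using acyclic_iff Z by simp
    moreover have "(u, hclass C Y Z j, hclass C Z (shift_complex C X) p) \<in> triangles (Kb C)"
      using standard_triangle u Z by blast
    moreover have "u \<in> mor (Kb C)" "trg (Kb C) (hclass C Y Z j) = Z" using u by auto
    ultimately show "u \<in> ?L" unfolding verdier_mors_def by (metis (mono_tags, lifting) mem_Collect_eq)
  qed
  show "?L \<subseteq> ?R"
  proof
    fix u assume "u \<in> ?L"
    then obtain v w where u: "u \<in> mor (Kb C)" and t: "(u, v, w) \<in> triangles (Kb C)" "trg (Kb C) v \<in> acyclic_complexes C"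
      by (auto simp: verdier_mors_def)
    obtain X' Y' Z f k j p q where s: "X' \<in> bc" "Y' \<in> bc" "Z \<in> bc" "f \<in> chain_maps C X' Y'" "cone X' Y' f Z k j p q"
      "triangle_iso (Kb C) (u, v, w) (hclass C X' Y' f, hclass C Y' Z j, hclass C Z (shift_complex C X') p)"
      "is_candidate (Kb C) (u, v, w)"
      by (rule Kb_triangleE[OF t(1)])
    obtain X Y g where g: "X \<in> bc" "Y \<in> bc" "g \<in> chain_maps C X Y" "u = hclass C X Y g" using u by (rule Kb_morE)
    obtain a b c where abc: "a \<in> Hom (Kb C) X X'" "b \<in> Hom (Kb C) (src (Kb C) v) Y'" "c \<in> Hom (Kb C) (src (Kb C) w) Z"
      "is_iso (Kb C) a" "is_iso (Kb C) b" "is_iso (Kb C) c" "cmp (Kb C) b u = cmp (Kb C) (hclass C X' Y' f) a"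
      using s(6) g(4) by auto
    have vw: "src (Kb C) v = Y" "src (Kb C) w = trg (Kb C) v" using s(7) g(4) by auto
    note abc = abc(1) abc(2,3)[unfolded vw] abc(4-7)
    obtain a' where a': "a' \<in> chain_maps C X X'" "a = hclass C X X' a'" using abc(1) by (rule Kb_HomE)
    obtain b' where b': "b' \<in> chain_maps C Y Y'" "b = hclass C Y Y' b'" using abc(2) by (rule Kb_HomE)
    obtain c' where c': "c' \<in> chain_maps C (trg (Kb C) v) Z" "c = hclass C (trg (Kb C) v) Z c'" using abc(3) by (rule Kb_HomE)
    have V: "trg (Kb C) v \<in> bc" "exact_cx (trg (Kb C) v)" using t(2) acyclic_iff by auto
    have "qis (trg (Kb C) v) Z c'" using Kb_iso_qis[OF V(1) s(3) c'(1)] abc c' by simp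
    then have "exact_cx Z" using qis_exact[OF bc_cx[OF V(1)] bc_cx[OF s(3)] c'(1)] V(2) by simp
    then have qf: "qis X' Y' f" using cone_exact_iff_qis[OF s(5) bc_cx[OF s(1)] bc_cx[OF s(2)] s(4)] by simp
    have qa: "qis X X' a'" using Kb_iso_qis[OF g(1) s(1) a'(1)] abc a' by simp
    have qb: "qis Y Y' b'" using Kb_iso_qis[OF g(2) s(2) b'(1)] abc b' by simp
    have "homotopic C X Y' (\<lambda>n. f n \<cdot> a' n) (\<lambda>n. b' n \<cdot> g n)"
      using abc(7) a' b' g s by (subst hclass_eq[symmetric]) (auto simp: cm_cmp)
    then have "qis X Y' (\<lambda>n. b' n \<cdot> g n)"
      using qis_homotopic[of X Y' "\<lambda>n. f n \<cdot> a' n" "\<lambda>n. b' n \<cdot> g n"] s(1,2,4) g(1-3) a' b'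
        qis_cmp[OF _ _ _ a'(1) s(4) qa qf] cm_cmp by simp
    then have "qis X Y g" using qis_cancel_left[of X Y Y' g b'] g b' s qb by simp
    then show "u \<in> ?R" using g by blast
  qed
qed

end

section \<open>Projective resolutions of complexes\<close>

text \<open>Dependent choice after the substitution n = M - k. It serves for homotopies and
  resolutions, which are built from the top degree downwards; R relates the data of neighbouring
  degrees.\<close>

lemma downward_choice:
  fixes S :: "int \<Rightarrow> 'b \<Rightarrow> bool"
  assumes "\<exists>x. S M x" and step: "\<And>n x. n \<le> M \<Longrightarrow> S n x \<Longrightarrow> \<exists>y. S (n - 1) y \<and> R n x y"
  shows "\<exists>h. \<forall>n\<le>M. S n (h n) \<and> R n (h n) (h (n - 1))"
proof -
  have "\<exists>H. \<forall>k. S (M - int k) (H k) \<and> R (M - int k) (H k) (H (Suc k))"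
  proof (rule dependent_nat_choice)
    show "\<exists>x. S (M - int 0) x" using assms(1) by simp
    fix x k assume "S (M - int k) x"
    then show "\<exists>y. S (M - int (Suc k)) y \<and> R (M - int k) x y"
      using step[of "M - int k" x] by (simp add: algebra_simps)
  qed
  then obtain H where H: "\<And>k. S (M - int k) (H k) \<and> R (M - int k) (H k) (H (Suc k))" by blast
  have "S n (H (nat (M - n))) \<and> R n (H (nat (M - n))) (H (nat (M - (n - 1))))" if "n \<le> M" for n
  proof -
    have "M - int (nat (M - n)) = n" "nat (M - (n - 1)) = Suc (nat (M - n))" using that by auto
    then show ?thesis using H[of "nat (M - n)"] by simp
  qed
  then show ?thesis by (intro exI[of _ "\<lambda>n. H (nat (M - n))"]) blast
qed

context abelian_enough
begin

definition bounded_proj :: "('o, 'm) cochain \<Rightarrow> bool" where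
  "bounded_proj P \<longleftrightarrow> cx P \<and> (\<forall>n. projective C (term_at P n)) \<and> (\<exists>N. \<forall>n>N. zero_object C (term_at P n))"

definition res :: "('o, 'm) cochain \<Rightarrow> ('o, 'm) cochain \<Rightarrow> (int \<Rightarrow> 'm) \<Rightarrow> bool" where
  "res X P \<pi> \<longleftrightarrow> bounded_proj P \<and> \<pi> \<in> chain_maps C P X \<and> qis P X \<pi>"

lemma bounded_projD: assumes "bounded_proj P" shows "cx P" "projective C (term_at P n)"
  using assms by (auto simp: bounded_proj_def)

lemma resD: assumes "res X P \<pi>" shows "cx P" "projective C (term_at P n)" "\<pi> \<in> chain_maps C P X" "qis P X \<pi>"
    "bounded_proj P"
  using assms bounded_projD by (auto simp: res_def)

text \<open>Above N the homotopy can be zero. Going down, the part of f not yet accounted for is a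
  cocycle of V with projective source, so exactness of V provides the next component.\<close>

lemma null_homotopy:
  assumes P: "bounded_proj P" and V: "cx V" "exact_cx V" and f: "f \<in> chain_maps C P V"
  obtains h where "\<forall>n. h n \<in> Hom C (term_at P n) (term_at V (n - 1))"
    "\<forall>n. f n = diff_at V (n - 1) \<cdot> h n \<oplus> h (n + 1) \<cdot> diff_at P n"
proof -
  note [simp] = bounded_projD[OF P] V(1) cm_typ[OF f]
  obtain N where N: "\<And>n. n > N \<Longrightarrow> zero_object C (term_at P n)" using P unfolding bounded_proj_def by blast
  \<comment> \<open>The invariant for a component h in degree n includes that the obstruction in
    degree n - 1 is a cocycle, which is what the next step needs in order to apply
    exactness.\<close>
  let ?S = "\<lambda>n h. h \<in> Hom C (term_at P n) (term_at V (n - 1)) \<and>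
     diff_at V (n - 1) \<cdot> (f (n - 1) \<ominus> h \<cdot> diff_at P (n - 1)) = zer C (term_at P (n - 1)) (term_at V n)"
  let ?R = "\<lambda>n h h'. f (n - 1) = diff_at V (n - 1 - 1) \<cdot> h' \<oplus> h \<cdot> diff_at P (n - 1)"
  have "\<exists>H. \<forall>n\<le>N+1. ?S n (H n) \<and> ?R n (H n) (H (n - 1))"
  proof (rule downward_choice)
    have "f (N + 1) \<cdot> diff_at P N = zer C (term_at P N) (term_at V (N + 1))"
    proof -
      have "diff_at P N = zer C (term_at P N) (term_at P (N + 1))"
        by (rule to_zero[OF N]) (auto simp: Hom_def)
      then show ?thesis by simp
    qed
    then show "\<exists>h. ?S (N + 1) h"
      by (intro exI[of _ "zer C (term_at P (N + 1)) (term_at V N)"]) (simp add: zer_Hom alg cm_comm[OF f])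
  next
    fix n h assume h: "?S n h"
    note [simp] = hom[OF conjunct1[OF h]]
    obtain h' where h': "h' \<in> Hom C (term_at P (n - 1)) (term_at V (n - 1 - 1))"
        "f (n - 1) \<ominus> h \<cdot> diff_at P (n - 1) = diff_at V (n - 1 - 1) \<cdot> h'"
      by (rule exactD[OF V(2), of "term_at P (n - 1)" "f (n - 1) \<ominus> h \<cdot> diff_at P (n - 1)" "n - 1"])
        (use h in \<open>auto simp: Hom_def\<close>)
    note [simp] = hom[OF h'(1)]
    have e: "f (n - 1) = diff_at V (n - 1 - 1) \<cdot> h' \<oplus> h \<cdot> diff_at P (n - 1)"
      using h'(2) by (subst (asm) sub_eq) simp_all
    have "diff_at V (n - 2) \<cdot> f (n - 2) = diff_at V (n - 2) \<cdot> (h' \<cdot> diff_at P (n - 2))"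
      using cm_comm[OF f, of "n - 2"] e by (simp add: alg)
    then have "?S (n - 1) h'" using h'(1) by (simp add: alg)
    then show "\<exists>h'. ?S (n - 1) h' \<and> ?R n h h'" using e by blast
  qed
  then obtain H where H: "\<And>n. n \<le> N + 1 \<Longrightarrow> ?S n (H n)" "\<And>n. n \<le> N + 1 \<Longrightarrow> ?R n (H n) (H (n - 1))" by blast
  define h where "h = (\<lambda>n. if n \<le> N + 1 then H n else zer C (term_at P n) (term_at V (n - 1)))"
  have 1: "h n \<in> Hom C (term_at P n) (term_at V (n - 1))" for n
    using H(1) by (simp add: h_def zer_Hom)
  moreover have "f n = diff_at V (n - 1) \<cdot> h n \<oplus> h (n + 1) \<cdot> diff_at P n" for n
  proof (cases "n \<le> N")
    case True
    then show ?thesis using H(2)[of "n + 1"] by (simp add: h_def)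
  next
    case False
    then have z: "zero_object C (term_at P n)" using N by simp
    note [simp] = hom[OF 1]
    have "diff_at V (n - 1) \<cdot> h n \<oplus> h (n + 1) \<cdot> diff_at P n \<in> Hom C (term_at P n) (term_at V n)"
      by (auto simp: Hom_def)
    then show ?thesis using from_zero[OF z] cm_Hom[OF f] by metis
  qed
  ultimately show ?thesis using that by blast
qed

text \<open>The cone of \<pi> is exact, so g followed by the inclusion of Y into the cone is
  null-homotopic. The X-component of the null-homotopy is the lift F, its Y-component the homotopy
  from g to \<pi> F.\<close>

lemma lift:
  assumes P: "bounded_proj P" and X: "cx X" and Y: "cx Y" and \<pi>: "\<pi> \<in> chain_maps C X Y" "qis X Y \<pi>"
    and g: "g \<in> chain_maps C P Y"
  obtains F where "F \<in> chain_maps C P X" "homotopic C P Y g (\<lambda>n. \<pi> n \<cdot> F n)"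
proof -
  obtain Z k j p q where c: "cone X Y \<pi> Z k j p q" using cone_exists[OF X Y] by blast
  note c' = c X Y \<pi>(1)
  note [simp] = cone_simps[OF c'] cone_cx[OF c'] bounded_projD[OF P] cm_typ[OF g]
  have e: "exact_cx Z" using cone_exact_iff_qis[OF c'] \<pi>(2) by simp
  obtain h where "\<forall>n. h n \<in> Hom C (term_at P n) (term_at Z (n - 1))"
    "\<forall>n. j n \<cdot> g n = diff_at Z (n - 1) \<cdot> h n \<oplus> h (n + 1) \<cdot> diff_at P n"
    by (rule null_homotopy[OF P cone_cx[OF c'] e cm_cmp[OF g cone_j[OF c'] bounded_projD(1)[OF P] Y cone_cx[OF c']]])
  then have h: "\<And>n. h n \<in> Hom C (term_at P n) (term_at Z (n - 1))"
    "\<And>n. j n \<cdot> g n = diff_at Z (n - 1) \<cdot> h n \<oplus> h (n + 1) \<cdot> diff_at P n" by blast+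
  note [simp] = hom[OF h(1)]
  have pe: "p n \<cdot> (j n \<cdot> g n) = p n \<cdot> (diff_at Z (n - 1) \<cdot> h n \<oplus> h (n + 1) \<cdot> diff_at P n)" for n by (simp only: h(2))
  have qe: "q n \<cdot> (j n \<cdot> g n) = q n \<cdot> (diff_at Z (n - 1) \<cdot> h n \<oplus> h (n + 1) \<cdot> diff_at P n)" for n by (simp only: h(2))
  let ?F = "\<lambda>n. p (n - 1) \<cdot> h n"
  have "?F \<in> chain_maps C P X"
    using pe by (intro cmI) (simp_all add: alg)
  moreover have "homotopic C P Y g (\<lambda>n. \<pi> n \<cdot> ?F n)"
  proof (rule htpI[of "\<lambda>n. q (n - 1) \<cdot> h n"])
    fix n show "g n = \<pi> n \<cdot> ?F n \<oplus> (diff_at Y (n - 1) \<cdot> (q (n - 1) \<cdot> h n) \<oplus> (q (n + 1 - 1) \<cdot> h (n + 1)) \<cdot> diff_at P n)"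
      using qe[of n] by (simp add: alg)
  qed simp_all
  ultimately show ?thesis by (rule that)
qed

text \<open>F - G together with a homotopy from \<pi> F to \<pi> G forms a chain map into the cone
  of \<pi>, displaced by one degree. As the cone is exact this map is null-homotopic, and the
  X-component of the null-homotopy is a homotopy from F to G.\<close>

lemma lift_unique:
  assumes P: "bounded_proj P" and X: "cx X" and Y: "cx Y" and \<pi>: "\<pi> \<in> chain_maps C X Y" "qis X Y \<pi>"
    and F: "F \<in> chain_maps C P X" and G: "G \<in> chain_maps C P X"
    and FG: "homotopic C P Y (\<lambda>n. \<pi> n \<cdot> F n) (\<lambda>n. \<pi> n \<cdot> G n)"
  shows "homotopic C P X F G"
proof -
  obtain s where s: "htp P Y (\<lambda>n. \<pi> n \<cdot> F n) (\<lambda>n. \<pi> n \<cdot> G n) s" using FG by (auto simp: homotopic_htp)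
  obtain Z k j p q where c: "cone X Y \<pi> Z k j p q" using cone_exists[OF X Y] by blast
  note c' = c X Y \<pi>(1)
  note [simp] = cone_simps[OF c'] cone_cx[OF c'] bounded_projD[OF P] htp(1,2,3)[OF s] cm_typ[OF F] cm_typ[OF G]
  have e: "exact_cx Z" using cone_exact_iff_qis[OF c'] \<pi>(2) by simp
  \<comment> \<open>The cone shifted by - 1, with the corresponding sign in the
    differential.\<close>
  define V where "V = \<lparr>term_at = (\<lambda>n. term_at Z (n - 1)), diff_at = (\<lambda>n. neg C (diff_at Z (n - 1)))\<rparr>"
  have V [simp]: "term_at V n = term_at Z (n - 1)" "diff_at V n = neg C (diff_at Z (n - 1))" for n
    by (simp_all add: V_def)
  have cV: "cx V" unfolding cx_def
    by (auto simp: Hom_def neg_cmp cmp_neg add.commute[of 1])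
  have eV: "exact_cx V"
  proof (rule exact_cxI)
    fix T n x assume T: "projective C T" and x: "x \<in> Hom C T (term_at V n)" "diff_at V n \<cdot> x = zer C T (term_at V (n + 1))"
    have x': "x \<in> Hom C T (term_at Z (n - 1))" using x(1) by simp
    note [simp] = hom[OF x']
    have "diff_at Z (n - 1) \<cdot> x = zer C T (term_at Z (n - 1 + 1))" using x(2) by (simp add: alg)
    then obtain v where v: "v \<in> Hom C T (term_at Z (n - 1 - 1))" "x = diff_at Z (n - 1 - 1) \<cdot> v"
      by (rule exactD[OF e T x'])
    note [simp] = hom[OF v(1)]
    show "\<exists>v\<in>Hom C T (term_at V (n - 1)). x = diff_at V (n - 1) \<cdot> v"
      using v by (intro bexI[of _ "neg C v"]) (auto simp: Hom_def neg_cmp cmp_neg)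
  qed
  \<comment> \<open>In components this is (F - G, - s). It commutes with the differentials exactly
    because s is a homotopy from \<pi> F to \<pi> G.\<close>
  let ?z = "\<lambda>n. k (n - 1) \<cdot> (F n \<ominus> G n) \<ominus> j (n - 1) \<cdot> s n"
  have z: "?z \<in> chain_maps C P V"
  proof (rule cmI)
    fix n
    have "\<pi> n \<cdot> F n = \<pi> n \<cdot> G n \<oplus> (diff_at Y (n - 1) \<cdot> s n \<oplus> s (n + 1) \<cdot> diff_at P n)"
      using htp(4)[OF s, of n] by simp
    then show "diff_at V n \<cdot> ?z n = ?z (n + 1) \<cdot> diff_at P n" by (simp add: alg cm_comm[OF F] cm_comm[OF G])
  qed simp_all
  obtain h where "\<forall>n. h n \<in> Hom C (term_at P n) (term_at V (n - 1))"
    "\<forall>n. ?z n = diff_at V (n - 1) \<cdot> h n \<oplus> h (n + 1) \<cdot> diff_at P n"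
    by (rule null_homotopy[OF P cV eV z])
  then have h: "\<And>n. h n \<in> Hom C (term_at P n) (term_at V (n - 1))"
    "\<And>n. ?z n = diff_at V (n - 1) \<cdot> h n \<oplus> h (n + 1) \<cdot> diff_at P n" by blast+
  have h1: "h n \<in> mor C" "src C (h n) = term_at P n" "trg C (h n) = term_at Z (n - 2)" for n
    using h(1)[of n] by (simp_all add: Hom_def)
  note [simp] = h1
  show ?thesis
  proof (rule htpI[of "\<lambda>n. p (n - 2) \<cdot> h n"])
    fix n
    have "p (n - 1) \<cdot> ?z n = p (n - 1) \<cdot> (diff_at V (n - 1) \<cdot> h n \<oplus> h (n + 1) \<cdot> diff_at P n)" by (simp only: h(2))
    then show "F n = G n \<oplus> (diff_at X (n - 1) \<cdot> (p (n - 2) \<cdot> h n) \<oplus> (p (n + 1 - 2) \<cdot> h (n + 1)) \<cdot> diff_at P n)"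
      by (simp add: alg)
  qed simp_all
qed

text \<open>The strong form of a resolution: \<open>P\<close> in degree \<open>n - 1\<close> covers the kernel of the
  differential of the mapping cone.\<close>

definition covering :: "('o, 'm) cochain \<Rightarrow> ('o, 'm) cochain \<Rightarrow> (int \<Rightarrow> 'm) \<Rightarrow> bool" where
  "covering X P \<pi> \<longleftrightarrow> (\<forall>T n a b. projective C T \<longrightarrow> a \<in> Hom C T (term_at P n) \<longrightarrow> b \<in> Hom C T (term_at X (n - 1)) \<longrightarrow>
     diff_at P n \<cdot> a = zer C T (term_at P (n + 1)) \<longrightarrow> \<pi> n \<cdot> a = diff_at X (n - 1) \<cdot> b \<longrightarrow>
     (\<exists>z \<in> Hom C T (term_at P (n - 1)). diff_at P (n - 1) \<cdot> z = a \<and> \<pi> (n - 1) \<cdot> z = b))"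

text \<open>Surjectivity is the covering property one degree higher with a = 0. Injectivity is the
  covering property with the equation for b forgotten.\<close>

lemma covering_qis:
  assumes "covering X P \<pi>" and X: "cx X" and P: "cx P" and \<pi>: "\<pi> \<in> chain_maps C P X"
  shows "qis P X \<pi>"
  unfolding qis_def
proof
  note [simp] = X P cm_typ[OF \<pi>]
  show "qsurj P X \<pi>"
  proof (rule qsurjI)
    fix T n y assume T: "projective C T" and y: "y \<in> Hom C T (term_at X n)" "diff_at X n \<cdot> y = zer C T (term_at X (n + 1))"
    note [simp] = hom[OF y(1)]
    have "\<exists>z \<in> Hom C T (term_at P (n + 1 - 1)). diff_at P (n + 1 - 1) \<cdot> z = zer C T (term_at P (n + 1)) \<and> \<pi> (n + 1 - 1) \<cdot> z = y"
      using assms(1) T y unfolding covering_def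
      by (elim allE[of _ T] allE[of _ "n + 1"] allE[of _ "zer C T (term_at P (n + 1))"] allE[of _ y])
        (auto simp: zer_Hom add.commute[of 2 n])
    then obtain z where z: "z \<in> Hom C T (term_at P n)" "diff_at P n \<cdot> z = zer C T (term_at P (n + 1))" "\<pi> n \<cdot> z = y" by auto
    note [simp] = hom[OF z(1)]
    show "\<exists>x u. x \<in> Hom C T (term_at P n) \<and> diff_at P n \<cdot> x = zer C T (term_at P (n + 1)) \<and>
        u \<in> Hom C T (term_at X (n - 1)) \<and> y = \<pi> n \<cdot> x \<oplus> diff_at X (n - 1) \<cdot> u"
      using z by (intro exI[of _ z] exI[of _ "zer C T (term_at X (n - 1))"]) (auto simp: zer_Hom)
  qed
  show "qinj P X \<pi>"
    using assms(1) unfolding covering_def by (intro qinjI) metis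
qed

text \<open>The pairs (a, b) in the last clause are the elements of the kernel of m, which maps the
  biproduct of P and y to that of Q and x by (a, b) to (d a, \<pi> a - dx b). An epimorphism from a
  projective object onto this kernel has the lifting property, and d' and \<pi>' are its two
  components.\<close>

lemma resolution_step:
  assumes d: "d \<in> Hom C P Q" and \<pi>: "\<pi> \<in> Hom C P x" and dx: "dx \<in> Hom C y x"
  obtains P' d' \<pi>' where "projective C P'" "d' \<in> Hom C P' P" "\<pi>' \<in> Hom C P' y" "d \<cdot> d' = zer C P' Q" "\<pi> \<cdot> d' = dx \<cdot> \<pi>'"
    "\<And>T a b. projective C T \<Longrightarrow> a \<in> Hom C T P \<Longrightarrow> b \<in> Hom C T y \<Longrightarrow> d \<cdot> a = zer C T Q \<Longrightarrow> \<pi> \<cdot> a = dx \<cdot> b \<Longrightarrow>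
       \<exists>z \<in> Hom C T P'. d' \<cdot> z = a \<and> \<pi>' \<cdot> z = b"
proof -
  note [simp] = hom[OF d] hom[OF \<pi>] hom[OF dx]
  obtain s i1 i2 p1 p2 where s: "is_biproduct C P y s i1 i2 p1 p2" using ex_biproduct[of P y] by auto
  obtain t j1 j2 q1 q2 where t: "is_biproduct C Q x t j1 j2 q1 q2" using ex_biproduct[of Q x] by auto
  note bs = biproduct_simps[OF s preadditive_category_axioms] and bt = biproduct_simps[OF t preadditive_category_axioms]
  note [simp] = hom[OF bs(4)] hom[OF bs(5)] hom[OF bs(6)] hom[OF bs(7)] hom[OF bt(4)] hom[OF bt(5)] hom[OF bt(6)] hom[OF bt(7)]
  define m where "m = j1 \<cdot> (d \<cdot> p1) \<oplus> j2 \<cdot> (\<pi> \<cdot> p1 \<ominus> dx \<cdot> p2)"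
  have m: "m \<in> Hom C s t" by (auto simp: m_def Hom_def)
  note [simp] = hom[OF m]
  obtain K k where k: "k \<in> Hom C K s" "m \<cdot> k = zer C K t"
      "\<And>w h. h \<in> Hom C w s \<Longrightarrow> m \<cdot> h = zer C w t \<Longrightarrow> \<exists>u \<in> Hom C w K. k \<cdot> u = h"
    using kernel[OF m] by metis
  note [simp] = hom[OF k(1)]
  obtain P' c where c: "projective C P'" "c \<in> Hom C P' K" "is_epi C c" using cover[of K] by auto
  note [simp] = hom[OF c(2)]
  have q1: "q1 \<cdot> m = d \<cdot> p1" and q2: "q2 \<cdot> m = \<pi> \<cdot> p1 \<ominus> dx \<cdot> p2"
    by (simp_all add: m_def cmp_add assoc[symmetric] bt(8-11))
  have 1: "d \<cdot> (p1 \<cdot> k) = zer C K Q"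
  proof -
    have "d \<cdot> (p1 \<cdot> k) = q1 \<cdot> (m \<cdot> k)" by (simp add: assoc[symmetric] q1)
    then show ?thesis by (simp add: k(2))
  qed
  have 2: "\<pi> \<cdot> (p1 \<cdot> k) = dx \<cdot> (p2 \<cdot> k)"
  proof -
    have "q2 \<cdot> m \<cdot> k = zer C K x" by (simp add: assoc k(2))
    then show ?thesis unfolding q2 by (simp add: alg)
  qed
  show ?thesis
  proof (rule that[OF c(1), of "p1 \<cdot> (k \<cdot> c)" "p2 \<cdot> (k \<cdot> c)"])
    show "p1 \<cdot> (k \<cdot> c) \<in> Hom C P' P" "p2 \<cdot> (k \<cdot> c) \<in> Hom C P' y" by (auto simp: Hom_def)
    show "d \<cdot> (p1 \<cdot> (k \<cdot> c)) = zer C P' Q" "\<pi> \<cdot> (p1 \<cdot> (k \<cdot> c)) = dx \<cdot> (p2 \<cdot> (k \<cdot> c))"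
      using cmp_eq_assoc[OF 1, of c] cmp_eq_assoc[OF 2, of c] by (simp_all add: assoc)
  next
    fix T a b assume T: "projective C T" and ab: "a \<in> Hom C T P" "b \<in> Hom C T y" "d \<cdot> a = zer C T Q" "\<pi> \<cdot> a = dx \<cdot> b"
    note [simp] = hom[OF ab(1)] hom[OF ab(2)]
    let ?e = "i1 \<cdot> a \<oplus> i2 \<cdot> b"
    have e: "?e \<in> Hom C T s" by (auto simp: Hom_def)
    have p: "p1 \<cdot> ?e = a" "p2 \<cdot> ?e = b"
      by (simp_all add: cmp_add assoc[symmetric] bs(8-11))
    have "m \<cdot> ?e = j1 \<cdot> (d \<cdot> (p1 \<cdot> ?e)) \<oplus> j2 \<cdot> (\<pi> \<cdot> (p1 \<cdot> ?e) \<ominus> dx \<cdot> (p2 \<cdot> ?e))"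
      unfolding m_def using hom[OF e] by (simp add: add_cmp sub_cmp assoc)
    also have "\<dots> = zer C T t" unfolding p ab(3,4) by simp
    finally obtain u where u: "u \<in> Hom C T K" "k \<cdot> u = ?e" using k(3)[OF e] by blast
    obtain z where z: "z \<in> Hom C T P'" "c \<cdot> z = u" using projective_lift[OF T c(3,2) u(1)] by blast
    note [simp] = hom[OF z(1)] hom[OF u(1)]
    have "p1 \<cdot> (k \<cdot> c) \<cdot> z = a" "p2 \<cdot> (k \<cdot> c) \<cdot> z = b" using p by (simp_all add: assoc z(2) u(2))
    then show "\<exists>z\<in>Hom C T P'. p1 \<cdot> (k \<cdot> c) \<cdot> z = a \<and> p2 \<cdot> (k \<cdot> c) \<cdot> z = b" using z(1) by blast
  qed
qed

text \<open>\<open>resolution_step\<close> is iterated downwards, starting with zero objects above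
  N. Every step keeps its lifting property, which gives \<open>covering\<close> and not merely a
  quasi-isomorphism.\<close>

lemma resolution:
  assumes X: "cx X" and N: "\<And>n. n > N \<Longrightarrow> zero_object C (term_at X n)"
  obtains P \<pi> where "res X P \<pi>" "\<And>n. n > N \<Longrightarrow> zero_object C (term_at P n)" "covering X P \<pi>"
proof -
  note [simp] = X
  obtain z where z: "zero_object C z" using ex_zero by blast
  note [simp] = zero_object_ob[OF z]
  \<comment> \<open>The state in degree n is the term P, the differential d out of it with its
    target Q, and the augmentation \<pi>. Recording Q makes the state meaningful without reference
    to degree n + 1.\<close>
  let ?S = "\<lambda>n (P, d, \<pi>, Q). projective C P \<and> d \<in> Hom C P Q \<and> \<pi> \<in> Hom C P (term_at X n) \<and> (n > N \<longrightarrow> P = z)"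
  let ?R = "\<lambda>n (P, d, \<pi>, Q) (P', d', \<pi>', Q'). Q' = P \<and> d \<cdot> d' = zer C P' Q \<and> \<pi> \<cdot> d' = diff_at X (n - 1) \<cdot> \<pi>' \<and>
    (\<forall>T a b. projective C T \<longrightarrow> a \<in> Hom C T P \<longrightarrow> b \<in> Hom C T (term_at X (n - 1)) \<longrightarrow> d \<cdot> a = zer C T Q \<longrightarrow>
       \<pi> \<cdot> a = diff_at X (n - 1) \<cdot> b \<longrightarrow> (\<exists>z \<in> Hom C T P'. d' \<cdot> z = a \<and> \<pi>' \<cdot> z = b))"
  have "\<exists>H. \<forall>n\<le>N+1. ?S n (H n) \<and> ?R n (H n) (H (n - 1))"
  proof (rule downward_choice)
    have "?S (N + 1) (z, zer C z z, zer C z (term_at X (N + 1)), z)"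
      using z by (auto simp: zer_Hom zero_object_projective)
    then show "\<exists>x. ?S (N + 1) x" by (rule exI)
  next
    fix n x assume n: "n \<le> N + 1" and "?S n x"
    then obtain P d \<pi> Q where x: "x = (P, d, \<pi>, Q)" and S: "projective C P" "d \<in> Hom C P Q" "\<pi> \<in> Hom C P (term_at X n)"
      by (cases x) auto
    have dx: "diff_at X (n - 1) \<in> Hom C (term_at X (n - 1)) (term_at X n)" by (simp add: Hom_def)
    obtain P' d' \<pi>' where "projective C P'" "d' \<in> Hom C P' P" "\<pi>' \<in> Hom C P' (term_at X (n - 1))" "d \<cdot> d' = zer C P' Q"
      "\<pi> \<cdot> d' = diff_at X (n - 1) \<cdot> \<pi>'"
      "\<And>T a b. projective C T \<Longrightarrow> a \<in> Hom C T P \<Longrightarrow> b \<in> Hom C T (term_at X (n - 1)) \<Longrightarrow> d \<cdot> a = zer C T Q \<Longrightarrow>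
        \<pi> \<cdot> a = diff_at X (n - 1) \<cdot> b \<Longrightarrow> \<exists>z \<in> Hom C T P'. d' \<cdot> z = a \<and> \<pi>' \<cdot> z = b"
      by (rule resolution_step[OF S(2,3) dx]) blast
    then have "?S (n - 1) (P', d', \<pi>', P) \<and> ?R n x (P', d', \<pi>', P)" using n x by auto
    then show "\<exists>y. ?S (n - 1) y \<and> ?R n x y" by (rule exI)
  qed
  then obtain H where H0: "\<forall>n\<le>N+1. ?S n (H n) \<and> ?R n (H n) (H (n - 1))" by (rule exE)
  note H = H0[rule_format, THEN conjunct1] H0[rule_format, THEN conjunct2]
  define p where "p = (\<lambda>n. fst (H n))"
  define D where "D = (\<lambda>n. fst (snd (H n)))"
  define \<rho> where "\<rho> = (\<lambda>n. fst (snd (snd (H n))))"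
  define Q where "Q = (\<lambda>n. snd (snd (snd (H n))))"
  have Hn: "H n = (p n, D n, \<rho> n, Q n)" for n by (simp add: p_def D_def \<rho>_def Q_def)
  have S: "projective C (p n)" "D n \<in> Hom C (p n) (Q n)" "\<rho> n \<in> Hom C (p n) (term_at X n)" "n > N \<Longrightarrow> p n = z"
    if "n \<le> N + 1" for n using H(1)[OF that] by (simp_all add: Hn)
  have R: "Q (n - 1) = p n" "D n \<cdot> D (n - 1) = zer C (p (n - 1)) (Q n)" "\<rho> n \<cdot> D (n - 1) = diff_at X (n - 1) \<cdot> \<rho> (n - 1)"
    "\<And>T a b. projective C T \<Longrightarrow> a \<in> Hom C T (p n) \<Longrightarrow> b \<in> Hom C T (term_at X (n - 1)) \<Longrightarrow> D n \<cdot> a = zer C T (Q n) \<Longrightarrow>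
       \<rho> n \<cdot> a = diff_at X (n - 1) \<cdot> b \<Longrightarrow> (\<exists>z \<in> Hom C T (p (n - 1)). D (n - 1) \<cdot> z = a \<and> \<rho> (n - 1) \<cdot> z = b)"
    if "n \<le> N + 1" for n using H(2)[OF that] by (simp_all add: Hn)
  define tP where "tP = (\<lambda>n. if n \<le> N + 1 then p n else z)"
  \<comment> \<open>The target of \<open>D\<close> is known to be the next term only up to degree N.
    In degree N + 1 the choice leaves it open, so from there on the differential is taken to be
    zero.\<close>
  define dP where "dP = (\<lambda>n. if n \<le> N then D n else zer C (tP n) (tP (n + 1)))"
  define \<pi> where "\<pi> = (\<lambda>n. if n \<le> N + 1 then \<rho> n else zer C (tP n) (term_at X n))"
  define P where "P = \<lparr>term_at = tP, diff_at = dP\<rparr>"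
  have P [simp]: "term_at P n = tP n" "diff_at P n = dP n" for n by (simp_all add: P_def)
  have proj: "projective C (tP n)" for n
    using S(1)[of n] z zero_object_projective by (auto simp: tP_def)
  have zP: "tP n = z" if "n > N" for n
    using S(4)[of n] that by (auto simp: tP_def)
  note [simp] = projective_ob[OF proj]
  have dP: "dP n \<in> Hom C (tP n) (tP (n + 1))" for n
    using S(2)[of n] R(1)[of "n + 1"] by (auto simp: zer_Hom dP_def) (simp add: tP_def)
  have \<pi>H: "\<pi> n \<in> Hom C (tP n) (term_at X n)" for n
    using S(3)[of n] by (auto simp: \<pi>_def zer_Hom) (simp add: tP_def)
  note [simp] = hom[OF dP] hom[OF \<pi>H]
  have dN: "dP n = zer C z z" if "n > N" for n using that zP[of n] zP[of "n + 1"] by (simp add: dP_def)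
  have dd: "dP (n + 1) \<cdot> dP n = zer C (tP n) (tP (n + 2))" for n
  proof (cases "n + 1 \<le> N")
    case True
    then show ?thesis using R(2)[of "n + 1"] R(1)[of "n + 2"] by (simp add: tP_def dP_def add.commute[of 1])
  next
    case False
    then show ?thesis using dN[of "n + 1"] zP[of "n + 1"] zP[of "n + 2"] by simp
  qed
  have comm: "diff_at X n \<cdot> \<pi> n = \<pi> (n + 1) \<cdot> dP n" for n
  proof (cases "n \<le> N")
    case True
    then show ?thesis using R(3)[of "n + 1"] by (simp add: tP_def dP_def \<pi>_def)
  next
    case False
    then have "zero_object C (tP n)" using z zP by simp
    then have "diff_at X n \<cdot> \<pi> n = zer C (tP n) (term_at X (n + 1))" "\<pi> (n + 1) \<cdot> dP n = zer C (tP n) (term_at X (n + 1))"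
      by (auto intro!: from_zero simp: Hom_def)
    then show ?thesis by simp
  qed
  have cP: "cx P" unfolding cx_def using dP dd by simp
  have c\<pi>: "\<pi> \<in> chain_maps C P X" using \<pi>H comm by (simp add: chain_maps_def)
  have cov: "covering X P \<pi>" unfolding covering_def
  proof (intro allI impI)
    fix T n a b assume T: "projective C T" and ab: "a \<in> Hom C T (term_at P n)" "b \<in> Hom C T (term_at X (n - 1))"
      "diff_at P n \<cdot> a = zer C T (term_at P (n + 1))" "\<pi> n \<cdot> a = diff_at X (n - 1) \<cdot> b"
    show "\<exists>z \<in> Hom C T (term_at P (n - 1)). diff_at P (n - 1) \<cdot> z = a \<and> \<pi> (n - 1) \<cdot> z = b"
    proof (cases "n \<le> N + 1")
      case True
      have t: "tP n = p n" "tP (n - 1) = p (n - 1)" "\<pi> n = \<rho> n" "\<pi> (n - 1) = \<rho> (n - 1)" "dP (n - 1) = D (n - 1)"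
        using True by (auto simp: tP_def \<pi>_def dP_def)
      note [simp] = hom[OF S(2)[OF True]]
      have "D n \<cdot> a = zer C T (Q n)"
      proof (cases "n \<le> N")
        case True
        then show ?thesis using ab(3) R(1)[of "n + 1"] by (simp add: dP_def tP_def)
      next
        case False
        have "a = zer C T (p n)" using to_zero ab(1) z zP[of n] t False by auto
        then show ?thesis using Hom_ob1[OF ab(1)] by simp
      qed
      then show ?thesis using R(4)[OF True T, of a b] ab t by simp
    next
      case False
      then have z': "zero_object C (tP n)" "zero_object C (term_at X (n - 1))" using z zP N by auto
      have T' [simp]: "T \<in> ob C" using projective_ob[OF T] .
      have "a = zer C T (tP n)" "b = zer C T (term_at X (n - 1))" using to_zero z' ab(1,2) by auto
      then show ?thesis by (intro bexI[of _ "zer C T (tP (n - 1))"]) (auto simp: zer_Hom)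
    qed
  qed
  have "bounded_proj P" unfolding bounded_proj_def using cP proj zP z by auto
  then have "res X P \<pi>" unfolding res_def using covering_qis[OF cov X cP c\<pi>] c\<pi> by blast
  then show ?thesis using that cov zP z by auto
qed

lemma bc_resolution: assumes "X \<in> bc" obtains P \<pi> where "res X P \<pi>"
proof -
  obtain N where "\<And>n. \<bar>n\<bar> > N \<Longrightarrow> zero_object C (term_at X n)" using assms unfolding bounded_complexes_iff bd_def by blast
  then have "n > \<bar>N\<bar> \<Longrightarrow> zero_object C (term_at X n)" for n by auto
  then show ?thesis using resolution[of X "\<bar>N\<bar>"] assms that by (metis bc_cx)
qed

end

section \<open>Perfect complexes\<close>

context abelian_enough
begin

text \<open>For a bounded above complex of projectives, \<open>lc P\<close> says that \<open>P\<close> is contractible in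
  sufficiently low degrees.\<close>

definition lc :: "('o, 'm) cochain \<Rightarrow> bool" where
  "lc P \<longleftrightarrow> (\<exists>N. \<forall>n\<le>N. \<forall>y \<phi>. \<phi> \<in> Hom C (term_at P n) y \<longrightarrow>
     \<phi> \<cdot> diff_at P (n - 1) = zer C (term_at P (n - 1)) y \<longrightarrow> (\<exists>h \<in> Hom C (term_at P (n + 1)) y. \<phi> = h \<cdot> diff_at P n))"

text \<open>The working form of perfectness. By \<open>LC_iff\<close> any resolution decides it, and
  for bounded complexes \<open>LC_Kb_Proj\<close> produces an actual bounded complex of
  projectives.\<close>

definition LC :: "('o, 'm) cochain \<Rightarrow> bool" where
  "LC X \<longleftrightarrow> (\<exists>P \<pi>. res X P \<pi> \<and> lc P)"

lemma lcI: "(\<And>n y \<phi>. n \<le> N \<Longrightarrow> \<phi> \<in> Hom C (term_at P n) y \<Longrightarrow>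
     \<phi> \<cdot> diff_at P (n - 1) = zer C (term_at P (n - 1)) y \<Longrightarrow> \<exists>h \<in> Hom C (term_at P (n + 1)) y. \<phi> = h \<cdot> diff_at P n) \<Longrightarrow> lc P"
  unfolding lc_def by blast

lemma lcE: assumes "lc P"
  obtains N where "\<forall>n\<le>N. \<forall>y \<phi>. \<phi> \<in> Hom C (term_at P n) y \<longrightarrow>
     \<phi> \<cdot> diff_at P (n - 1) = zer C (term_at P (n - 1)) y \<longrightarrow> (\<exists>h \<in> Hom C (term_at P (n + 1)) y. \<phi> = h \<cdot> diff_at P n)"
  using assms unfolding lc_def by blast

lemma lc_if_bounded_below: assumes P: "cx P" and N: "\<And>n. n \<le> N \<Longrightarrow> zero_object C (term_at P n)" shows "lc P"
proof (rule lcI)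
  fix n y \<phi> assume n: "n \<le> N" and \<phi>: "\<phi> \<in> Hom C (term_at P n) y"
  note [simp] = P hom[OF \<phi>]
  have "\<phi> = zer C (term_at P n) y" using from_zero[OF N[OF n] \<phi>] .
  then have "\<phi> = zer C (term_at P (n + 1)) y \<cdot> diff_at P n" by simp
  then show "\<exists>h \<in> Hom C (term_at P (n + 1)) y. \<phi> = h \<cdot> diff_at P n" by (rule bexI) (simp add: zer_Hom)
qed

text \<open>After Hom(-, y) the cohomology of P is a retract of that of P', so vanishing in low
  degrees is inherited, with the same bound for all y.\<close>

lemma lc_retract:
  assumes P: "cx P" and P': "cx P'" and G: "G \<in> chain_maps C P P'" and H: "H \<in> chain_maps C P' P"
    and HG: "homotopic C P P (\<lambda>n. H n \<cdot> G n) (\<lambda>n. idm C (term_at P n))" and lc: "lc P'"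
  shows "lc P"
proof -
  obtain s where s: "htp P P (\<lambda>n. H n \<cdot> G n) (\<lambda>n. idm C (term_at P n)) s" using HG by (auto simp: homotopic_htp)
  note [simp] = P P' cm_typ[OF G] cm_typ[OF H] htp(1,2,3)[OF s]
  obtain N where N: "\<forall>n\<le>N. \<forall>y \<phi>. \<phi> \<in> Hom C (term_at P' n) y \<longrightarrow>
     \<phi> \<cdot> diff_at P' (n - 1) = zer C (term_at P' (n - 1)) y \<longrightarrow> (\<exists>h \<in> Hom C (term_at P' (n + 1)) y. \<phi> = h \<cdot> diff_at P' n)"
    using lc by (rule lcE)
  show ?thesis
  proof (rule lcI[of N])
    fix n y \<phi> assume n: "n \<le> N" and \<phi>: "\<phi> \<in> Hom C (term_at P n) y" "\<phi> \<cdot> diff_at P (n - 1) = zer C (term_at P (n - 1)) y"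
    note [simp] = hom[OF \<phi>(1)] and \<phi>d = cmp_eq_assoc[OF \<phi>(2)]
    have "H n \<cdot> diff_at P' (n - 1) = diff_at P (n - 1) \<cdot> H (n - 1)" using cm_comm[OF H, of "n - 1"] by simp
    then obtain h where h: "h \<in> Hom C (term_at P' (n + 1)) y" "\<phi> \<cdot> H n = h \<cdot> diff_at P' n"
      using N n by (metis (no_types, lifting) HomI \<phi>d assoc cm_typ[OF H] cmp_mor cx_simps(1-4)[OF P] cx_simps(1-4)[OF P'] diff_add_cancel hom[OF \<phi>(1)] src_cmp trg_cmp zer_cmp)
    note [simp] = hom[OF h(1)]
    have "\<phi> \<cdot> (H n \<cdot> G n) = \<phi> \<cdot> (idm C (term_at P n) \<oplus> (diff_at P (n - 1) \<cdot> s n \<oplus> s (n + 1) \<cdot> diff_at P n))"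
      using htp(4)[OF s, of n] by simp
    then have "(\<phi> \<cdot> H n) \<cdot> G n = \<phi> \<oplus> \<phi> \<cdot> (s (n + 1) \<cdot> diff_at P n)" by (simp add: alg \<phi>d)
    then have "h \<cdot> (G (n + 1) \<cdot> diff_at P n) = \<phi> \<oplus> \<phi> \<cdot> (s (n + 1) \<cdot> diff_at P n)"
      unfolding h(2) by (simp add: assoc cm_comm[OF G])
    then have "\<phi> = (h \<cdot> G (n + 1) \<ominus> \<phi> \<cdot> s (n + 1)) \<cdot> diff_at P n" by (simp add: alg)
    then show "\<exists>h \<in> Hom C (term_at P (n + 1)) y. \<phi> = h \<cdot> diff_at P n" by (rule bexI) (simp add: HomI)
  qed
qed

text \<open>Lifting \<pi> and \<pi>' through each other gives G and H. Both H G and the identity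
  lift \<pi> through \<pi>, so they are homotopic by \<open>lift_unique\<close>, and P is a retract
  of P' up to homotopy.\<close>

lemma lc_res: assumes X: "cx X" and P: "res X P \<pi>" and P': "res X P' \<pi>'" and lc: "lc P'" shows "lc P"
proof -
  note p = resD[OF P] and p' = resD[OF P']
  obtain G where G: "G \<in> chain_maps C P P'" "homotopic C P X \<pi> (\<lambda>n. \<pi>' n \<cdot> G n)"
    using lift[OF p(5) p'(1) X p'(3,4) p(3)] by blast
  obtain H where H: "H \<in> chain_maps C P' P" "homotopic C P' X \<pi>' (\<lambda>n. \<pi> n \<cdot> H n)"
    using lift[OF p'(5) p(1) X p(3,4) p'(3)] by blast
  note [simp] = p(1) p'(1) X cm_typ[OF p(3)] cm_typ[OF G(1)] cm_typ[OF H(1)]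
  have HG: "(\<lambda>n. H n \<cdot> G n) \<in> chain_maps C P P" by (rule cm_cmp[OF G(1) H(1)]) auto
  have c1: "(\<lambda>n. \<pi>' n \<cdot> G n) \<in> chain_maps C P X" by (rule cm_cmp[OF G(1) p'(3)]) auto
  have c2: "(\<lambda>n. \<pi> n \<cdot> H n) \<in> chain_maps C P' X" by (rule cm_cmp[OF H(1) p(3)]) auto
  have "homotopic C P X (\<lambda>n. \<pi>' n \<cdot> G n) (\<lambda>n. (\<pi> n \<cdot> H n) \<cdot> G n)"
    by (rule homotopic_cmp_right[OF _ _ p'(3) c2 H(2) G(1)]) auto
  then have "homotopic C P X \<pi> (\<lambda>n. (\<pi> n \<cdot> H n) \<cdot> G n)"
    using homotopic_trans[OF p(1) X cm_cmp[OF G(1) c2 p(1) p'(1) X] G(2)] by simp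
  then have "homotopic C P X \<pi> (\<lambda>n. \<pi> n \<cdot> (H n \<cdot> G n))" by (simp add: assoc)
  then have "homotopic C P X (\<lambda>n. \<pi> n \<cdot> (H n \<cdot> G n)) \<pi>"
    by (rule homotopic_sym[OF p(1) X p(3) cm_cmp[OF HG p(3) p(1) p(1) X]])
  then have "homotopic C P X (\<lambda>n. \<pi> n \<cdot> (H n \<cdot> G n)) (\<lambda>n. \<pi> n \<cdot> idm C (term_at P n))" by simp
  then have "homotopic C P P (\<lambda>n. H n \<cdot> G n) (\<lambda>n. idm C (term_at P n))"
    by (rule lift_unique[OF p(5) p(1) X p(3,4) HG cm_idm[OF p(1)]])
  then show ?thesis using lc_retract[OF p(1) p'(1) G(1) H(1) _ lc] by blast
qed

lemma LC_iff: "cx X \<Longrightarrow> res X P \<pi> \<Longrightarrow> LC X \<longleftrightarrow> lc P"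
  unfolding LC_def using lc_res by blast

lemma res_cmp: assumes "res X P \<pi>" "cx X" "cx Y" "f \<in> chain_maps C X Y" "qis X Y f"
  shows "res Y P (\<lambda>n. f n \<cdot> \<pi> n)"
proof -
  note p = resD[OF assms(1)]
  show ?thesis unfolding res_def using p(5) cm_cmp[OF p(3) assms(4) p(1) assms(2,3)]
    qis_cmp[OF p(1) assms(2,3) p(3) assms(4) p(4) assms(5)] by blast
qed

text \<open>A resolution of X followed by the quasi-isomorphism f is a resolution of Y with the same
  complex P.\<close>

lemma LC_qis: assumes X: "X \<in> bc" and Y: "Y \<in> bc" and f: "f \<in> chain_maps C X Y" "qis X Y f" shows "LC X \<longleftrightarrow> LC Y"
proof -
  obtain P \<pi> where P: "res X P \<pi>" using bc_resolution[OF X] by blast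
  have "res Y P (\<lambda>n. f n \<cdot> \<pi> n)" by (rule res_cmp[OF P _ _ f]) (use X Y in auto)
  then show ?thesis using LC_iff[OF _ P] LC_iff[of Y P] X Y by simp
qed

definition zob :: 'o where "zob = (SOME z. zero_object C z)"

lemma zob: "zero_object C zob" unfolding zob_def using ex_zero by (rule someI_ex)

lemma zob_ob [simp]: "zob \<in> ob C" using zob zero_object_ob by blast

definition stalk :: "'o \<Rightarrow> int \<Rightarrow> ('o, 'm) cochain" where
  "stalk M a = \<lparr>term_at = (\<lambda>n. if n = a then M else zob),
     diff_at = (\<lambda>n. zer C (if n = a then M else zob) (if n + 1 = a then M else zob))\<rparr>"

lemma stalk_simps [simp]: "term_at (stalk M a) n = (if n = a then M else zob)"
   "diff_at (stalk M a) n = zer C (if n = a then M else zob) (if n + 1 = a then M else zob)"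
  by (simp_all add: stalk_def)

lemma stalk_cx: "M \<in> ob C \<Longrightarrow> cx (stalk M a)"
  unfolding cx_def by (auto simp: zer_Hom)

lemma stalk_bc: "M \<in> ob C \<Longrightarrow> stalk M a \<in> bc"
proof -
  assume M: "M \<in> ob C"
  have "\<forall>n. \<bar>n\<bar> > \<bar>a\<bar> \<longrightarrow> zero_object C (term_at (stalk M a) n)" using zob by auto
  then show ?thesis using stalk_cx[OF M] unfolding bounded_complexes_iff bd_def by blast
qed

text \<open>The zero complex resolves every exact complex.\<close>

lemma exact_LC: assumes X: "cx X" and e: "exact_cx X" shows "LC X"
proof -
  note [simp] = X zob
  define P where "P = stalk zob 0"
  have P [simp]: "term_at P n = zob" "diff_at P n = zer C zob zob" for n by (auto simp: P_def)
  have cP: "cx P" unfolding P_def by (rule stalk_cx) simp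
  let ?\<pi> = "\<lambda>n. zer C zob (term_at X n)"
  have c: "?\<pi> \<in> chain_maps C P X" by (rule cmI) simp_all
  have "bounded_proj P" unfolding bounded_proj_def using cP zero_object_projective[OF zob] zob by simp
  moreover have "qis P X ?\<pi>" unfolding qis_def
  proof
    show "qsurj P X ?\<pi>"
    proof (rule qsurjI)
      fix T n y assume T: "projective C T" and y: "y \<in> Hom C T (term_at X n)" "diff_at X n \<cdot> y = zer C T (term_at X (n + 1))"
      obtain v where v: "v \<in> Hom C T (term_at X (n - 1))" "y = diff_at X (n - 1) \<cdot> v" by (rule exactD[OF e T y])
      note [simp] = hom[OF v(1)]
      show "\<exists>x u. x \<in> Hom C T (term_at P n) \<and> diff_at P n \<cdot> x = zer C T (term_at P (n + 1)) \<and>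
        u \<in> Hom C T (term_at X (n - 1)) \<and> y = ?\<pi> n \<cdot> x \<oplus> diff_at X (n - 1) \<cdot> u"
        using v by (intro exI[of _ "zer C T zob"] exI[of _ v]) (auto simp: zer_Hom)
    qed
    show "qinj P X ?\<pi>"
    proof (rule qinjI)
      fix T n x u assume T: "projective C T" and x: "x \<in> Hom C T (term_at P n)"
      have "x = zer C T zob" using to_zero[OF zob] x by simp
      then show "\<exists>v\<in>Hom C T (term_at P (n - 1)). x = diff_at P (n - 1) \<cdot> v"
        using projective_ob[OF T] by (intro bexI[of _ "zer C T zob"]) (auto simp: zer_Hom)
    qed
  qed
  moreover have "lc P" by (rule lc_if_bounded_below[OF cP]) simp
  ultimately show ?thesis unfolding LC_def res_def using c by blast
qed

lemma Kb_Proj_iff: "X \<in> Kb_Proj C \<longleftrightarrow> X \<in> bc \<and> (\<forall>n. projective C (term_at X n))"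
  by (simp add: Kb_Proj_def)

lemma Kb_Proj_res: assumes X: "X \<in> Kb_Proj C" shows "res X X (\<lambda>n. idm C (term_at X n))" "lc X"
proof -
  have c: "cx X" using X by (simp add: Kb_Proj_iff)
  obtain N where N: "\<And>n. \<bar>n\<bar> > N \<Longrightarrow> zero_object C (term_at X n)" using X unfolding Kb_Proj_iff bounded_complexes_iff bd_def by blast
  have "bounded_proj X" unfolding bounded_proj_def using c X by (auto simp: Kb_Proj_iff intro!: exI[of _ "\<bar>N\<bar>"] N)
  then show "res X X (\<lambda>n. idm C (term_at X n))" unfolding res_def using cm_idm[OF c] qis_idm[OF c] by blast
  show "lc X" by (rule lc_if_bounded_below[OF c, of "- \<bar>N\<bar> - 1"]) (rule N, auto)
qed

lemma Kb_Proj_LC: "X \<in> Kb_Proj C \<Longrightarrow> LC X"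
  unfolding LC_def using Kb_Proj_res by blast

section \<open>Low-degree contractibility and mapping cones of complexes of projectives\<close>

context
  fixes P P' F Y K J A B
  assumes co: "cone P P' F Y K J A B" and P: "cx P" and P': "cx P'" and F: "F \<in> chain_maps C P P'"
begin

text \<open>A piece of the long exact sequence of Hom(-, y) for the cone Y of F: where the
  cohomology of Hom(Y, y) vanishes, every class on P is the restriction along F of a class on P'.
  The bound does not depend on y.\<close>

lemma lc_cone_surj:
  assumes "lc Y"
  obtains N where "\<forall>n\<le>N. \<forall>y \<phi>. \<phi> \<in> Hom C (term_at P n) y \<longrightarrow> \<phi> \<cdot> diff_at P (n - 1) = zer C (term_at P (n - 1)) y \<longrightarrow>
    (\<exists>\<psi> h. \<psi> \<in> Hom C (term_at P' n) y \<and> \<psi> \<cdot> diff_at P' (n - 1) = zer C (term_at P' (n - 1)) y \<and>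
       h \<in> Hom C (term_at P (n + 1)) y \<and> \<phi> = \<psi> \<cdot> F n \<oplus> h \<cdot> diff_at P n)"
proof -
  note [simp] = cone_simps[OF co P P' F] cone_cx[OF co P P' F]
  obtain N where N: "\<forall>n\<le>N. \<forall>y \<phi>. \<phi> \<in> Hom C (term_at Y n) y \<longrightarrow>
     \<phi> \<cdot> diff_at Y (n - 1) = zer C (term_at Y (n - 1)) y \<longrightarrow> (\<exists>h \<in> Hom C (term_at Y (n + 1)) y. \<phi> = h \<cdot> diff_at Y n)"
    using assms by (rule lcE)
  have "\<exists>\<psi> h. \<psi> \<in> Hom C (term_at P' n) y \<and> \<psi> \<cdot> diff_at P' (n - 1) = zer C (term_at P' (n - 1)) y \<and>
       h \<in> Hom C (term_at P (n + 1)) y \<and> \<phi> = \<psi> \<cdot> F n \<oplus> h \<cdot> diff_at P n"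
    if n: "n \<le> N" and \<phi>: "\<phi> \<in> Hom C (term_at P n) y" "\<phi> \<cdot> diff_at P (n - 1) = zer C (term_at P (n - 1)) y" for n y \<phi>
  proof -
    note [simp] = hom[OF \<phi>(1)] and \<phi>d = cmp_eq_assoc[OF \<phi>(2)]
    \<comment> \<open>The projection A goes from degree n - 1 of the cone to degree n of P. So the
      cocycle \<phi> pulls back to a cocycle on the cone one degree lower.\<close>
    have 1: "\<phi> \<cdot> A (n - 1) \<in> Hom C (term_at Y (n - 1)) y" by (simp add: HomI)
    have 2: "\<phi> \<cdot> A (n - 1) \<cdot> diff_at Y (n - 1 - 1) = zer C (term_at Y (n - 1 - 1)) y"
      by (simp add: alg \<phi>d)
    obtain m where "m \<in> Hom C (term_at Y (n - 1 + 1)) y" and m: "\<phi> \<cdot> A (n - 1) = m \<cdot> diff_at Y (n - 1)"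
      using N[rule_format, OF _ 1 2] n by auto
    then have m1: "m \<in> Hom C (term_at Y n) y" by simp
    note [simp] = hom[OF m1]
    have a: "(\<phi> \<cdot> A (n - 1)) \<cdot> K (n - 1) = (m \<cdot> diff_at Y (n - 1)) \<cdot> K (n - 1)"
      and b: "(\<phi> \<cdot> A (n - 1)) \<cdot> J (n - 1) = (m \<cdot> diff_at Y (n - 1)) \<cdot> J (n - 1)" using m by simp_all
    have "\<phi> = (m \<cdot> J n) \<cdot> F n \<oplus> neg C (m \<cdot> K n) \<cdot> diff_at P n" using a by (simp add: alg)
    moreover have "(m \<cdot> J n) \<cdot> diff_at P' (n - 1) = zer C (term_at P' (n - 1)) y" using b by (simp add: alg)
    ultimately show ?thesis by (intro exI[of _ "m \<cdot> J n"] exI[of _ "neg C (m \<cdot> K n)"]) (simp add: HomI)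
  qed
  then show ?thesis using that by blast
qed

text \<open>The adjacent piece of the same long exact sequence: a class on P' whose restriction
  along F is trivial comes from a class on the cone, and that is trivial in low degrees.\<close>

lemma lc_cone_inj:
  assumes "lc Y"
  obtains N where "\<forall>n\<le>N. \<forall>y \<psi> h. \<psi> \<in> Hom C (term_at P' n) y \<longrightarrow> \<psi> \<cdot> diff_at P' (n - 1) = zer C (term_at P' (n - 1)) y \<longrightarrow>
    h \<in> Hom C (term_at P (n + 1)) y \<longrightarrow> \<psi> \<cdot> F n = h \<cdot> diff_at P n \<longrightarrow>
    (\<exists>h \<in> Hom C (term_at P' (n + 1)) y. \<psi> = h \<cdot> diff_at P' n)"
proof -
  note [simp] = cone_simps[OF co P P' F] cone_cx[OF co P P' F]
  obtain N where N: "\<forall>n\<le>N. \<forall>y \<phi>. \<phi> \<in> Hom C (term_at Y n) y \<longrightarrow>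
     \<phi> \<cdot> diff_at Y (n - 1) = zer C (term_at Y (n - 1)) y \<longrightarrow> (\<exists>h \<in> Hom C (term_at Y (n + 1)) y. \<phi> = h \<cdot> diff_at Y n)"
    using assms by (rule lcE)
  have "\<exists>h \<in> Hom C (term_at P' (n + 1)) y. \<psi> = h \<cdot> diff_at P' n"
    if n: "n \<le> N" and \<psi>: "\<psi> \<in> Hom C (term_at P' n) y" "\<psi> \<cdot> diff_at P' (n - 1) = zer C (term_at P' (n - 1)) y"
      "h \<in> Hom C (term_at P (n + 1)) y" "\<psi> \<cdot> F n = h \<cdot> diff_at P n" for n y \<psi> h
  proof -
    note [simp] = hom[OF \<psi>(1)] hom[OF \<psi>(3)] and \<psi>d = cmp_eq_assoc[OF \<psi>(2)] cmp_eq_assoc[OF \<psi>(4)]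
    \<comment> \<open>The relation \<psi> F = h d makes this combination a cocycle on the cone. It
      restricts to \<psi> along J.\<close>
    have 1: "h \<cdot> A n \<oplus> \<psi> \<cdot> B n \<in> Hom C (term_at Y n) y" by (simp add: HomI)
    have 2: "(h \<cdot> A n \<oplus> \<psi> \<cdot> B n) \<cdot> diff_at Y (n - 1) = zer C (term_at Y (n - 1)) y"
      by (simp add: alg \<psi>d)
    obtain m where m1: "m \<in> Hom C (term_at Y (n + 1)) y" and m: "h \<cdot> A n \<oplus> \<psi> \<cdot> B n = m \<cdot> diff_at Y n"
      using N[rule_format, OF n 1 2] by auto
    note [simp] = hom[OF m1]
    have "(h \<cdot> A n \<oplus> \<psi> \<cdot> B n) \<cdot> J n = (m \<cdot> diff_at Y n) \<cdot> J n" using m by simp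
    then have "\<psi> = (m \<cdot> J (n + 1)) \<cdot> diff_at P' n" by (simp add: alg)
    then show ?thesis by (rule bexI) (simp add: HomI)
  qed
  then show ?thesis using that by blast
qed

text \<open>By the two preceding lemmas restriction along F is surjective, and has trivial kernel,
  on cohomology classes in low degrees. Thus these groups vanish for P exactly when they vanish for
  P'.\<close>

lemma lc_cone_eq: assumes "lc Y" shows "lc P \<longleftrightarrow> lc P'"
proof
  note [simp] = cone_simps[OF co P P' F]
  obtain N where N: "\<forall>n\<le>N. \<forall>y \<phi>. \<phi> \<in> Hom C (term_at P n) y \<longrightarrow> \<phi> \<cdot> diff_at P (n - 1) = zer C (term_at P (n - 1)) y \<longrightarrow>
    (\<exists>\<psi> h. \<psi> \<in> Hom C (term_at P' n) y \<and> \<psi> \<cdot> diff_at P' (n - 1) = zer C (term_at P' (n - 1)) y \<and>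
       h \<in> Hom C (term_at P (n + 1)) y \<and> \<phi> = \<psi> \<cdot> F n \<oplus> h \<cdot> diff_at P n)"
    using lc_cone_surj[OF assms] by blast
  assume "lc P'"
  then obtain M where M: "\<forall>n\<le>M. \<forall>y \<phi>. \<phi> \<in> Hom C (term_at P' n) y \<longrightarrow>
     \<phi> \<cdot> diff_at P' (n - 1) = zer C (term_at P' (n - 1)) y \<longrightarrow> (\<exists>h \<in> Hom C (term_at P' (n + 1)) y. \<phi> = h \<cdot> diff_at P' n)"
    by (rule lcE)
  show "lc P"
  proof (rule lcI[of "min M N"])
    fix n y \<phi> assume n: "n \<le> min M N" and \<phi>: "\<phi> \<in> Hom C (term_at P n) y" "\<phi> \<cdot> diff_at P (n - 1) = zer C (term_at P (n - 1)) y"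
    obtain \<psi> h where h: "\<psi> \<in> Hom C (term_at P' n) y" "\<psi> \<cdot> diff_at P' (n - 1) = zer C (term_at P' (n - 1)) y"
       "h \<in> Hom C (term_at P (n + 1)) y" "\<phi> = \<psi> \<cdot> F n \<oplus> h \<cdot> diff_at P n"
      using N[rule_format, OF _ \<phi>] n by auto
    obtain h' where h': "h' \<in> Hom C (term_at P' (n + 1)) y" "\<psi> = h' \<cdot> diff_at P' n"
      using M[rule_format, OF _ h(1,2)] n by auto
    note [simp] = hom[OF h(3)] hom[OF h'(1)]
    have "\<phi> = (h' \<cdot> F (n + 1) \<oplus> h) \<cdot> diff_at P n" unfolding h(4) h'(2) by (simp add: alg cm_comm[OF F])
    then show "\<exists>h \<in> Hom C (term_at P (n + 1)) y. \<phi> = h \<cdot> diff_at P n" by (rule bexI) (simp add: HomI)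
  qed
next
  note [simp] = cone_simps[OF co P P' F]
  obtain N where N: "\<forall>n\<le>N. \<forall>y \<psi> h. \<psi> \<in> Hom C (term_at P' n) y \<longrightarrow> \<psi> \<cdot> diff_at P' (n - 1) = zer C (term_at P' (n - 1)) y \<longrightarrow>
    h \<in> Hom C (term_at P (n + 1)) y \<longrightarrow> \<psi> \<cdot> F n = h \<cdot> diff_at P n \<longrightarrow>
    (\<exists>h \<in> Hom C (term_at P' (n + 1)) y. \<psi> = h \<cdot> diff_at P' n)"
    using lc_cone_inj[OF assms] by blast
  assume "lc P"
  then obtain M where M: "\<forall>n\<le>M. \<forall>y \<phi>. \<phi> \<in> Hom C (term_at P n) y \<longrightarrow>
     \<phi> \<cdot> diff_at P (n - 1) = zer C (term_at P (n - 1)) y \<longrightarrow> (\<exists>h \<in> Hom C (term_at P (n + 1)) y. \<phi> = h \<cdot> diff_at P n)"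
    by (rule lcE)
  show "lc P'"
  proof (rule lcI[of "min M N"])
    fix n y \<psi> assume n: "n \<le> min M N" and \<psi>: "\<psi> \<in> Hom C (term_at P' n) y" "\<psi> \<cdot> diff_at P' (n - 1) = zer C (term_at P' (n - 1)) y"
    note [simp] = hom[OF \<psi>(1)] and \<psi>d = cmp_eq_assoc[OF \<psi>(2)]
    have 1: "\<psi> \<cdot> F n \<in> Hom C (term_at P n) y" by (simp add: HomI)
    have "F n \<cdot> diff_at P (n - 1) = diff_at P' (n - 1) \<cdot> F (n - 1)" using cm_comm[OF F, of "n - 1"] by simp
    then have 2: "\<psi> \<cdot> F n \<cdot> diff_at P (n - 1) = zer C (term_at P (n - 1)) y" by (simp add: assoc \<psi>d)
    obtain h where "h \<in> Hom C (term_at P (n + 1)) y" "\<psi> \<cdot> F n = h \<cdot> diff_at P n"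
      using M[rule_format, OF _ 1 2] n by auto
    then show "\<exists>h \<in> Hom C (term_at P' (n + 1)) y. \<psi> = h \<cdot> diff_at P' n"
      using N[rule_format, OF _ \<psi>] n by auto
  qed
qed

text \<open>A cocycle on the cone is first bounded on the summand P', after which the remaining part
  is a cocycle on P and is bounded there.\<close>

lemma lc_cone: assumes "lc P" "lc P'" shows "lc Y"
proof -
  note [simp] = cone_simps[OF co P P' F] cone_cx[OF co P P' F]
  obtain N where N: "\<forall>n\<le>N. \<forall>y \<phi>. \<phi> \<in> Hom C (term_at P n) y \<longrightarrow>
     \<phi> \<cdot> diff_at P (n - 1) = zer C (term_at P (n - 1)) y \<longrightarrow> (\<exists>h \<in> Hom C (term_at P (n + 1)) y. \<phi> = h \<cdot> diff_at P n)"
    using assms(1) by (rule lcE)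
  obtain M where M: "\<forall>n\<le>M. \<forall>y \<phi>. \<phi> \<in> Hom C (term_at P' n) y \<longrightarrow>
     \<phi> \<cdot> diff_at P' (n - 1) = zer C (term_at P' (n - 1)) y \<longrightarrow> (\<exists>h \<in> Hom C (term_at P' (n + 1)) y. \<phi> = h \<cdot> diff_at P' n)"
    using assms(2) by (rule lcE)
  show ?thesis
  \<comment> \<open>N - 1 instead of N, because P enters the cone in degree n with its term of
    degree n + 1.\<close>
  proof (rule lcI[of "min M (N - 1)"])
    fix n y \<phi> assume n: "n \<le> min M (N - 1)" and \<phi>: "\<phi> \<in> Hom C (term_at Y n) y" "\<phi> \<cdot> diff_at Y (n - 1) = zer C (term_at Y (n - 1)) y"
    note [simp] = hom[OF \<phi>(1)] and \<phi>d = cmp_eq_assoc[OF \<phi>(2)]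
    have "\<phi> \<cdot> diff_at Y (n - 1) \<cdot> J (n - 1) = zer C (term_at Y (n - 1)) y \<cdot> J (n - 1)" by (simp only: \<phi>(2))
    then have a: "(\<phi> \<cdot> J n) \<cdot> diff_at P' (n - 1) = zer C (term_at P' (n - 1)) y" by (simp add: assoc)
    obtain h' where h': "h' \<in> Hom C (term_at P' (n + 1)) y" "\<phi> \<cdot> J n = h' \<cdot> diff_at P' n"
      using M[rule_format, OF _ _ a] n by (auto simp: HomI)
    note [simp] = hom[OF h'(1)] and h'd = cmp_eq_assoc[OF h'(2)]
    have "\<phi> \<cdot> diff_at Y (n - 1) \<cdot> K (n - 1) = zer C (term_at Y (n - 1)) y \<cdot> K (n - 1)" by (simp only: \<phi>(2))
    then have b: "(\<phi> \<cdot> K n \<ominus> h' \<cdot> F (n + 1)) \<cdot> diff_at P (n + 1 - 1) = zer C (term_at P (n + 1 - 1)) y"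
      by (simp add: alg h'd cm_comm[OF F])
    obtain h'' where h'': "h'' \<in> Hom C (term_at P (n + 1 + 1)) y" "\<phi> \<cdot> K n \<ominus> h' \<cdot> F (n + 1) = h'' \<cdot> diff_at P (n + 1)"
      using N[rule_format, OF _ _ b] n by (auto simp: HomI)
    note [simp] = hom[OF h''(1)]
    have h2: "\<phi> \<cdot> K n = h' \<cdot> F (n + 1) \<oplus> h'' \<cdot> diff_at P (n + 1)" using h''(2) by (simp add: alg)
    have "\<phi> = (h' \<cdot> B (n + 1) \<ominus> h'' \<cdot> A (n + 1)) \<cdot> diff_at Y n"
      by (rule cone_eq_out[OF co, of _ n y]) (simp_all add: HomI alg h2 h'(2) add.commute[of 2 n])
    then show "\<exists>h \<in> Hom C (term_at Y (n + 1)) y. \<phi> = h \<cdot> diff_at Y n" by (rule bexI) (simp add: HomI add.commute[of 2 n])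
  qed
qed

lemma cone_bounded_proj: assumes "bounded_proj P" "bounded_proj P'" shows "bounded_proj Y"
proof -
  have bp: "is_biproduct C (term_at P (n + 1)) (term_at P' n) (term_at Y n) (K n) (J n) (A n) (B n)" for n
    using co by (simp add: cone_def)
  obtain N M where N: "\<And>n. n > N \<Longrightarrow> zero_object C (term_at P n)" "\<And>n. n > M \<Longrightarrow> zero_object C (term_at P' n)"
    using assms unfolding bounded_proj_def by blast
  have "zero_object C (term_at Y n)" if "n > max N M" for n
    using biproduct_zero[OF bp preadditive_category_axioms] N that by simp
  moreover have "projective C (term_at Y n)" for n
    using biproduct_projective[OF bp preadditive_category_axioms] assms by (simp add: bounded_proj_def)
  ultimately show ?thesis unfolding bounded_proj_def using cone_cx[OF co P P' F] by blast
qed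

end

section \<open>The cone of a lift resolves the cone\<close>

context
  fixes X X' f Z k j p q P P' \<pi> \<pi>' F s Y K J A B
  assumes cz: "cone X X' f Z k j p q" and X: "cx X" and X': "cx X'" and f: "f \<in> chain_maps C X X'"
    and rP: "res X P \<pi>" and rP': "res X' P' \<pi>'" and F: "F \<in> chain_maps C P P'"
    and s: "htp P X' (\<lambda>n. f n \<cdot> \<pi> n) (\<lambda>n. \<pi>' n \<cdot> F n) s" and cy: "cone P P' F Y K J A B"
begin

text \<open>The comparison of two cones for a square that commutes only up to the homotopy s. In
  components it is (x, y) to (\<pi> x, \<pi>' y - s x); the correction by s makes it a chain
  map.\<close>

definition gg :: "int \<Rightarrow> 'm" where
  "gg n = k n \<cdot> (\<pi> (n + 1) \<cdot> A n) \<oplus> j n \<cdot> (\<pi>' n \<cdot> B n \<ominus> s (n + 1) \<cdot> A n)"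

lemma fpi: "f n \<cdot> \<pi> n = \<pi>' n \<cdot> F n \<oplus> (diff_at X' (n - 1) \<cdot> s n \<oplus> s (n + 1) \<cdot> diff_at P n)"
  using htp(4)[OF s, of n] .

lemma fpi': "x \<in> mor C \<Longrightarrow> trg C x = term_at P n \<Longrightarrow>
    f n \<cdot> (\<pi> n \<cdot> x) = \<pi>' n \<cdot> (F n \<cdot> x) \<oplus> (diff_at X' (n - 1) \<cdot> (s n \<cdot> x) \<oplus> s (n + 1) \<cdot> (diff_at P n \<cdot> x))"
  using cmp_eq_assoc[OF fpi, of n x]
  by (simp add: X X' cm_typ[OF f] cm_typ[OF F] cm_typ[OF resD(3)[OF rP]] cm_typ[OF resD(3)[OF rP']]
      resD(1)[OF rP] resD(1)[OF rP'] htp(1,2,3)[OF s] alg)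

lemmas cs = cone_simps[OF cz X X' f] cone_cx[OF cz X X' f] cone_simps[OF cy resD(1)[OF rP] resD(1)[OF rP'] F]
    cone_cx[OF cy resD(1)[OF rP] resD(1)[OF rP'] F]
    cm_typ[OF resD(3)[OF rP]] cm_typ[OF resD(3)[OF rP']] htp(1,2,3)[OF s]

lemma gg_typ: "gg n \<in> mor C" "src C (gg n) = term_at Y n" "trg C (gg n) = term_at Z n"
  by (simp_all add: gg_def cs)

lemma p_gg: "x \<in> mor C \<Longrightarrow> trg C x = term_at Y n \<Longrightarrow> p n \<cdot> (gg n \<cdot> x) = \<pi> (n + 1) \<cdot> (A n \<cdot> x)"
  and q_gg: "x \<in> mor C \<Longrightarrow> trg C x = term_at Y n \<Longrightarrow> q n \<cdot> (gg n \<cdot> x) = \<pi>' n \<cdot> (B n \<cdot> x) \<ominus> s (n + 1) \<cdot> (A n \<cdot> x)"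
  by (simp_all add: gg_def cs alg)

lemma p_gg0: "p n \<cdot> gg n = \<pi> (n + 1) \<cdot> A n"
  and q_gg0: "q n \<cdot> gg n = \<pi>' n \<cdot> B n \<ominus> s (n + 1) \<cdot> A n"
  by (simp_all add: gg_def cs alg)

lemma gg_cm: "gg \<in> chain_maps C Y Z"
proof (rule cmI)
  fix n
  have 1: "p (n + 1) \<cdot> (gg (n + 1) \<cdot> diff_at Y n) = p (n + 1) \<cdot> (diff_at Z n \<cdot> gg n)"
    by (simp add: cs gg_typ p_gg p_gg0 cm_comm'[OF resD(3)[OF rP]] cmp_neg add.commute[of 2 n])
  have 2: "q (n + 1) \<cdot> (gg (n + 1) \<cdot> diff_at Y n) = q (n + 1) \<cdot> (diff_at Z n \<cdot> gg n)"
    by (simp add: cs gg_typ q_gg p_gg0 q_gg0 fpi' cm_comm'[OF resD(3)[OF rP']] alg add.commute[of 2 n] add.commute[of 1 n])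
  show "diff_at Z n \<cdot> gg n = gg (n + 1) \<cdot> diff_at Y n"
    by (rule cone_eq_in[OF cz, of _ "term_at Y n" "n + 1"]) (simp_all only: 1 2, simp_all add: HomI cs gg_typ)
qed (simp_all add: gg_typ)

text \<open>Half of the five lemma for the two cones, done on elements: surjectivity of \<pi> treats
  the X-component, injectivity of \<pi>' makes the result a cocycle, and surjectivity of \<pi>'
  treats the X'-component.\<close>

lemma gg_surj: "qsurj Y Z gg"
proof (rule qsurjI)
  note [simp] = cs gg_typ p_gg q_gg
  note p = resD[OF rP] and p' = resD[OF rP']
  fix T n z assume T: "projective C T" and z: "z \<in> Hom C T (term_at Z n)" "diff_at Z n \<cdot> z = zer C T (term_at Z (n + 1))"
  note [simp] = hom[OF z(1)]
  have "p (n + 1) \<cdot> (diff_at Z n \<cdot> z) = p (n + 1) \<cdot> zer C T (term_at Z (n + 1))"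
    "q (n + 1) \<cdot> (diff_at Z n \<cdot> z) = q (n + 1) \<cdot> zer C T (term_at Z (n + 1))"
    using z(2) by simp_all
  then have 1: "diff_at X (n + 1) \<cdot> (p n \<cdot> z) = zer C T (term_at X (n + 1 + 1))"
    and 2: "f (n + 1) \<cdot> (p n \<cdot> z) \<oplus> diff_at X' n \<cdot> (q n \<cdot> z) = zer C T (term_at X' (n + 1))"
    by (simp_all add: alg add.commute[of 2 n])
  obtain x u where x: "x \<in> Hom C T (term_at P (n + 1))" "diff_at P (n + 1) \<cdot> x = zer C T (term_at P (n + 1 + 1))"
    "u \<in> Hom C T (term_at X (n + 1 - 1))" "p n \<cdot> z = \<pi> (n + 1) \<cdot> x \<oplus> diff_at X (n + 1 - 1) \<cdot> u"
    by (rule qsurjD[OF conjunct1[OF p(4)[unfolded qis_def]] T _ 1]) (simp_all add: HomI)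
  have u: "u \<in> Hom C T (term_at X n)" using x(3) by simp
  note [simp] = hom[OF x(1)] hom[OF u]
  have x4: "p n \<cdot> z = \<pi> (n + 1) \<cdot> x \<oplus> diff_at X n \<cdot> u" using x(4) by simp
  have x2: "diff_at P (n + 1) \<cdot> x = zer C T (term_at P (n + 2))" using x(2) by (simp add: add.commute[of 2 n])
  \<comment> \<open>As F x becomes a coboundary under \<pi>', it is a coboundary d y0 in P'. Then
    (x, - y0) is a cocycle of the cone of F.\<close>
  have 3: "\<pi>' (n + 1) \<cdot> (F (n + 1) \<cdot> x) = diff_at X' n \<cdot> (neg C (q n \<cdot> z \<oplus> f n \<cdot> u \<oplus> s (n + 1) \<cdot> x))"
    using 2 by (simp add: x4 alg fpi' x2 cm_comm'[OF f] add.commute[of 2 n] add.commute[of 1 n])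
  obtain y0 where y0: "y0 \<in> Hom C T (term_at P' (n + 1 - 1))" "F (n + 1) \<cdot> x = diff_at P' (n + 1 - 1) \<cdot> y0"
    by (rule qinjD[OF conjunct2[OF p'(4)[unfolded qis_def]] T _ _ _ , of "F (n + 1) \<cdot> x" "n + 1" "neg C (q n \<cdot> z \<oplus> f n \<cdot> u \<oplus> s (n + 1) \<cdot> x)"])
      (use 3 in \<open>simp_all add: HomI cm_comm'[OF F] x2 add.commute[of 2 n]\<close>)
  have y0: "y0 \<in> Hom C T (term_at P' n)" "F (n + 1) \<cdot> x = diff_at P' n \<cdot> y0" using y0 by simp_all
  note [simp] = hom[OF y0(1)]
  \<comment> \<open>The X'-component of what is left of z after subtracting the image of (x, - y0)
    and the boundary of (- u, 0); its X-component is already zero.\<close>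
  let ?c = "q n \<cdot> z \<oplus> \<pi>' n \<cdot> y0 \<oplus> s (n + 1) \<cdot> x \<oplus> f n \<cdot> u"
  have "\<pi>' (n + 1) \<cdot> (diff_at P' n \<cdot> y0) \<oplus> (diff_at X' n \<cdot> (q n \<cdot> z) \<oplus> diff_at X' n \<cdot> (f n \<cdot> u) \<oplus> diff_at X' n \<cdot> (s (n + 1) \<cdot> x)) = zer C T (term_at X' (n + 1))"
    using 3 unfolding y0(2) by (simp add: alg)
  then have 4: "diff_at X' n \<cdot> ?c = zer C T (term_at X' (n + 1))"
    by (simp add: alg cm_comm'[OF p'(3)])
  obtain y1 w where y1: "y1 \<in> Hom C T (term_at P' n)" "diff_at P' n \<cdot> y1 = zer C T (term_at P' (n + 1))"
    "w \<in> Hom C T (term_at X' (n - 1))" "?c = \<pi>' n \<cdot> y1 \<oplus> diff_at X' (n - 1) \<cdot> w"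
    by (rule qsurjD[OF conjunct1[OF p'(4)[unfolded qis_def]] T _ 4]) (simp_all add: HomI)
  note [simp] = hom[OF y1(1)] hom[OF y1(3)]
  let ?v = "K n \<cdot> x \<oplus> J n \<cdot> (y1 \<ominus> y0)" and ?t = "j (n - 1) \<cdot> w \<ominus> k (n - 1) \<cdot> u"
  have qz: "q n \<cdot> z = \<pi>' n \<cdot> y1 \<oplus> diff_at X' (n - 1) \<cdot> w \<ominus> (\<pi>' n \<cdot> y0 \<oplus> s (n + 1) \<cdot> x \<oplus> f n \<cdot> u)"
    using y1(4) by (simp add: alg)
  have "diff_at Y n \<cdot> ?v = zer C T (term_at Y (n + 1))"
    by (simp add: alg y0(2) y1(2) x2 add.commute[of 2 n])
  moreover have "z = gg n \<cdot> ?v \<oplus> diff_at Z (n - 1) \<cdot> ?t"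
    by (rule cone_eq_in[OF cz, of _ T n]) (simp_all add: HomI cmp_add cmp_sub x4, simp_all add: qz alg)
  ultimately show "\<exists>x u. x \<in> Hom C T (term_at Y n) \<and> diff_at Y n \<cdot> x = zer C T (term_at Y (n + 1)) \<and>
        u \<in> Hom C T (term_at Z (n - 1)) \<and> z = gg n \<cdot> x \<oplus> diff_at Z (n - 1) \<cdot> u"
    by (intro exI[of _ ?v] exI[of _ ?t]) (simp add: HomI)
qed

text \<open>The cancellation for \<open>gg_inj\<close>, isolated with variables in place of the long
  composites so that it concerns only the addition of morphisms.\<close>

lemma sum_rearrange:
  assumes "u1 \<in> Hom C x y" "u2 \<in> Hom C x y" "e1 \<in> Hom C x y" "e2 \<in> Hom C x y" "g \<in> Hom C x y" "c1 \<in> Hom C x y" "w \<in> Hom C x y"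
  shows "((u2 \<oplus> e2) \<oplus> c1 \<ominus> (u1 \<oplus> (e1 \<oplus> g))) \<oplus> w \<oplus> g \<oplus> u1 \<ominus> u2 = w \<oplus> e2 \<oplus> c1 \<ominus> e1"
proof -
  note [simp] = hom[OF assms(1)] hom[OF assms(2)] hom[OF assms(3)] hom[OF assms(4)] hom[OF assms(5)] hom[OF assms(6)] hom[OF assms(7)]
  show ?thesis by (simp add: alg)
qed

text \<open>The other half of the five lemma: injectivity of \<pi> bounds the P-component of v,
  surjectivity of \<pi> adjusts this bound, and injectivity of \<pi>' bounds the remaining
  P'-component.\<close>

lemma gg_inj: "qinj Y Z gg"
proof (rule qinjI)
  note [simp] = cs gg_typ p_gg q_gg
  note p = resD[OF rP] and p' = resD[OF rP']
  fix T n v t assume T: "projective C T" and v: "v \<in> Hom C T (term_at Y n)" "diff_at Y n \<cdot> v = zer C T (term_at Y (n + 1))"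
    and t: "t \<in> Hom C T (term_at Z (n - 1))" "gg n \<cdot> v = diff_at Z (n - 1) \<cdot> t"
  note [simp] = hom[OF v(1)] hom[OF t(1)]
  have "A (n + 1) \<cdot> (diff_at Y n \<cdot> v) = A (n + 1) \<cdot> zer C T (term_at Y (n + 1))"
    "B (n + 1) \<cdot> (diff_at Y n \<cdot> v) = B (n + 1) \<cdot> zer C T (term_at Y (n + 1))"
    using v(2) by simp_all
  then have 1: "diff_at P (n + 1) \<cdot> (A n \<cdot> v) = zer C T (term_at P (n + 1 + 1))"
    and 2: "F (n + 1) \<cdot> (A n \<cdot> v) \<oplus> diff_at P' n \<cdot> (B n \<cdot> v) = zer C T (term_at P' (n + 1))"
    by (simp_all add: alg add.commute[of 2 n])
  have "p n \<cdot> (gg n \<cdot> v) = p n \<cdot> (diff_at Z (n - 1) \<cdot> t)" "q n \<cdot> (gg n \<cdot> v) = q n \<cdot> (diff_at Z (n - 1) \<cdot> t)"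
    using t(2) by simp_all
  then have 3: "\<pi> (n + 1) \<cdot> (A n \<cdot> v) = diff_at X n \<cdot> neg C (p (n - 1) \<cdot> t)"
    and 4: "\<pi>' n \<cdot> (B n \<cdot> v) = f n \<cdot> (p (n - 1) \<cdot> t) \<oplus> diff_at X' (n - 1) \<cdot> (q (n - 1) \<cdot> t) \<oplus> s (n + 1) \<cdot> (A n \<cdot> v)"
    by (simp add: cmp_neg) (use \<open>q n \<cdot> (gg n \<cdot> v) = _\<close> in \<open>simp add: alg\<close>)
  obtain a where a: "a \<in> Hom C T (term_at P (n + 1 - 1))" "A n \<cdot> v = diff_at P (n + 1 - 1) \<cdot> a"
    by (rule qinjD[OF conjunct2[OF p(4)[unfolded qis_def]] T _ 1, of "neg C (p (n - 1) \<cdot> t)"]) (simp_all add: HomI 3)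
  then have a: "a \<in> Hom C T (term_at P n)" "A n \<cdot> v = diff_at P n \<cdot> a" by simp_all
  note [simp] = hom[OF a(1)]
  \<comment> \<open>The element a bounding the P-component may be changed by a cocycle. The
    correction b obtained from this cocycle of X is chosen so that p t + \<pi> (a - b) is the
    coboundary of c.\<close>
  have 5: "diff_at X n \<cdot> (p (n - 1) \<cdot> t \<oplus> \<pi> n \<cdot> a) = zer C T (term_at X (n + 1))"
    using 3 by (simp add: alg a(2) cm_comm'[OF p(3)])
  obtain b c where b: "b \<in> Hom C T (term_at P n)" "diff_at P n \<cdot> b = zer C T (term_at P (n + 1))"
    "c \<in> Hom C T (term_at X (n - 1))" "p (n - 1) \<cdot> t \<oplus> \<pi> n \<cdot> a = \<pi> n \<cdot> b \<oplus> diff_at X (n - 1) \<cdot> c"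
    by (rule qsurjD[OF conjunct1[OF p(4)[unfolded qis_def]] T _ 5]) (simp_all add: HomI)
  note [simp] = hom[OF b(1)] hom[OF b(3)]
  have pt: "p (n - 1) \<cdot> t = \<pi> n \<cdot> b \<oplus> diff_at X (n - 1) \<cdot> c \<ominus> \<pi> n \<cdot> a" using b(4) by (simp add: eq_sub)
  \<comment> \<open>The P'-component that is left after subtracting the boundary of (b - a, 0) from
    v.\<close>
  let ?e = "B n \<cdot> v \<oplus> F n \<cdot> a \<ominus> F n \<cdot> b"
  have 6: "diff_at P' n \<cdot> ?e = zer C T (term_at P' (n + 1))"
    using 2 by (simp add: alg a(2) b(2) cm_comm'[OF F])
  have 7: "\<pi>' n \<cdot> ?e = diff_at X' (n - 1) \<cdot> (q (n - 1) \<cdot> t \<oplus> s n \<cdot> b \<oplus> f (n - 1) \<cdot> c \<ominus> s n \<cdot> a)"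
  proof -
    have "\<pi>' n \<cdot> ?e = ((\<pi>' n \<cdot> (F n \<cdot> b) \<oplus> diff_at X' (n - 1) \<cdot> (s n \<cdot> b)) \<oplus> f n \<cdot> (diff_at X (n - 1) \<cdot> c) \<ominus>
       (\<pi>' n \<cdot> (F n \<cdot> a) \<oplus> (diff_at X' (n - 1) \<cdot> (s n \<cdot> a) \<oplus> s (n + 1) \<cdot> (diff_at P n \<cdot> a)))) \<oplus>
       diff_at X' (n - 1) \<cdot> (q (n - 1) \<cdot> t) \<oplus> s (n + 1) \<cdot> (diff_at P n \<cdot> a) \<oplus> \<pi>' n \<cdot> (F n \<cdot> a) \<ominus> \<pi>' n \<cdot> (F n \<cdot> b)"
      by (simp add: cmp_add cmp_sub 4 pt a(2) fpi' b(2))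
    also have "\<dots> = diff_at X' (n - 1) \<cdot> (q (n - 1) \<cdot> t) \<oplus> diff_at X' (n - 1) \<cdot> (s n \<cdot> b) \<oplus> f n \<cdot> (diff_at X (n - 1) \<cdot> c) \<ominus>
      diff_at X' (n - 1) \<cdot> (s n \<cdot> a)"
      by (rule sum_rearrange[of _ T "term_at X' n"]) (simp_all add: HomI)
    also have "\<dots> = diff_at X' (n - 1) \<cdot> (q (n - 1) \<cdot> t \<oplus> s n \<cdot> b \<oplus> f (n - 1) \<cdot> c \<ominus> s n \<cdot> a)"
      by (simp add: cmp_add cmp_sub cm_comm'[OF f])
    finally show ?thesis .
  qed
  obtain w where w: "w \<in> Hom C T (term_at P' (n - 1))" "?e = diff_at P' (n - 1) \<cdot> w"
    by (rule qinjD[OF conjunct2[OF p'(4)[unfolded qis_def]] T _ 6 _ 7]) (simp_all add: HomI)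
  note [simp] = hom[OF w(1)]
  have Bv: "B n \<cdot> v = diff_at P' (n - 1) \<cdot> w \<oplus> F n \<cdot> b \<ominus> F n \<cdot> a" using w(2) by (simp add: alg)
  have "v = diff_at Y (n - 1) \<cdot> (K (n - 1) \<cdot> (b \<ominus> a) \<oplus> J (n - 1) \<cdot> w)"
    by (rule cone_eq_in[OF cy, of _ T n]) (simp_all add: HomI a(2) Bv, simp_all add: alg b(2))
  then show "\<exists>v'\<in>Hom C T (term_at Y (n - 1)). v = diff_at Y (n - 1) \<cdot> v'" by (rule bexI) (simp add: HomI)
qed

lemma cone_res: "res Z Y gg"
  unfolding res_def qis_def
  using cone_bounded_proj[OF cy resD(1)[OF rP] resD(1)[OF rP'] F resD(5)[OF rP] resD(5)[OF rP']] gg_cm gg_surj gg_inj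
  by blast

end

end

context abelian_enough
begin

lemma cone_resolution:
  assumes cz: "cone X X' f Z k j p q" and X: "cx X" and X': "cx X'" and f: "f \<in> chain_maps C X X'"
    and rP: "res X P \<pi>" and rP': "res X' P' \<pi>'"
  obtains F Y K J A B g where "F \<in> chain_maps C P P'" "homotopic C P X' (\<lambda>n. f n \<cdot> \<pi> n) (\<lambda>n. \<pi>' n \<cdot> F n)"
    "cone P P' F Y K J A B" "res Z Y g"
proof -
  note p = resD[OF rP] and p' = resD[OF rP']
  obtain F where F: "F \<in> chain_maps C P P'" "homotopic C P X' (\<lambda>n. f n \<cdot> \<pi> n) (\<lambda>n. \<pi>' n \<cdot> F n)"
    using lift[OF p(5) p'(1) X' p'(3,4) cm_cmp[OF p(3) f p(1) X X']] by blast
  obtain s where s: "htp P X' (\<lambda>n. f n \<cdot> \<pi> n) (\<lambda>n. \<pi>' n \<cdot> F n) s" using F(2) by (auto simp: homotopic_htp)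
  obtain Y K J A B where cy: "cone P P' F Y K J A B" using cone_exists[OF p(1) p'(1)] by blast
  show ?thesis using that[OF F cy cone_res[OF cz X X' f rP rP' F(1) s cy]] .
qed

text \<open>By \<open>cone_resolution\<close> the cone of a lift between resolutions resolves the
  cone of f, so both claims reduce to those about \<open>lc\<close> for cones of complexes of
  projectives.\<close>

lemma
  assumes X: "X \<in> bc" and X': "X' \<in> bc" and f: "f \<in> chain_maps C X X'" and cz: "cone X X' f Z k j p q"
  shows LC_cone_eq: "LC Z \<Longrightarrow> LC X \<longleftrightarrow> LC X'" and LC_cone: "LC X \<Longrightarrow> LC X' \<Longrightarrow> LC Z"
proof -
  obtain P \<pi> where rP: "res X P \<pi>" using bc_resolution[OF X] .
  obtain P' \<pi>' where rP': "res X' P' \<pi>'" using bc_resolution[OF X'] .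
  note c = bc_cx[OF X] bc_cx[OF X']
  obtain F Y K J A B g where F: "F \<in> chain_maps C P P'" and cy: "cone P P' F Y K J A B" and rY: "res Z Y g"
    using cone_resolution[OF cz c f rP rP'] by metis
  have "LC X \<longleftrightarrow> lc P" "LC X' \<longleftrightarrow> lc P'" "LC Z \<longleftrightarrow> lc Y"
    using LC_iff[OF c(1) rP] LC_iff[OF c(2) rP'] LC_iff[OF cone_cx[OF cz c f] rY] by auto
  then show "LC Z \<Longrightarrow> LC X \<longleftrightarrow> LC X'" "LC X \<Longrightarrow> LC X' \<Longrightarrow> LC Z"
    using lc_cone_eq[OF cy resD(1)[OF rP] resD(1)[OF rP'] F] lc_cone[OF cy resD(1)[OF rP] resD(1)[OF rP'] F] by auto
qed

text \<open>In low degrees \<open>P\<close> is split exact, so the cokernel \<open>M\<close> of the differential into degree \<open>m\<close>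
  is a summand of the next term, and \<open>P\<close> can be cut off there.\<close>

lemma truncation:
  assumes P: "bounded_proj P" and lc: "lc P"
  obtains m M \<iota> where "m \<le> m0" "projective C M" "\<iota> \<in> Hom C M (term_at P (m + 1))" "is_mono C \<iota>"
    "diff_at P (m + 1) \<cdot> \<iota> = zer C M (term_at P (m + 2))"
    "\<And>T v. projective C T \<Longrightarrow> v \<in> Hom C T (term_at P m) \<Longrightarrow> \<exists>w \<in> Hom C T M. \<iota> \<cdot> w = diff_at P m \<cdot> v"
    "\<And>x \<phi>. \<phi> \<in> Hom C (term_at P (m + 1)) x \<Longrightarrow> \<phi> \<cdot> diff_at P m = zer C (term_at P m) x \<Longrightarrow> \<phi> \<cdot> \<iota> = zer C M x"
proof -
  note [simp] = bounded_projD[OF P]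
  obtain N where N: "\<forall>n\<le>N. \<forall>y \<phi>. \<phi> \<in> Hom C (term_at P n) y \<longrightarrow>
     \<phi> \<cdot> diff_at P (n - 1) = zer C (term_at P (n - 1)) y \<longrightarrow> (\<exists>h \<in> Hom C (term_at P (n + 1)) y. \<phi> = h \<cdot> diff_at P n)"
    using lc by (rule lcE)
  define m where "m = min N m0"
  have d: "diff_at P (m - 1) \<in> Hom C (term_at P (m - 1)) (term_at P m)" by (simp add: HomI)
  obtain M c where c: "c \<in> Hom C (term_at P m) M" "c \<cdot> diff_at P (m - 1) = zer C (term_at P (m - 1)) M" "is_epi C c"
    "\<And>w h. h \<in> Hom C (term_at P m) w \<Longrightarrow> h \<cdot> diff_at P (m - 1) = zer C (term_at P (m - 1)) w \<Longrightarrow> \<exists>u \<in> Hom C M w. u \<cdot> c = h"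
    using cokernel[OF d] by metis
  \<comment> \<open>The cokernel c is itself a cocycle with values in M. By \<open>lc\<close> it
    factors through the differential, and the factor h splits \<iota>.\<close>
  obtain h where h: "h \<in> Hom C (term_at P (m + 1)) M" "c = h \<cdot> diff_at P m"
    using N[rule_format, OF _ c(1,2)] by (auto simp: m_def)
  obtain \<iota> where i: "\<iota> \<in> Hom C M (term_at P (m + 1))" "\<iota> \<cdot> c = diff_at P m"
    using c(4)[of "diff_at P m" "term_at P (m + 1)"] by (auto simp: HomI add.commute[of 1 m])
  note [simp] = hom[OF c(1)] hom[OF h(1)] hom[OF i(1)]
  have ih: "h \<cdot> \<iota> = idm C M"
    by (rule epiD[OF c(3,1), of _ M]) (simp_all add: HomI assoc i(2) h(2)[symmetric])
  show ?thesis
  proof (rule that[of m M \<iota>])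
    show "projective C M" by (rule projective_retract[OF bounded_projD(2)[OF P] i(1) h(1) ih])
    show "is_mono C \<iota>" unfolding is_mono_def
    proof (intro conjI ballI impI)
      fix x a b assume a: "a \<in> Hom C x (src C \<iota>)" and b: "b \<in> Hom C x (src C \<iota>)" and ab: "\<iota> \<cdot> a = \<iota> \<cdot> b"
      have "h \<cdot> (\<iota> \<cdot> a) = h \<cdot> (\<iota> \<cdot> b)" using ab by simp
      then show "a = b" using hom[OF a] hom[OF b] by (simp add: assoc[symmetric] ih)
    qed simp
    show "diff_at P (m + 1) \<cdot> \<iota> = zer C M (term_at P (m + 2))"
      by (rule epiD[OF c(3,1), of _ "term_at P (m + 2)"]) (simp_all add: HomI assoc i(2) add.commute[of 2 m])
    fix T v assume v: "v \<in> Hom C T (term_at P m)"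
    note [simp] = hom[OF v]
    show "\<exists>w \<in> Hom C T M. \<iota> \<cdot> w = diff_at P m \<cdot> v"
      by (intro bexI[of _ "c \<cdot> v"]) (simp_all add: HomI assoc[symmetric] i(2))
  next
    fix x \<phi> assume \<phi>: "\<phi> \<in> Hom C (term_at P (m + 1)) x" "\<phi> \<cdot> diff_at P m = zer C (term_at P m) x"
    note [simp] = hom[OF \<phi>(1)]
    show "\<phi> \<cdot> \<iota> = zer C M x"
      by (rule epiD[OF c(3,1), of _ x]) (simp_all add: HomI assoc i(2) \<phi>(2))
  qed (use i in \<open>simp_all add: m_def\<close>)
qed

text \<open>A resolution of Z is cut off at a degree m where it splits: below m it becomes zero, and
  in degree m the summand M of the next term replaces the given term.\<close>

lemma LC_Kb_Proj:
  assumes Z: "Z \<in> bc" and LC: "LC Z"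
  obtains S t where "S \<in> Kb_Proj C" "t \<in> chain_maps C S Z" "qis S Z t"
proof -
  note Zc [simp] = bc_cx[OF Z]
  obtain N where N: "\<And>n. \<bar>n\<bar> > N \<Longrightarrow> zero_object C (term_at Z n)" using Z unfolding bounded_complexes_iff bd_def by blast
  have "zero_object C (term_at Z n)" if "n > \<bar>N\<bar>" for n using that by (intro N) auto
  then obtain P \<pi> where P: "res Z P \<pi>" and zP: "\<And>n. n > \<bar>N\<bar> \<Longrightarrow> zero_object C (term_at P n)"
    using resolution[of Z "\<bar>N\<bar>"] Zc by metis
  note p = resD[OF P] and q = resD(4)[OF P, unfolded qis_def]
  have "lc P" using LC_iff[OF Zc P] LC by simp
  \<comment> \<open>The bound places the cut below all non-zero terms of Z, so that the map to Z can
    be zero in degrees up to m.\<close>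
  then obtain m M \<iota> where m: "m \<le> - \<bar>N\<bar> - 1" "projective C M" "\<iota> \<in> Hom C M (term_at P (m + 1))" "is_mono C \<iota>"
    "diff_at P (m + 1) \<cdot> \<iota> = zer C M (term_at P (m + 2))"
    "\<And>T v. projective C T \<Longrightarrow> v \<in> Hom C T (term_at P m) \<Longrightarrow> \<exists>w \<in> Hom C T M. \<iota> \<cdot> w = diff_at P m \<cdot> v"
    "\<And>x \<phi>. \<phi> \<in> Hom C (term_at P (m + 1)) x \<Longrightarrow> \<phi> \<cdot> diff_at P m = zer C (term_at P m) x \<Longrightarrow> \<phi> \<cdot> \<iota> = zer C M x"
    using truncation[OF p(5), where ?m0.0 = "- \<bar>N\<bar> - 1"] by metis
  note [simp] = p(1,2) cm_typ[OF p(3)] hom[OF m(3)] projective_ob[OF m(2)]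
  have zZ: "zero_object C (term_at Z n)" if "n \<le> m" for n using that m(1) by (intro N) auto
  define tS where "tS = (\<lambda>n. if n < m then zob else if n = m then M else term_at P n)"
  define dS where "dS = (\<lambda>n. if n < m then zer C (tS n) (tS (n + 1)) else if n = m then \<iota> else diff_at P n)"
  define S where "S = \<lparr>term_at = tS, diff_at = dS\<rparr>"
  define t where "t = (\<lambda>n. if n \<le> m then zer C (tS n) (term_at Z n) else \<pi> n)"
  have S [simp]: "term_at S n = tS n" "diff_at S n = dS n" for n by (simp_all add: S_def)
  have tS [simp]: "tS n \<in> ob C" for n by (simp add: tS_def)
  have dS: "dS n \<in> Hom C (tS n) (tS (n + 1))" for n
    by (simp add: dS_def HomI) (simp add: tS_def HomI)
  note [simp] = hom[OF dS]
  have dd: "dS (n + 1) \<cdot> dS n = zer C (tS n) (tS (n + 2))" for n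
  proof -
    consider "n < m" | "n = m" | "n > m" by linarith
    then show ?thesis
    proof cases
      case 1 then show ?thesis by (simp add: dS_def[THEN fun_cong, of n] add.commute[of 2 n])
    qed (simp_all add: dS_def tS_def m(5))
  qed
  have cS [simp]: "cx S" unfolding cx_def using dS dd by simp
  have bS: "bd S" unfolding bd_def
  proof (intro exI[of _ "\<bar>m\<bar> + \<bar>N\<bar>"] allI impI)
    fix n assume "\<bar>m\<bar> + \<bar>N\<bar> < \<bar>n\<bar>"
    then have "n < m \<or> (n > m \<and> n > \<bar>N\<bar>)" using m(1) by auto
    then show "zero_object C (term_at S n)" using zob zP by (auto simp: tS_def)
  qed
  have SK: "S \<in> Kb_Proj C" unfolding Kb_Proj_iff bounded_complexes_iff
    using cS bS m(2) zero_object_projective[OF zob] by (simp add: tS_def)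
  have tH: "t n \<in> Hom C (tS n) (term_at Z n)" for n
    by (simp add: t_def zer_Hom) (simp add: tS_def HomI)
  note [simp] = hom[OF tH]
  \<comment> \<open>In degree m the augmentation has zero target, so \<pi> in degree m + 1 kills the
    differential into that degree and hence its factor \<iota>.\<close>
  have \<pi>i: "\<pi> (m + 1) \<cdot> \<iota> = zer C M (term_at Z (m + 1))"
  proof (rule m(7))
    have "\<pi> m = zer C (term_at P m) (term_at Z m)" by (rule to_zero[OF zZ]) (simp_all add: HomI)
    then show "\<pi> (m + 1) \<cdot> diff_at P m = zer C (term_at P m) (term_at Z (m + 1))"
      using cm_comm[OF p(3), of m] by simp
  qed (simp add: HomI)
  have t: "t \<in> chain_maps C S Z"
  proof (rule cmI)
    fix n
    consider "n < m" | "n = m" | "n > m" by linarith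
    then show "diff_at Z n \<cdot> t n = t (n + 1) \<cdot> diff_at S n"
    proof cases
      case 1 then show ?thesis by (simp add: t_def dS_def)
    next
      case 2 then show ?thesis by (simp add: t_def dS_def tS_def \<pi>i)
    next
      case 3 then show ?thesis by (simp add: t_def dS_def cm_comm[OF p(3)])
    qed
  qed simp_all
  have "qsurj S Z t"
  proof (rule qsurjI)
    fix T n y assume T: "projective C T" and y: "y \<in> Hom C T (term_at Z n)" "diff_at Z n \<cdot> y = zer C T (term_at Z (n + 1))"
    note [simp] = hom[OF y(1)]
    show "\<exists>x u. x \<in> Hom C T (term_at S n) \<and> diff_at S n \<cdot> x = zer C T (term_at S (n + 1)) \<and>
        u \<in> Hom C T (term_at Z (n - 1)) \<and> y = t n \<cdot> x \<oplus> diff_at Z (n - 1) \<cdot> u"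
    proof (cases "n \<le> m")
      case True
      then have "y = zer C T (term_at Z n)" using to_zero zZ y(1) by blast
      then show ?thesis
        by (intro exI[of _ "zer C T (tS n)"] exI[of _ "zer C T (term_at Z (n - 1))"]) (auto simp: zer_Hom)
    next
      case False
      obtain x u where "x \<in> Hom C T (term_at P n)" "diff_at P n \<cdot> x = zer C T (term_at P (n + 1))"
        "u \<in> Hom C T (term_at Z (n - 1))" "y = \<pi> n \<cdot> x \<oplus> diff_at Z (n - 1) \<cdot> u"
        by (rule qsurjD[OF conjunct1[OF q] T y])
      then show ?thesis using False by (intro exI[of _ x] exI[of _ u]) (simp add: t_def dS_def tS_def)
    qed
  qed
  moreover have "qinj S Z t"
  proof (rule qinjI)
    fix T n x u assume T: "projective C T" and x: "x \<in> Hom C T (term_at S n)" "diff_at S n \<cdot> x = zer C T (term_at S (n + 1))"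
      and u: "u \<in> Hom C T (term_at Z (n - 1))" "t n \<cdot> x = diff_at Z (n - 1) \<cdot> u"
    note [simp] = hom[OF x(1)] hom[OF u(1)]
    consider "n < m" | "n = m" | "n = m + 1" | "n > m + 1" by linarith
    then show "\<exists>v\<in>Hom C T (term_at S (n - 1)). x = diff_at S (n - 1) \<cdot> v"
    proof cases
      case 1
      then have "x = zer C T (tS n)" using to_zero[OF zob] x(1) by (simp add: tS_def)
      then show ?thesis by (intro bexI[of _ "zer C T (tS (n - 1))"]) (auto simp: zer_Hom)
    next
      case 2
      then have "\<iota> \<cdot> x = zer C T (term_at P (m + 1))" "x \<in> Hom C T M" using x by (simp_all add: dS_def tS_def)
      then have "x = zer C T M" using m(4) unfolding mono_iff by simp
      then have "x = zer C T (tS n)" using 2 by (simp add: tS_def)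
      then show ?thesis by (intro bexI[of _ "zer C T (tS (n - 1))"]) (auto simp: zer_Hom)
    next
      case 3
      have x': "x \<in> Hom C T (term_at P n)" "diff_at P n \<cdot> x = zer C T (term_at P (n + 1))" "\<pi> n \<cdot> x = diff_at Z (n - 1) \<cdot> u"
        using 3 x u by (simp_all add: dS_def tS_def t_def)
      obtain v where v: "v \<in> Hom C T (term_at P (n - 1))" "x = diff_at P (n - 1) \<cdot> v"
        by (rule qinjD[OF conjunct2[OF q] T x'(1,2) u(1) x'(3)])
      obtain w where "w \<in> Hom C T M" "\<iota> \<cdot> w = diff_at P m \<cdot> v" using m(6)[OF T, of v] v(1) 3 by auto
      then show ?thesis using 3 v(2) by (intro bexI[of _ w]) (simp_all add: dS_def tS_def)
    next
      case 4
      have x': "x \<in> Hom C T (term_at P n)" "diff_at P n \<cdot> x = zer C T (term_at P (n + 1))" "\<pi> n \<cdot> x = diff_at Z (n - 1) \<cdot> u"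
        using 4 x u by (simp_all add: dS_def tS_def t_def)
      obtain v where v: "v \<in> Hom C T (term_at P (n - 1))" "x = diff_at P (n - 1) \<cdot> v"
        by (rule qinjD[OF conjunct2[OF q] T x'(1,2) u(1) x'(3)])
      then show ?thesis using 4 by (intro bexI[of _ v]) (simp_all add: dS_def tS_def)
    qed
  qed
  ultimately show ?thesis using that[OF SK t] by (simp add: qis_def)
qed

section \<open>Finite projective dimension and perfect stalk complexes\<close>

lemma pd_finite_iff: "pd C x < \<infinity> \<longleftrightarrow> (\<exists>n P d \<epsilon>. projective_resolution C x P d \<epsilon> \<and> (\<forall>k>n. zero_object C (P k)))"
proof -
  let ?A = "{enat n | n. \<exists>P d \<epsilon>. projective_resolution C x P d \<epsilon> \<and> (\<forall>k > n. zero_object C (P k))}"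
  have "pd C x < \<infinity> \<longleftrightarrow> (\<exists>a\<in>?A. a < \<infinity>)" unfolding pd_def by (rule Inf_less_iff)
  moreover have "(\<exists>a\<in>?A. a < \<infinity>) \<longleftrightarrow> (\<exists>n. enat n \<in> ?A)"
  proof
    assume "\<exists>n. enat n \<in> ?A"
    then obtain n where "enat n \<in> ?A" ..
    then show "\<exists>a\<in>?A. a < \<infinity>" by (rule bexI[rotated]) simp
  qed blast
  ultimately show ?thesis by simp
qed

text \<open>A resolution of the stalk complex that vanishes in positive degrees is truncated at a
  degree m < 0. Read backwards, it is a projective resolution of length - m whose last term is the
  summand K.\<close>

lemma LC_stalk_pd:
  assumes M: "M \<in> ob C" and LC: "LC (stalk M 0)"
  shows "pd C M < \<infinity>"
proof -
  let ?X = "stalk M 0"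
  have cX: "cx ?X" by (rule stalk_cx[OF M])
  have "zero_object C (term_at ?X n)" if "n > 0" for n using that zob by simp
  then obtain P \<pi> where P: "res ?X P \<pi>" and zP: "\<And>n. n > 0 \<Longrightarrow> zero_object C (term_at P n)" and cov: "covering ?X P \<pi>"
    using resolution[OF cX, of 0] by metis
  note p = resD[OF P] and q = resD(4)[OF P, unfolded qis_def]
  have "lc P" using LC_iff[OF cX P] LC by simp
  then obtain m K \<iota> where m: "m \<le> - 1" "projective C K" "\<iota> \<in> Hom C K (term_at P (m + 1))" "is_mono C \<iota>"
    "diff_at P (m + 1) \<cdot> \<iota> = zer C K (term_at P (m + 2))"
    "\<And>T v. projective C T \<Longrightarrow> v \<in> Hom C T (term_at P m) \<Longrightarrow> \<exists>w \<in> Hom C T K. \<iota> \<cdot> w = diff_at P m \<cdot> v"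
    "\<And>x \<phi>. \<phi> \<in> Hom C (term_at P (m + 1)) x \<Longrightarrow> \<phi> \<cdot> diff_at P m = zer C (term_at P m) x \<Longrightarrow> \<phi> \<cdot> \<iota> = zer C K x"
    using truncation[OF p(5), where ?m0.0 = "- 1"] by metis
  note [simp] = p(1,2) cm_typ[OF p(3)] hom[OF m(3)] projective_ob[OF m(2)] M
  define l where "l = nat (- m)"
  have l: "l > 0" "m = - int l" using m(1) by (auto simp: l_def)
  define Q where "Q = (\<lambda>k. if k < l then term_at P (- int k) else if k = l then K else zob)"
  \<comment> \<open>Homological degree k is cohomological degree - k, so d k starts in degree - 1 -
    k. The last non-trivial differential is \<iota>, out of the summand that replaces the
    tail.\<close>
  define d where "d = (\<lambda>k. if Suc k < l then diff_at P (- 1 - int k) else if Suc k = l then \<iota> else zer C (Q (Suc k)) (Q k))"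
  have [simp]: "Q k \<in> ob C" for k by (simp add: Q_def)
  have projQ: "projective C (Q k)" for k using m(2) zero_object_projective[OF zob] by (simp add: Q_def)
  have li: "- int k = m + 1" if "Suc k = l" for k using l that by auto
  have d: "d k \<in> Hom C (Q (Suc k)) (Q k)" for k
  proof -
    consider "Suc k < l" | "Suc k = l" | "Suc k > l" by linarith
    then show ?thesis
    proof cases
      case 1 then show ?thesis by (simp add: d_def Q_def HomI)
    next
      case 2 then show ?thesis using li[OF 2] by (simp add: d_def Q_def HomI)
    next
      case 3 then show ?thesis by (simp add: d_def zer_Hom)
    qed
  qed
  note [simp] = hom[OF d]
  \<comment> \<open>In negative degrees the stalk complex is zero, so injectivity of the
    augmentation on cohomology is exactness of P.\<close>
  have exP: "\<exists>v \<in> Hom C T (term_at P (n - 1)). diff_at P (n - 1) \<cdot> v = x"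
    if T: "projective C T" and x: "x \<in> Hom C T (term_at P n)" "diff_at P n \<cdot> x = zer C T (term_at P (n + 1))" and n: "n < 0" for T n x
  proof -
    note [simp] = hom[OF x(1)]
    have "\<pi> n = zer C (term_at P n) (term_at ?X n)" using n zob by (intro to_zero) (simp_all add: HomI)
    then have e: "\<pi> n \<cdot> x = diff_at ?X (n - 1) \<cdot> zer C T (term_at ?X (n - 1))"
      using n by simp
    obtain v where "v \<in> Hom C T (term_at P (n - 1))" "x = diff_at P (n - 1) \<cdot> v"
      by (rule qinjD[OF conjunct2[OF q] T x _ e]) (simp_all add: zer_Hom)
    then show ?thesis by blast
  qed
  have \<pi>0: "\<pi> 0 \<in> Hom C (term_at P 0) M" using p(3) cm_typ[OF p(3), of 0] by (simp add: HomI)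
  note [simp] = hom[OF \<pi>0]
  have \<pi>d: "\<pi> 0 \<cdot> diff_at P (- 1) = zer C (term_at P (- 1)) M" using cm_comm[OF p(3), of "- 1"] by (simp add: zob)
  have epi: "is_epi C (\<pi> 0)"
  proof (rule epi_if_surj_on_projectives[OF \<pi>0])
    fix T a assume T: "projective C T" and a: "a \<in> Hom C T M"
    note [simp] = hom[OF a]
    \<comment> \<open>The covering property in degree 1 for the pair (0, a): its two conditions hold
      since the outgoing differential of the stalk vanishes.\<close>
    have "\<exists>z \<in> Hom C T (term_at P (1 - 1)). diff_at P (1 - 1) \<cdot> z = zer C T (term_at P 1) \<and> \<pi> (1 - 1) \<cdot> z = a"
      using cov[unfolded covering_def, rule_format, OF T, of "zer C T (term_at P 1)" 1 a] a by (simp add: zer_Hom)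
    then show "\<exists>b\<in>Hom C T (term_at P 0). \<pi> 0 \<cdot> b = a" by auto
  qed
  have ex0: "\<exists>v \<in> Hom C T (term_at P (- 1)). diff_at P (- 1) \<cdot> v = x"
    if T: "projective C T" and x: "x \<in> Hom C T (term_at P 0)" "\<pi> 0 \<cdot> x = zer C T M" for T x
  proof -
    note [simp] = hom[OF x(1)]
    have e1: "diff_at P 0 \<cdot> x = zer C T (term_at P (0 + 1))" by (rule to_zero[OF zP]) (simp_all add: HomI)
    have e2: "\<pi> 0 \<cdot> x = diff_at ?X (0 - 1) \<cdot> zer C T (term_at ?X (0 - 1))" using x by simp
    obtain v where "v \<in> Hom C T (term_at P (0 - 1))" "x = diff_at P (0 - 1) \<cdot> v"
      by (rule qinjD[OF conjunct2[OF q] T x(1) e1 _ e2]) (simp_all add: zer_Hom)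
    then show ?thesis by auto
  qed
  have Q0: "Q 0 = term_at P 0" using l by (simp add: Q_def)
  have e0: "exact_at C (d 0) (\<pi> 0)"
  proof (subst exact_at_iff[OF _ \<pi>0])
    show d0: "d 0 \<in> Hom C (Q 1) (term_at P 0)" using d[of 0] Q0 by simp
    show "\<pi> 0 \<cdot> d 0 = zer C (Q 1) M \<and> texact (d 0) (\<pi> 0)"
    proof (cases "l = 1")
      case True
      have *: "m = - 1" "d 0 = \<iota>" "Q 1 = K" using l True by (auto simp: d_def Q_def)
      have "\<pi> 0 \<cdot> \<iota> = zer C K M" using m(7)[of "\<pi> 0" M] \<pi>d * \<pi>0 by simp
      moreover have "texact (d 0) (\<pi> 0)"
        using ex0 m(6) * by (intro texactI[OF d0 \<pi>0]) (metis (no_types, lifting))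
      ultimately show ?thesis using * by simp
    next
      case False
      then have *: "d 0 = diff_at P (- 1)" "Q 1 = term_at P (- 1)" using l by (auto simp: d_def Q_def)
      have "texact (d 0) (\<pi> 0)" using ex0 * by (intro texactI[OF d0 \<pi>0]) simp
      then show ?thesis using * \<pi>d by simp
    qed
  qed
  have e: "exact_at C (d (Suc k)) (d k)" for k
  proof (subst exact_at_iff[OF d d])
    consider "Suc (Suc k) < l" | "Suc (Suc k) = l" | "Suc k = l" | "Suc k > l" by linarith
    then show "d k \<cdot> d (Suc k) = zer C (Q (Suc (Suc k))) (Q k) \<and> texact (d (Suc k)) (d k)"
    proof cases
      case 1
      then have *: "d k = diff_at P (- 1 - int k)" "d (Suc k) = diff_at P (- int k - 2)" "Q k = term_at P (- int k)"
        "Q (Suc k) = term_at P (- 1 - int k)" "Q (Suc (Suc k)) = term_at P (- int k - 2)"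
        by (auto simp: d_def Q_def algebra_simps)
      have "texact (d (Suc k)) (d k)"
        using exP[of _ _ "- 1 - int k"] minus_diff_commute[of 2 "int k"] by (intro texactI[OF d d]) (simp add: *)
      then show ?thesis unfolding * by simp
    next
      case 2
      then have *: "d k = diff_at P (m + 1)" "d (Suc k) = \<iota>" "Q k = term_at P (m + 2)"
        "Q (Suc k) = term_at P (m + 1)" "Q (Suc (Suc k)) = K"
        using l by (auto simp: d_def Q_def)
      have "texact (d (Suc k)) (d k)"
      proof (rule texactI[OF d d], unfold *)
        fix T a assume T: "projective C T" and a: "a \<in> Hom C T (term_at P (m + 1))" "diff_at P (m + 1) \<cdot> a = zer C T (term_at P (m + 2))"
        have "m + 1 < 0" using l 2 by simp
        then obtain v where v: "v \<in> Hom C T (term_at P (m + 1 - 1))" "diff_at P (m + 1 - 1) \<cdot> v = a"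
          using exP[OF T, of a "m + 1"] a by (auto simp: add.commute[of 2 m])
        then show "\<exists>b\<in>Hom C T K. \<iota> \<cdot> b = a" using m(6)[OF T, of v] by auto
      qed
      then show ?thesis unfolding * using m(5) by simp
    next
      case 3
      then have *: "d k = \<iota>" "Q (Suc k) = K" "Q k = term_at P (m + 1)" "d (Suc k) = zer C (Q (Suc (Suc k))) (Q (Suc k))"
        using l li[OF 3] by (auto simp: d_def Q_def)
      have "texact (d (Suc k)) (d k)"
      proof (rule texactI[OF d d])
        fix T a assume T: "projective C T" and a: "a \<in> Hom C T (Q (Suc k))" "d k \<cdot> a = zer C T (Q k)"
        have a': "a \<in> Hom C T K" "\<iota> \<cdot> a = zer C T (term_at P (m + 1))" using a * by auto
        then have "a = zer C T K" using m(4) unfolding mono_iff by simp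
        then show "\<exists>b\<in>Hom C T (Q (Suc (Suc k))). d (Suc k) \<cdot> b = a"
          using * projective_ob[OF T] by (intro bexI[of _ "zer C T (Q (Suc (Suc k)))"]) (simp_all add: zer_Hom)
      qed
      then show ?thesis using * by simp
    next
      case 4
      then have *: "Q (Suc k) = zob" "d k = zer C zob (Q k)" "d (Suc k) = zer C (Q (Suc (Suc k))) zob"
        by (auto simp: d_def Q_def)
      have "texact (d (Suc k)) (d k)"
      proof (rule texactI[OF d d])
        fix T a assume T: "projective C T" and a: "a \<in> Hom C T (Q (Suc k))" "d k \<cdot> a = zer C T (Q k)"
        then have "a = zer C T zob" using to_zero[OF zob] * by simp
        then show "\<exists>b\<in>Hom C T (Q (Suc (Suc k))). d (Suc k) \<cdot> b = a"
          using * projective_ob[OF T] by (intro bexI[of _ "zer C T (Q (Suc (Suc k)))"]) (simp_all add: zer_Hom)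
      qed
      then show ?thesis using * by simp
    qed
  qed
  have "projective_resolution C M Q d (\<pi> 0)"
    unfolding projective_resolution_def using projQ d \<pi>0 Q0 epi e0 e by simp
  moreover have "\<forall>k>l. zero_object C (Q k)" using zob by (simp add: Q_def)
  ultimately show ?thesis unfolding pd_finite_iff by blast
qed

text \<open>A finite projective resolution, with homological degree k placed in degree a - k, is a
  resolution of the stalk complex that is zero in low degrees, where \<open>lc\<close> is then
  immediate.\<close>

lemma pd_LC_stalk:
  assumes M: "M \<in> ob C" and pd: "pd C M < \<infinity>"
  shows "LC (stalk M a)"
proof -
  obtain l P d \<epsilon> where r: "projective_resolution C M P d \<epsilon>" and z: "\<And>k. k > l \<Longrightarrow> zero_object C (P k)"
    using pd unfolding pd_finite_iff by blast
  have proj: "projective C (P k)" and d: "d k \<in> Hom C (P (Suc k)) (P k)" and \<epsilon>: "\<epsilon> \<in> Hom C (P 0) M" "is_epi C \<epsilon>"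
    and e0: "exact_at C (d 0) \<epsilon>" and e: "exact_at C (d (Suc k)) (d k)" for k
    using r by (auto simp: projective_resolution_def)
  note [simp] = hom[OF d] hom[OF \<epsilon>(1)] M
  have d\<epsilon>: "\<epsilon> \<cdot> d 0 = zer C (P 1) M" "texact (d 0) \<epsilon>" using exact_at_iff[OF d \<epsilon>(1)] e0 by auto
  have dd: "d k \<cdot> d (Suc k) = zer C (P (Suc (Suc k))) (P k)" "texact (d (Suc k)) (d k)" for k
    using exact_at_iff[OF d d] e by auto
  define tQ where "tQ = (\<lambda>n. if n \<le> a then P (nat (a - n)) else zob)"
  define dQ where "dQ = (\<lambda>n. if n < a then d (nat (a - n - 1)) else zer C (tQ n) (tQ (n + 1)))"
  define Q where "Q = \<lparr>term_at = tQ, diff_at = dQ\<rparr>"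
  define \<pi> where "\<pi> = (\<lambda>n. if n = a then \<epsilon> else zer C (tQ n) (term_at (stalk M a) n))"
  have Q [simp]: "term_at Q n = tQ n" "diff_at Q n = dQ n" for n by (simp_all add: Q_def)
  have tQ [simp]: "tQ n \<in> ob C" for n using projective_ob[OF proj] by (simp add: tQ_def)
  have nat: "nat (a - n) = Suc (nat (a - n - 1))" if "n < a" for n using that by simp
  have tQ1: "tQ n = P (Suc (nat (a - n - 1)))" "tQ (n + 1) = P (nat (a - n - 1))" if "n < a" for n
    using that nat[OF that] by (auto simp: tQ_def algebra_simps)
  have dQ: "dQ n \<in> Hom C (tQ n) (tQ (n + 1))" for n
    using tQ1[of n] d by (auto simp: dQ_def zer_Hom)
  note [simp] = hom[OF dQ]
  have ddQ: "dQ (n + 1) \<cdot> dQ n = zer C (tQ n) (tQ (n + 2))" for n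
  proof (cases "n + 1 < a")
    case True
    have "nat (a - n - 1) = Suc (nat (a - n - 2))" using True by simp
    then show ?thesis using True tQ1[of n] tQ1[of "n + 1"] dd(1)[of "nat (a - n - 2)"]
      by (simp add: dQ_def algebra_simps)
  next
    case False
    then have "dQ (n + 1) = zer C (tQ (n + 1)) (tQ (n + 2))" by (simp add: dQ_def add.commute[of 2 n])
    then show ?thesis by simp
  qed
  have cQ: "cx Q" unfolding cx_def using dQ ddQ by simp
  have zQ: "zero_object C (tQ n)" if "n > a \<or> n < a - int l" for n
    using that zob z[of "nat (a - n)"] by (auto simp: tQ_def)
  have "projective C (tQ n)" for n using proj zero_object_projective[OF zob] by (simp add: tQ_def)
  then have bQ: "bounded_proj Q" unfolding bounded_proj_def using cQ zQ by auto
  have \<pi>H: "\<pi> n \<in> Hom C (tQ n) (term_at (stalk M a) n)" for n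
    using \<epsilon> by (simp add: \<pi>_def zer_Hom) (simp add: tQ_def)
  note [simp] = hom[OF \<pi>H]
  have \<pi>: "\<pi> \<in> chain_maps C Q (stalk M a)"
  proof (rule cmI)
    fix n
    show "diff_at (stalk M a) n \<cdot> \<pi> n = \<pi> (n + 1) \<cdot> diff_at Q n"
    proof (cases "n + 1 = a")
      case True
      then have "dQ n = d 0" "tQ n = P 1" by (auto simp: dQ_def tQ_def)
      then show ?thesis using True d\<epsilon>(1) hom[OF \<pi>H, of n] by (simp add: \<pi>_def)
    next
      case False
      have "zero_object C (term_at (stalk M a) (n + 1))" using False zob by simp
      then show ?thesis using to_zero hom[OF \<pi>H, of n] hom[OF \<pi>H, of "n + 1"] False
        by (auto simp: \<pi>_def)
    qed
  qed (use hom[OF \<pi>H] in auto)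
  have "qsurj Q (stalk M a) \<pi>"
  proof (rule qsurjI)
    fix T n y assume T: "projective C T" and y: "y \<in> Hom C T (term_at (stalk M a) n)"
    note [simp] = hom[OF y]
    show "\<exists>x u. x \<in> Hom C T (term_at Q n) \<and> diff_at Q n \<cdot> x = zer C T (term_at Q (n + 1)) \<and>
        u \<in> Hom C T (term_at (stalk M a) (n - 1)) \<and> y = \<pi> n \<cdot> x \<oplus> diff_at (stalk M a) (n - 1) \<cdot> u"
    proof (cases "n = a")
      case True
      then have y': "y \<in> Hom C T M" using y by simp
      note [simp] = hom[OF y']
      obtain x where x: "x \<in> Hom C T (P 0)" "\<epsilon> \<cdot> x = y" using projective_lift[OF T \<epsilon>(2,1) y'] .
      note [simp] = hom[OF x(1)]
      have "zero_object C (tQ (a + 1))" by (rule zQ) simp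
      then have "dQ a \<cdot> x = zer C T (tQ (a + 1))" by (rule to_zero) (simp add: HomI tQ_def)
      then show ?thesis using True x
        by (intro exI[of _ x] exI[of _ "zer C T zob"]) (simp add: tQ_def \<pi>_def zer_Hom)
    next
      case False
      then have "y = zer C T zob" using to_zero[OF zob] y by simp
      then show ?thesis using False hom[OF y]
        by (intro exI[of _ "zer C T (tQ n)"] exI[of _ "zer C T (term_at (stalk M a) (n - 1))"])
          (auto simp: \<pi>_def zer_Hom)
    qed
  qed
  moreover have "qinj Q (stalk M a) \<pi>"
  proof (rule qinjI)
    fix T n x u assume T: "projective C T" and x: "x \<in> Hom C T (term_at Q n)" "diff_at Q n \<cdot> x = zer C T (term_at Q (n + 1))"
     and u: "u \<in> Hom C T (term_at (stalk M a) (n - 1))" "\<pi> n \<cdot> x = diff_at (stalk M a) (n - 1) \<cdot> u"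
    note [simp] = hom[OF x(1)] hom[OF u(1)]
    consider "n > a" | "n = a" | "n < a" by linarith
    then show "\<exists>v\<in>Hom C T (term_at Q (n - 1)). x = diff_at Q (n - 1) \<cdot> v"
    proof cases
      case 1
      then have "x = zer C T (tQ n)" using to_zero[OF zQ] x(1) by simp
      then show ?thesis by (intro bexI[of _ "zer C T (tQ (n - 1))"]) (auto simp: zer_Hom)
    next
      case 2
      then have x': "x \<in> Hom C T (P 0)" "\<epsilon> \<cdot> x = zer C T M"
        using x(1) u hom[OF u(1)] by (simp_all add: tQ_def \<pi>_def)
      obtain v where "v \<in> Hom C T (P (Suc 0))" "d 0 \<cdot> v = x" using texactD[OF d\<epsilon>(2) d \<epsilon>(1) T x'] by blast
      then show ?thesis using 2 by (intro bexI[of _ v]) (auto simp: tQ_def dQ_def)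
    next
      case 3
      let ?k = "nat (a - n - 1)"
      have x': "x \<in> Hom C T (P (Suc ?k))" "d ?k \<cdot> x = zer C T (P ?k)"
        using x 3 tQ1[OF 3] by (simp_all add: dQ_def)
      obtain v where "v \<in> Hom C T (P (Suc (Suc ?k)))" "d (Suc ?k) \<cdot> v = x" using texactD[OF dd(2) d d T x'] by blast
      moreover have "nat (a - (n - 1) - 1) = Suc ?k" using 3 by simp
      ultimately show ?thesis using 3 tQ1[of "n - 1"] by (intro bexI[of _ v]) (simp_all add: dQ_def)
    qed
  qed
  ultimately have "res (stalk M a) Q \<pi>" unfolding res_def qis_def using bQ \<pi> by blast
  moreover have "lc Q" by (rule lc_if_bounded_below[OF cQ, of "a - int l - 1"]) (use zQ in auto)
  ultimately show ?thesis unfolding LC_def by blast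
qed

end

section \<open>An invariant of the singularity category\<close>

text \<open>Idempotent relations and the relations between them: the idempotent completion of the
  category of relations. Partial equivalence relations are objects, so no quotients are needed.\<close>

definition rel_cat :: "('a rel, 'a rel \<times> 'a rel \<times> 'a rel) cat" where
  "rel_cat = \<lparr>ob = {r. r O r = r}, mor = {(r, s, R). r O r = r \<and> s O s = s \<and> r O R = R \<and> R O s = R},
     src = fst, trg = fst \<circ> snd, idm = (\<lambda>r. (r, r, r)), cmp = (\<lambda>(s, t, S) (r, s', R). (r, t, R O S))\<rparr>"

lemma rel_cat_simps: "r \<in> ob rel_cat \<longleftrightarrow> r O r = r"
  "m \<in> Hom rel_cat r s \<longleftrightarrow> (\<exists>R. m = (r, s, R) \<and> r O r = r \<and> s O s = s \<and> r O R = R \<and> R O s = R)"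
  "src rel_cat m = fst m" "trg rel_cat m = fst (snd m)" "idm rel_cat r = (r, r, r)"
  "cmp rel_cat (s, t, S) (r, s', R) = (r, t, R O S)"
  by (auto simp: rel_cat_def Hom_def)

lemma rel_cat_category: "category rel_cat"
proof
  fix f :: "'a rel \<times> 'a rel \<times> 'a rel" assume "f \<in> mor rel_cat"
  then obtain r s R where f: "f = (r, s, R)" "r O r = r" "s O s = s" "r O R = R" "R O s = R"
    by (auto simp: rel_cat_def)
  show "src rel_cat f \<in> ob rel_cat" "trg rel_cat f \<in> ob rel_cat" "cmp rel_cat f (idm rel_cat (src rel_cat f)) = f"
    "cmp rel_cat (idm rel_cat (trg rel_cat f)) f = f" using f by (simp_all add: rel_cat_simps)
next
  fix r :: "'a rel" assume "r \<in> ob rel_cat"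
  then show "idm rel_cat r \<in> Hom rel_cat r r" by (simp add: rel_cat_simps)
next
  fix f g :: "'a rel \<times> 'a rel \<times> 'a rel" and r s t
  assume "f \<in> Hom rel_cat r s" "g \<in> Hom rel_cat s t"
  then obtain R S where f: "f = (r, s, R)" "r O r = r" "r O R = R" and g: "g = (s, t, S)" "t O t = t" "S O t = S"
    by (auto simp: rel_cat_simps(2))
  have "r O R O S = R O S" "(R O S) O t = R O S" using f g by (simp_all only: O_assoc[symmetric]) (simp_all only: O_assoc)
  then show "cmp rel_cat g f \<in> Hom rel_cat r t" using f g by (simp add: rel_cat_simps)
next
  fix f g h :: "'a rel \<times> 'a rel \<times> 'a rel" and q r s t
  assume "f \<in> Hom rel_cat q r" "g \<in> Hom rel_cat r s" "h \<in> Hom rel_cat s t"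
  then show "cmp rel_cat (cmp rel_cat h g) f = cmp rel_cat h (cmp rel_cat g f)"
    by (auto simp: rel_cat_simps O_assoc)
qed

text \<open>For a partial equivalence relation: there is at most one class. \<open>Domain\<close>
  and \<open>Range\<close> are kept apart because objects of \<open>rel_cat\<close> are merely
  idempotent relations.\<close>

definition trivial_rel :: "'a rel \<Rightarrow> bool" where
  "trivial_rel r \<longleftrightarrow> (\<forall>a \<in> Domain r. \<forall>b \<in> Range r. (a, b) \<in> r)"

text \<open>An isomorphism writes r as R O R' with R and R' absorbing s. Every path from the domain
  to the range of r passes through s, where triviality supplies the missing link.\<close>

lemma trivial_rel_iso:
  assumes iso: "isomorphic rel_cat r s" and s: "trivial_rel s" shows "trivial_rel r"
proof -
  obtain m where m: "m \<in> Hom rel_cat r s" "is_iso rel_cat m" using iso unfolding isomorphic_def by blast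
  obtain g where g: "g \<in> Hom rel_cat s r" "cmp rel_cat g m = idm rel_cat r"
    using m(2) unfolding is_iso_def by (auto simp: HomD[OF m(1)])
  obtain R where R: "m = (r, s, R)" "r O R = R" "R O s = R" using m(1) unfolding rel_cat_simps(2) by blast
  obtain R' where R': "g = (s, r, R')" "s O R' = R'" using g(1) unfolding rel_cat_simps(2) by blast
  have "R O R' = r" using g(2) R(1) R'(1) by (simp add: rel_cat_simps)
  note R = R(2,3) R'(2) this
  show ?thesis unfolding trivial_rel_def
  proof (intro ballI)
    fix a b assume "a \<in> Domain r" "b \<in> Range r"
    then obtain u v where "(a, u) \<in> R O R'" "(v, b) \<in> R O R'" unfolding R(4) by blast
    then obtain c d where "(a, c) \<in> R" "(d, b) \<in> R'" by blast
    then have "(a, c) \<in> R O s" "(d, b) \<in> s O R'" unfolding R(2,3) by simp_all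
    then obtain c' d' where "(a, c') \<in> R" "(c', c) \<in> s" "(d, d') \<in> s" "(d', b) \<in> R'" by blast
    then have "(a, d') \<in> R O s" using s unfolding trivial_rel_def by blast
    then have "(a, d') \<in> R" unfolding R(2) .
    then have "(a, b) \<in> R O R'" using \<open>(d', b) \<in> R'\<close> by blast
    then show "(a, b) \<in> r" unfolding R(4) .
  qed
qed

section \<open>Germs of cocycle families as a functor on the homotopy category\<close>

context abelian_enough
begin

definition the_res :: "('o, 'm) cochain \<Rightarrow> ('o, 'm) cochain \<times> (int \<Rightarrow> 'm)" where
  "the_res X = (SOME (P, \<pi>). res X P \<pi>)"

abbreviation "rP X \<equiv> fst (the_res X)"
abbreviation "r\<pi> X \<equiv> snd (the_res X)"

lemma the_res: assumes "X \<in> bc" shows "res X (rP X) (r\<pi> X)"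
proof -
  obtain P \<pi> where "res X P \<pi>" using bc_resolution[OF assms] .
  then have "case (P, \<pi>) of (P, \<pi>) \<Rightarrow> res X P \<pi>" by simp
  then have "case the_res X of (P, \<pi>) \<Rightarrow> res X P \<pi>" unfolding the_res_def by (rule someI)
  then show ?thesis by (simp add: case_prod_unfold)
qed

text \<open>Families of cocycles of \<open>Hom(P, Y n)\<close>, and equality up to coboundaries in low degrees.
  For a resolution \<open>P\<close> of \<open>X\<close> the classes are germs at infinity of elements of the Ext groups of \<open>X\<close>.\<close>

definition fam :: "(int \<Rightarrow> 'o) \<Rightarrow> ('o, 'm) cochain \<Rightarrow> (int \<Rightarrow> 'm) set" where
  "fam Y P = {\<phi>. \<forall>n. \<phi> n \<in> Hom C (term_at P n) (Y n) \<and> \<phi> n \<cdot> diff_at P (n - 1) = zer C (term_at P (n - 1)) (Y n)}"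

definition ev :: "(int \<Rightarrow> 'o) \<Rightarrow> ('o, 'm) cochain \<Rightarrow> (int \<Rightarrow> 'm) \<Rightarrow> (int \<Rightarrow> 'm) \<Rightarrow> bool" where
  "ev Y P \<phi> \<psi> \<longleftrightarrow> (\<exists>N. \<forall>n\<le>N. \<exists>h \<in> Hom C (term_at P (n + 1)) (Y n). \<phi> n = \<psi> n \<oplus> h \<cdot> diff_at P n)"

definition erel :: "(int \<Rightarrow> 'o) \<Rightarrow> ('o, 'm) cochain \<Rightarrow> (int \<Rightarrow> 'm) rel" where
  "erel Y P = {(\<phi>, \<psi>). \<phi> \<in> fam Y P \<and> \<psi> \<in> fam Y P \<and> ev Y P \<phi> \<psi>}"

lemma famD: assumes "\<phi> \<in> fam Y P" shows "\<phi> n \<in> Hom C (term_at P n) (Y n)"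
    "\<phi> n \<cdot> diff_at P (n - 1) = zer C (term_at P (n - 1)) (Y n)"
  using assms by (auto simp: fam_def)

lemma evI: "(\<And>n. n \<le> N \<Longrightarrow> \<exists>h \<in> Hom C (term_at P (n + 1)) (Y n). \<phi> n = \<psi> n \<oplus> h \<cdot> diff_at P n) \<Longrightarrow> ev Y P \<phi> \<psi>"
  unfolding ev_def by blast

lemma evE: assumes "ev Y P \<phi> \<psi>"
  obtains N where "\<forall>n\<le>N. \<exists>h \<in> Hom C (term_at P (n + 1)) (Y n). \<phi> n = \<psi> n \<oplus> h \<cdot> diff_at P n"
  using assms unfolding ev_def by blast

lemma ev_refl: assumes P: "cx P" and \<phi>: "\<phi> \<in> fam Y P" shows "ev Y P \<phi> \<phi>"
proof (rule evI)
  fix n :: int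
  note [simp] = P hom[OF famD(1)[OF \<phi>]]
  have "\<phi> n = \<phi> n \<oplus> zer C (term_at P (n + 1)) (Y n) \<cdot> diff_at P n" by simp
  then show "\<exists>h\<in>Hom C (term_at P (n + 1)) (Y n). \<phi> n = \<phi> n \<oplus> h \<cdot> diff_at P n" by (rule bexI) (simp add: zer_Hom)
qed

lemma ev_sym: assumes P: "cx P" and \<phi>: "\<phi> \<in> fam Y P" and \<psi>: "\<psi> \<in> fam Y P" and ev: "ev Y P \<phi> \<psi>" shows "ev Y P \<psi> \<phi>"
proof -
  obtain N where N: "\<forall>n\<le>N. \<exists>h \<in> Hom C (term_at P (n + 1)) (Y n). \<phi> n = \<psi> n \<oplus> h \<cdot> diff_at P n" using ev by (rule evE)
  show ?thesis
  proof (rule evI[of N])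
    fix n assume "n \<le> N"
    then obtain h where h: "h \<in> Hom C (term_at P (n + 1)) (Y n)" "\<phi> n = \<psi> n \<oplus> h \<cdot> diff_at P n" using N by blast
    note [simp] = P hom[OF famD(1)[OF \<psi>]] hom[OF h(1)]
    have "\<psi> n = \<phi> n \<oplus> neg C h \<cdot> diff_at P n" unfolding h(2) by (simp add: alg)
    then show "\<exists>h\<in>Hom C (term_at P (n + 1)) (Y n). \<psi> n = \<phi> n \<oplus> h \<cdot> diff_at P n" by (rule bexI) (simp add: HomI)
  qed
qed

lemma ev_trans: assumes P: "cx P" and \<chi>: "\<chi> \<in> fam Y P" and 1: "ev Y P \<phi> \<psi>" and 2: "ev Y P \<psi> \<chi>" shows "ev Y P \<phi> \<chi>"
proof -
  obtain N where N: "\<forall>n\<le>N. \<exists>h \<in> Hom C (term_at P (n + 1)) (Y n). \<phi> n = \<psi> n \<oplus> h \<cdot> diff_at P n" using 1 by (rule evE)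
  obtain M where M: "\<forall>n\<le>M. \<exists>h \<in> Hom C (term_at P (n + 1)) (Y n). \<psi> n = \<chi> n \<oplus> h \<cdot> diff_at P n" using 2 by (rule evE)
  show ?thesis
  proof (rule evI[of "min N M"])
    fix n assume "n \<le> min N M"
    then obtain h k where h: "h \<in> Hom C (term_at P (n + 1)) (Y n)" "\<phi> n = \<psi> n \<oplus> h \<cdot> diff_at P n"
      and k: "k \<in> Hom C (term_at P (n + 1)) (Y n)" "\<psi> n = \<chi> n \<oplus> k \<cdot> diff_at P n" using N M by (metis min.boundedE)
    note [simp] = P hom[OF famD(1)[OF \<chi>]] hom[OF h(1)] hom[OF k(1)]
    have "\<phi> n = \<chi> n \<oplus> (h \<oplus> k) \<cdot> diff_at P n" unfolding h(2) k(2) by (simp add: alg)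
    then show "\<exists>h\<in>Hom C (term_at P (n + 1)) (Y n). \<phi> n = \<chi> n \<oplus> h \<cdot> diff_at P n" by (rule bexI) (simp add: HomI)
  qed
qed

context
  fixes Y :: "int \<Rightarrow> 'o" and P P' G
  assumes P: "cx P" and P': "cx P'" and G: "G \<in> chain_maps C P P'"
begin

lemma fam_cmp: assumes \<psi>: "\<psi> \<in> fam Y P'" shows "(\<lambda>n. \<psi> n \<cdot> G n) \<in> fam Y P"
  unfolding fam_def
proof (intro CollectI allI conjI)
  fix n
  note [simp] = P P' hom[OF famD(1)[OF \<psi>]] cm_typ[OF G]
  show "\<psi> n \<cdot> G n \<in> Hom C (term_at P n) (Y n)" by (simp add: HomI)
  have "G n \<cdot> diff_at P (n - 1) = diff_at P' (n - 1) \<cdot> G (n - 1)" using cm_comm[OF G, of "n - 1"] by simp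
  then show "\<psi> n \<cdot> G n \<cdot> diff_at P (n - 1) = zer C (term_at P (n - 1)) (Y n)"
    using cmp_eq_assoc[OF famD(2)[OF \<psi>], of n "G (n - 1)"] by (simp add: assoc)
qed

lemma ev_cmp: assumes \<psi>: "\<psi> \<in> fam Y P'" and ev: "ev Y P' \<phi> \<psi>" shows "ev Y P (\<lambda>n. \<phi> n \<cdot> G n) (\<lambda>n. \<psi> n \<cdot> G n)"
proof -
  obtain N where N: "\<forall>n\<le>N. \<exists>h \<in> Hom C (term_at P' (n + 1)) (Y n). \<phi> n = \<psi> n \<oplus> h \<cdot> diff_at P' n" using ev by (rule evE)
  show ?thesis
  proof (rule evI[of N])
    fix n assume "n \<le> N"
    then obtain h where h: "h \<in> Hom C (term_at P' (n + 1)) (Y n)" "\<phi> n = \<psi> n \<oplus> h \<cdot> diff_at P' n" using N by blast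
    note [simp] = P P' hom[OF famD(1)[OF \<psi>]] hom[OF h(1)] cm_typ[OF G]
    have "\<phi> n \<cdot> G n = \<psi> n \<cdot> G n \<oplus> (h \<cdot> G (n + 1)) \<cdot> diff_at P n" unfolding h(2) by (simp add: alg cm_comm[OF G])
    then show "\<exists>h\<in>Hom C (term_at P (n + 1)) (Y n). \<phi> n \<cdot> G n = \<psi> n \<cdot> G n \<oplus> h \<cdot> diff_at P n"
      by (rule bexI) (simp add: HomI)
  qed
qed

text \<open>Of the two terms of a homotopy, the one starting with the differential of P' is killed
  by the cocycle \<psi>, and the other is a coboundary.\<close>

lemma ev_homotopic: assumes \<psi>: "\<psi> \<in> fam Y P'" and H: "H \<in> chain_maps C P P'" and GH: "homotopic C P P' G H"
  shows "ev Y P (\<lambda>n. \<psi> n \<cdot> G n) (\<lambda>n. \<psi> n \<cdot> H n)"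
proof -
  obtain s where s: "htp P P' G H s" using GH by (auto simp: homotopic_htp)
  note [simp] = P P' hom[OF famD(1)[OF \<psi>]] htp(1,2,3)[OF s] cm_typ[OF H]
  show ?thesis
  proof (rule evI)
    fix n :: int
    have "\<psi> n \<cdot> G n = \<psi> n \<cdot> H n \<oplus> (\<psi> n \<cdot> s (n + 1)) \<cdot> diff_at P n"
      using cmp_eq_assoc[OF famD(2)[OF \<psi>], of n "s n"] by (simp add: htp(4)[OF s, of n] cmp_add assoc)
    then show "\<exists>h\<in>Hom C (term_at P (n + 1)) (Y n). \<psi> n \<cdot> G n = \<psi> n \<cdot> H n \<oplus> h \<cdot> diff_at P n"
      by (rule bexI) (simp add: HomI)
  qed
qed

end

definition is_lift :: "('o, 'm) cochain \<Rightarrow> ('o, 'm) cochain \<Rightarrow> (int \<Rightarrow> 'm) \<Rightarrow> (int \<Rightarrow> 'm) \<Rightarrow> bool" where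
  "is_lift X X' f G \<longleftrightarrow> G \<in> chain_maps C (rP X) (rP X') \<and>
     homotopic C (rP X) X' (\<lambda>n. f n \<cdot> r\<pi> X n) (\<lambda>n. r\<pi> X' n \<cdot> G n)"

text \<open>Pulling back along G leads from cocycles on the resolution of X' to cocycles on that of
  X. As a relation read in the opposite direction it becomes covariant in X.\<close>

definition grel :: "(int \<Rightarrow> 'o) \<Rightarrow> ('o, 'm) cochain \<Rightarrow> ('o, 'm) cochain \<Rightarrow> (int \<Rightarrow> 'm) \<Rightarrow> (int \<Rightarrow> 'm) rel" where
  "grel Y X X' G = {(\<phi>, \<psi>). \<phi> \<in> fam Y (rP X) \<and> \<psi> \<in> fam Y (rP X') \<and> ev Y (rP X) \<phi> (\<lambda>n. \<psi> n \<cdot> G n)}"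

text \<open>A morphism of \<open>Kb C\<close> is a class of chain maps, and a lift of any
  representative may be used: lifts of homotopic chain maps are homotopic and define the same
  relation (\<open>lift_homotopic\<close>, \<open>grel_homotopic\<close>).\<close>

definition germ_functor :: "(int \<Rightarrow> 'o) \<Rightarrow> (('o, 'm) cochain, ('o, 'm) htpy_mor, (int \<Rightarrow> 'm) rel,
    (int \<Rightarrow> 'm) rel \<times> (int \<Rightarrow> 'm) rel \<times> (int \<Rightarrow> 'm) rel) functr" where
  "germ_functor Y = \<lparr>fob = (\<lambda>X. erel Y (rP X)),
     fmor = (\<lambda>(X, X', F). (erel Y (rP X), erel Y (rP X'), grel Y X X' (SOME G. \<exists>f\<in>F. is_lift X X' f G)))\<rparr>"

lemma lift_exists: assumes X: "X \<in> bc" and X': "X' \<in> bc" and f: "f \<in> chain_maps C X X'"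
  obtains G where "is_lift X X' f G"
proof -
  note p = resD[OF the_res[OF X]] and p' = resD[OF the_res[OF X']]
  show ?thesis
    using lift[OF p(5) p'(1) bc_cx[OF X'] p'(3,4) cm_cmp[OF p(3) f p(1) bc_cx[OF X] bc_cx[OF X']]] that
    unfolding is_lift_def by blast
qed

lemma lift_homotopic:
  assumes X: "X \<in> bc" and X': "X' \<in> bc" and f: "f \<in> chain_maps C X X'" "f' \<in> chain_maps C X X'"
    and h: "homotopic C X X' f f'" and G: "is_lift X X' f G" and G': "is_lift X X' f' G'"
  shows "homotopic C (rP X) (rP X') G G'"
proof -
  note p = resD[OF the_res[OF X]] and p' = resD[OF the_res[OF X']]
  note c [simp] = bc_cx[OF X] bc_cx[OF X'] p(1) p'(1)
  have g: "G \<in> chain_maps C (rP X) (rP X')" "homotopic C (rP X) X' (\<lambda>n. f n \<cdot> r\<pi> X n) (\<lambda>n. r\<pi> X' n \<cdot> G n)"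
    and g': "G' \<in> chain_maps C (rP X) (rP X')" "homotopic C (rP X) X' (\<lambda>n. f' n \<cdot> r\<pi> X n) (\<lambda>n. r\<pi> X' n \<cdot> G' n)"
    using G G' by (auto simp: is_lift_def)
  have m: "(\<lambda>n. f n \<cdot> r\<pi> X n) \<in> chain_maps C (rP X) X'" "(\<lambda>n. r\<pi> X' n \<cdot> G n) \<in> chain_maps C (rP X) X'"
    "(\<lambda>n. r\<pi> X' n \<cdot> G' n) \<in> chain_maps C (rP X) X'" "(\<lambda>n. f' n \<cdot> r\<pi> X n) \<in> chain_maps C (rP X) X'"
    using p p' f g g' by (auto intro!: cm_cmp)
  have "homotopic C (rP X) X' (\<lambda>n. f n \<cdot> r\<pi> X n) (\<lambda>n. f' n \<cdot> r\<pi> X n)"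
    by (rule homotopic_cmp_right[OF c(1,2) f h p(3) c(3)])
  then have "homotopic C (rP X) X' (\<lambda>n. f n \<cdot> r\<pi> X n) (\<lambda>n. r\<pi> X' n \<cdot> G' n)"
    by (rule homotopic_trans[OF c(3,2) m(3) _ g'(2)])
  then have "homotopic C (rP X) X' (\<lambda>n. r\<pi> X' n \<cdot> G n) (\<lambda>n. r\<pi> X' n \<cdot> G' n)"
    by (rule homotopic_trans[OF c(3,2) m(3) homotopic_sym[OF c(3,2) m(1,2) g(2)]])
  then show ?thesis by (rule lift_unique[OF p(5) p'(1) c(2) p'(3,4) g(1) g'(1)])
qed

lemma grel_homotopic:
  assumes X: "X \<in> bc" and X': "X' \<in> bc" and G: "G \<in> chain_maps C (rP X) (rP X')" and G': "G' \<in> chain_maps C (rP X) (rP X')"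
    and h: "homotopic C (rP X) (rP X') G G'"
  shows "grel Y X X' G = grel Y X X' G'"
proof -
  note p = resD(1)[OF the_res[OF X]] resD(1)[OF the_res[OF X']]
  have 1: "ev Y (rP X) \<phi> (\<lambda>n. \<psi> n \<cdot> G' n)" if "homotopic C (rP X) (rP X') G G'" "ev Y (rP X) \<phi> (\<lambda>n. \<psi> n \<cdot> G n)"
     "\<psi> \<in> fam Y (rP X')" "G \<in> chain_maps C (rP X) (rP X')" "G' \<in> chain_maps C (rP X) (rP X')" for \<phi> \<psi> G G'
    using ev_trans[OF p(1) fam_cmp[OF p that(5,3)] that(2) ev_homotopic[OF p that(4,3,5,1)]] .
  show ?thesis unfolding grel_def using 1[OF h _ _ G G'] 1[OF homotopic_sym[OF p G G' h] _ _ G' G] by blast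
qed

lemma fmor_germ:
  assumes X: "X \<in> bc" and X': "X' \<in> bc" and f: "f \<in> chain_maps C X X'" and G: "is_lift X X' f G"
  shows "fmor (germ_functor Y) (hclass C X X' f) = (erel Y (rP X), erel Y (rP X'), grel Y X X' G)"
proof -
  let ?Q = "\<lambda>G. \<exists>f'\<in>{g \<in> chain_maps C X X'. homotopic C X X' f g}. is_lift X X' f' G"
  have "?Q G" using G f homotopic_refl[OF bc_cx[OF X] bc_cx[OF X'] f] by blast
  then have "?Q (SOME G. ?Q G)" by (rule someI[of ?Q])
  then obtain f' where f': "f' \<in> chain_maps C X X'" "homotopic C X X' f f'" "is_lift X X' f' (SOME G. ?Q G)" by blast
  have "grel Y X X' G = grel Y X X' (SOME G. ?Q G)"
    using lift_homotopic[OF X X' f f'(1,2) G f'(3)] G f'(3) by (intro grel_homotopic[OF X X']) (auto simp: is_lift_def)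
  then show ?thesis by (simp add: germ_functor_def hclass_def)
qed

lemma fob_germ [simp]: "fob (germ_functor Y) X = erel Y (rP X)"
  by (simp add: germ_functor_def)

lemma erel_idem: "cx P \<Longrightarrow> erel Y P O erel Y P = erel Y P"
  unfolding erel_def using ev_refl ev_trans by blast

lemma grel_laws:
  assumes X: "X \<in> bc" and X': "X' \<in> bc" and G: "G \<in> chain_maps C (rP X) (rP X')"
  shows "erel Y (rP X) O grel Y X X' G = grel Y X X' G" "grel Y X X' G O erel Y (rP X') = grel Y X X' G"
proof -
  note p = resD(1)[OF the_res[OF X]] resD(1)[OF the_res[OF X']]
  note c = fam_cmp[OF p G, of _ Y] ev_cmp[OF p G, of _ Y]
  show "erel Y (rP X) O grel Y X X' G = grel Y X X' G"
    unfolding erel_def grel_def using ev_refl[OF p(1)] ev_trans[OF p(1) c(1)] by blast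
  show "grel Y X X' G O erel Y (rP X') = grel Y X X' G"
    unfolding erel_def grel_def using ev_refl[OF p(2)] ev_trans[OF p(1) c(1) _ c(2)] by blast
qed

lemma germ_functor: "is_functor (Kb C) rel_cat (germ_functor Y)"
proof -
  interpret Kb: category "Kb C" by (rule Kb_category)
  interpret R: category rel_cat by (rule rel_cat_category)
  show ?thesis
  proof
    fix X assume "X \<in> ob (Kb C)"
    then have X: "X \<in> bc" by simp
    note p = resD[OF the_res[OF X]]
    show "fob (germ_functor Y) X \<in> ob rel_cat" using erel_idem p(1) by (simp add: rel_cat_simps)
    have l: "is_lift X X (\<lambda>n. idm C (term_at X n)) (\<lambda>n. idm C (term_at (rP X) n))"
      unfolding is_lift_def using cm_idm[OF p(1)] homotopic_refl[OF p(1) bc_cx[OF X] p(3)] X p(1) cm_typ[OF p(3)] by simp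
    have "grel Y X X (\<lambda>n. idm C (term_at (rP X) n)) = erel Y (rP X)"
    proof -
      have "(\<lambda>n. \<psi> n \<cdot> idm C (term_at (rP X) n)) = \<psi>" if "\<psi> \<in> fam Y (rP X)" for \<psi>
        using hom[OF famD(1)[OF that]] by auto
      then show ?thesis unfolding grel_def erel_def by auto
    qed
    then show "fmor (germ_functor Y) (idm (Kb C) X) = idm rel_cat (fob (germ_functor Y) X)"
      using fmor_germ[OF X X cm_idm[OF bc_cx[OF X]] l] by (simp add: rel_cat_simps)
  next
    fix m X X' assume "m \<in> Hom (Kb C) X X'"
    then obtain f where f: "X \<in> bc" "X' \<in> bc" "f \<in> chain_maps C X X'" "m = hclass C X X' f" by (rule Kb_HomE)
    obtain G where G: "is_lift X X' f G" using lift_exists[OF f(1-3)] .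
    show "fmor (germ_functor Y) m \<in> Hom rel_cat (fob (germ_functor Y) X) (fob (germ_functor Y) X')"
      using grel_laws[OF f(1,2)] G erel_idem resD(1)[OF the_res[OF f(1)]] resD(1)[OF the_res[OF f(2)]]
      by (simp add: f(4) fmor_germ[OF f(1-3) G] rel_cat_simps is_lift_def)
  next
    fix m n X X' X'' assume "m \<in> Hom (Kb C) X X'" "n \<in> Hom (Kb C) X' X''"
    then obtain f g where f: "X \<in> bc" "X' \<in> bc" "X'' \<in> bc" "f \<in> chain_maps C X X'" "g \<in> chain_maps C X' X''"
      "m = hclass C X X' f" "n = hclass C X' X'' g" by (metis Kb_HomE)
    obtain G where G: "is_lift X X' f G" using lift_exists[OF f(1,2,4)] .
    obtain H where H: "is_lift X' X'' g H" using lift_exists[OF f(2,3,5)] .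
    note p = resD[OF the_res[OF f(1)]] and p' = resD[OF the_res[OF f(2)]] and p'' = resD[OF the_res[OF f(3)]]
    note c [simp] = bc_cx[OF f(1)] bc_cx[OF f(2)] bc_cx[OF f(3)] p(1) p'(1) p''(1)
    have G': "G \<in> chain_maps C (rP X) (rP X')" "homotopic C (rP X) X' (\<lambda>n. f n \<cdot> r\<pi> X n) (\<lambda>n. r\<pi> X' n \<cdot> G n)"
      and H': "H \<in> chain_maps C (rP X') (rP X'')" "homotopic C (rP X') X'' (\<lambda>n. g n \<cdot> r\<pi> X' n) (\<lambda>n. r\<pi> X'' n \<cdot> H n)"
      using G H by (auto simp: is_lift_def)
    note [simp] = cm_typ[OF f(4)] cm_typ[OF f(5)] cm_typ[OF p(3)] cm_typ[OF p'(3)] cm_typ[OF p''(3)] cm_typ[OF G'(1)] cm_typ[OF H'(1)]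
    have gf: "(\<lambda>n. g n \<cdot> f n) \<in> chain_maps C X X''" using f by (auto intro: cm_cmp)
    have HG: "(\<lambda>n. H n \<cdot> G n) \<in> chain_maps C (rP X) (rP X'')" using G' H' by (auto intro: cm_cmp)
    have "homotopic C (rP X) X'' (\<lambda>n. g n \<cdot> (f n \<cdot> r\<pi> X n)) (\<lambda>n. g n \<cdot> (r\<pi> X' n \<cdot> G n))"
      by (rule homotopic_cmp_left[OF _ _ _ _ G'(2) f(5)]) (use f p p' G' in \<open>auto intro!: cm_cmp\<close>)
    moreover have "homotopic C (rP X) X'' (\<lambda>n. g n \<cdot> r\<pi> X' n \<cdot> G n) (\<lambda>n. r\<pi> X'' n \<cdot> H n \<cdot> G n)"
      by (rule homotopic_cmp_right[OF _ _ _ _ H'(2) G'(1)]) (use f p' p'' H' in \<open>auto intro!: cm_cmp\<close>)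
    ultimately have "homotopic C (rP X) X'' (\<lambda>n. (g n \<cdot> f n) \<cdot> r\<pi> X n) (\<lambda>n. r\<pi> X'' n \<cdot> (H n \<cdot> G n))"
      using homotopic_trans[OF c(4,3) cm_cmp[OF HG p''(3) c(4,6,3)]] by (simp add: assoc)
    then have l: "is_lift X X'' (\<lambda>n. g n \<cdot> f n) (\<lambda>n. H n \<cdot> G n)" unfolding is_lift_def using HG by blast
    have "grel Y X X'' (\<lambda>n. H n \<cdot> G n) = grel Y X X' G O grel Y X' X'' H" (is "?L = ?R")
    proof
      have a: "(\<lambda>n. \<chi> n \<cdot> (H n \<cdot> G n)) = (\<lambda>n. (\<chi> n \<cdot> H n) \<cdot> G n)" if "\<chi> \<in> fam Y (rP X'')" for \<chi>
        using hom[OF famD(1)[OF that]] by (simp add: assoc)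
      show "?L \<subseteq> ?R"
      proof
        fix z assume "z \<in> ?L"
        then obtain \<phi> \<chi> where z: "z = (\<phi>, \<chi>)" "\<phi> \<in> fam Y (rP X)" "\<chi> \<in> fam Y (rP X'')" "ev Y (rP X) \<phi> (\<lambda>n. (\<chi> n \<cdot> H n) \<cdot> G n)"
          using a unfolding grel_def by auto
        \<comment> \<open>The intermediate family required by relational composition is the pullback
          of \<chi> along H.\<close>
        have f1: "(\<lambda>n. \<chi> n \<cdot> H n) \<in> fam Y (rP X')" by (rule fam_cmp[OF c(5,6) H'(1) z(3)])
        show "z \<in> ?R" unfolding z(1) grel_def using z f1 ev_refl[OF c(5) f1] by blast
      qed
      show "?R \<subseteq> ?L"
      proof
        fix z assume "z \<in> ?R"
        then obtain \<phi> \<psi> \<chi> where z: "z = (\<phi>, \<chi>)" "\<phi> \<in> fam Y (rP X)" "\<psi> \<in> fam Y (rP X')" "\<chi> \<in> fam Y (rP X'')"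
            "ev Y (rP X) \<phi> (\<lambda>n. \<psi> n \<cdot> G n)" "ev Y (rP X') \<psi> (\<lambda>n. \<chi> n \<cdot> H n)"
          unfolding grel_def by blast
        have f1: "(\<lambda>n. \<chi> n \<cdot> H n) \<in> fam Y (rP X')" by (rule fam_cmp[OF c(5,6) H'(1) z(4)])
        have "ev Y (rP X) \<phi> (\<lambda>n. (\<chi> n \<cdot> H n) \<cdot> G n)"
          by (rule ev_trans[OF c(4) fam_cmp[OF c(4,5) G'(1) f1] z(5) ev_cmp[OF c(4,5) G'(1) f1 z(6)]])
        then show "z \<in> ?L" unfolding z(1) grel_def using z a by auto
      qed
    qed
    then show "fmor (germ_functor Y) (cmp (Kb C) n m) = cmp rel_cat (fmor (germ_functor Y) n) (fmor (germ_functor Y) m)"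
      by (simp add: f cmp_Kb fmor_germ[OF f(1,2,4) G] fmor_germ[OF f(2,3,5) H] fmor_germ[OF f(1,3) gf l] rel_cat_simps)
  qed
qed

text \<open>The inverse is the converse relation. On low degrees \<open>lc_cone_surj\<close> and
  \<open>lc_cone_inj\<close> make pullback along G surjective and injective on classes; their bounds
  are uniform in y, so they serve all the objects Y n at once.\<close>

lemma germ_iso:
  assumes X: "X \<in> bc" and X': "X' \<in> bc" and f: "f \<in> chain_maps C X X'" and Z: "cone X X' f Z k j p q" "LC Z"
    and Y: "\<And>n. Y n \<in> ob C"
  shows "is_iso rel_cat (fmor (germ_functor Y) (hclass C X X' f))"
proof -
  note r = the_res[OF X] the_res[OF X'] and c [simp] = bc_cx[OF X] bc_cx[OF X']
  note p = resD[OF r(1)] and p' = resD[OF r(2)]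
  obtain G T K J A B g where G: "G \<in> chain_maps C (rP X) (rP X')" "homotopic C (rP X) X' (\<lambda>n. f n \<cdot> r\<pi> X n) (\<lambda>n. r\<pi> X' n \<cdot> G n)"
    and cy: "cone (rP X) (rP X') G T K J A B" and rT: "res Z T g"
    by (rule cone_resolution[OF Z(1) c f r])
  have l: "is_lift X X' f G" unfolding is_lift_def using G by blast
  have lcT: "lc T" using LC_iff[OF cone_cx[OF Z(1) c f] rT] Z(2) by simp
  obtain N where N: "\<forall>n\<le>N. \<forall>y \<phi>. \<phi> \<in> Hom C (term_at (rP X) n) y \<longrightarrow> \<phi> \<cdot> diff_at (rP X) (n - 1) = zer C (term_at (rP X) (n - 1)) y \<longrightarrow>
    (\<exists>\<psi> h. \<psi> \<in> Hom C (term_at (rP X') n) y \<and> \<psi> \<cdot> diff_at (rP X') (n - 1) = zer C (term_at (rP X') (n - 1)) y \<and>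
       h \<in> Hom C (term_at (rP X) (n + 1)) y \<and> \<phi> = \<psi> \<cdot> G n \<oplus> h \<cdot> diff_at (rP X) n)"
    using lc_cone_surj[OF cy p(1) p'(1) G(1) lcT] by blast
  obtain M where M: "\<forall>n\<le>M. \<forall>y \<psi> h. \<psi> \<in> Hom C (term_at (rP X') n) y \<longrightarrow> \<psi> \<cdot> diff_at (rP X') (n - 1) = zer C (term_at (rP X') (n - 1)) y \<longrightarrow>
    h \<in> Hom C (term_at (rP X) (n + 1)) y \<longrightarrow> \<psi> \<cdot> G n = h \<cdot> diff_at (rP X) n \<longrightarrow>
    (\<exists>h \<in> Hom C (term_at (rP X') (n + 1)) y. \<psi> = h \<cdot> diff_at (rP X') n)"
    using lc_cone_inj[OF cy p(1) p'(1) G(1) lcT] by blast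
  note [simp] = p(1) p'(1) cm_typ[OF G(1)]
  have surj: "\<exists>\<psi>\<in>fam Y (rP X'). ev Y (rP X) \<phi> (\<lambda>n. \<psi> n \<cdot> G n)" if \<phi>: "\<phi> \<in> fam Y (rP X)" for \<phi>
  proof -
    \<comment> \<open>Above N the germ imposes no condition, and the zero cocycle is chosen there so
      that \<psi> is a family in all degrees.\<close>
    have "\<exists>\<psi>. \<psi> \<in> Hom C (term_at (rP X') n) (Y n) \<and> \<psi> \<cdot> diff_at (rP X') (n - 1) = zer C (term_at (rP X') (n - 1)) (Y n) \<and>
       (n \<le> N \<longrightarrow> (\<exists>h \<in> Hom C (term_at (rP X) (n + 1)) (Y n). \<phi> n = \<psi> \<cdot> G n \<oplus> h \<cdot> diff_at (rP X) n))" for n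
    proof (cases "n \<le> N")
      case True
      then show ?thesis using N[rule_format, OF True famD[OF \<phi>, of n]] by blast
    next
      case False
      then show ?thesis by (intro exI[of _ "zer C (term_at (rP X') n) (Y n)"]) (simp add: zer_Hom Y)
    qed
    then obtain \<psi> where \<psi>: "\<And>n. \<psi> n \<in> Hom C (term_at (rP X') n) (Y n) \<and> \<psi> n \<cdot> diff_at (rP X') (n - 1) = zer C (term_at (rP X') (n - 1)) (Y n) \<and>
       (n \<le> N \<longrightarrow> (\<exists>h \<in> Hom C (term_at (rP X) (n + 1)) (Y n). \<phi> n = \<psi> n \<cdot> G n \<oplus> h \<cdot> diff_at (rP X) n))" by metis
    have "\<psi> \<in> fam Y (rP X')" using \<psi> by (simp add: fam_def)
    moreover have "ev Y (rP X) \<phi> (\<lambda>n. \<psi> n \<cdot> G n)" by (rule evI[of N]) (use \<psi> in blast)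
    ultimately show ?thesis by blast
  qed
  have inj: "ev Y (rP X') \<psi> \<psi>'" if \<psi>: "\<psi> \<in> fam Y (rP X')" and \<psi>': "\<psi>' \<in> fam Y (rP X')"
    and ev: "ev Y (rP X) (\<lambda>n. \<psi> n \<cdot> G n) (\<lambda>n. \<psi>' n \<cdot> G n)" for \<psi> \<psi>'
  proof -
    obtain L where L: "\<forall>n\<le>L. \<exists>h \<in> Hom C (term_at (rP X) (n + 1)) (Y n). \<psi> n \<cdot> G n = \<psi>' n \<cdot> G n \<oplus> h \<cdot> diff_at (rP X) n"
      using ev by (rule evE)
    show ?thesis
    proof (rule evI[of "min L M"])
      fix n assume n: "n \<le> min L M"
      obtain h where h: "h \<in> Hom C (term_at (rP X) (n + 1)) (Y n)" "\<psi> n \<cdot> G n = \<psi>' n \<cdot> G n \<oplus> h \<cdot> diff_at (rP X) n" using L n by auto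
      note [simp] = hom[OF famD(1)[OF \<psi>]] hom[OF famD(1)[OF \<psi>']] hom[OF h(1)]
      obtain h' where h': "h' \<in> Hom C (term_at (rP X') (n + 1)) (Y n)" "\<psi> n \<ominus> \<psi>' n = h' \<cdot> diff_at (rP X') n"
        using M[rule_format, of n "\<psi> n \<ominus> \<psi>' n" "Y n" h] n h by (auto simp: HomI alg famD(2)[OF \<psi>] famD(2)[OF \<psi>'])
      note [simp] = hom[OF h'(1)]
      have "\<psi> n = \<psi>' n \<oplus> h' \<cdot> diff_at (rP X') n" using h'(2) by (simp add: alg)
      then show "\<exists>h\<in>Hom C (term_at (rP X') (n + 1)) (Y n). \<psi> n = \<psi>' n \<oplus> h \<cdot> diff_at (rP X') n" using h'(1) by blast
    qed
  qed
  note fc = fam_cmp[OF p(1) p'(1) G(1), of _ Y] and ec = ev_cmp[OF p(1) p'(1) G(1), of _ Y]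
  let ?R = "grel Y X X' G"
  have RR: "?R O ?R\<inverse> = erel Y (rP X)"
  proof
    show "?R O ?R\<inverse> \<subseteq> erel Y (rP X)"
      unfolding grel_def erel_def using ev_trans[OF p(1) _ _ ev_sym[OF p(1) _ fc]] by blast
    show "erel Y (rP X) \<subseteq> ?R O ?R\<inverse>"
    proof
      fix z assume "z \<in> erel Y (rP X)"
      then obtain \<phi> \<phi>' where z: "z = (\<phi>, \<phi>')" "\<phi> \<in> fam Y (rP X)" "\<phi>' \<in> fam Y (rP X)" "ev Y (rP X) \<phi> \<phi>'"
        by (auto simp: erel_def)
      obtain \<psi> where \<psi>: "\<psi> \<in> fam Y (rP X')" "ev Y (rP X) \<phi>' (\<lambda>n. \<psi> n \<cdot> G n)" using surj[OF z(3)] by blast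
      have "ev Y (rP X) \<phi> (\<lambda>n. \<psi> n \<cdot> G n)" by (rule ev_trans[OF p(1) fc[OF \<psi>(1)] z(4) \<psi>(2)])
      then show "z \<in> ?R O ?R\<inverse>" unfolding z(1) grel_def using z \<psi> by blast
    qed
  qed
  have RR': "?R\<inverse> O ?R = erel Y (rP X')"
  proof
    show "?R\<inverse> O ?R \<subseteq> erel Y (rP X')"
      unfolding grel_def erel_def using inj ev_trans[OF p(1) fc ev_sym[OF p(1) _ fc]] by blast
    show "erel Y (rP X') \<subseteq> ?R\<inverse> O ?R"
      unfolding grel_def erel_def using fc ec ev_refl[OF p(1)] by blast
  qed
  have m: "fmor (germ_functor Y) (hclass C X X' f) = (erel Y (rP X), erel Y (rP X'), ?R)" by (rule fmor_germ[OF X X' f l])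
  note laws = grel_laws[OF X X' G(1), of Y] erel_idem[OF p(1), of Y] erel_idem[OF p'(1), of Y]
  have conv: "(erel Y P)\<inverse> = erel Y P" if "cx P" for P unfolding erel_def using ev_sym[OF that] by blast
  have "erel Y (rP X') O ?R\<inverse> = ?R\<inverse>" "?R\<inverse> O erel Y (rP X) = ?R\<inverse>"
    using laws(1,2) conv[OF p(1)] conv[OF p'(1)] by (metis converse_relcomp)+
  then show ?thesis unfolding m
    by (intro is_isoI[of _ _ "erel Y (rP X)" "erel Y (rP X')" "(erel Y (rP X'), erel Y (rP X), ?R\<inverse>)"])
      (simp_all add: rel_cat_simps laws RR RR')
qed

text \<open>A family of non-trivial cocycles in arbitrarily low degrees is a non-trivial germ.\<close>

lemma LC_iff_trivial:
  assumes X: "X \<in> bc"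
  shows "LC X \<longleftrightarrow> (\<forall>Y. (\<forall>n. Y n \<in> ob C) \<longrightarrow> trivial_rel (erel Y (rP X)))"
proof -
  note p [simp] = resD(1)[OF the_res[OF X]]
  have "lc (rP X) \<longleftrightarrow> (\<forall>Y. (\<forall>n. Y n \<in> ob C) \<longrightarrow> trivial_rel (erel Y (rP X)))" (is "_ \<longleftrightarrow> ?R")
  proof
    assume "lc (rP X)"
    then obtain N where N: "\<forall>n\<le>N. \<forall>y \<phi>. \<phi> \<in> Hom C (term_at (rP X) n) y \<longrightarrow>
     \<phi> \<cdot> diff_at (rP X) (n - 1) = zer C (term_at (rP X) (n - 1)) y \<longrightarrow> (\<exists>h \<in> Hom C (term_at (rP X) (n + 1)) y. \<phi> = h \<cdot> diff_at (rP X) n)"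
      by (rule lcE)
    show ?R unfolding trivial_rel_def
    proof (intro allI impI ballI)
      fix Y \<phi> \<psi> assume "\<phi> \<in> Domain (erel Y (rP X))" "\<psi> \<in> Range (erel Y (rP X))"
      then have f: "\<phi> \<in> fam Y (rP X)" "\<psi> \<in> fam Y (rP X)" by (auto simp: erel_def)
      have "ev Y (rP X) \<phi> \<psi>"
      proof (rule evI[of N])
        fix n assume n: "n \<le> N"
        note [simp] = hom[OF famD(1)[OF f(1)]] hom[OF famD(1)[OF f(2)]]
        obtain h where h: "h \<in> Hom C (term_at (rP X) (n + 1)) (Y n)" "\<phi> n \<ominus> \<psi> n = h \<cdot> diff_at (rP X) n"
          using N[rule_format, OF n, of "\<phi> n \<ominus> \<psi> n" "Y n"] by (auto simp: HomI alg famD(2)[OF f(1)] famD(2)[OF f(2)])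
        note [simp] = hom[OF h(1)]
        have "\<phi> n = \<psi> n \<oplus> h \<cdot> diff_at (rP X) n" using h(2) by (simp add: alg)
        then show "\<exists>h \<in> Hom C (term_at (rP X) (n + 1)) (Y n). \<phi> n = \<psi> n \<oplus> h \<cdot> diff_at (rP X) n" using h(1) by blast
      qed
      then show "(\<phi>, \<psi>) \<in> erel Y (rP X)" using f by (simp add: erel_def)
    qed
  next
    assume R: ?R
    show "lc (rP X)"
    proof (rule ccontr)
      assume "\<not> lc (rP X)"
      define bad where "bad n y \<phi> \<longleftrightarrow> \<phi> \<in> Hom C (term_at (rP X) n) y \<and>
        \<phi> \<cdot> diff_at (rP X) (n - 1) = zer C (term_at (rP X) (n - 1)) y \<and>
        \<not> (\<exists>h \<in> Hom C (term_at (rP X) (n + 1)) y. \<phi> = h \<cdot> diff_at (rP X) n)" for n y \<phi>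
      have bad: "\<exists>n\<le>N. \<exists>y \<phi>. bad n y \<phi>" for N
        using \<open>\<not> lc (rP X)\<close> unfolding lc_def bad_def by blast
      \<comment> \<open>A bad cocycle, together with its own test object, is chosen in each degree
        that has one; elsewhere a zero cocycle completes the family. Triviality would identify this
        family with zero in all low degrees.\<close>
      have "\<exists>y \<phi>. ((\<exists>y \<phi>. bad n y \<phi>) \<longrightarrow> bad n y \<phi>) \<and> \<phi> \<in> Hom C (term_at (rP X) n) y \<and>
        \<phi> \<cdot> diff_at (rP X) (n - 1) = zer C (term_at (rP X) (n - 1)) y" for n
      proof (cases "\<exists>y \<phi>. bad n y \<phi>")
        case True then show ?thesis by (metis bad_def)
      next
        case False
        then show ?thesis by (intro exI[of _ zob] exI[of _ "zer C (term_at (rP X) n) zob"]) (simp add: zer_Hom)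
      qed
      then obtain Y \<phi> where Y: "\<And>n. (\<exists>y \<phi>. bad n y \<phi>) \<Longrightarrow> bad n (Y n) (\<phi> n)" "\<And>n. \<phi> n \<in> Hom C (term_at (rP X) n) (Y n)"
        "\<And>n. \<phi> n \<cdot> diff_at (rP X) (n - 1) = zer C (term_at (rP X) (n - 1)) (Y n)" by metis
      let ?z = "\<lambda>n. zer C (term_at (rP X) n) (Y n)"
      have Yo: "Y n \<in> ob C" for n using Hom_ob2[OF Y(2)] .
      have f: "\<phi> \<in> fam Y (rP X)" "?z \<in> fam Y (rP X)" using Y Yo by (auto simp: fam_def zer_Hom)
      have "(\<phi>, ?z) \<in> erel Y (rP X)" using R Yo f ev_refl[OF p] unfolding trivial_rel_def erel_def by blast
      then obtain N where N: "\<forall>n\<le>N. \<exists>h \<in> Hom C (term_at (rP X) (n + 1)) (Y n). \<phi> n = ?z n \<oplus> h \<cdot> diff_at (rP X) n"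
        unfolding erel_def by (auto elim: evE)
      obtain n where n: "n \<le> N" "\<exists>y \<phi>. bad n y \<phi>" using bad by blast
      obtain h where h: "h \<in> Hom C (term_at (rP X) (n + 1)) (Y n)" "\<phi> n = ?z n \<oplus> h \<cdot> diff_at (rP X) n" using N n by blast
      note [simp] = hom[OF h(1)]
      have "\<phi> n = h \<cdot> diff_at (rP X) n" using h(2) by simp
      then show False using Y(1)[OF n(2)] h(1) unfolding bad_def by blast
    qed
  qed
  then show ?thesis using LC_iff[OF bc_cx[OF X] the_res[OF X]] by simp
qed

lemma LC_isomorphic:
  assumes "X \<in> bc" "X' \<in> bc" and "\<And>Y. (\<And>n. Y n \<in> ob C) \<Longrightarrow> isomorphic rel_cat (erel Y (rP X)) (erel Y (rP X'))"
  shows "LC X \<longleftrightarrow> LC X'"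
  using assms trivial_rel_iso category.isomorphic_sym[OF rel_cat_category] unfolding LC_iff_trivial[OF assms(1)] LC_iff_trivial[OF assms(2)]
  by metis

end

section \<open>Verdier quotients\<close>

lemma is_loc_verdier_quotient: "is_loc T (verdier_mors T S) (verdier_quotient T S)"
  by (simp add: is_loc_def verdier_quotient_def Let_def cat.defs)

lemma verdier_mors_mor: "verdier_mors T S \<subseteq> mor T"
  by (auto simp: verdier_mors_def)

lemma shift_verdier_quotient: "shift (verdier_quotient T S) = loc_induced T (verdier_mors T S) (shift T)"
  by (simp add: verdier_quotient_def Let_def cat.defs)

lemma triangles_verdier_quotient:
  "t \<in> triangles (verdier_quotient T S) \<longleftrightarrow> is_candidate (verdier_quotient T S) t \<and>
     (\<exists>u v w. (u, v, w) \<in> triangles T \<and> triangle_iso (verdier_quotient T S) t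
        (fmor (loc_functor T (verdier_mors T S)) u, fmor (loc_functor T (verdier_mors T S)) v,
         fmor (loc_functor T (verdier_mors T S)) w))"
proof -
  let ?Q = "fmor (loc_functor T (verdier_mors T S))"
  have "\<exists>T'. verdier_quotient T S = close_triangles T' \<and> triangles T' = {(?Q u, ?Q v, ?Q w) | u v w. (u, v, w) \<in> triangles T}"
    by (intro exI[of _ "cat.extend (localization T (verdier_mors T S)) \<lparr>shift = loc_induced T (verdier_mors T S) (shift T),
        triangles = {(?Q u, ?Q v, ?Q w) | u v w. (u, v, w) \<in> triangles T}\<rparr>"])
      (simp add: verdier_quotient_def Let_def cat.defs)
  then obtain T' where T': "verdier_quotient T S = close_triangles T'" "triangles T' = {(?Q u, ?Q v, ?Q w) | u v w. (u, v, w) \<in> triangles T}"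
    by blast
  show ?thesis unfolding T'(1) close_triangles_iff T'(2) by blast
qed

context preadditive_category
begin

lemma qis_shift:
  assumes X: "cx X" and Y: "cx Y" and f: "f \<in> chain_maps C X Y" and q: "qis X Y f"
  shows "qis (shift_complex C X) (shift_complex C Y) (\<lambda>n. f (n + 1))"
  unfolding qis_def
proof
  note [simp] = X Y cm_typ[OF f]
  show "qsurj (shift_complex C X) (shift_complex C Y) (\<lambda>n. f (n + 1))"
  proof (rule qsurjI)
    fix T n y assume T: "projective C T" and y: "y \<in> Hom C T (term_at (shift_complex C Y) n)"
      "diff_at (shift_complex C Y) n \<cdot> y = zer C T (term_at (shift_complex C Y) (n + 1))"
    have y': "y \<in> Hom C T (term_at Y (n + 1))" using y(1) by simp
    note [simp] = hom[OF y']
    have dy: "diff_at Y (n + 1) \<cdot> y = zer C T (term_at Y (n + 1 + 1))" using y(2) by (simp add: alg)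
    obtain x u where x: "x \<in> Hom C T (term_at X (n + 1))" "diff_at X (n + 1) \<cdot> x = zer C T (term_at X (n + 1 + 1))"
      "u \<in> Hom C T (term_at Y (n + 1 - 1))" "y = f (n + 1) \<cdot> x \<oplus> diff_at Y (n + 1 - 1) \<cdot> u"
      by (rule qsurjD[OF conjunct1[OF q[unfolded qis_def]] T y' dy])
    have u: "u \<in> Hom C T (term_at Y n)" using x(3) by simp
    note [simp] = hom[OF x(1)] hom[OF u]
    show "\<exists>x u. x \<in> Hom C T (term_at (shift_complex C X) n) \<and>
        diff_at (shift_complex C X) n \<cdot> x = zer C T (term_at (shift_complex C X) (n + 1)) \<and>
        u \<in> Hom C T (term_at (shift_complex C Y) (n - 1)) \<and> y = f (n + 1) \<cdot> x \<oplus> diff_at (shift_complex C Y) (n - 1) \<cdot> u"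
      using x by (intro exI[of _ x] exI[of _ "neg C u"]) (auto simp: HomI neg_cmp cmp_neg)
  qed
  show "qinj (shift_complex C X) (shift_complex C Y) (\<lambda>n. f (n + 1))"
  proof (rule qinjI)
    fix T n x u assume T: "projective C T" and x: "x \<in> Hom C T (term_at (shift_complex C X) n)"
      "diff_at (shift_complex C X) n \<cdot> x = zer C T (term_at (shift_complex C X) (n + 1))"
      and u: "u \<in> Hom C T (term_at (shift_complex C Y) (n - 1))" "f (n + 1) \<cdot> x = diff_at (shift_complex C Y) (n - 1) \<cdot> u"
    have x': "x \<in> Hom C T (term_at X (n + 1))" and u': "u \<in> Hom C T (term_at Y n)" using x(1) u(1) by simp_all
    note [simp] = hom[OF x'] hom[OF u']
    have dx: "diff_at X (n + 1) \<cdot> x = zer C T (term_at X (n + 1 + 1))" using x(2) by (simp add: alg)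
    obtain v where v: "v \<in> Hom C T (term_at X (n + 1 - 1))" "x = diff_at X (n + 1 - 1) \<cdot> v"
      by (rule qinjD[OF conjunct2[OF q[unfolded qis_def]] T x' dx, of "neg C u"]) (use u(2) in \<open>simp_all add: HomI neg_cmp cmp_neg\<close>)
    have v': "v \<in> Hom C T (term_at X n)" using v(1) by simp
    note [simp] = hom[OF v']
    show "\<exists>v\<in>Hom C T (term_at (shift_complex C X) (n - 1)). x = diff_at (shift_complex C X) (n - 1) \<cdot> v"
      using v(2) by (intro bexI[of _ "neg C v"]) (auto simp: HomI neg_cmp cmp_neg)
  qed
qed

end

section \<open>The categories \<open>Db C\<close> and \<open>Dsg C\<close> as localizations, and
  their morphisms with perfect cone\<close>

context abelian_enough
begin

abbreviation "WK \<equiv> verdier_mors (Kb C) (acyclic_complexes C)"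
abbreviation "WD \<equiv> verdier_mors (Db C) (Kb_Proj C)"

end

sublocale abelian_enough \<subseteq> K: localized "Kb C" WK "Db C"
  unfolding Db_def by (intro localized_localization Kb_category verdier_mors_mor is_loc_verdier_quotient)

sublocale abelian_enough \<subseteq> D: localized "Db C" WD "Dsg C"
  unfolding Dsg_def by (intro localized_localization K.category_L verdier_mors_mor is_loc_verdier_quotient)

sublocale abelian_enough \<subseteq> QK: is_functor "Kb C" "Db C" "loc_functor (Kb C) WK"
  by (rule K.loc_functor_is_functor)

sublocale abelian_enough \<subseteq> QD: is_functor "Db C" "Dsg C" "loc_functor (Db C) WD"
  by (rule D.loc_functor_is_functor)

context abelian_enough
begin

lemma ob_Db [simp]: "ob (Db C) = bc" and ob_Dsg [simp]: "ob (Dsg C) = bc"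
  by (simp_all add: K.L_simps D.L_simps)

abbreviation "hc \<equiv> hclass C"

lemma QK_simps: "m \<in> mor (Kb C) \<Longrightarrow> K.Q m \<in> mor (Db C)" "m \<in> mor (Kb C) \<Longrightarrow> src (Db C) (K.Q m) = src (Kb C) m"
    "m \<in> mor (Kb C) \<Longrightarrow> trg (Db C) (K.Q m) = trg (Kb C) m"
  by (simp_all del: K.loc_functor_simps(2))

lemma WK_iff: "X \<in> bc \<Longrightarrow> Y \<in> bc \<Longrightarrow> f \<in> chain_maps C X Y \<Longrightarrow> qis X Y f \<Longrightarrow> hc X Y f \<in> WK"
  unfolding Kb_quasi_isos by blast

lemma WKE: assumes "s \<in> WK"
  obtains X Y f where "X \<in> bc" "Y \<in> bc" "f \<in> chain_maps C X Y" "qis X Y f" "s = hc X Y f"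
  using assms unfolding Kb_quasi_isos by blast

lemma qis_Db_iso: "X \<in> bc \<Longrightarrow> Y \<in> bc \<Longrightarrow> f \<in> chain_maps C X Y \<Longrightarrow> qis X Y f \<Longrightarrow> is_iso (Db C) (K.Q (hc X Y f))"
  by (rule K.Q_iso[OF WK_iff])

lemma shift_Db: "shift (Db C) = loc_induced (Kb C) WK (shift (Kb C))"
  unfolding Db_def by (rule shift_verdier_quotient)

lemma shift_Db_loc: "loc_functors (Kb C) WK (Db C) (Kb C) WK (Db C) (shift (Kb C))"
  unfolding loc_functors_def loc_functors_axioms_def
  by (auto intro!: K.localized_axioms shift_functor elim!: WKE simp: fmor_shift WK_iff qis_shift cm_shift)

lemma shift_Db_functor: "is_functor (Db C) (Db C) (shift (Db C))"
  and shift_Db_ob: "fob (shift (Db C)) X = shift_complex C X"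
  unfolding shift_Db
  using loc_functors.loc_induced_functor[OF shift_Db_loc] loc_functors.fob_loc_induced[OF shift_Db_loc] by auto

lemma germ_inverting: assumes Y: "\<And>n. Y n \<in> ob C"
  shows "inverting_functor (Kb C) WK (Db C) rel_cat (germ_functor Y)"
  unfolding inverting_functor_def inverting_functor_axioms_def
proof (intro conjI allI impI K.localized_axioms germ_functor)
  fix s assume "s \<in> WK"
  then obtain X X' f where f: "X \<in> bc" "X' \<in> bc" "f \<in> chain_maps C X X'" "qis X X' f" "s = hc X X' f" by (rule WKE)
  obtain Z k j p q where Z: "cone X X' f Z k j p q" "Z \<in> bc" using cone_bc[OF f(1-3)] by blast
  have "exact_cx Z" using cone_exact_iff_qis[OF Z(1) bc_cx[OF f(1)] bc_cx[OF f(2)] f(3)] f(4) by simp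
  then show "is_iso rel_cat (fmor (germ_functor Y) s)"
    using germ_iso[OF f(1-3) Z(1) exact_LC[OF bc_cx[OF Z(2)]] Y] f(5) by simp
qed

abbreviation "germ_Db Y \<equiv> loc_lift (Kb C) rel_cat (germ_functor Y)"

lemma germ_Db_functor: "(\<And>n. Y n \<in> ob C) \<Longrightarrow> is_functor (Db C) rel_cat (germ_Db Y)"
  by (rule inverting_functor.loc_lift_functor[OF germ_inverting])

text \<open>The germ functors extend to \<open>Db C\<close> since acyclic cones are perfect, and by
  \<open>LC_isomorphic\<close> their values determine perfectness.\<close>

lemma Db_isomorphic_LC: assumes "X \<in> bc" "X' \<in> bc" "isomorphic (Db C) X X'" shows "LC X \<longleftrightarrow> LC X'"
proof (rule LC_isomorphic[OF assms(1,2)])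
  fix Y :: "int \<Rightarrow> 'o" assume Y: "\<And>n. Y n \<in> ob C"
  interpret is_functor "Db C" rel_cat "germ_Db Y" by (rule germ_Db_functor[OF Y])
  show "isomorphic rel_cat (erel Y (rP X)) (erel Y (rP X'))" using fob_isomorphic[OF assms(3)] by simp
qed

lemma LC_isomorphic_Kb_Proj:
  assumes "Z \<in> bc" "LC Z"
  obtains S c where "S \<in> Kb_Proj C" "c \<in> Hom (Db C) S Z" "is_iso (Db C) c"
proof -
  obtain S t where S: "S \<in> Kb_Proj C" "t \<in> chain_maps C S Z" "qis S Z t" using LC_Kb_Proj[OF assms] .
  have Sb: "S \<in> bc" using S(1) by (simp add: Kb_Proj_iff)
  show ?thesis
    using that[OF S(1), of "K.Q (hc S Z t)"] qis_Db_iso[OF Sb assms(1) S(2,3)] QK.fmor_Hom[OF hclass_Hom[OF Sb assms(1) S(2)]]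
    by simp
qed

text \<open>Up to isomorphism in the derived category, the morphisms with perfect cone are the chain
  maps with perfect cone.\<close>

definition perf_mor :: "('o, 'm) der_mor \<Rightarrow> ('o, 'm) cochain \<Rightarrow> ('o, 'm) cochain \<Rightarrow> (int \<Rightarrow> 'm) \<Rightarrow> ('o, 'm) cochain \<Rightarrow>
    (int \<Rightarrow> 'm) \<Rightarrow> (int \<Rightarrow> 'm) \<Rightarrow> (int \<Rightarrow> 'm) \<Rightarrow> (int \<Rightarrow> 'm) \<Rightarrow> ('o, 'm) der_mor \<Rightarrow> ('o, 'm) der_mor \<Rightarrow> bool" where
  "perf_mor u X X' f Z k j p q a b \<longleftrightarrow> u \<in> mor (Db C) \<and> X \<in> bc \<and> X' \<in> bc \<and> Z \<in> bc \<and> f \<in> chain_maps C X X' \<and>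
     cone X X' f Z k j p q \<and> LC Z \<and> a \<in> Hom (Db C) (src (Db C) u) X \<and> b \<in> Hom (Db C) (trg (Db C) u) X' \<and>
     is_iso (Db C) a \<and> is_iso (Db C) b \<and> cmp (Db C) b u = cmp (Db C) (K.Q (hc X X' f)) a"

text \<open>A triangle of \<open>Db C\<close> is isomorphic to the image of a triangle of
  \<open>Kb C\<close>, which is isomorphic to a standard one. Composing the first two components of
  these isomorphisms gives a and b; the third components show that Z is perfect.\<close>

lemma WD_perf_mor:
  assumes "u \<in> WD"
  obtains X X' f Z k j p q a b where "perf_mor u X X' f Z k j p q a b"
proof -
  note KQ = QK_simps and [simp del] = K.loc_functor_simps(2)
  obtain v w where u: "u \<in> mor (Db C)" and t: "(u, v, w) \<in> triangles (Db C)" and v: "trg (Db C) v \<in> Kb_Proj C"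
    using assms unfolding verdier_mors_def by blast
  obtain u' v' w' where c: "is_candidate (Db C) (u, v, w)" and t': "(u', v', w') \<in> triangles (Kb C)"
    and i: "triangle_iso (Db C) (u, v, w) (K.Q u', K.Q v', K.Q w')"
    using t unfolding Db_def triangles_verdier_quotient by blast
  obtain X X' Z f k j p q where s: "X \<in> bc" "X' \<in> bc" "Z \<in> bc" "f \<in> chain_maps C X X'" "cone X X' f Z k j p q"
      "triangle_iso (Kb C) (u', v', w') (hc X X' f, hc X' Z j, hc Z (shift_complex C X) p)"
      "is_candidate (Kb C) (u', v', w')"
      by (rule Kb_triangleE[OF t'])
  have m: "u' \<in> mor (Kb C)" "v' \<in> mor (Kb C)" "w' \<in> mor (Kb C)" "src (Kb C) v' = trg (Kb C) u'" "src (Kb C) w' = trg (Kb C) v'"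
    using s(7) by auto
  have m': "v \<in> mor (Db C)" "w \<in> mor (Db C)" "src (Db C) v = trg (Db C) u" "src (Db C) w = trg (Db C) v"
    using c by auto
  obtain a' b' c' where a': "a' \<in> Hom (Kb C) (src (Kb C) u') X" "b' \<in> Hom (Kb C) (trg (Kb C) u') X'" "c' \<in> Hom (Kb C) (trg (Kb C) v') Z"
      "is_iso (Kb C) a'" "is_iso (Kb C) b'" "is_iso (Kb C) c'" "cmp (Kb C) b' u' = cmp (Kb C) (hc X X' f) a'"
    using s(6) m by auto
  obtain a b c where a: "a \<in> Hom (Db C) (src (Db C) u) (src (Kb C) u')" "b \<in> Hom (Db C) (trg (Db C) u) (trg (Kb C) u')"
      "c \<in> Hom (Db C) (trg (Db C) v) (trg (Kb C) v')"
      "is_iso (Db C) a" "is_iso (Db C) b" "is_iso (Db C) c" "cmp (Db C) b u = cmp (Db C) (K.Q u') a"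
    using i unfolding triangle_iso.simps m' KQ(2)[OF m(1)] KQ(2)[OF m(2)] KQ(2)[OF m(3)] m(4,5) by blast
  note [simp] = HomD[OF a(1)] HomD[OF a(2)] HomD[OF a(3)] HomD[OF a'(1)] HomD[OF a'(2)] HomD[OF a'(3)] u m m'
  have f: "hc X X' f \<in> mor (Kb C)" using s by simp
  let ?a = "cmp (Db C) (K.Q a') a" and ?b = "cmp (Db C) (K.Q b') b" and ?c = "cmp (Db C) (K.Q c') c"
  have iso: "is_iso (Db C) ?a" "is_iso (Db C) ?b" "is_iso (Db C) ?c"
    using a a' by (auto intro!: D.iso_cmp QK.fmor_iso)
  have "isomorphic (Db C) (trg (Db C) v) Z"
    by (rule D.isomorphicI[OF iso(3)]) simp_all
  then have "LC Z" using Db_isomorphic_LC[of "trg (Db C) v" Z] Kb_Proj_LC[OF v] v s(3) by (simp add: Kb_Proj_iff)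
  moreover have "cmp (Db C) ?b u = cmp (Db C) (K.Q (hc X X' f)) ?a"
  proof -
    have "cmp (Db C) ?b u = cmp (Db C) (K.Q b') (cmp (Db C) (K.Q u') a)" by (simp add: D.assoc a(7))
    also have "\<dots> = cmp (Db C) (K.Q (cmp (Kb C) b' u')) a" by (simp add: D.assoc QK.fmor_cmp')
    also have "\<dots> = cmp (Db C) (K.Q (hc X X' f)) ?a" using f by (simp add: D.assoc QK.fmor_cmp' a'(7))
    finally show ?thesis .
  qed
  ultimately have "perf_mor u X X' f Z k j p q ?a ?b"
    unfolding perf_mor_def using s iso by (auto intro!: HomI)
  then show ?thesis by (rule that)
qed

text \<open>The standard triangle of f is transported to one that starts with u. \<open>WD\<close>
  asks for a third object in \<open>Kb_Proj C\<close> itself, so the perfect cone Z is replaced by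
  an isomorphic complex S from that set.\<close>

lemma perf_mor_WD:
  assumes pm: "perf_mor u X X' f Z k j p q a b" shows "u \<in> WD"
proof -
  note KQ = QK_simps and [simp del] = K.loc_functor_simps(2)
  have u: "u \<in> mor (Db C)" and X: "X \<in> bc" "X' \<in> bc" "Z \<in> bc" and f: "f \<in> chain_maps C X X'"
    and Z: "cone X X' f Z k j p q" "LC Z" and a: "a \<in> Hom (Db C) (src (Db C) u) X" "b \<in> Hom (Db C) (trg (Db C) u) X'"
    "is_iso (Db C) a" "is_iso (Db C) b" "cmp (Db C) b u = cmp (Db C) (K.Q (hc X X' f)) a"
    using pm by (auto simp: perf_mor_def)
  obtain S c where S: "S \<in> Kb_Proj C" and c: "c \<in> Hom (Db C) S Z" "is_iso (Db C) c"
    using LC_isomorphic_Kb_Proj[OF X(3) Z(2)] .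
  interpret S: is_functor "Db C" "Db C" "shift (Db C)" by (rule shift_Db_functor)
  let ?f = "hc X X' f" and ?j = "hc X' Z j" and ?p = "hc Z (shift_complex C X) p"
  have j: "j \<in> chain_maps C X' Z" and p: "p \<in> chain_maps C Z (shift_complex C X)"
    using cone_j[OF Z(1) bc_cx[OF X(1)] bc_cx[OF X(2)] f] cone_p[OF Z(1) bc_cx[OF X(1)] bc_cx[OF X(2)] f] by auto
  have m: "?f \<in> mor (Kb C)" "?j \<in> mor (Kb C)" "?p \<in> mor (Kb C)" using X f j p by auto
  note [simp] = u HomD[OF a(1)] HomD[OF a(2)] HomD[OF c(1)] a(3,4) c(2) m
  let ?v = "cmp (Db C) (inv_mor (Db C) c) (cmp (Db C) (K.Q ?j) b)"
  let ?w = "cmp (Db C) (fmor (shift (Db C)) (inv_mor (Db C) a)) (cmp (Db C) (K.Q ?p) c)"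
  have cand: "is_candidate (Db C) (u, ?v, ?w)" by (simp add: shift_Db_ob)
  have "cmp (Db C) c ?v = cmp (Db C) (K.Q ?j) b" by (rule D.inv_mor_cancel2) simp_all
  moreover have "cmp (Db C) (fmor (shift (Db C)) a) ?w = cmp (Db C) (K.Q ?p) c"
  proof -
    have "cmp (Db C) (fmor (shift (Db C)) a) ?w = cmp (Db C) (cmp (Db C) (fmor (shift (Db C)) a) (fmor (shift (Db C)) (inv_mor (Db C) a))) (cmp (Db C) (K.Q ?p) c)"
      by (simp add: D.assoc shift_Db_ob)
    also have "cmp (Db C) (fmor (shift (Db C)) a) (fmor (shift (Db C)) (inv_mor (Db C) a)) = idm (Db C) (shift_complex C X)"
      using X by (simp add: S.fmor_cmp'[symmetric] inv_mor_right S.fmor_idm shift_Db_ob)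
    finally show ?thesis by simp
  qed
  moreover have s: "src (Db C) (K.Q ?f) = X" "src (Db C) (K.Q ?j) = X'" "src (Db C) (K.Q ?p) = Z"
    "src (Db C) ?v = trg (Db C) u" "src (Db C) ?w = S" by (simp_all add: shift_Db_ob)
  ultimately have "triangle_iso (Db C) (u, ?v, ?w) (K.Q ?f, K.Q ?j, K.Q ?p)"
    unfolding triangle_iso.simps s using a c by blast
  moreover have "(?f, ?j, ?p) \<in> triangles (Kb C)" by (rule standard_triangle[OF X f Z(1)])
  ultimately have "(u, ?v, ?w) \<in> triangles (Db C)"
    using cand unfolding Db_def triangles_verdier_quotient by blast
  moreover have "trg (Db C) ?v \<in> Kb_Proj C" using S by simp
  ultimately show ?thesis unfolding verdier_mors_def using u by blast
qed

lemma perf_chain_map_WD: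
  assumes "X \<in> bc" "X' \<in> bc" "Z \<in> bc" "f \<in> chain_maps C X X'" "cone X X' f Z k j p q" "LC Z"
  shows "K.Q (hc X X' f) \<in> WD"
proof (rule perf_mor_WD)
  have m: "hc X X' f \<in> mor (Kb C)" using assms by simp
  show "perf_mor (K.Q (hc X X' f)) X X' f Z k j p q (idm (Db C) X) (idm (Db C) X')"
    unfolding perf_mor_def using assms m
    by (auto simp: QK_simps intro!: D.iso_idm HomI simp del: K.loc_functor_simps(2))
qed

text \<open>Up to isomorphisms in \<open>Db C\<close> an element of \<open>WD\<close> is a chain map
  with perfect cone, to which \<open>germ_iso\<close> applies. The isomorphisms are then cancelled
  in \<open>rel_cat\<close>.\<close>

lemma germ_Db_inverting: assumes Y: "\<And>n. Y n \<in> ob C"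
  shows "inverting_functor (Db C) WD (Dsg C) rel_cat (germ_Db Y)"
  unfolding inverting_functor_def inverting_functor_axioms_def
proof (intro conjI allI impI D.localized_axioms germ_Db_functor[OF Y])
  interpret G: is_functor "Db C" rel_cat "germ_Db Y" by (rule germ_Db_functor[OF Y])
  note [simp del] = K.loc_functor_simps(2)
  fix u assume "u \<in> WD"
  then obtain X X' f Z k j p q a b where "perf_mor u X X' f Z k j p q a b" by (rule WD_perf_mor)
  then have u: "u \<in> mor (Db C)" and X: "X \<in> bc" "X' \<in> bc" "Z \<in> bc" and f: "f \<in> chain_maps C X X'"
    and Z: "cone X X' f Z k j p q" "LC Z" and a: "a \<in> Hom (Db C) (src (Db C) u) X" "b \<in> Hom (Db C) (trg (Db C) u) X'"
    "is_iso (Db C) a" "is_iso (Db C) b" "cmp (Db C) b u = cmp (Db C) (K.Q (hc X X' f)) a"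
    by (auto simp: perf_mor_def)
  have m: "hc X X' f \<in> mor (Kb C)" using X f by simp
  note [simp] = u HomD[OF a(1)] HomD[OF a(2)] m
  have "is_iso rel_cat (fmor (germ_Db Y) (K.Q (hc X X' f)))"
    using germ_iso[OF X(1,2) f Z Y] inverting_functor.loc_lift_Q[OF germ_inverting[OF Y] m] by simp
  then have "is_iso rel_cat (fmor (germ_Db Y) (cmp (Db C) b u))"
    unfolding a(5) using a(3) by (simp add: G.fmor_cmp' G.fmor_iso G.cod.iso_cmp)
  then have i: "is_iso rel_cat (cmp rel_cat (fmor (germ_Db Y) b) (fmor (germ_Db Y) u))" by (simp add: G.fmor_cmp')
  show "is_iso rel_cat (fmor (germ_Db Y) u)"
    by (rule G.cod.iso_cancel_left[OF G.fmor_iso[OF a(4)] i]) (use G.fmor_mor G.fmor_src G.fmor_trg in simp_all)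
qed

text \<open>As the germ functors invert \<open>WD\<close>, they descend to \<open>Dsg C\<close>.
  This makes perfectness visible there, and in particular an object isomorphic to a zero complex is
  perfect.\<close>

lemma Dsg_isomorphic_LC: assumes "X \<in> bc" "X' \<in> bc" "isomorphic (Dsg C) X X'" shows "LC X \<longleftrightarrow> LC X'"
proof (rule LC_isomorphic[OF assms(1,2)])
  fix Y :: "int \<Rightarrow> 'o" assume Y: "\<And>n. Y n \<in> ob C"
  interpret is_functor "Dsg C" rel_cat "loc_lift (Db C) rel_cat (germ_Db Y)"
    by (rule inverting_functor.loc_lift_functor[OF germ_Db_inverting[OF Y]])
  show "isomorphic rel_cat (erel Y (rP X)) (erel Y (rP X'))" using fob_isomorphic[OF assms(3)] by simp
qed

end

section \<open>Devissage\<close>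

context preadditive_category
begin

lemma degreewise_iso_Kb:
  assumes X: "X \<in> bc" and Y: "Y \<in> bc" and f: "f \<in> chain_maps C X Y" and iso: "\<And>n. is_iso C (f n)"
  shows "is_iso (Kb C) (hclass C X Y f)"
proof -
  note c [simp] = bc_cx[OF X] bc_cx[OF Y] cm_typ[OF f] iso
  let ?g = "\<lambda>n. inv_mor C (f n)"
  have g: "?g \<in> chain_maps C Y X"
  proof (rule cmI)
    fix n
    have "diff_at X n \<cdot> ?g n = ?g (n + 1) \<cdot> (f (n + 1) \<cdot> (diff_at X n \<cdot> ?g n))"
      by (rule inv_mor_cancel1[symmetric]) simp_all
    also have "\<dots> = ?g (n + 1) \<cdot> (diff_at Y n \<cdot> (f n \<cdot> ?g n))" by (simp add: cm_comm'[OF f])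
    also have "\<dots> = ?g (n + 1) \<cdot> diff_at Y n" by (simp add: inv_mor_right)
    finally show "diff_at X n \<cdot> ?g n = ?g (n + 1) \<cdot> diff_at Y n" .
  qed simp_all
  show ?thesis
    by (rule is_isoI[OF hclass_Hom[OF X Y f] hclass_Hom[OF Y X g]])
      (use X Y f g in \<open>simp_all add: inv_mor_left inv_mor_right\<close>)
qed

lemma zero_iso: assumes "zero_object C x" "zero_object C y" shows "is_iso C (zer C x y)"
  using assms by (intro is_isoI[of _ C x y "zer C y x"]) (auto simp: zer_Hom zero_object_iff)

end

context abelian_enough
begin

lemma cokernel_texact: assumes f: "f \<in> Hom C x y" and c: "is_cokernel C f c" shows "texact f c"
proof -
  have cH: "c \<in> Hom C y (trg C c)" using c f by (auto simp: is_cokernel_def Hom_def)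
  obtain k where "is_kernel C c k" using ex_kernel[OF Hom_mor[OF cH]] by blast
  then have "exact_at C f c" using c unfolding exact_at_def is_image_def by blast
  then show ?thesis using exact_at_iff[OF f cH] by blast
qed

lemma zero_complex_LC: assumes X: "X \<in> bc" and z: "\<And>n. zero_object C (term_at X n)" shows "LC X"
proof (rule exact_LC[OF bc_cx[OF X]], rule exact_cxI)
  note [simp] = bc_cx[OF X]
  fix T n x assume T: "projective C T" and x: "x \<in> Hom C T (term_at X n)"
  have "x = diff_at X (n - 1) \<cdot> zer C T (term_at X (n - 1))"
    using to_zero[OF z x] projective_ob[OF T] by simp
  then show "\<exists>v\<in>Hom C T (term_at X (n - 1)). x = diff_at X (n - 1) \<cdot> v"
    by (rule bexI) (simp add: zer_Hom projective_ob[OF T])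
qed

lemma stalk_iso_LC: assumes iso: "isomorphic C M M'" and LC: "LC (stalk M a)" shows "LC (stalk M' a)"
proof -
  obtain f where f: "f \<in> Hom C M M'" "is_iso C f" using iso unfolding isomorphic_def by blast
  note [simp] = hom[OF f(1)]
  let ?f = "\<lambda>n. if n = a then f else zer C zob zob"
  have c: "?f \<in> chain_maps C (stalk M a) (stalk M' a)" by (rule cmI) auto
  have b: "stalk M a \<in> bc" "stalk M' a \<in> bc" by (simp_all add: stalk_bc)
  have "qis (stalk M a) (stalk M' a) ?f"
    by (rule Kb_iso_qis[OF b c degreewise_iso_Kb[OF b c]]) (simp add: f(2) zero_iso zob)
  then show ?thesis using LC_qis[OF b c] LC by simp
qed

text \<open>Induction on the number k of degrees in which X may be non-zero. The lowest term is
  split off by writing X as a cone. The stalks are taken in degree n + 1 because the first summand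
  of a cone is shifted.\<close>

lemma LC_from_stalks_aux:
  "X \<in> bc \<Longrightarrow> (\<And>n. LC (stalk (term_at X n) (n + 1))) \<Longrightarrow> (\<And>n. n > b \<or> n \<le> b - int k \<Longrightarrow> zero_object C (term_at X n)) \<Longrightarrow> LC X"
proof (induction k arbitrary: X)
  case 0
  then have "zero_object C (term_at X n)" for n by (metis diff_zero linorder_le_less_linear of_nat_0)
  then show ?case by (rule zero_complex_LC[OF 0(1)])
next
  case (Suc k)
  define a where "a = b - int k"
  note X = bc_cx[OF Suc.prems(1)] and [simp] = bc_cx[OF Suc.prems(1)]
  have z: "zero_object C (term_at X n)" if "n < a \<or> n > b" for n
    using Suc.prems(3)[of n] that by (auto simp: a_def)
  let ?U = "stalk (term_at X a) (a + 1)"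
  \<comment> \<open>The part of X in degrees above a, with the term in degree a replaced by
    zero.\<close>
  define V where "V = \<lparr>term_at = (\<lambda>n. if n \<le> a then zob else term_at X n),
     diff_at = (\<lambda>n. if n \<le> a then zer C zob (if n + 1 \<le> a then zob else term_at X (n + 1)) else diff_at X n)\<rparr>"
  have V [simp]: "term_at V n = (if n \<le> a then zob else term_at X n)"
     "diff_at V n = (if n \<le> a then zer C zob (if n + 1 \<le> a then zob else term_at X (n + 1)) else diff_at X n)" for n
    by (simp_all add: V_def)
  have cV: "cx V" unfolding cx_def by (auto simp: HomI zer_Hom add.commute[of 2])
  obtain N where N: "\<And>n. \<bar>n\<bar> > N \<Longrightarrow> zero_object C (term_at X n)" using Suc.prems(1) unfolding bounded_complexes_iff bd_def by blast
  have bV: "V \<in> bc" unfolding bounded_complexes_iff bd_def using cV N zob by auto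
  have "LC V"
  proof (rule Suc.IH[OF bV])
    fix n
    show "LC (stalk (term_at V n) (n + 1))"
      using Suc.prems(2)[of n] zero_complex_LC[OF stalk_bc[of zob]] zob by simp
  next
    fix n assume "b < n \<or> n \<le> b - int k" then show "zero_object C (term_at V n)" using z zob by (auto simp: a_def)
  qed
  moreover have "LC ?U" by (rule Suc.prems(2))
  moreover have bU: "?U \<in> bc" by (simp add: stalk_bc)
  \<comment> \<open>The attaching map is the differential out of degree a. Its cone is X itself,
    where the sign in the cone is invisible because the stalk has zero differential.\<close>
  let ?f = "\<lambda>n. if n = a + 1 then diff_at X a else zer C zob (term_at V n)"
  have f: "?f \<in> chain_maps C ?U V" by (rule cmI) (auto simp: add.commute[of 2 a])
  let ?k = "\<lambda>n. if n = a then idm C (term_at X a) else zer C zob (term_at X n)"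
  let ?p = "\<lambda>n. if n = a then idm C (term_at X a) else zer C (term_at X n) zob"
  let ?j = "\<lambda>n. if n \<le> a then zer C zob (term_at X n) else idm C (term_at X n)"
  let ?q = "\<lambda>n. if n \<le> a then zer C (term_at X n) zob else idm C (term_at X n)"
  have id0: "idm C (term_at X n) = zer C (term_at X n) (term_at X n)" if "n < a" for n
    using z[of n] that by (simp add: zero_object_iff)
  have idz: "idm C zob = zer C zob zob" using zob by (simp add: zero_object_iff)
  have "cone ?U V ?f X ?k ?j ?p ?q" unfolding cone_def is_biproduct_def
  proof (intro allI conjI)
    fix n
    have d0: "diff_at X n = zer C (term_at X n) (term_at X (n + 1))" if "n < a"
      using from_zero[OF z, of n "diff_at X n"] that by (simp add: HomI)
    consider "n < a" | "n = a" | "n > a" by linarith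
    then show "diff_at X n = ?k (n + 1) \<cdot> neg C (diff_at ?U (n + 1)) \<cdot> ?p n \<oplus>
       (?j (n + 1) \<cdot> ?f (n + 1) \<cdot> ?p n \<oplus> ?j (n + 1) \<cdot> diff_at V n \<cdot> ?q n)"
    proof cases
      case 1 then show ?thesis by (simp add: d0)
    qed simp_all
  qed (auto simp: HomI zer_Hom id0 idz)
  ultimately show ?case using LC_cone[OF bU bV f] by blast
qed

lemma LC_from_stalks:
  assumes X: "X \<in> bc" and "\<And>n. LC (stalk (term_at X n) (n + 1))" shows "LC X"
proof -
  obtain N where N: "\<And>n. \<bar>n\<bar> > N \<Longrightarrow> zero_object C (term_at X n)" using X unfolding bounded_complexes_iff bd_def by blast
  \<comment> \<open>A window of 2 \<bar>N\<bar> + 1 degrees with top \<bar>N\<bar> contains all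
    non-zero terms.\<close>
  show ?thesis by (rule LC_from_stalks_aux[OF assms, of "\<bar>N\<bar>" "nat (2 * \<bar>N\<bar> + 1)"]) (auto intro!: N)
qed

end

section \<open>Exact functors and the complexes that they make acyclic\<close>

locale exact_functor = additive C D F + C: abelian_enough C + D: abelian_enough D
  for C :: "('o, 'm, 'z) addcat_scheme" and D :: "('o2, 'm2, 'z2) addcat_scheme"
    and F :: "('o, 'm, 'o2, 'm2) functr" +
  assumes texact: "f \<in> Hom C x y \<Longrightarrow> g \<in> Hom C y z \<Longrightarrow> C.texact f g \<Longrightarrow> D.texact (fmor F f) (fmor F g)"

context additive
begin

lemma K_cone:
  assumes "C.cone X Y f Z k j p q" and X: "C.cx X" and Y: "C.cx Y" and f: "f \<in> chain_maps C X Y"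
  shows "D.cone (fob K X) (fob K Y) (\<lambda>n. fmor F (f n)) (fob K Z) (\<lambda>n. fmor F (k n)) (\<lambda>n. fmor F (j n)) (\<lambda>n. fmor F (p n)) (\<lambda>n. fmor F (q n))"
  unfolding D.cone_def
proof (intro allI conjI)
  fix n
  note [simp] = C.cone_typ[OF assms(1)] X Y C.cm_typ[OF f]
  have c: "is_biproduct C (term_at X (n + 1)) (term_at Y n) (term_at Z n) (k n) (j n) (p n) (q n)"
    "diff_at Z n = add C (cmp C (cmp C (k (n + 1)) (neg C (diff_at X (n + 1)))) (p n))
        (add C (cmp C (cmp C (j (n + 1)) (f (n + 1))) (p n)) (cmp C (cmp C (j (n + 1)) (diff_at Y n)) (q n)))"
    using assms(1) unfolding C.cone_def by auto
  show "is_biproduct D (term_at (fob K X) (n + 1)) (term_at (fob K Y) n) (term_at (fob K Z) n) (fmor F (k n)) (fmor F (j n)) (fmor F (p n)) (fmor F (q n))"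
    using fob_biproduct[OF c(1)] by simp
  show "diff_at (fob K Z) n = add D (cmp D (cmp D (fmor F (k (n + 1))) (neg D (diff_at (fob K X) (n + 1)))) (fmor F (p n)))
      (add D (cmp D (cmp D (fmor F (j (n + 1))) (fmor F (f (n + 1)))) (fmor F (p n)))
             (cmp D (cmp D (fmor F (j (n + 1))) (diff_at (fob K Y) n)) (fmor F (q n))))"
    by (simp add: c(2) fmor_add fmor_cmp' fmor_neg)
qed

end

context exact_functor
begin

lemma K_exact: assumes X: "C.cx X" and e: "C.exact_cx X" shows "D.exact_cx (fob K X)"
proof (rule D.exact_cxI)
  note [simp] = X K_cx[OF X]
  fix T n x assume T: "projective D T" and x: "x \<in> Hom D T (term_at (fob K X) n)"
    "cmp D (diff_at (fob K X) n) x = zer D T (term_at (fob K X) (n + 1))"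
  have d: "diff_at X (n - 1) \<in> Hom C (term_at X (n - 1)) (term_at X n)" "diff_at X n \<in> Hom C (term_at X n) (term_at X (n + 1))"
    by (simp_all add: HomI)
  have "C.texact (diff_at X (n - 1)) (diff_at X n)"
    by (rule C.texactI[OF d]) (metis C.exactD[OF e])
  then have "D.texact (fmor F (diff_at X (n - 1))) (fmor F (diff_at X n))" by (rule texact[OF d])
  then show "\<exists>v\<in>Hom D T (term_at (fob K X) (n - 1)). x = cmp D (diff_at (fob K X) (n - 1)) v"
    using D.texactD[OF _ fmor_Hom[OF d(1)] fmor_Hom[OF d(2)] T, of x] x by auto
qed

lemma K_qis: assumes X: "C.cx X" and Y: "C.cx Y" and f: "f \<in> chain_maps C X Y" and q: "C.qis X Y f"
  shows "D.qis (fob K X) (fob K Y) (\<lambda>n. fmor F (f n))"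
proof -
  obtain Z k j p q where c: "C.cone X Y f Z k j p q" using C.cone_exists[OF X Y] by blast
  have "C.exact_cx Z" using C.cone_exact_iff_qis[OF c X Y f] \<open>C.qis X Y f\<close> by simp
  then have "D.exact_cx (fob K Z)" by (rule K_exact[OF C.cone_cx[OF c X Y f]])
  then show ?thesis using D.cone_exact_iff_qis[OF K_cone[OF c X Y f] K_cx[OF X] K_cx[OF Y] K_cm[OF f X Y]] by simp
qed

text \<open>Being epi is expressed as exactness of c followed by a zero morphism, a condition that F
  transports. For \<open>mono_inj\<close> the zero morphism stands in front.\<close>

lemma epi_surj: assumes c: "is_epi C c" "c \<in> Hom C x y" and T: "projective D T" and a: "a \<in> Hom D T (fob F y)"
  shows "\<exists>b \<in> Hom D T (fob F x). cmp D (fmor F c) b = a"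
proof -
  note [simp] = C.hom[OF c(2)] D.hom[OF a]
  have z: "zer C y C.zob \<in> Hom C y C.zob" by (simp add: C.zer_Hom)
  have "C.texact c (zer C y C.zob)"
    by (rule C.texactI[OF c(2) z]) (metis C.projective_lift[OF _ c])
  then have "D.texact (fmor F c) (fmor F (zer C y C.zob))" by (rule texact[OF c(2) z])
  then show ?thesis using D.texactD[OF _ fmor_Hom[OF c(2)] fmor_Hom[OF z] T a] by simp
qed

lemma mono_inj: assumes c: "is_mono C c" "c \<in> Hom C x y" and T: "projective D T" and a: "a \<in> Hom D T (fob F x)"
  "cmp D (fmor F c) a = zer D T (fob F y)"
  shows "a = zer D T (fob F x)"
proof -
  note [simp] = C.hom[OF c(2)] D.hom[OF a(1)]
  have z: "zer C C.zob x \<in> Hom C C.zob x" by (simp add: C.zer_Hom)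
  have "C.texact (zer C C.zob x) c"
  proof (rule C.texactI[OF z c(2)])
    fix T b assume T: "projective C T" and b: "b \<in> Hom C T x" "cmp C c b = zer C T y"
    then have "b = zer C T x" using c(1) unfolding C.mono_iff by simp
    then show "\<exists>d\<in>Hom C T C.zob. cmp C (zer C C.zob x) d = b"
      using C.projective_ob[OF T] by (intro bexI[of _ "zer C T C.zob"]) (simp_all add: C.zer_Hom)
  qed
  then have "D.texact (fmor F (zer C C.zob x)) (fmor F c)" by (rule texact[OF z c(2)])
  then obtain b where "b \<in> Hom D T (fob F C.zob)" "cmp D (fmor F (zer C C.zob x)) b = a"
    using D.texactD[OF _ fmor_Hom[OF z] fmor_Hom[OF c(2)] T a] by blast
  then show ?thesis using D.hom[OF \<open>b \<in> _\<close>] by auto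
qed

text \<open>X' is the canonical truncation of X above the lowest degree a, with the cokernel M of
  the lowest differential in degree a + 1. The part removed is the cohomology N in degree a, which F
  annihilates and whose stalk is therefore perfect by H. As X' is quasi-isomorphic to the cone of
  the inclusion of this stalk, perfectness passes from X' to X.\<close>

lemma kernel_LC_step:
  assumes X: "X \<in> C.bc" and e: "D.exact_cx (fob K X)" and z: "\<And>n. n < a \<Longrightarrow> zero_object C (term_at X n)"
    and H: "\<And>M n. M \<in> ob C \<Longrightarrow> zero_object D (fob F M) \<Longrightarrow> C.LC (C.stalk M n)"
  obtains X' where "X' \<in> C.bc" "D.exact_cx (fob K X')" "\<And>n. n \<le> a \<Longrightarrow> zero_object C (term_at X' n)"
    "\<And>n. n > a \<Longrightarrow> zero_object C (term_at X n) \<Longrightarrow> zero_object C (term_at X' n)" "C.LC X' \<Longrightarrow> C.LC X"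
proof -
  note Xc [simp] = C.bc_cx[OF X]
  have da: "diff_at X a \<in> Hom C (term_at X a) (term_at X (a + 1))" by (simp add: HomI)
  obtain N \<kappa> where k: "\<kappa> \<in> Hom C N (term_at X a)" "cmp C (diff_at X a) \<kappa> = zer C N (term_at X (a + 1))" "is_mono C \<kappa>"
    "\<And>w h. h \<in> Hom C w (term_at X a) \<Longrightarrow> cmp C (diff_at X a) h = zer C w (term_at X (a + 1)) \<Longrightarrow> \<exists>u \<in> Hom C w N. cmp C \<kappa> u = h"
    using C.kernel[OF da] by metis
  obtain M c where c: "c \<in> Hom C (term_at X (a + 1)) M" "cmp C c (diff_at X a) = zer C (term_at X a) M" "is_epi C c"
    "\<And>w h. h \<in> Hom C (term_at X (a + 1)) w \<Longrightarrow> cmp C h (diff_at X a) = zer C (term_at X a) w \<Longrightarrow> \<exists>u \<in> Hom C M w. cmp C u c = h"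
    "is_cokernel C (diff_at X a) c"
    using C.cokernel[OF da] by metis
  have tc: "C.texact (diff_at X a) c" by (rule C.cokernel_texact[OF da c(5)])
  obtain d' where d': "d' \<in> Hom C M (term_at X (a + 2))" "cmp C d' c = diff_at X (a + 1)"
    using c(4)[of "diff_at X (a + 1)" "term_at X (a + 2)"] by (auto simp: HomI add.commute[of 2 a])
  note [simp] = C.hom[OF k(1)] C.hom[OF c(1)] C.hom[OF d'(1)]
  have dd': "cmp C (diff_at X (a + 2)) d' = zer C M (term_at X (a + 3))"
    by (rule C.epiD[OF c(3,1), of _ "term_at X (a + 3)"])
      (simp_all add: HomI C.assoc d'(2) add.commute[of 3 a] add.commute[of 2 a])
  \<comment> \<open>Elements of F N are cocycles of F X in degree a, hence coboundaries. The term in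
    degree a - 1 is zero, so they vanish.\<close>
  have FN: "zero_object D (fob F N)"
  proof (rule D.zero_if_no_elements)
    fix T b assume T: "projective D T" and b: "b \<in> Hom D T (fob F N)"
    note [simp] = D.hom[OF b]
    obtain v where v: "v \<in> Hom D T (term_at (fob K X) (a - 1))" "cmp D (fmor F \<kappa>) b = cmp D (diff_at (fob K X) (a - 1)) v"
      by (rule D.exactD[OF e T, of "cmp D (fmor F \<kappa>) b" a])
       (simp_all add: HomI D.assoc[symmetric] fmor_cmp'[symmetric] k(2))
    have "zero_object D (term_at (fob K X) (a - 1))" using fob_zero[OF z[of "a - 1"]] by simp
    then have "v = zer D T (term_at (fob K X) (a - 1))" using D.to_zero v(1) by blast
    then have "cmp D (fmor F \<kappa>) b = zer D T (fob F (term_at X a))" using v(2) by simp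
    then show "b = zer D T (fob F N)" by (rule mono_inj[OF k(3,1) T b])
  qed simp
  have LCN: "C.LC (C.stalk N a)" using H[OF _ FN] by simp
  define tX where "tX = (\<lambda>n. if n \<le> a then C.zob else if n = a + 1 then M else term_at X n)"
  define dX where "dX = (\<lambda>n. if n \<le> a then zer C (tX n) (tX (n + 1)) else if n = a + 1 then d' else diff_at X n)"
  define X' where "X' = \<lparr>term_at = tX, diff_at = dX\<rparr>"
  have X' [simp]: "term_at X' n = tX n" "diff_at X' n = dX n" for n by (simp_all add: X'_def)
  have tX [simp]: "tX n \<in> ob C" for n by (simp add: tX_def)
  have dX: "dX n \<in> Hom C (tX n) (tX (n + 1))" for n
    by (simp add: dX_def C.zer_Hom) (simp add: tX_def HomI add.commute[of 2 a])
  note [simp] = C.hom[OF dX]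
  have ddX: "cmp C (dX (n + 1)) (dX n) = zer C (tX n) (tX (n + 2))" for n
  proof -
    consider "n \<le> a" | "n = a + 1" | "n > a + 1" by linarith
    then show ?thesis
    proof cases
      case 1
      then have "dX n = zer C (tX n) (tX (n + 1))" by (simp add: dX_def)
      then show ?thesis by (simp add: add.commute[of 2 n])
    next
      case 2 then show ?thesis by (simp add: dX_def tX_def dd' add.commute[of 2 a] add.commute[of 3 a])
    next
      case 3 then show ?thesis by (simp add: dX_def tX_def)
    qed
  qed
  have cX' [simp]: "C.cx X'" unfolding C.cx_def using dX ddX by simp
  have M0: "zero_object C M" if "zero_object C (term_at X (a + 1))"
    unfolding C.zero_object_iff
  proof (intro conjI)
    show "idm C M = zer C M M"
      using C.epiD[OF c(3,1), of "idm C M" M "zer C M M"] C.from_zero[OF that c(1)] by (simp add: HomI)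
  qed simp
  have zX': "zero_object C (tX n)" if "n \<le> a \<or> zero_object C (term_at X n)" for n
    using that M0 C.zob by (auto simp: tX_def)
  have bX': "X' \<in> C.bc"
    using X zX' unfolding C.bounded_complexes_iff C.bd_def by (metis X'(1) cX')
  have eX': "D.exact_cx (fob K X')"
  proof (rule D.exact_cxI)
    fix T n x assume T: "projective D T" and x: "x \<in> Hom D T (term_at (fob K X') n)"
      "cmp D (diff_at (fob K X') n) x = zer D T (term_at (fob K X') (n + 1))"
    note [simp] = D.projective_ob[OF T]
    consider "n \<le> a" | "n = a + 1" | "n = a + 2" | "n > a + 2" by linarith
    then show "\<exists>v\<in>Hom D T (term_at (fob K X') (n - 1)). x = cmp D (diff_at (fob K X') (n - 1)) v"
    proof cases
      case 1
      then have "zero_object D (term_at (fob K X') n)" using fob_zero zX' by simp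
      then have "x = zer D T (term_at (fob K X') n)" using D.to_zero x(1) by blast
      then show ?thesis by (intro bexI[of _ "zer D T (term_at (fob K X') (n - 1))"]) (simp_all add: D.zer_Hom)
    next
      \<comment> \<open>At F M exactness means that x vanishes. Lifted along the epimorphism c it
        becomes a cocycle of F X, hence a coboundary from degree a, and c kills that
        differential.\<close>
      case 2
      then have x': "x \<in> Hom D T (fob F M)" "cmp D (fmor F d') x = zer D T (fob F (term_at X (a + 2)))"
        using x by (simp_all add: tX_def dX_def add.commute[of 2 a])
      obtain y where y: "y \<in> Hom D T (fob F (term_at X (a + 1)))" "cmp D (fmor F c) y = x"
        using epi_surj[OF c(3,1) T x'(1)] by blast
      note [simp] = D.hom[OF y(1)]
      have "cmp D (cmp D (fmor F d') (fmor F c)) y = zer D T (fob F (term_at X (a + 2)))"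
        using x'(2) y(2) by (simp add: D.assoc)
      then have "cmp D (diff_at (fob K X) (a + 1)) y = zer D T (term_at (fob K X) (a + 1 + 1))"
        by (simp add: fmor_cmp'[symmetric] d'(2) add.commute[of 2 a])
      then obtain v where v: "v \<in> Hom D T (term_at (fob K X) (a + 1 - 1))" "y = cmp D (diff_at (fob K X) (a + 1 - 1)) v"
        using D.exactD[OF e T, of y "a + 1"] y(1) by auto
      have v': "v \<in> Hom D T (fob F (term_at X a))" using v(1) by simp
      note [simp] = D.hom[OF v']
      have "x = cmp D (cmp D (fmor F c) (fmor F (diff_at X a))) v" using v(2) y(2) by (simp add: D.assoc)
      then have "x = zer D T (fob F M)" by (simp add: fmor_cmp'[symmetric] c(2))
      then show ?thesis using 2 by (intro bexI[of _ "zer D T (term_at (fob K X') (n - 1))"]) (simp_all add: D.zer_Hom tX_def)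
    next
      case 3
      then have x': "x \<in> Hom D T (term_at (fob K X) (a + 2))" "cmp D (diff_at (fob K X) (a + 2)) x = zer D T (term_at (fob K X) (a + 2 + 1))"
        using x by (simp_all add: tX_def dX_def)
      obtain v where v: "v \<in> Hom D T (term_at (fob K X) (a + 2 - 1))" "x = cmp D (diff_at (fob K X) (a + 2 - 1)) v"
        by (rule D.exactD[OF e T x'])
      have v': "v \<in> Hom D T (fob F (term_at X (a + 1)))" using v(1) by (simp add: add.commute[of 1 a])
      note [simp] = D.hom[OF v']
      have "x = cmp D (fmor F d') (cmp D (fmor F c) v)" using v(2) by (simp add: D.assoc[symmetric] fmor_cmp'[symmetric] d'(2) add.commute[of 1 a])
      then show ?thesis using 3 by (intro bexI[of _ "cmp D (fmor F c) v"]) (simp_all add: HomI tX_def dX_def)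
    next
      case 4
      then have x': "x \<in> Hom D T (term_at (fob K X) n)" "cmp D (diff_at (fob K X) n) x = zer D T (term_at (fob K X) (n + 1))"
        using x by (simp_all add: tX_def dX_def)
      obtain v where v: "v \<in> Hom D T (term_at (fob K X) (n - 1))" "x = cmp D (diff_at (fob K X) (n - 1)) v"
        by (rule D.exactD[OF e T x'])
      then show ?thesis using 4 by (intro bexI[of _ v]) (simp_all add: tX_def dX_def)
    qed
  qed
  let ?S = "C.stalk N a"
  have bS: "?S \<in> C.bc" by (simp add: C.stalk_bc)
  note [simp] = C.bc_cx[OF bS]
  let ?k = "\<lambda>n. if n = a then \<kappa> else zer C C.zob (term_at X n)"
  have km: "?k \<in> chain_maps C ?S X" by (rule C.cmI) (auto simp: k(2))
  obtain Z k' j p q where Z: "C.cone ?S X ?k Z k' j p q" and bZ: "Z \<in> C.bc" using C.cone_bc[OF bS X km] by blast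
  note zs = C.cone_simps[OF Z C.bc_cx[OF bS] Xc km]
  \<comment> \<open>The projection of X onto its truncation.\<close>
  define \<gamma> where "\<gamma> = (\<lambda>n. if n \<le> a then zer C (term_at X n) C.zob else if n = a + 1 then c else idm C (term_at X n))"
  have \<gamma>: "\<gamma> \<in> chain_maps C X X'"
  proof (rule C.cmI)
    fix n
    consider "n < a" | "n = a" | "n = a + 1" | "n > a + 1" by linarith
    then show "cmp C (diff_at X' n) (\<gamma> n) = cmp C (\<gamma> (n + 1)) (diff_at X n)"
    proof cases
      case 1 then show ?thesis by (simp add: \<gamma>_def dX_def tX_def)
    next
      case 2 then show ?thesis by (simp add: \<gamma>_def dX_def tX_def c(2))
    next
      case 3 then show ?thesis by (simp add: \<gamma>_def dX_def tX_def d'(2) add.commute[of 2 a])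
    next
      case 4 then show ?thesis by (simp add: \<gamma>_def dX_def tX_def)
    qed
  qed (simp_all add: \<gamma>_def tX_def)
  have \<gamma>k: "cmp C (\<gamma> n) (?k n) = zer C (term_at ?S n) (tX n)" for n
    by (simp add: \<gamma>_def tX_def)
  \<comment> \<open>Since \<gamma> annihilates the inclusion of the stalk, \<gamma> after the
    X-component of the cone is a chain map; no homotopy is involved.\<close>
  let ?g = "\<lambda>n. cmp C (\<gamma> n) (q n)"
  note g_typ [simp] = C.cm_typ[OF \<gamma>, unfolded X'(1)]
  have gm: "?g \<in> chain_maps C Z X'"
  proof (rule C.cmI)
    fix n
    have "cmp C (cmp C (\<gamma> (n + 1)) (?k (n + 1))) (p n) = zer C (term_at Z n) (tX (n + 1))"
      unfolding \<gamma>k by (simp only: C.zer_cmp zs tX)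
    then have 1: "cmp C (\<gamma> (n + 1)) (cmp C (?k (n + 1)) (p n)) = zer C (term_at Z n) (tX (n + 1))"
      using C.assoc[OF zs(7)[of n], of "?k (n + 1)" "\<gamma> (n + 1)"] C.cm_typ[OF km, of "n + 1"] zs(9)[of n] g_typ[of "n + 1"] by (metis (no_types, lifting))
    have "cmp C (diff_at X' n) (?g n) = cmp C (cmp C (\<gamma> (n + 1)) (diff_at X n)) (q n)"
      using C.cm_comm'[OF \<gamma> Xc cX' zs(10)[of n] zs(12)[of n]] zs(10-12)[of n] by (simp add: C.assoc)
    also have "\<dots> = cmp C (\<gamma> (n + 1)) (cmp C (q (n + 1)) (diff_at Z n))"
    proof -
      have "cmp C (q (n + 1)) (diff_at Z n) = add C (cmp C (?k (n + 1)) (p n)) (cmp C (diff_at X n) (q n))"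
        by (rule C.cone_qd[OF Z C.bc_cx[OF bS] Xc km]) simp
      moreover have "cmp C (?k (n + 1)) (p n) \<in> Hom C (term_at Z n) (term_at X (n + 1))"
        using C.cm_typ[OF km, of "n + 1"] zs(7-9)[of n] by (intro HomI) simp_all
      note [simp] = C.hom[OF this] zs(10-12)[of n]
      ultimately show ?thesis by (simp add: C.cmp_add 1 C.assoc)
    qed
    finally show "cmp C (diff_at X' n) (?g n) = cmp C (?g (n + 1)) (diff_at Z n)"
      using zs(10-12)[of "n + 1"] C.cone_diff_mor[OF Z C.bc_cx[OF bS] Xc km, of n] by (simp add: C.assoc)
  qed (simp_all add: zs(10-12))
  have "C.qis Z X' ?g" unfolding C.qis_def
  proof
    show "C.qsurj Z X' ?g"
    proof (rule C.qsurjI)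
      fix T n y assume T: "projective C T" and y: "y \<in> Hom C T (term_at X' n)" "cmp C (diff_at X' n) y = zer C T (term_at X' (n + 1))"
      note [simp] = C.projective_ob[OF T]
      have "\<exists>x \<in> Hom C T (term_at X n). cmp C (diff_at X n) x = zer C T (term_at X (n + 1)) \<and> cmp C (\<gamma> n) x = y"
      proof -
        consider "n \<le> a" | "n = a + 1" | "n > a + 1" by linarith
        then show ?thesis
        proof cases
          case 1
          then have "y = zer C T (tX n)" using C.to_zero zX' y(1) by simp
          then show ?thesis by (intro bexI[of _ "zer C T (term_at X n)"]) (simp_all add: C.zer_Hom)
        next
          case 2
          then have y': "y \<in> Hom C T M" "cmp C d' y = zer C T (term_at X (a + 2))" using y by (simp_all add: tX_def dX_def add.commute[of 2 a])
          obtain x where x: "x \<in> Hom C T (term_at X (a + 1))" "cmp C c x = y" using C.projective_lift[OF T c(3,1) y'(1)] .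
          note [simp] = C.hom[OF x(1)]
          have "cmp C (diff_at X (a + 1)) x = zer C T (term_at X (a + 2))"
            using y'(2) unfolding x(2)[symmetric] d'(2)[symmetric] by (simp add: C.assoc)
          then show ?thesis using 2 x by (intro bexI[of _ x]) (simp_all add: \<gamma>_def add.commute[of 2 a])
        next
          case 3
          then have "y \<in> Hom C T (term_at X n)" "cmp C (diff_at X n) y = zer C T (term_at X (n + 1))" using y by (simp_all add: tX_def dX_def)
          then show ?thesis using 3 C.hom[of y] by (intro bexI[of _ y]) (auto simp: \<gamma>_def Hom_def)
        qed
      qed
      then obtain x where x: "x \<in> Hom C T (term_at X n)" "cmp C (diff_at X n) x = zer C T (term_at X (n + 1))" "cmp C (\<gamma> n) x = y" by blast
      note [simp] = C.hom[OF x(1)]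
      have "cmp C (diff_at Z n) (cmp C (j n) x) = zer C T (term_at Z (n + 1))"
        using C.cone_dj'[OF Z C.bc_cx[OF bS] Xc km, of x n] zs(4-6)[of "n + 1"] x(2) by simp
      moreover have "cmp C (?g n) (cmp C (j n) x) = y"
        using C.cone_assoc(2)[OF Z, of x n] zs(4-6)[of n] zs(10-12)[of n] x(3) by (simp add: C.assoc)
      moreover have "cmp C (j n) x \<in> Hom C T (term_at Z n)" using zs(4-6)[of n] by (simp add: HomI)
      ultimately show "\<exists>z u. z \<in> Hom C T (term_at Z n) \<and> cmp C (diff_at Z n) z = zer C T (term_at Z (n + 1)) \<and>
        u \<in> Hom C T (term_at X' (n - 1)) \<and> y = add C (cmp C (?g n) z) (cmp C (diff_at X' (n - 1)) u)"
        using C.hom[OF y(1)] by (intro exI[of _ "cmp C (j n) x"] exI[of _ "zer C T (term_at X' (n - 1))"]) (simp add: C.zer_Hom)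
    qed
    show "C.qinj Z X' ?g"
    proof (rule C.qinjI)
      fix T n z u assume T: "projective C T" and zz: "z \<in> Hom C T (term_at Z n)" "cmp C (diff_at Z n) z = zer C T (term_at Z (n + 1))"
        and u: "u \<in> Hom C T (term_at X' (n - 1))" "cmp C (?g n) z = cmp C (diff_at X' (n - 1)) u"
      note [simp] = C.projective_ob[OF T] C.hom[OF zz(1)] C.hom[OF u(1), unfolded X'] zs(1-12)
      note c' = C.cone_cx[OF Z C.bc_cx[OF bS] Xc km]
      have pz: "cmp C (p n) z \<in> Hom C T (term_at ?S (n + 1))" and qz: "cmp C (q n) z \<in> Hom C T (term_at X n)"
        by (simp_all add: HomI del: C.stalk_simps)
      note [simp] = C.hom[OF qz]
      have p0: "cmp C (p n) z = zer C T (term_at ?S (n + 1))" if "n + 1 \<noteq> a"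
        using C.to_zero[OF C.zob] pz that by simp
      have "cmp C (q (n + 1)) (cmp C (diff_at Z n) z) = zer C T (term_at X (n + 1))"
        unfolding zz(2) by simp
      then have dq: "add C (cmp C (?k (n + 1)) (cmp C (p n) z)) (cmp C (diff_at X n) (cmp C (q n) z)) = zer C T (term_at X (n + 1))"
        using C.cone_qd'[OF Z C.bc_cx[OF bS] Xc km, of "n + 1" n z] by simp
      have dq0: "cmp C (diff_at X n) (cmp C (q n) z) = zer C T (term_at X (n + 1))" if "n + 1 \<noteq> a"
        using dq p0[OF that] that by simp
      have gq: "cmp C (\<gamma> n) (cmp C (q n) z) = cmp C (dX (n - 1)) u" using u(2) by (simp add: C.assoc)
      \<comment> \<open>Outside degree a - 1 the stalk contributes nothing to the cone, so z is the
        image of its X-component, and it suffices to bound that component in X.\<close>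
      have lift: "\<exists>v\<in>Hom C T (term_at Z (n - 1)). z = cmp C (diff_at Z (n - 1)) v"
        if "n + 1 \<noteq> a" "w \<in> Hom C T (term_at X (n - 1))" "cmp C (q n) z = cmp C (diff_at X (n - 1)) w" for w
      proof -
        note [simp] = C.hom[OF that(2)]
        have "cmp C (diff_at Z (n - 1)) (cmp C (j (n - 1)) w) = cmp C (j n) (cmp C (q n) z)"
          using C.cone_dj'[OF Z C.bc_cx[OF bS] Xc km, of w "n - 1"] that(3) by simp
        moreover have "z = cmp C (j n) (cmp C (q n) z)"
        proof (rule C.cone_eq_in[OF Z zz(1)])
          show "cmp C (j n) (cmp C (q n) z) \<in> Hom C T (term_at Z n)" by (simp add: HomI)
          show "cmp C (p n) z = cmp C (p n) (cmp C (j n) (cmp C (q n) z))"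
            unfolding p0[OF that(1)] using C.cone_assoc(3)[OF Z Hom_mor[OF qz], of n] by simp
          show "cmp C (q n) z = cmp C (q n) (cmp C (j n) (cmp C (q n) z))"
            using C.cone_assoc(2)[OF Z Hom_mor[OF qz], of n] by simp
        qed
        ultimately have "z = cmp C (diff_at Z (n - 1)) (cmp C (j (n - 1)) w)" by simp
        then show ?thesis by (rule bexI) (simp add: HomI)
      qed
      consider "n > a + 2" | "n = a + 2" | "n = a + 1" | "n = a" | "n = a - 1" | "n < a - 1" by linarith
      then show "\<exists>v\<in>Hom C T (term_at Z (n - 1)). z = cmp C (diff_at Z (n - 1)) v"
      proof cases
        case 1
        then have "u \<in> Hom C T (term_at X (n - 1))" "cmp C (q n) z = cmp C (diff_at X (n - 1)) u"
          using u(1) gq by (simp_all add: tX_def dX_def \<gamma>_def)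
        then show ?thesis using lift 1 by simp
      next
        case 2
        then have u': "u \<in> Hom C T M" "cmp C (q n) z = cmp C d' u"
          using u(1) gq by (simp_all add: tX_def dX_def \<gamma>_def add.commute[of 1 a])
        obtain w where w: "w \<in> Hom C T (term_at X (a + 1))" "cmp C c w = u" using C.projective_lift[OF T c(3,1) u'(1)] .
        note [simp] = C.hom[OF w(1)]
        have "cmp C (q n) z = cmp C (diff_at X (n - 1)) w"
          using 2 unfolding u'(2) w(2)[symmetric] by (simp add: C.assoc[symmetric] d'(2) add.commute[of 1 a])
        then show ?thesis using lift[of w] 2 w by (simp add: add.commute[of 1 a])
      next
        case 3
        then have "u = zer C T (tX (n - 1))" using C.to_zero[OF zX'] u(1) by simp
        then have "cmp C c (cmp C (q n) z) = zer C T M" using gq 3 by (simp add: \<gamma>_def tX_def)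
        then obtain w where w: "w \<in> Hom C T (term_at X a)" "cmp C (diff_at X a) w = cmp C (q n) z"
          using C.texactD[OF tc da c(1) T, of "cmp C (q n) z"] qz 3 by auto
        then show ?thesis using lift[of w] 3 by simp
      next
        \<comment> \<open>In degree a every cocycle of X comes from N along \<kappa>. It becomes a
          boundary in the cone, namely that of the corresponding element of the stalk summand in
          degree a - 1.\<close>
        case 4
        then obtain w where w: "w \<in> Hom C T N" "cmp C \<kappa> w = cmp C (q n) z"
          using k(4)[of "cmp C (q n) z" T] dq0 qz by auto
        note [simp] = C.hom[OF w(1)]
        have t: "trg C w = term_at ?S (n - 1 + 1)" using 4 by simp
        have "z = cmp C (diff_at Z (n - 1)) (cmp C (k' (n - 1)) w)"
        proof (rule C.cone_eq_in[OF Z zz(1)])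
          show "cmp C (diff_at Z (n - 1)) (cmp C (k' (n - 1)) w) \<in> Hom C T (term_at Z n)"
            using C.cone_diff_mor[OF Z C.bc_cx[OF bS] Xc km, of "n - 1"] t by (intro HomI) simp_all
          show "cmp C (p n) z = cmp C (p n) (cmp C (diff_at Z (n - 1)) (cmp C (k' (n - 1)) w))"
            using C.cone_pd'[OF Z C.bc_cx[OF bS] Xc km, of n "n - 1" "cmp C (k' (n - 1)) w"] t 4 p0 C.cone_assoc(1)[OF Z, of w "n - 1"] by simp
          show "cmp C (q n) z = cmp C (q n) (cmp C (diff_at Z (n - 1)) (cmp C (k' (n - 1)) w))"
            using C.cone_qd'[OF Z C.bc_cx[OF bS] Xc km, of n "n - 1" "cmp C (k' (n - 1)) w"] t 4 w(2)
              C.cone_assoc(1,4)[OF Z, of w "n - 1"] by simp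
        qed
        then show ?thesis by (rule bexI) (use t in \<open>simp add: HomI\<close>)
      next
        \<comment> \<open>In degree a - 1 the cone is essentially N, and the cocycle condition says
          that \<kappa> kills the element; \<kappa> is mono.\<close>
        case 5
        have q0: "cmp C (q n) z = zer C T (term_at X n)" using C.to_zero[OF z qz] 5 by simp
        have pz': "cmp C (p n) z \<in> Hom C T N" using pz 5 by simp
        note [simp] = C.hom[OF pz']
        have "cmp C \<kappa> (cmp C (p n) z) = zer C T (term_at X a)" using dq[unfolded q0] 5 by simp
        then have "cmp C (p n) z = zer C T N" using k(3) pz' unfolding C.mono_iff by simp
        then have "z = zer C T (term_at Z n)"
          using q0 5 by (intro C.cone_eq_in[OF Z zz(1)]) (simp_all add: C.zer_Hom C.cx_simps(1)[OF c'])
        then show ?thesis using C.cx_simps[OF c']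
          by (intro bexI[of _ "zer C T (term_at Z (n - 1))"]) (simp_all add: C.zer_Hom)
      next
        case 6
        have q0: "cmp C (q n) z = zer C T (term_at X n)" using C.to_zero[OF z qz] 6 by simp
        have "z = zer C T (term_at Z n)"
          using q0 p0 6 by (intro C.cone_eq_in[OF Z zz(1)]) (simp_all add: C.zer_Hom)
        then show ?thesis using C.cx_simps[OF c']
          by (intro bexI[of _ "zer C T (term_at Z (n - 1))"]) (simp_all add: C.zer_Hom)
      qed
    qed
  qed
  then have "C.LC Z \<longleftrightarrow> C.LC X'" using C.LC_qis[OF bZ bX' gm] by simp
  moreover have "C.LC Z \<Longrightarrow> C.LC X" using C.LC_cone_eq[OF bS X km Z] LCN by simp
  ultimately have "C.LC X' \<Longrightarrow> C.LC X" by simp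
  then show ?thesis using that[OF bX' eX'] zX' by simp
qed

text \<open>Each application of \<open>kernel_LC_step\<close> clears the lowest of the k degrees in
  which X may be non-zero while keeping F X exact.\<close>

lemma kernel_LC_aux:
  assumes H: "\<And>M n. M \<in> ob C \<Longrightarrow> zero_object D (fob F M) \<Longrightarrow> C.LC (C.stalk M n)"
  shows "X \<in> C.bc \<Longrightarrow> D.exact_cx (fob K X) \<Longrightarrow> (\<And>n. n > b \<or> n \<le> b - int k \<Longrightarrow> zero_object C (term_at X n)) \<Longrightarrow> C.LC X"
proof (induction k arbitrary: X)
  case 0
  then have "zero_object C (term_at X n)" for n by (metis diff_zero linorder_le_less_linear of_nat_0)
  then show ?case by (rule C.zero_complex_LC[OF 0(1)])
next
  case (Suc k)
  have "zero_object C (term_at X n)" if "n < b - int k" for n using Suc.prems(3)[of n] that by simp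
  then obtain X' where X': "X' \<in> C.bc" "D.exact_cx (fob K X')" "\<And>n. n \<le> b - int k \<Longrightarrow> zero_object C (term_at X' n)"
    "\<And>n. n > b - int k \<Longrightarrow> zero_object C (term_at X n) \<Longrightarrow> zero_object C (term_at X' n)" "C.LC X' \<Longrightarrow> C.LC X"
    using kernel_LC_step[OF Suc.prems(1,2) _ H, of "b - int k"] by metis
  have "C.LC X'" by (rule Suc.IH[OF X'(1,2)]) (use X'(3,4) Suc.prems(3) in auto)
  then show ?case by (rule X'(5))
qed

lemma kernel_LC:
  assumes H: "\<And>M n. M \<in> ob C \<Longrightarrow> zero_object D (fob F M) \<Longrightarrow> C.LC (C.stalk M n)"
    and X: "X \<in> C.bc" and e: "D.exact_cx (fob K X)"
  shows "C.LC X"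
proof -
  obtain N where N: "\<And>n. \<bar>n\<bar> > N \<Longrightarrow> zero_object C (term_at X n)" using X unfolding C.bounded_complexes_iff C.bd_def by blast
  show ?thesis by (rule kernel_LC_aux[OF H X e, of "\<bar>N\<bar>" "nat (2 * \<bar>N\<bar> + 1)"]) (auto intro!: N)
qed

end

section \<open>Recollements\<close>

locale adjunction = L: is_functor C D L + R: is_functor D C R
  for C :: "('o, 'm, 'z) cat_scheme" and D :: "('o2, 'm2, 'z2) cat_scheme"
    and L :: "('o, 'm, 'o2, 'm2) functr" and R :: "('o2, 'm2, 'o, 'm) functr" +
  assumes adjoint: "adjoint C D L R"
begin

definition transp :: "'o \<Rightarrow> 'o2 \<Rightarrow> 'm2 \<Rightarrow> 'm" where
  "transp = (SOME \<phi>.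
     (\<forall>x \<in> ob C. \<forall>y \<in> ob D. bij_betw (\<phi> x y) (Hom D (fob L x) y) (Hom C x (fob R y))) \<and>
     (\<forall>x \<in> ob C. \<forall>x' \<in> ob C. \<forall>y \<in> ob D. \<forall>y' \<in> ob D.
        \<forall>f \<in> Hom C x' x. \<forall>g \<in> Hom D y y'. \<forall>h \<in> Hom D (fob L x) y.
          \<phi> x' y' (g \<cdot>\<^bsub>D\<^esub> h \<cdot>\<^bsub>D\<^esub> fmor L f) = fmor R g \<cdot>\<^bsub>C\<^esub> \<phi> x y h \<cdot>\<^bsub>C\<^esub> f))"

lemma transp:
  shows transp_bij: "x \<in> ob C \<Longrightarrow> y \<in> ob D \<Longrightarrow> bij_betw (transp x y) (Hom D (fob L x) y) (Hom C x (fob R y))"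
    and transp_nat: "f \<in> Hom C x' x \<Longrightarrow> g \<in> Hom D y y' \<Longrightarrow> h \<in> Hom D (fob L x) y \<Longrightarrow>
      transp x' y' (g \<cdot>\<^bsub>D\<^esub> h \<cdot>\<^bsub>D\<^esub> fmor L f) = fmor R g \<cdot>\<^bsub>C\<^esub> transp x y h \<cdot>\<^bsub>C\<^esub> f"
proof -
  have *: "(\<forall>x \<in> ob C. \<forall>y \<in> ob D. bij_betw (transp x y) (Hom D (fob L x) y) (Hom C x (fob R y))) \<and>
     (\<forall>x \<in> ob C. \<forall>x' \<in> ob C. \<forall>y \<in> ob D. \<forall>y' \<in> ob D.
        \<forall>f \<in> Hom C x' x. \<forall>g \<in> Hom D y y'. \<forall>h \<in> Hom D (fob L x) y.
          transp x' y' (g \<cdot>\<^bsub>D\<^esub> h \<cdot>\<^bsub>D\<^esub> fmor L f) = fmor R g \<cdot>\<^bsub>C\<^esub> transp x y h \<cdot>\<^bsub>C\<^esub> f)"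
    using adjoint unfolding adjoint_def transp_def by (rule someI_ex)
  show "x \<in> ob C \<Longrightarrow> y \<in> ob D \<Longrightarrow> bij_betw (transp x y) (Hom D (fob L x) y) (Hom C x (fob R y))" using * by blast
  assume "f \<in> Hom C x' x" "g \<in> Hom D y y'" "h \<in> Hom D (fob L x) y"
  then show "transp x' y' (g \<cdot>\<^bsub>D\<^esub> h \<cdot>\<^bsub>D\<^esub> fmor L f) = fmor R g \<cdot>\<^bsub>C\<^esub> transp x y h \<cdot>\<^bsub>C\<^esub> f"
    using * L.dom.Hom_ob1 L.dom.Hom_ob2 L.cod.Hom_ob1 L.cod.Hom_ob2 by (meson)
qed

lemma transp_Hom: assumes "x \<in> ob C" "h \<in> Hom D (fob L x) y" shows "transp x y h \<in> Hom C x (fob R y)"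
  using transp_bij[OF assms(1) L.cod.Hom_ob2[OF assms(2)]] assms(2) by (auto simp: bij_betw_def)

lemma transp_inj: "x \<in> ob C \<Longrightarrow> h \<in> Hom D (fob L x) y \<Longrightarrow> h' \<in> Hom D (fob L x) y \<Longrightarrow> transp x y h = transp x y h' \<Longrightarrow> h = h'"
  using transp_bij[of x y] L.cod.Hom_ob2[of h] by (auto simp: bij_betw_def inj_on_def)

lemma transp_surj: assumes "x \<in> ob C" "y \<in> ob D" "a \<in> Hom C x (fob R y)"
  obtains h where "h \<in> Hom D (fob L x) y" "transp x y h = a"
proof -
  have "a \<in> transp x y ` Hom D (fob L x) y"
    using assms(3) bij_betw_imp_surj_on[OF transp_bij[OF assms(1,2)]] by simp
  then show thesis using that by (auto elim: imageE)
qed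

lemma transp_post:
  assumes x: "x \<in> ob C" and g: "g \<in> Hom D y y'" and h: "h \<in> Hom D (fob L x) y"
  shows "transp x y' (g \<cdot>\<^bsub>D\<^esub> h) = fmor R g \<cdot>\<^bsub>C\<^esub> transp x y h"
  using transp_nat[OF L.dom.idm_Hom[OF x] g h] HomD[OF g] HomD[OF h] HomD[OF transp_Hom[OF x h]] x
  by (simp add: L.fmor_idm)

lemma transp_pre:
  assumes f: "f \<in> Hom C x' x" and h: "h \<in> Hom D (fob L x) y"
  shows "transp x' y (h \<cdot>\<^bsub>D\<^esub> fmor L f) = transp x y h \<cdot>\<^bsub>C\<^esub> f"
  using transp_nat[OF f L.cod.idm_Hom[OF L.cod.Hom_ob2[OF h]] h] HomD[OF f] HomD[OF h]
    HomD[OF transp_Hom[OF L.dom.Hom_ob2[OF f] h]] L.cod.Hom_ob2[OF h]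
  by (simp add: R.fmor_idm)

definition unit :: "'o \<Rightarrow> 'm" where "unit x = transp x (fob L x) (idm D (fob L x))"

definition counit :: "'o2 \<Rightarrow> 'm2" where
  "counit y = (SOME h. h \<in> Hom D (fob L (fob R y)) y \<and> transp (fob R y) y h = idm C (fob R y))"

lemma unit_Hom: "x \<in> ob C \<Longrightarrow> unit x \<in> Hom C x (fob R (fob L x))"
  unfolding unit_def by (intro transp_Hom L.cod.idm_Hom) auto

lemma unit_nat: assumes f: "f \<in> Hom C x' x"
  shows "unit x \<cdot>\<^bsub>C\<^esub> f = fmor R (fmor L f) \<cdot>\<^bsub>C\<^esub> unit x'"
proof -
  note [simp] = HomD[OF f] L.dom.Hom_ob1[OF f] L.dom.Hom_ob2[OF f]
  have "unit x \<cdot>\<^bsub>C\<^esub> f = transp x' (fob L x) (idm D (fob L x) \<cdot>\<^bsub>D\<^esub> fmor L f)"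
    unfolding unit_def by (rule transp_pre[symmetric, OF f]) (simp add: L.cod.idm_Hom)
  also have "\<dots> = transp x' (fob L x) (fmor L f \<cdot>\<^bsub>D\<^esub> idm D (fob L x'))" by simp
  also have "\<dots> = fmor R (fmor L f) \<cdot>\<^bsub>C\<^esub> unit x'"
    unfolding unit_def by (rule transp_post) (auto intro: L.fmor_Hom f L.cod.idm_Hom)
  finally show ?thesis .
qed

lemma counit: assumes y: "y \<in> ob D"
  shows counit_Hom: "counit y \<in> Hom D (fob L (fob R y)) y" and counit_transp: "transp (fob R y) y (counit y) = idm C (fob R y)"
proof -
  have "\<exists>h. h \<in> Hom D (fob L (fob R y)) y \<and> transp (fob R y) y h = idm C (fob R y)"
    using transp_surj[of "fob R y" y "idm C (fob R y)"] y L.dom.idm_Hom by (metis R.fob)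
  then have "counit y \<in> Hom D (fob L (fob R y)) y \<and> transp (fob R y) y (counit y) = idm C (fob R y)"
    unfolding counit_def by (rule someI_ex)
  then show "counit y \<in> Hom D (fob L (fob R y)) y" "transp (fob R y) y (counit y) = idm C (fob R y)" by auto
qed

lemma counit_nat: assumes g: "g \<in> Hom D y y'"
  shows "counit y' \<cdot>\<^bsub>D\<^esub> fmor L (fmor R g) = g \<cdot>\<^bsub>D\<^esub> counit y"
proof -
  note y [simp] = L.cod.Hom_ob1[OF g] L.cod.Hom_ob2[OF g]
  note [simp] = HomD[OF g] HomD[OF counit_Hom[OF y(1)]] HomD[OF counit_Hom[OF y(2)]]
  have Rg: "fmor R g \<in> Hom C (fob R y) (fob R y')" using g by (rule R.fmor_Hom)
  have "transp (fob R y) y' (counit y' \<cdot>\<^bsub>D\<^esub> fmor L (fmor R g)) = fmor R g"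
    using transp_pre[OF Rg counit_Hom[OF y(2)]] by (simp add: counit_transp)
  moreover have "transp (fob R y) y' (g \<cdot>\<^bsub>D\<^esub> counit y) = fmor R g"
    using transp_post[OF _ g counit_Hom[OF y(1)]] by (simp add: counit_transp)
  ultimately show ?thesis
    by (intro transp_inj[of "fob R y" _ y']) (auto intro: HomI)
qed

lemma R_counit_unit: assumes y: "y \<in> ob D" shows "fmor R (counit y) \<cdot>\<^bsub>C\<^esub> unit (fob R y) = idm C (fob R y)"
proof -
  note [simp] = HomD[OF counit_Hom[OF y]] y
  have "fmor R (counit y) \<cdot>\<^bsub>C\<^esub> unit (fob R y) = transp (fob R y) y (counit y \<cdot>\<^bsub>D\<^esub> idm D (fob L (fob R y)))"
    unfolding unit_def by (rule transp_post[symmetric, OF _ counit_Hom[OF y]]) (auto intro: L.cod.idm_Hom)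
  then show ?thesis by (simp add: counit_transp)
qed

text \<open>Composition with the unit is the transpose of the action of \<open>L\<close>, so it is bijective.\<close>

lemma unit_iso: assumes ff: "fully_faithful C D L" and x: "x \<in> ob C" shows "is_iso C (unit x)"
proof -
  note [simp] = HomD[OF unit_Hom[OF x]] x
  have *: "transp w (fob L x) (fmor L f) = unit x \<cdot>\<^bsub>C\<^esub> f" if f: "f \<in> Hom C w x" for w f
    using transp_pre[OF f, of "idm D (fob L x)" "fob L x"] HomD[OF f] by (simp add: unit_def L.cod.idm_Hom)
  have surj: "\<exists>f \<in> Hom C w x. unit x \<cdot>\<^bsub>C\<^esub> f = a" if w: "w \<in> ob C" and a: "a \<in> Hom C w (fob R (fob L x))" for w a
  proof -
    obtain h where h: "h \<in> Hom D (fob L w) (fob L x)" "transp w (fob L x) h = a" using transp_surj[OF w _ a] by auto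
    obtain f where f: "f \<in> Hom C w x" "fmor L f = h" using ff w h(1) unfolding fully_faithful_def bij_betw_def by (metis imageE x)
    then show ?thesis using *[OF f(1)] f h(2) by auto
  qed
  have inj: "f = f'" if f: "f \<in> Hom C w x" "f' \<in> Hom C w x" "unit x \<cdot>\<^bsub>C\<^esub> f = unit x \<cdot>\<^bsub>C\<^esub> f'" for w f f'
  proof -
    have "fmor L f = fmor L f'" using f *[OF f(1)] *[OF f(2)] L.dom.Hom_ob1[OF f(1)] L.fmor_Hom by (intro transp_inj[of w]) auto
    then show ?thesis using ff f L.dom.Hom_ob1[OF f(1)] unfolding fully_faithful_def bij_betw_def inj_on_def by (meson x)
  qed
  obtain g where g: "g \<in> Hom C (fob R (fob L x)) x" "unit x \<cdot>\<^bsub>C\<^esub> g = idm C (fob R (fob L x))"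
    using surj[of "fob R (fob L x)" "idm C (fob R (fob L x))"] L.dom.idm_Hom by auto
  note [simp] = HomD[OF g(1)]
  have "g \<cdot>\<^bsub>C\<^esub> unit x = idm C x"
    by (rule inj[of _ x]) (auto simp: L.dom.assoc[symmetric] g(2) intro: HomI L.dom.idm_Hom)
  then show ?thesis using g unit_Hom[OF x] by (intro is_isoI) auto
qed

text \<open>Transposition turns composition with L g into composition with g, and it is
  injective.\<close>

lemma L_epi: assumes "is_epi C g" shows "is_epi D (fmor L g)"
  unfolding is_epi_def
proof (intro conjI ballI impI)
  have gm: "g \<in> mor C" using assms by (simp add: is_epi_def)
  then show "fmor L g \<in> mor D" by simp
  fix z a b assume "z \<in> ob D" "a \<in> Hom D (trg D (fmor L g)) z" "b \<in> Hom D (trg D (fmor L g)) z"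
    and eq: "a \<cdot>\<^bsub>D\<^esub> fmor L g = b \<cdot>\<^bsub>D\<^esub> fmor L g"
  then have a: "a \<in> Hom D (fob L (trg C g)) z" and b: "b \<in> Hom D (fob L (trg C g)) z" using gm by simp_all
  have "transp (trg C g) z a \<cdot>\<^bsub>C\<^esub> g = transp (trg C g) z b \<cdot>\<^bsub>C\<^esub> g"
    using transp_pre[OF mor_Hom[OF gm] a] transp_pre[OF mor_Hom[OF gm] b] eq by simp
  then have "transp (trg C g) z a = transp (trg C g) z b"
    using assms transp_Hom[OF _ a] transp_Hom[OF _ b] gm unfolding is_epi_def by (metis L.dom.trg_ob' L.dom.Hom_ob2)
  then show "a = b" by (rule transp_inj[OF _ a b, rotated]) (simp add: gm)
qed

text \<open>A lifting problem for L P along g transposes to one for P along R g, and R g is epi by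
  assumption.\<close>

lemma L_projective:
  assumes epi: "\<And>g. is_epi D g \<Longrightarrow> is_epi C (fmor R g)" and P: "projective C P" shows "projective D (fob L P)"
  unfolding projective_def
proof (intro conjI allI impI ballI)
  have Po: "P \<in> ob C" using P by (simp add: projective_def)
  then show "fob L P \<in> ob D" by simp
  fix g f assume g: "is_epi D g" and f: "f \<in> Hom D (fob L P) (trg D g)"
  have gm: "g \<in> mor D" using g by (simp add: is_epi_def)
  have "transp P (trg D g) f \<in> Hom C P (trg C (fmor R g))" using transp_Hom[OF Po f] gm by simp
  then obtain a where a: "a \<in> Hom C P (src C (fmor R g))" "fmor R g \<cdot>\<^bsub>C\<^esub> a = transp P (trg D g) f"
    using P epi[OF g] unfolding projective_def by blast
  have "a \<in> Hom C P (fob R (src D g))" using a(1) gm by simp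
  then obtain h where h: "h \<in> Hom D (fob L P) (src D g)" "transp P (src D g) h = a" using transp_surj[OF Po] gm by (metis L.cod.src_ob')
  have "transp P (trg D g) (g \<cdot>\<^bsub>D\<^esub> h) = transp P (trg D g) f"
    using transp_post[OF Po mor_Hom[OF gm] h(1)] h(2) a(2) by simp
  then have "g \<cdot>\<^bsub>D\<^esub> h = f" by (rule transp_inj[OF Po L.cod.cmp_Hom[OF h(1) mor_Hom[OF gm]] f])
  then show "\<exists>h\<in>Hom D (fob L P) (src D g). g \<cdot>\<^bsub>D\<^esub> h = f" using h by blast
qed

end

section \<open>The functors \<open>e\<close> and \<open>l\<close> of a recollement\<close>

locale recollement_enough =
  fixes A :: "('oa, 'ma, 'za) addcat_scheme" and B :: "('ob, 'mb, 'zb) addcat_scheme" and C :: "('oc, 'mc, 'zc) addcat_scheme"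
    and i :: "('oa, 'ma, 'ob, 'mb) functr" and e :: "('ob, 'mb, 'oc, 'mc) functr"
    and q p :: "('ob, 'mb, 'oa, 'ma) functr" and l r :: "('oc, 'mc, 'ob, 'mb) functr"
  assumes recollement: "recollement A B C i e q p l r"
    and enough_B: "enough_projectives B" and enough_C: "enough_projectives C"

sublocale recollement_enough \<subseteq> B: abelian_enough B
  using recollement enough_B by (simp add: recollement_def abelian_enough_def abelian_enough_axioms_def)

sublocale recollement_enough \<subseteq> C: abelian_enough C
  using recollement enough_C by (simp add: recollement_def abelian_enough_def abelian_enough_axioms_def)

sublocale recollement_enough \<subseteq> e: additive B C e
  using recollement B.preadditive_category_axioms C.preadditive_category_axioms
  by (simp add: recollement_def additive_def additive_axioms_def)

sublocale recollement_enough \<subseteq> l: additive C B l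
  using recollement B.preadditive_category_axioms C.preadditive_category_axioms
  by (simp add: recollement_def additive_def additive_axioms_def)

sublocale recollement_enough \<subseteq> le: adjunction C B l e
  using recollement l.is_functor_axioms e.is_functor_axioms
  by (simp add: recollement_def adjunction_def adjunction_axioms_def)

context recollement_enough
begin

text \<open>\<open>e\<close> is the left adjoint of r.\<close>

lemma e_epi: "is_epi B g \<Longrightarrow> is_epi C (fmor e g)"
proof -
  have "adjunction B C e r"
    using recollement e.is_functor_axioms
    by (simp add: recollement_def adjunction_def adjunction_axioms_def additive_functor_def)
  then show "is_epi B g \<Longrightarrow> is_epi C (fmor e g)" by (rule adjunction.L_epi)
qed

lemma l_projective: "projective C P \<Longrightarrow> projective B (fob l P)"
  by (rule le.L_projective[OF e_epi])

text \<open>An element T -> e y transposes to l T -> y. Since l T is projective, exactness in B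
  provides a preimage, which is transposed back.\<close>

lemma e_texact:
  assumes f: "f \<in> Hom B x y" and g: "g \<in> Hom B y z" and t: "B.texact f g"
  shows "C.texact (fmor e f) (fmor e g)"
proof (rule C.texactI[OF e.fmor_Hom[OF f] e.fmor_Hom[OF g]])
  note [simp] = B.hom[OF f] B.hom[OF g]
  fix T a assume T: "projective C T" and a: "a \<in> Hom C T (fob e y)" "cmp C (fmor e g) a = zer C T (fob e z)"
  note [simp] = C.hom[OF a(1)]
  have To: "T \<in> ob C" using T C.projective_ob by blast
  obtain h where h: "h \<in> Hom B (fob l T) y" "le.transp T y h = a" using le.transp_surj[OF To _ a(1)] by auto
  note [simp] = B.hom[OF h(1)]
  have z: "zer B y z \<in> Hom B y z" by (simp add: B.zer_Hom)
  have "le.transp T z (cmp B g h) = le.transp T z (cmp B (zer B y z) h)"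
    unfolding le.transp_post[OF To g h(1)] le.transp_post[OF To z h(1)] h(2) by (simp add: a(2))
  then have "cmp B g h = cmp B (zer B y z) h"
    by (rule le.transp_inj[OF To B.cmp_Hom[OF h(1) g] B.cmp_Hom[OF h(1) z]])
  then have "cmp B g h = zer B (fob l T) z" by simp
  then obtain b where b: "b \<in> Hom B (fob l T) x" "cmp B f b = h" using B.texactD[OF t f g l_projective[OF T] h(1)] by blast
  have "cmp C (fmor e f) (le.transp T x b) = a" using le.transp_post[OF To f b(1)] b(2) h(2) by simp
  then show "\<exists>b\<in>Hom C T (fob e x). cmp C (fmor e f) b = a" using le.transp_Hom[OF To b(1)] by blast
qed

end

sublocale recollement_enough \<subseteq> e: exact_functor B C e
  by unfold_locales (rule e_texact)

context recollement_enough
begin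

abbreviation "Ke \<equiv> Kb_functor C e"
abbreviation "Kl \<equiv> Kb_functor B l"

lemma kernel_e: "b \<in> ob B \<Longrightarrow> zero_object C (fob e b) \<longleftrightarrow> (\<exists>a \<in> ob A. isomorphic B (fob i a) b)"
  using recollement unfolding recollement_def by blast

lemma i_functor: "is_functor A B i"
  using recollement by (simp add: recollement_def additive_functor_def)

lemma e_i_zero: "a \<in> ob A \<Longrightarrow> zero_object C (fob e (fob i a))"
  using kernel_e[of "fob i a"] is_functor.fob[OF i_functor] B.isomorphic_refl by blast

lemma l_Kb_Proj: "S \<in> Kb_Proj C \<Longrightarrow> fob Kl S \<in> Kb_Proj B"
  by (simp add: B.Kb_Proj_iff C.Kb_Proj_iff l_projective)

text \<open>The inverse of the unit rather than the unit, so that both comparison maps point towards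
  the identity functor, as \<open>is_equivalence\<close> requires.\<close>

definition ucm :: "('oc, 'mc) cochain \<Rightarrow> int \<Rightarrow> 'mc" where "ucm X n = inv_mor C (le.unit (term_at X n))"
definition ccm :: "('ob, 'mb) cochain \<Rightarrow> int \<Rightarrow> 'mb" where "ccm X n = le.counit (term_at X n)"

lemma unit_is_iso: "x \<in> ob C \<Longrightarrow> is_iso C (le.unit x)"
  using recollement by (intro le.unit_iso) (simp_all add: recollement_def)

lemma ucm: assumes X: "C.cx X"
  shows ucm_cm: "ucm X \<in> chain_maps C (fob Ke (fob Kl X)) X" and ucm_iso: "is_iso C (ucm X n)"
proof -
  note [simp] = X unit_is_iso HomD[OF le.unit_Hom]
  show "is_iso C (ucm X n)" unfolding ucm_def by (rule C.inv_mor_iso) simp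
  note u = HomD[OF le.unit_Hom]
  show "ucm X \<in> chain_maps C (fob Ke (fob Kl X)) X"
  proof (rule C.cmI)
    fix n
    let ?d = "diff_at X n" and ?u = "le.unit (term_at X n)" and ?u' = "le.unit (term_at X (n + 1))"
    have n: "cmp C ?u' ?d = cmp C (fmor e (fmor l ?d)) ?u"
      by (rule le.unit_nat) (simp add: HomI)
    have "cmp C ?d (inv_mor C ?u) = cmp C (inv_mor C ?u') (cmp C ?u' (cmp C ?d (inv_mor C ?u)))"
      by (rule C.inv_mor_cancel1[symmetric]) (simp_all add: u)
    also have "\<dots> = cmp C (inv_mor C ?u') (cmp C (cmp C ?u' ?d) (inv_mor C ?u))" by (simp add: u C.assoc)
    also have "\<dots> = cmp C (inv_mor C ?u') (cmp C (fmor e (fmor l ?d)) (cmp C ?u (inv_mor C ?u)))" unfolding n by (simp add: u C.assoc)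
    also have "\<dots> = cmp C (inv_mor C ?u') (fmor e (fmor l ?d))" by (simp add: u inv_mor_right)
    finally show "cmp C (diff_at X n) (ucm X n) = cmp C (ucm X (n + 1)) (diff_at (fob Ke (fob Kl X)) n)" by (simp add: ucm_def)
  qed (simp_all add: ucm_def u)
qed

lemma ccm_cm: assumes X: "B.cx X" shows "ccm X \<in> chain_maps B (fob Kl (fob Ke X)) X"
proof (rule B.cmI)
  note [simp] = X
  note u = HomD[OF le.counit_Hom]
  fix n
  show "cmp B (diff_at X n) (ccm X n) = cmp B (ccm X (n + 1)) (diff_at (fob Kl (fob Ke X)) n)"
    using le.counit_nat[of "diff_at X n" "term_at X n" "term_at X (n + 1)"] by (simp add: ccm_def HomI)
qed (simp_all add: ccm_def HomD[OF le.counit_Hom] X)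

text \<open>By the triangle identity e of the counit is left inverse to the unit at e x, which is
  invertible because l is fully faithful.\<close>

lemma e_ccm_iso: assumes x: "x \<in> ob B" shows "is_iso C (fmor e (le.counit x))"
proof (rule C.iso_cancel_right)
  show "is_iso C (le.unit (fob e x))" by (rule unit_is_iso) (simp add: x)
  show "is_iso C (cmp C (fmor e (le.counit x)) (le.unit (fob e x)))"
    unfolding le.R_counit_unit[OF x] by (rule C.iso_idm) (simp add: x)
qed (use HomD[OF le.counit_Hom[OF x]] HomD[OF le.unit_Hom[of "fob e x"]] x in simp_all)

subsection \<open>From finite projective dimensions to the singular equivalence\<close>

context
  assumes pdi: "\<And>a. a \<in> ob A \<Longrightarrow> pd B (fob i a) < \<infinity>" and pde: "\<And>P. projective B P \<Longrightarrow> pd C (fob e P) < \<infinity>"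
begin

lemma LC_kernel_stalk: assumes M: "M \<in> ob B" "zero_object C (fob e M)" shows "B.LC (B.stalk M n)"
proof -
  obtain a where a: "a \<in> ob A" "isomorphic B (fob i a) M" using kernel_e[OF M(1)] M(2) by blast
  have "B.LC (B.stalk (fob i a) n)" using is_functor.fob[OF i_functor a(1)] pdi[OF a(1)] by (rule B.pd_LC_stalk)
  then show ?thesis by (rule B.stalk_iso_LC[OF a(2)])
qed

lemma LC_kernel: "X \<in> B.bc \<Longrightarrow> C.exact_cx (fob Ke X) \<Longrightarrow> B.LC X"
  by (rule e.kernel_LC[OF LC_kernel_stalk])

text \<open>\<open>e\<close> is exact, so Z may be replaced by a bounded complex S of projectives.
  The terms of e S have finite projective dimension by \<open>pde\<close>, and devissage gives
  perfectness of e S.\<close>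

lemma e_LC: assumes Z: "Z \<in> B.bc" "B.LC Z" shows "C.LC (fob Ke Z)"
proof -
  obtain S t where S: "S \<in> Kb_Proj B" and t: "t \<in> chain_maps B S Z" "B.qis S Z t" using B.LC_Kb_Proj[OF Z] .
  have Sb: "S \<in> B.bc" and Sp: "\<And>n. projective B (term_at S n)" using S by (simp_all add: B.Kb_Proj_iff)
  have "C.LC (fob Ke S)"
  proof (rule C.LC_from_stalks)
    show "C.LC (C.stalk (term_at (fob Ke S) n) (n + 1))" for n
      using C.pd_LC_stalk[OF _ pde[OF Sp]] Sb by simp
  qed (simp add: Sb)
  then show ?thesis
    using C.LC_qis[OF _ _ e.K_cm[OF t(1)] e.K_qis[OF _ _ t]] Sb Z by simp
qed

text \<open>\<open>l\<close> need not preserve the quasi-isomorphism t from S to Z, so the cone N of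
  t has to be examined. It is acyclic and e l N is isomorphic to N, hence l N is perfect by
  \<open>LC_kernel\<close>. As l S consists of projectives, l Z is perfect too.\<close>

lemma l_LC: assumes Z: "Z \<in> C.bc" "C.LC Z" shows "B.LC (fob Kl Z)"
proof -
  obtain S t where S: "S \<in> Kb_Proj C" and t: "t \<in> chain_maps C S Z" "C.qis S Z t" using C.LC_Kb_Proj[OF Z] .
  have Sb: "S \<in> C.bc" using S by (simp add: C.Kb_Proj_iff)
  note c [simp] = C.bc_cx[OF Sb] C.bc_cx[OF Z(1)]
  obtain N k j p q where N: "C.cone S Z t N k j p q" "N \<in> C.bc" using C.cone_bc[OF Sb Z(1) t(1)] by blast
  have eN: "C.exact_cx N" using C.cone_exact_iff_qis[OF N(1) c t(1)] t(2) by simp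
  have "B.LC (fob Kl N)"
  proof (rule LC_kernel)
    have "C.qis (fob Ke (fob Kl N)) N (ucm N)"
      using C.Kb_iso_qis[OF _ N(2) ucm_cm C.degreewise_iso_Kb[OF _ N(2) ucm_cm ucm_iso]] N(2) by simp
    then show "C.exact_cx (fob Ke (fob Kl N))"
      using C.qis_exact[OF _ _ ucm_cm[OF C.bc_cx[OF N(2)]]] N(2) eN by simp
  qed (simp add: N)
  then show ?thesis
    using B.LC_cone_eq[OF _ _ l.K_cm[OF t(1) c] l.K_cone[OF N(1) c t(1)]] B.Kb_Proj_LC[OF l_Kb_Proj[OF S]] Sb Z(1) by simp
qed

section \<open>The functor induced by \<open>e\<close> and its quasi-inverse induced by
  \<open>l\<close>\<close>

lemma Db_e: "Db_functor C e = loc_induced (Kb C) C.WK Ke"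
  by (simp add: Db_functor_def verdier_induced_def)

abbreviation "De \<equiv> Db_functor C e"

lemma De_loc: "loc_functors (Kb B) B.WK (Db B) (Kb C) C.WK (Db C) Ke"
  unfolding loc_functors_def loc_functors_axioms_def
  by (auto intro!: B.K.localized_axioms C.K.localized_axioms e.K_functor elim!: B.WKE
      simp: e.fmor_K intro!: C.WK_iff e.K_cm e.K_qis)

lemma De_functor: "is_functor (Db B) (Db C) De"
  and De_ob: "fob De X = fob Ke X"
  unfolding Db_e
  using loc_functors.loc_induced_functor[OF De_loc] loc_functors.fob_loc_induced[OF De_loc] by auto

lemma De_Q: assumes "X \<in> B.bc" "Y \<in> B.bc" "f \<in> chain_maps B X Y"
  shows "fmor De (B.K.Q (B.hc X Y f)) = C.K.Q (C.hc (fob Ke X) (fob Ke Y) (\<lambda>n. fmor e (f n)))"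
  using loc_functors.loc_induced_Q[OF De_loc, of "B.hc X Y f"] assms by (simp add: Db_e e.fmor_K)

lemma De_perf: assumes u: "u \<in> B.WD" shows "fmor De u \<in> C.WD"
proof -
  interpret De: is_functor "Db B" "Db C" De by (rule De_functor)
  note [simp del] = B.K.loc_functor_simps(2) C.K.loc_functor_simps(2)
  obtain X X' f Z k j p q a b where pm: "B.perf_mor u X X' f Z k j p q a b" using B.WD_perf_mor[OF u] .
  then have um: "u \<in> mor (Db B)" and X: "X \<in> B.bc" "X' \<in> B.bc" "Z \<in> B.bc" and f: "f \<in> chain_maps B X X'"
    and Z: "B.cone X X' f Z k j p q" "B.LC Z" and a: "a \<in> Hom (Db B) (src (Db B) u) X" "b \<in> Hom (Db B) (trg (Db B) u) X'"
    "is_iso (Db B) a" "is_iso (Db B) b" "cmp (Db B) b u = cmp (Db B) (B.K.Q (B.hc X X' f)) a"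
    by (auto simp: B.perf_mor_def)
  note c [simp] = B.bc_cx[OF X(1)] B.bc_cx[OF X(2)]
  have m: "B.hc X X' f \<in> mor (Kb B)" using X f by simp
  note [simp] = um HomD[OF a(1)] HomD[OF a(2)] m
  have "cmp (Db C) (fmor De b) (fmor De u) = cmp (Db C) (C.K.Q (C.hc (fob Ke X) (fob Ke X') (\<lambda>n. fmor e (f n)))) (fmor De a)"
    using a(5) De_Q[OF X(1,2) f] by (simp add: De.fmor_cmp'[symmetric]) (simp add: De.fmor_cmp')
  then have "C.perf_mor (fmor De u) (fob Ke X) (fob Ke X') (\<lambda>n. fmor e (f n)) (fob Ke Z) (\<lambda>n. fmor e (k n)) (\<lambda>n. fmor e (j n))
     (\<lambda>n. fmor e (p n)) (\<lambda>n. fmor e (q n)) (fmor De a) (fmor De b)"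
    unfolding C.perf_mor_def using X e.K_cm[OF f c] e.K_cone[OF Z(1) c f] e_LC[OF X(3) Z(2)] De.fmor_iso[OF a(3)] De.fmor_iso[OF a(4)]
      De.fmor_Hom[OF a(1)] De.fmor_Hom[OF a(2)]
    by (simp add: De_ob)
  then show ?thesis by (rule C.perf_mor_WD)
qed

abbreviation "Se \<equiv> Dsg_functor C e"

lemma Se_def: "Se = loc_induced (Db C) C.WD De"
  by (simp add: Dsg_functor_def verdier_induced_def)

lemma Se_loc: "loc_functors (Db B) B.WD (Dsg B) (Db C) C.WD (Dsg C) De"
  unfolding loc_functors_def loc_functors_axioms_def
  by (auto intro!: B.D.localized_axioms C.D.localized_axioms De_functor De_perf)

lemma Se_functor: "is_functor (Dsg B) (Dsg C) Se"
  and Se_ob: "fob Se X = fob Ke X"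
  unfolding Se_def
  using loc_functors.loc_induced_functor[OF Se_loc] loc_functors.fob_loc_induced[OF Se_loc] by (auto simp: De_ob)

lemma Se_Q: "u \<in> mor (Db B) \<Longrightarrow> fmor Se (B.D.Q u) = C.D.Q (fmor De u)"
  unfolding Se_def by (rule loc_functors.loc_induced_Q[OF Se_loc])

text \<open>Both localizations of B are applied at once: \<open>l\<close> sends quasi-isomorphisms
  only to morphisms with perfect cone, which need not be invertible in \<open>Db B\<close> but are
  in \<open>Dsg B\<close>.\<close>

definition Gl0 where
  "Gl0 = comp_functor (loc_functor (Db B) B.WD) (comp_functor (loc_functor (Kb B) B.WK) Kl)"

lemma Gl0_functor: "is_functor (Kb C) (Dsg B) Gl0"
  unfolding Gl0_def
  by (rule is_functor_comp[OF is_functor_comp[OF l.K_functor B.QK.is_functor_axioms] B.QD.is_functor_axioms])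

lemma Gl0_ob: "fob Gl0 X = fob Kl X" by (simp add: Gl0_def)

lemma Gl0_hc: "X \<in> C.bc \<Longrightarrow> Y \<in> C.bc \<Longrightarrow> f \<in> chain_maps C X Y \<Longrightarrow>
    fmor Gl0 (C.hc X Y f) = B.D.Q (B.K.Q (B.hc (fob Kl X) (fob Kl Y) (\<lambda>n. fmor l (f n))))"
  by (simp add: Gl0_def l.fmor_K del: B.K.loc_functor_simps(2) B.D.loc_functor_simps(2))

lemma Gl0_iso: assumes "X \<in> C.bc" "Y \<in> C.bc" "f \<in> chain_maps C X Y" "C.cone X Y f Z k j p' q'" "Z \<in> C.bc" "B.LC (fob Kl Z)"
  shows "is_iso (Dsg B) (fmor Gl0 (C.hc X Y f))"
  unfolding Gl0_hc[OF assms(1-3)]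
  by (rule B.D.Q_iso[OF B.perf_chain_map_WD[OF _ _ _ l.K_cm l.K_cone]]) (use assms in auto)

lemma Gl0_inverting: "inverting_functor (Kb C) C.WK (Db C) (Dsg B) Gl0"
  unfolding inverting_functor_def inverting_functor_axioms_def
proof (intro conjI allI impI C.K.localized_axioms Gl0_functor)
  fix s assume "s \<in> C.WK"
  then obtain X Y f where f: "X \<in> C.bc" "Y \<in> C.bc" "f \<in> chain_maps C X Y" "C.qis X Y f" "s = C.hc X Y f" by (rule C.WKE)
  obtain Z k j p q where Z: "C.cone X Y f Z k j p q" "Z \<in> C.bc" using C.cone_bc[OF f(1-3)] by blast
  have "C.exact_cx Z" using C.cone_exact_iff_qis[OF Z(1) C.bc_cx[OF f(1)] C.bc_cx[OF f(2)] f(3)] f(4) by simp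
  then have "B.LC (fob Kl Z)" using l_LC[OF Z(2)] C.exact_LC[OF C.bc_cx[OF Z(2)]] by simp
  then show "is_iso (Dsg B) (fmor Gl0 s)" using Gl0_iso[OF f(1-3) Z] f(5) by simp
qed

abbreviation "Gl1 \<equiv> loc_lift (Kb C) (Dsg B) Gl0"

lemma Gl1_functor: "is_functor (Db C) (Dsg B) Gl1"
  by (rule inverting_functor.loc_lift_functor[OF Gl0_inverting])

lemma Gl1_Q: "m \<in> mor (Kb C) \<Longrightarrow> fmor Gl1 (C.K.Q m) = fmor Gl0 m"
  by (rule inverting_functor.loc_lift_Q[OF Gl0_inverting])

lemma Gl1_inverting: "inverting_functor (Db C) C.WD (Dsg C) (Dsg B) Gl1"
  unfolding inverting_functor_def inverting_functor_axioms_def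
proof (intro conjI allI impI C.D.localized_axioms Gl1_functor)
  interpret G: is_functor "Db C" "Dsg B" Gl1 by (rule Gl1_functor)
  note [simp del] = C.K.loc_functor_simps(2)
  fix u assume "u \<in> C.WD"
  then obtain X X' f Z k j p q a b where "C.perf_mor u X X' f Z k j p q a b" by (rule C.WD_perf_mor)
  then have u: "u \<in> mor (Db C)" and X: "X \<in> C.bc" "X' \<in> C.bc" "Z \<in> C.bc" and f: "f \<in> chain_maps C X X'"
    and Z: "C.cone X X' f Z k j p q" "C.LC Z" and a: "a \<in> Hom (Db C) (src (Db C) u) X" "b \<in> Hom (Db C) (trg (Db C) u) X'"
    "is_iso (Db C) a" "is_iso (Db C) b" "cmp (Db C) b u = cmp (Db C) (C.K.Q (C.hc X X' f)) a"
    by (auto simp: C.perf_mor_def)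
  have m: "C.hc X X' f \<in> mor (Kb C)" using X f by simp
  note [simp] = u HomD[OF a(1)] HomD[OF a(2)] m
  have "is_iso (Dsg B) (fmor Gl1 (C.K.Q (C.hc X X' f)))"
    using Gl0_iso[OF X(1,2) f Z(1) X(3) l_LC[OF X(3) Z(2)]] Gl1_Q[OF m] by simp
  then have "is_iso (Dsg B) (fmor Gl1 (cmp (Db C) b u))"
    unfolding a(5) using a(3) by (simp add: G.fmor_cmp' G.fmor_iso B.QD.cod.iso_cmp)
  then have i: "is_iso (Dsg B) (cmp (Dsg B) (fmor Gl1 b) (fmor Gl1 u))" by (simp add: G.fmor_cmp')
  show "is_iso (Dsg B) (fmor Gl1 u)"
    by (rule B.QD.cod.iso_cancel_left[OF G.fmor_iso[OF a(4)] i]) (use G.fmor_mor G.fmor_src G.fmor_trg in simp_all)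
qed

abbreviation "Gl \<equiv> loc_lift (Db C) (Dsg B) Gl1"

lemma Gl_functor: "is_functor (Dsg C) (Dsg B) Gl"
  by (rule inverting_functor.loc_lift_functor[OF Gl1_inverting])

lemma Gl_Q: "m \<in> mor (Db C) \<Longrightarrow> fmor Gl (C.D.Q m) = fmor Gl1 m"
  by (rule inverting_functor.loc_lift_Q[OF Gl1_inverting])

section \<open>The natural isomorphisms given by unit and counit\<close>

lemma ccm_perf: assumes X: "X \<in> B.bc" shows "B.K.Q (B.hc (fob Kl (fob Ke X)) X (ccm X)) \<in> B.WD"
proof -
  note c [simp] = B.bc_cx[OF X] X
  have lb: "fob Kl (fob Ke X) \<in> B.bc" by simp
  note cm = ccm_cm[OF c(1)]
  obtain Z k j p q where Z: "B.cone (fob Kl (fob Ke X)) X (ccm X) Z k j p q" "Z \<in> B.bc" using B.cone_bc[OF lb X cm] by blast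
  have eb: "fob Ke (fob Kl (fob Ke X)) \<in> C.bc" "fob Ke X \<in> C.bc" by simp_all
  have em: "(\<lambda>n. fmor e (ccm X n)) \<in> chain_maps C (fob Ke (fob Kl (fob Ke X))) (fob Ke X)"
    by (rule e.K_cm[OF cm]) (use lb in auto)
  have "C.qis (fob Ke (fob Kl (fob Ke X))) (fob Ke X) (\<lambda>n. fmor e (ccm X n))"
    by (rule C.Kb_iso_qis[OF eb em C.degreewise_iso_Kb[OF eb em]]) (simp add: ccm_def e_ccm_iso)
  moreover have "C.cone (fob Ke (fob Kl (fob Ke X))) (fob Ke X) (\<lambda>n. fmor e (ccm X n)) (fob Ke Z) (\<lambda>n. fmor e (k n)) (\<lambda>n. fmor e (j n)) (\<lambda>n. fmor e (p n)) (\<lambda>n. fmor e (q n))"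
    by (rule e.K_cone[OF Z(1) B.bc_cx[OF lb] c(1) cm])
  ultimately have "C.exact_cx (fob Ke Z)" using C.cone_exact_iff_qis[OF _ C.bc_cx[OF eb(1)] C.bc_cx[OF eb(2)] em] by blast
  then have "B.LC Z" by (rule LC_kernel[OF Z(2)])
  then show ?thesis by (rule B.perf_chain_map_WD[OF lb X Z(2) cm Z(1)])
qed

definition eta_B :: "('ob, 'mb) cochain \<Rightarrow> ('ob, 'mb) sing_mor" where
  "eta_B X = B.D.Q (B.K.Q (B.hc (fob Kl (fob Ke X)) X (ccm X)))"

definition eta_C :: "('oc, 'mc) cochain \<Rightarrow> ('oc, 'mc) sing_mor" where
  "eta_C X = C.D.Q (C.K.Q (C.hc (fob Ke (fob Kl X)) X (ucm X)))"

lemma eta_B: assumes X: "X \<in> B.bc" shows "eta_B X \<in> Hom (Dsg B) (fob Kl (fob Ke X)) X" "is_iso (Dsg B) (eta_B X)"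
proof -
  have "B.hc (fob Kl (fob Ke X)) X (ccm X) \<in> Hom (Kb B) (fob Kl (fob Ke X)) X"
    by (rule B.hclass_Hom) (use X ccm_cm in auto)
  then show "eta_B X \<in> Hom (Dsg B) (fob Kl (fob Ke X)) X"
    unfolding eta_B_def using B.QD.fmor_Hom[OF B.QK.fmor_Hom] by simp
  show "is_iso (Dsg B) (eta_B X)" unfolding eta_B_def by (rule B.D.Q_iso[OF ccm_perf[OF X]])
qed

lemma eta_C: assumes X: "X \<in> C.bc" shows "eta_C X \<in> Hom (Dsg C) (fob Ke (fob Kl X)) X" "is_iso (Dsg C) (eta_C X)"
proof -
  have b: "fob Ke (fob Kl X) \<in> C.bc" using X by simp
  note cm = ucm_cm[OF C.bc_cx[OF X]]
  have "C.hc (fob Ke (fob Kl X)) X (ucm X) \<in> Hom (Kb C) (fob Ke (fob Kl X)) X"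
    by (rule C.hclass_Hom[OF b X cm])
  then show "eta_C X \<in> Hom (Dsg C) (fob Ke (fob Kl X)) X"
    unfolding eta_C_def using C.QD.fmor_Hom[OF C.QK.fmor_Hom] by simp
  show "is_iso (Dsg C) (eta_C X)" unfolding eta_C_def
    using C.degreewise_iso_Kb[OF b X cm ucm_iso[OF C.bc_cx[OF X]]] by (intro C.QD.fmor_iso C.QK.fmor_iso)
qed

lemma eta_B_natural_Kb:
  assumes X: "X \<in> B.bc" and X': "X' \<in> B.bc" and f: "f \<in> chain_maps B X X'"
  shows "cmp (Dsg B) (eta_B X') (B.D.Q (B.K.Q (B.hc (fob Kl (fob Ke X)) (fob Kl (fob Ke X')) (\<lambda>n. fmor l (fmor e (f n)))))) =
    cmp (Dsg B) (B.D.Q (B.K.Q (B.hc X X' f))) (eta_B X)"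
proof -
  note [simp del] = B.K.loc_functor_simps(2) B.D.loc_functor_simps(2)
  note c [simp] = B.bc_cx[OF X] B.bc_cx[OF X'] X X' ccm_cm B.cm_typ[OF f]
  have b: "fob Kl (fob Ke X) \<in> B.bc" "fob Kl (fob Ke X') \<in> B.bc" by simp_all
  have m: "(\<lambda>n. fmor l (fmor e (f n))) \<in> chain_maps B (fob Kl (fob Ke X)) (fob Kl (fob Ke X'))"
    by (rule l.K_cm[OF e.K_cm[OF f]]) (simp_all add: e.K_cx)
  have h: "B.hc (fob Kl (fob Ke X')) X' (ccm X') \<in> mor (Kb B)" "B.hc (fob Kl (fob Ke X)) X (ccm X) \<in> mor (Kb B)" "B.hc X X' f \<in> mor (Kb B)"
     "B.hc (fob Kl (fob Ke X)) (fob Kl (fob Ke X')) (\<lambda>n. fmor l (fmor e (f n))) \<in> mor (Kb B)"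
    using b f m by simp_all
  have "(\<lambda>n. cmp B (ccm X' n) (fmor l (fmor e (f n)))) = (\<lambda>n. cmp B (f n) (ccm X n))"
    using le.counit_nat[OF B.cm_Hom[OF f]] by (simp add: ccm_def)
  then have "cmp (Kb B) (B.hc (fob Kl (fob Ke X')) X' (ccm X')) (B.hc (fob Kl (fob Ke X)) (fob Kl (fob Ke X')) (\<lambda>n. fmor l (fmor e (f n)))) =
    cmp (Kb B) (B.hc X X' f) (B.hc (fob Kl (fob Ke X)) X (ccm X))"
    using b m f by simp
  then show ?thesis unfolding eta_B_def using h by (simp add: B.QD.fmor_cmp'[symmetric] B.QK.fmor_cmp'[symmetric])
qed

lemma eta_C_natural_Kb:
  assumes X: "X \<in> C.bc" and X': "X' \<in> C.bc" and f: "f \<in> chain_maps C X X'"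
  shows "cmp (Dsg C) (eta_C X') (C.D.Q (C.K.Q (C.hc (fob Ke (fob Kl X)) (fob Ke (fob Kl X')) (\<lambda>n. fmor e (fmor l (f n)))))) =
    cmp (Dsg C) (C.D.Q (C.K.Q (C.hc X X' f))) (eta_C X)"
proof -
  note [simp del] = C.K.loc_functor_simps(2) C.D.loc_functor_simps(2)
  note c [simp] = C.bc_cx[OF X] C.bc_cx[OF X'] X X' ucm_cm C.cm_typ[OF f]
  have b: "fob Ke (fob Kl X) \<in> C.bc" "fob Ke (fob Kl X') \<in> C.bc" by simp_all
  have m: "(\<lambda>n. fmor e (fmor l (f n))) \<in> chain_maps C (fob Ke (fob Kl X)) (fob Ke (fob Kl X'))"
    by (rule e.K_cm[OF l.K_cm[OF f]]) (simp_all add: l.K_cx)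
  have h: "C.hc (fob Ke (fob Kl X')) X' (ucm X') \<in> mor (Kb C)" "C.hc (fob Ke (fob Kl X)) X (ucm X) \<in> mor (Kb C)" "C.hc X X' f \<in> mor (Kb C)"
     "C.hc (fob Ke (fob Kl X)) (fob Ke (fob Kl X')) (\<lambda>n. fmor e (fmor l (f n))) \<in> mor (Kb C)"
    using b f m by simp_all
  have "cmp C (ucm X' n) (fmor e (fmor l (f n))) = cmp C (f n) (ucm X n)" for n
  proof -
    let ?u = "le.unit (term_at X n)" and ?u' = "le.unit (term_at X' n)"
    note u = HomD[OF le.unit_Hom]
    have n: "cmp C ?u' (f n) = cmp C (fmor e (fmor l (f n))) ?u" by (rule le.unit_nat[OF C.cm_Hom[OF f]])
    have "cmp C (ucm X' n) (fmor e (fmor l (f n))) = cmp C (inv_mor C ?u') (cmp C (cmp C (fmor e (fmor l (f n))) ?u) (inv_mor C ?u))"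
      by (simp add: ucm_def C.assoc u unit_is_iso inv_mor_right)
    also have "\<dots> = cmp C (f n) (ucm X n)"
      unfolding n[symmetric] by (simp add: ucm_def C.assoc u unit_is_iso C.inv_mor_cancel1)
    finally show ?thesis .
  qed
  then have "cmp (Kb C) (C.hc (fob Ke (fob Kl X')) X' (ucm X')) (C.hc (fob Ke (fob Kl X)) (fob Ke (fob Kl X')) (\<lambda>n. fmor e (fmor l (f n)))) =
    cmp (Kb C) (C.hc X X' f) (C.hc (fob Ke (fob Kl X)) X (ucm X))"
    using b m f by simp
  then show ?thesis unfolding eta_C_def using h by (simp add: C.QD.fmor_cmp'[symmetric] C.QK.fmor_cmp'[symmetric])
qed

text \<open>Generators are used twice, first to pass from \<open>Dsg B\<close> to
  \<open>Db B\<close> and then from \<open>Db B\<close> to chain maps, where the claim is the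
  naturality of the counit in each degree.\<close>

lemma GF_natural: assumes m: "m \<in> Hom (Dsg B) x y"
  shows "cmp (Dsg B) (eta_B y) (fmor (comp_functor Gl Se) m) =
    cmp (Dsg B) (fmor (id_functor :: (('ob, 'mb) cochain, ('ob, 'mb) sing_mor, _, _) functr) m) (eta_B x)"
proof (rule B.D.naturality_from_generators[OF is_functor_comp[OF Se_functor Gl_functor] is_functor_id[OF B.D.category_L] _ _ m])
  interpret De: is_functor "Db B" "Db C" De by (rule De_functor)
  note [simp del] = B.K.loc_functor_simps(2) B.D.loc_functor_simps(2) C.K.loc_functor_simps(2) C.D.loc_functor_simps(2)
  fix X assume "X \<in> ob (Db B)"
  then show "eta_B X \<in> Hom (Dsg B) (fob (comp_functor Gl Se) X) (fob id_functor X)"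
    using eta_B(1) by (simp add: Se_ob Gl0_ob)
next
  interpret De: is_functor "Db B" "Db C" De by (rule De_functor)
  note [simp del] = B.K.loc_functor_simps(2) B.D.loc_functor_simps(2) C.K.loc_functor_simps(2) C.D.loc_functor_simps(2)
  fix u assume u: "u \<in> mor (Db B)"
  have "cmp (Dsg B) (eta_B (trg (Db B) u)) (fmor (comp_functor Gl1 De) u) = cmp (Dsg B) (fmor (loc_functor (Db B) B.WD) u) (eta_B (src (Db B) u))"
  proof (rule B.K.naturality_from_generators[OF is_functor_comp[OF De_functor Gl1_functor] B.QD.is_functor_axioms _ _ mor_Hom[OF u]])
    fix X assume "X \<in> ob (Kb B)"
    then show "eta_B X \<in> Hom (Dsg B) (fob (comp_functor Gl1 De) X) (fob (loc_functor (Db B) B.WD) X)"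
      using eta_B(1) by (simp add: De_ob Gl0_ob)
  next
    fix m assume "m \<in> mor (Kb B)"
    then obtain X X' f where f: "X \<in> B.bc" "X' \<in> B.bc" "f \<in> chain_maps B X X'" "m = B.hc X X' f" by (rule B.Kb_morE)
    have cm: "(\<lambda>n. fmor e (f n)) \<in> chain_maps C (fob Ke X) (fob Ke X')" by (rule e.K_cm[OF f(3)]) (use f in auto)
    have "fmor (comp_functor Gl1 De) (B.K.Q m) = B.D.Q (B.K.Q (B.hc (fob Kl (fob Ke X)) (fob Kl (fob Ke X')) (\<lambda>n. fmor l (fmor e (f n)))))"
      using f cm by (simp add: De_Q Gl1_Q Gl0_hc)
    then show "cmp (Dsg B) (eta_B (trg (Kb B) m)) (fmor (comp_functor Gl1 De) (B.K.Q m)) =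
      cmp (Dsg B) (fmor (loc_functor (Db B) B.WD) (B.K.Q m)) (eta_B (src (Kb B) m))"
      using eta_B_natural_Kb[OF f(1-3)] f(4) by simp
  qed
  then show "cmp (Dsg B) (eta_B (trg (Db B) u)) (fmor (comp_functor Gl Se) (B.D.Q u)) =
      cmp (Dsg B) (fmor id_functor (B.D.Q u)) (eta_B (src (Db B) u))"
    using u by (simp add: Se_Q Gl_Q)
qed

lemma FG_natural: assumes m: "m \<in> Hom (Dsg C) x y"
  shows "cmp (Dsg C) (eta_C y) (fmor (comp_functor Se Gl) m) =
    cmp (Dsg C) (fmor (id_functor :: (('oc, 'mc) cochain, ('oc, 'mc) sing_mor, _, _) functr) m) (eta_C x)"
proof (rule C.D.naturality_from_generators[OF is_functor_comp[OF Gl_functor Se_functor] is_functor_id[OF C.D.category_L] _ _ m])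
  note [simp del] = B.K.loc_functor_simps(2) B.D.loc_functor_simps(2) C.K.loc_functor_simps(2) C.D.loc_functor_simps(2)
  fix X assume "X \<in> ob (Db C)"
  then show "eta_C X \<in> Hom (Dsg C) (fob (comp_functor Se Gl) X) (fob id_functor X)"
    using eta_C(1) by (simp add: Se_ob Gl0_ob)
next
  note [simp del] = B.K.loc_functor_simps(2) B.D.loc_functor_simps(2) C.K.loc_functor_simps(2) C.D.loc_functor_simps(2)
  fix u assume u: "u \<in> mor (Db C)"
  have "cmp (Dsg C) (eta_C (trg (Db C) u)) (fmor (comp_functor Se Gl1) u) = cmp (Dsg C) (fmor (loc_functor (Db C) C.WD) u) (eta_C (src (Db C) u))"
  proof (rule C.K.naturality_from_generators[OF is_functor_comp[OF Gl1_functor Se_functor] C.QD.is_functor_axioms _ _ mor_Hom[OF u]])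
    fix X assume "X \<in> ob (Kb C)"
    then show "eta_C X \<in> Hom (Dsg C) (fob (comp_functor Se Gl1) X) (fob (loc_functor (Db C) C.WD) X)"
      using eta_C(1) by (simp add: Se_ob Gl0_ob)
  next
    fix m assume "m \<in> mor (Kb C)"
    then obtain X X' f where f: "X \<in> C.bc" "X' \<in> C.bc" "f \<in> chain_maps C X X'" "m = C.hc X X' f" by (rule C.Kb_morE)
    have cm: "(\<lambda>n. fmor l (f n)) \<in> chain_maps B (fob Kl X) (fob Kl X')" by (rule l.K_cm[OF f(3)]) (use f in auto)
    have "fmor (comp_functor Se Gl1) (C.K.Q m) = C.D.Q (C.K.Q (C.hc (fob Ke (fob Kl X)) (fob Ke (fob Kl X')) (\<lambda>n. fmor e (fmor l (f n)))))"
      using f cm by (simp add: De_Q Gl1_Q Gl0_hc Se_Q)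
    then show "cmp (Dsg C) (eta_C (trg (Kb C) m)) (fmor (comp_functor Se Gl1) (C.K.Q m)) =
      cmp (Dsg C) (fmor (loc_functor (Db C) C.WD) (C.K.Q m)) (eta_C (src (Kb C) m))"
      using eta_C_natural_Kb[OF f(1-3)] f(4) by simp
  qed
  then show "cmp (Dsg C) (eta_C (trg (Db C) u)) (fmor (comp_functor Se Gl) (C.D.Q u)) =
      cmp (Dsg C) (fmor id_functor (C.D.Q u)) (eta_C (src (Db C) u))"
    using u by (simp add: Gl_Q)
qed

lemma singular_equivalence: "induces_singular_equivalence B C e"
  unfolding induces_singular_equivalence_def
proof
  show "\<forall>X\<in>Kb_Proj B. \<exists>Y\<in>Kb_Proj C. isomorphic (Db C) (fob De X) Y"
  proof
    fix X assume X: "X \<in> Kb_Proj B"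
    then have Xb: "X \<in> B.bc" by (simp add: B.Kb_Proj_iff)
    obtain S c where S: "S \<in> Kb_Proj C" "c \<in> Hom (Db C) S (fob Ke X)" "is_iso (Db C) c"
      by (rule C.LC_isomorphic_Kb_Proj[OF _ e_LC[OF Xb B.Kb_Proj_LC[OF X]]]) (use Xb in auto)
    have "isomorphic (Db C) S (fob Ke X)" using S(2,3) unfolding isomorphic_def by blast
    then show "\<exists>Y\<in>Kb_Proj C. isomorphic (Db C) (fob De X) Y"
      using S(1) C.D.isomorphic_sym by (auto simp: De_ob)
  qed
  have "naturally_isomorphic (Dsg B) (Dsg B) (comp_functor Gl Se) id_functor"
    unfolding naturally_isomorphic_def
    by (rule exI[of _ eta_B], intro conjI ballI GF_natural) (use eta_B in \<open>auto simp: Se_ob Gl0_ob\<close>)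
  moreover have "naturally_isomorphic (Dsg C) (Dsg C) (comp_functor Se Gl) id_functor"
    unfolding naturally_isomorphic_def
    by (rule exI[of _ eta_C], intro conjI ballI FG_natural) (use eta_C in \<open>auto simp: Se_ob Gl0_ob\<close>)
  ultimately show "is_equivalence (Dsg B) (Dsg C) Se"
    unfolding is_equivalence_def using Se_functor Gl_functor by blast
qed

end

subsection \<open>From the singular equivalence to finite projective dimensions\<close>

text \<open>The two complexes differ only in their zero terms: e sends the chosen zero object of B
  to some zero object of C, not necessarily the chosen one.\<close>

lemma stalk_e_iso: assumes M: "M \<in> ob B"
  shows "is_iso (Kb C) (C.hc (fob Ke (B.stalk M 0)) (C.stalk (fob e M) 0) (\<lambda>n. if n = 0 then idm C (fob e M) else zer C (fob e B.zob) C.zob))"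
    (is "is_iso _ (C.hc ?X ?Y ?f)")
proof -
  note [simp] = M
  have b: "?X \<in> C.bc" "?Y \<in> C.bc" using B.stalk_bc[OF M] C.stalk_bc[of "fob e M"] by simp_all
  have z: "zero_object C (fob e B.zob)" by (rule e.fob_zero[OF B.zob])
  have c: "?f \<in> chain_maps C ?X ?Y" by (rule C.cmI) auto
  show ?thesis by (rule C.degreewise_iso_Kb[OF b c]) (auto intro: C.zero_iso z C.zob C.iso_idm)
qed

text \<open>The stalk of P lies in \<open>Kb_Proj B\<close>, so its image is perfect, and
  perfectness of the stalk of e P bounds the projective dimension.\<close>

lemma finite_pd_e:
  assumes s: "induces_singular_equivalence B C e" and P: "projective B P" shows "pd C (fob e P) < \<infinity>"
proof -
  have Po [simp]: "P \<in> ob B" by (rule B.projective_ob[OF P])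
  have "B.stalk P 0 \<in> Kb_Proj B"
    using B.stalk_bc[OF Po] P B.zero_object_projective[OF B.zob] by (simp add: B.Kb_Proj_iff)
  then obtain Y where Y: "Y \<in> Kb_Proj C" "isomorphic (Db C) (fob (Db_functor C e) (B.stalk P 0)) Y"
    using s unfolding induces_singular_equivalence_def by blast
  have "fob (Db_functor C e) (B.stalk P 0) = fob Ke (B.stalk P 0)"
    by (simp add: Db_functor_def verdier_induced_def loc_induced_def)
  then have Y': "isomorphic (Db C) (fob Ke (B.stalk P 0)) Y" using Y(2) by simp
  have b: "fob Ke (B.stalk P 0) \<in> C.bc" "C.stalk (fob e P) 0 \<in> C.bc" using B.stalk_bc[OF Po] C.stalk_bc[of "fob e P"] by simp_all
  have "C.LC (fob Ke (B.stalk P 0))"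
    using C.Db_isomorphic_LC[OF b(1) _ Y'] C.Kb_Proj_LC[OF Y(1)] Y(1) by (simp add: C.Kb_Proj_iff)
  moreover have "isomorphic (Db C) (fob Ke (B.stalk P 0)) (C.stalk (fob e P) 0)"
    using C.QK.fob_isomorphic[OF C.K.isomorphicI[OF stalk_e_iso[OF Po]]] by simp
  ultimately have "C.LC (C.stalk (fob e P) 0)" using C.Db_isomorphic_LC[OF b] by simp
  then show ?thesis by (intro C.LC_stalk_pd) simp_all
qed

text \<open>As e (i a) = 0, the stalk of i a and a zero complex have isomorphic images in
  \<open>Dsg C\<close>. The quasi-inverse G carries this isomorphism back to \<open>Dsg B\<close>,
  where perfectness is invariant under isomorphism.\<close>

lemma finite_pd_i:
  assumes s: "induces_singular_equivalence B C e" and a: "a \<in> ob A" shows "pd B (fob i a) < \<infinity>"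
proof -
  let ?b = "fob i a" and ?S = "Dsg_functor C e"
  let ?X = "B.stalk ?b 0" and ?O = "B.stalk B.zob 0"
  have bo [simp]: "?b \<in> ob B" by (rule is_functor.fob[OF i_functor a])
  have X: "?X \<in> B.bc" "?O \<in> B.bc" by (simp_all add: B.stalk_bc)
  have z: "zero_object C (fob e ?b)" "zero_object C (fob e B.zob)" using e_i_zero[OF a] e.fob_zero[OF B.zob] by auto
  obtain G where F: "is_functor (Dsg B) (Dsg C) ?S" and G: "is_functor (Dsg C) (Dsg B) G"
    and nat: "naturally_isomorphic (Dsg B) (Dsg B) (comp_functor G ?S) id_functor"
    using s unfolding induces_singular_equivalence_def is_equivalence_def by blast
  have S_ob: "fob ?S Y = fob Ke Y" for Y
    by (simp add: Dsg_functor_def Db_functor_def verdier_induced_def loc_induced_def)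
  have GS: "isomorphic (Dsg B) (fob G (fob Ke Y)) Y" if "Y \<in> B.bc" for Y
  proof -
    have "\<exists>\<eta>. \<forall>x \<in> ob (Dsg B). \<eta> x \<in> Hom (Dsg B) (fob (comp_functor G ?S) x) x \<and> is_iso (Dsg B) (\<eta> x)"
      using nat unfolding naturally_isomorphic_def by (rule ex_forward) simp
    then show ?thesis using that unfolding isomorphic_def by (auto simp: S_ob)
  qed
  have b: "fob Ke ?X \<in> C.bc" "fob Ke ?O \<in> C.bc" using X by simp_all
  let ?f = "\<lambda>n. zer C (term_at (fob Ke ?X) n) (term_at (fob Ke ?O) n)"
  have zX: "zero_object C (term_at (fob Ke ?X) n)" "zero_object C (term_at (fob Ke ?O) n)" for n
    using z by simp_all
  have c: "?f \<in> chain_maps C (fob Ke ?X) (fob Ke ?O)"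
    by (rule C.cmI) (use C.bc_cx[OF b(1)] C.bc_cx[OF b(2)] in simp_all)
  have "is_iso (Kb C) (C.hc (fob Ke ?X) (fob Ke ?O) ?f)"
    by (rule C.degreewise_iso_Kb[OF b c C.zero_iso[OF zX]])
  then have "isomorphic (Kb C) (fob Ke ?X) (fob Ke ?O)" by (rule C.K.isomorphicI) simp_all
  then have "isomorphic (Dsg C) (fob Ke ?X) (fob Ke ?O)"
    using C.QD.fob_isomorphic[OF C.QK.fob_isomorphic] by simp
  then have 1: "isomorphic (Dsg B) (fob G (fob Ke ?X)) (fob G (fob Ke ?O))" by (rule is_functor.fob_isomorphic[OF G])
  have "isomorphic (Dsg B) ?X ?O"
    by (rule B.QD.cod.isomorphic_trans[OF B.QD.cod.isomorphic_sym[OF GS[OF X(1)]] B.QD.cod.isomorphic_trans[OF 1 GS[OF X(2)]]])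
  then have "B.LC ?X \<longleftrightarrow> B.LC ?O" by (rule B.Dsg_isomorphic_LC[OF X])
  moreover have "B.LC ?O" by (rule B.zero_complex_LC[OF X(2)]) (simp add: B.zob)
  ultimately show ?thesis by (intro B.LC_stalk_pd) simp_all
qed

end

theorem theorem5p2:
  fixes A :: "('oa, 'ma) addcat" and B :: "('ob, 'mb) addcat" and C :: "('oc, 'mc) addcat"
    and i :: "('oa, 'ma, 'ob, 'mb) functr" and e :: "('ob, 'mb, 'oc, 'mc) functr"
    and q p :: "('ob, 'mb, 'oa, 'ma) functr" and l r :: "('oc, 'mc, 'ob, 'mb) functr"
  assumes "recollement A B C i e q p l r"
    and "enough_projectives B" and "enough_projectives C"
  shows "((\<forall>a \<in> ob A. pd B (fob i a) < \<infinity>) \<and> (\<forall>P. projective B P \<longrightarrow> pd C (fob e P) < \<infinity>))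
    \<longleftrightarrow> induces_singular_equivalence B C e"
proof -
  interpret recollement_enough A B C i e q p l r using assms by unfold_locales
  show ?thesis using singular_equivalence finite_pd_e finite_pd_i by blast
qed

end
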